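(* Let $K$ be an algebraically closed field of characteristic not $2$ or $3$. Let $p\in K^*$, $q=p^{-1}$, $f=pt\in K[t]$, and let $g\in K[t]$ be a homogeneous polynomial of degree $2$. Let $\mathcal{H}_q(f,g)$ be the $K$-algebra generated by $x,y,t$ with defining relations $$tx=xf,\qquad yt=fy,\qquad yx-qxy=g,$$ graded by $\deg x=\deg y=\deg t=1$. Then $\mathcal{H}_q(f,g)$ is a graded Calabi--Yau algebra of dimension $3$.
   Context: Algebras are associative unital $K$-algebras; $K^*=K\setminus\{0\}$. A homogeneous polynomial of degree $2$ in $K[t]$ is one of the form $ct^2$, $c\in K$. Graded Calabi--Yau: let $B^e=B\otimes_K B^{op}$. A graded algebra $B$ is graded Calabi--Yau of dimension $d$ if $B$ has, as a $B^e$-module, a projective resolution of finite length with finitely generated terms, and, as $B^e$-modules, $\mathrm{Ext}^i_{B^e}(B,B^e)=0$ for $i\neq d$ and $\mathrm{Ext}^d_{B^e}(B,B^e)\cong B(l)$ for some integer $l$ (a degree shift). *)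

theory Defs
  imports
    "HOL-Library.Poly_Mapping"
    "HOL-Computational_Algebra.Polynomial"
    "HOL-Algebra.Module"
    "HOL-Algebra.QuotRing"
begin

section \<open>Graded algebras and graded modules\<close>

text \<open>
  The base field is a type \<open>'k\<close> of class \<^class>\<open>field\<close>; algebras, rings and modules are carrier-based
  in the style of HOL-Algebra.  As in \<^locale>\<open>algebra\<close>, a \<open>K\<close>-algebra is a \<^typ>\<open>('k, 'b) module\<close>
  record whose \<open>smult\<close> is scalar multiplication.  When the same record type represents a module,
  \<open>mult\<close> and \<open>one\<close> carry no information.  The field \<open>grade\<close> is the \<open>\<int>\<close>-indexed family of
  homogeneous components.
\<close>

record ('a, 'b) graded_module = "('a, 'b) module" +
  grade :: "int \<Rightarrow> 'b set"

locale k_algebra = ring A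
  for A :: "('k :: field, 'b, 'z) module_scheme" (structure) +
  assumes scal_closed: "x \<in> carrier A \<Longrightarrow> k \<odot> x \<in> carrier A"
    and scal_l_distr: "x \<in> carrier A \<Longrightarrow> (k + l) \<odot> x = k \<odot> x \<oplus> l \<odot> x"
    and scal_r_distr: "\<lbrakk>x \<in> carrier A; y \<in> carrier A\<rbrakk> \<Longrightarrow> k \<odot> (x \<oplus> y) = k \<odot> x \<oplus> k \<odot> y"
    and scal_assoc: "x \<in> carrier A \<Longrightarrow> (k * l) \<odot> x = k \<odot> (l \<odot> x)"
    and scal_one: "x \<in> carrier A \<Longrightarrow> 1 \<odot> x = x"
    and scal_mult_l: "\<lbrakk>x \<in> carrier A; y \<in> carrier A\<rbrakk> \<Longrightarrow> (k \<odot> x) \<otimes> y = k \<odot> (x \<otimes> y)"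
    and scal_mult_r: "\<lbrakk>x \<in> carrier A; y \<in> carrier A\<rbrakk> \<Longrightarrow> x \<otimes> (k \<odot> y) = k \<odot> (x \<otimes> y)"

text \<open>The library locale \<^locale>\<open>module\<close> requires a commutative ring.\<close>

locale left_module = R?: ring R + M?: abelian_group M
  for R :: "('r, 'y) ring_scheme" (structure) and M :: "('r, 'm, 'z) module_scheme" (structure) +
  assumes smult_closed: "\<lbrakk>r \<in> carrier R; x \<in> carrier M\<rbrakk> \<Longrightarrow> r \<odot>\<^bsub>M\<^esub> x \<in> carrier M"
    and smult_l_distr: "\<lbrakk>r \<in> carrier R; s \<in> carrier R; x \<in> carrier M\<rbrakk>
      \<Longrightarrow> (r \<oplus>\<^bsub>R\<^esub> s) \<odot>\<^bsub>M\<^esub> x = r \<odot>\<^bsub>M\<^esub> x \<oplus>\<^bsub>M\<^esub> s \<odot>\<^bsub>M\<^esub> x"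
    and smult_r_distr: "\<lbrakk>r \<in> carrier R; x \<in> carrier M; y \<in> carrier M\<rbrakk>
      \<Longrightarrow> r \<odot>\<^bsub>M\<^esub> (x \<oplus>\<^bsub>M\<^esub> y) = r \<odot>\<^bsub>M\<^esub> x \<oplus>\<^bsub>M\<^esub> r \<odot>\<^bsub>M\<^esub> y"
    and smult_assoc: "\<lbrakk>r \<in> carrier R; s \<in> carrier R; x \<in> carrier M\<rbrakk>
      \<Longrightarrow> (r \<otimes>\<^bsub>R\<^esub> s) \<odot>\<^bsub>M\<^esub> x = r \<odot>\<^bsub>M\<^esub> (s \<odot>\<^bsub>M\<^esub> x)"
    and smult_one: "x \<in> carrier M \<Longrightarrow> \<one>\<^bsub>R\<^esub> \<odot>\<^bsub>M\<^esub> x = x"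

definition graded_group :: "('a, 'b) graded_module \<Rightarrow> bool" where
  "graded_group M \<longleftrightarrow> abelian_group M \<and>
     (\<forall>n. subgroup (grade M n) (add_monoid M)) \<and>
     (\<forall>m \<in> carrier M. \<exists>!c :: int \<Rightarrow> 'b.
        (\<forall>n. c n \<in> grade M n) \<and> finite {n. c n \<noteq> \<zero>\<^bsub>M\<^esub>} \<and>
        m = (\<Oplus>\<^bsub>M\<^esub>n \<in> {n. c n \<noteq> \<zero>\<^bsub>M\<^esub>}. c n))"

definition graded_algebra :: "('k :: field, 'b) graded_module \<Rightarrow> bool" where
  "graded_algebra A \<longleftrightarrow> k_algebra A \<and> graded_group A \<and> \<one>\<^bsub>A\<^esub> \<in> grade A 0 \<and>
     (\<forall>k n. \<forall>x \<in> grade A n. k \<odot>\<^bsub>A\<^esub> x \<in> grade A n) \<and>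
     (\<forall>i j. \<forall>x \<in> grade A i. \<forall>y \<in> grade A j. x \<otimes>\<^bsub>A\<^esub> y \<in> grade A (i + j))"

definition graded_left_module ::
    "('k, 'r) graded_module \<Rightarrow> ('r, 'm) graded_module \<Rightarrow> bool" where
  "graded_left_module R M \<longleftrightarrow> left_module R M \<and> graded_group M \<and>
     (\<forall>i j. \<forall>r \<in> grade R i. \<forall>x \<in> grade M j. r \<odot>\<^bsub>M\<^esub> x \<in> grade M (i + j))"

definition shift :: "int \<Rightarrow> ('a, 'b) graded_module \<Rightarrow> ('a, 'b) graded_module" where
  "shift l M = M\<lparr>grade := \<lambda>n. grade M (n + l)\<rparr>"


section \<open>Constructions of algebras\<close>

text \<open>
  The monoid algebra \<open>K[G]\<close>, consisting of the finitely supported functions on \<open>G\<close>.  Its degree \<open>n\<close>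
  part is the span of the given set \<open>D n\<close> of monomials.
\<close>

definition monoid_algebra ::
    "('g, 'z) monoid_scheme \<Rightarrow> (int \<Rightarrow> 'g set) \<Rightarrow> ('k :: field, 'g \<Rightarrow>\<^sub>0 'k) graded_module" where
  "monoid_algebra G D =
     \<lparr>carrier = {u. Poly_Mapping.keys u \<subseteq> carrier G},
      mult = (\<lambda>u v. \<Sum>a \<in> Poly_Mapping.keys u. \<Sum>b \<in> Poly_Mapping.keys v.
                Poly_Mapping.single (a \<otimes>\<^bsub>G\<^esub> b) (Poly_Mapping.lookup u a * Poly_Mapping.lookup v b)),
      one = Poly_Mapping.single \<one>\<^bsub>G\<^esub> 1,
      zero = 0,
      add = (+),
      smult = (\<lambda>k. Poly_Mapping.map ((*) k)),
      grade = (\<lambda>n. {u. Poly_Mapping.keys u \<subseteq> carrier G \<inter> D n})\<rparr>"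

definition quot_algebra ::
    "('k, 'b) graded_module \<Rightarrow> 'b set \<Rightarrow> ('k, 'b set) graded_module" where
  "quot_algebra A I =
     \<lparr>carrier = carrier (A Quot I), mult = mult (A Quot I), one = one (A Quot I),
      zero = zero (A Quot I), add = add (A Quot I),
      smult = (\<lambda>k X. \<Union>x \<in> X. I +>\<^bsub>A\<^esub> (k \<odot>\<^bsub>A\<^esub> x)),
      grade = (\<lambda>n. (\<lambda>x. I +>\<^bsub>A\<^esub> x) ` grade A n)\<rparr>"

definition opp :: "('k, 'b) graded_module \<Rightarrow> ('k, 'b) graded_module" where
  "opp A = A\<lparr>mult := \<lambda>x y. y \<otimes>\<^bsub>A\<^esub> x\<rparr>"

text \<open>
  The tensor product \<open>A \<otimes>\<^sub>K C\<close> is the vector space with basis \<open>A \<times> C\<close>, modulo the relations making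
  \<open>(a, c) \<mapsto> a \<otimes> c\<close> bilinear.  With \<open>A \<times> C\<close> multiplied componentwise, the span of these relations is
  closed under multiplication by basis elements on both sides, so it coincides with the ideal that
  they generate.
\<close>

definition tensor_relations ::
    "('k :: field, 'a) graded_module \<Rightarrow> ('k, 'c) graded_module \<Rightarrow> (('a \<times> 'c) \<Rightarrow>\<^sub>0 'k) set" where
  "tensor_relations A C =
     {Poly_Mapping.single (a \<oplus>\<^bsub>A\<^esub> a', c) 1
        - Poly_Mapping.single (a, c) 1 - Poly_Mapping.single (a', c) 1
        | a a' c. a \<in> carrier A \<and> a' \<in> carrier A \<and> c \<in> carrier C}
   \<union> {Poly_Mapping.single (a, c \<oplus>\<^bsub>C\<^esub> c') 1
        - Poly_Mapping.single (a, c) 1 - Poly_Mapping.single (a, c') 1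
        | a c c'. a \<in> carrier A \<and> c \<in> carrier C \<and> c' \<in> carrier C}
   \<union> {Poly_Mapping.single (k \<odot>\<^bsub>A\<^esub> a, c) 1 - Poly_Mapping.single (a, c) k
        | k a c. a \<in> carrier A \<and> c \<in> carrier C}
   \<union> {Poly_Mapping.single (a, k \<odot>\<^bsub>C\<^esub> c) 1 - Poly_Mapping.single (a, c) k
        | k a c. a \<in> carrier A \<and> c \<in> carrier C}"

definition tensor_algebra ::
    "('k :: field, 'a) graded_module \<Rightarrow> ('k, 'c) graded_module
     \<Rightarrow> ('k, (('a \<times> 'c) \<Rightarrow>\<^sub>0 'k) set) graded_module" where
  "tensor_algebra A C =
     (let F = monoid_algebra (A \<times>\<times> C) (\<lambda>n. \<Union>i. grade A i \<times> grade C (n - i))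
      in quot_algebra F (genideal F (tensor_relations A C)))"

type_synonym ('k, 'b) env = "(('b \<times> 'b) \<Rightarrow>\<^sub>0 'k) set"

definition enveloping ::
    "('k :: field, 'b) graded_module \<Rightarrow> ('k, ('k, 'b) env) graded_module" where
  "enveloping B = tensor_algebra B (opp B)"

text \<open>
  \<open>B\<close> as a left \<open>B\<^sup>e\<close>-module, \<open>(a \<otimes> c) m = a m c\<close>, and as a right \<open>B\<^sup>e\<close>-module,
  \<open>m (a \<otimes> c) = c m a\<close>; both encode the bimodule \<open>B\<close>.  The value is computed from any representative
  of the class in \<open>B\<^sup>e\<close>.  A right \<open>R\<close>-module is represented as a left module over \<open>opp R\<close>.
\<close>

definition env_left :: "('k :: field, 'b) graded_module \<Rightarrow> (('k, 'b) env, 'b) graded_module" where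
  "env_left B =
     \<lparr>carrier = carrier B, mult = mult B, one = one B, zero = zero B, add = add B,
      smult = (\<lambda>u m. the_elem ((\<lambda>v. \<Oplus>\<^bsub>B\<^esub>w \<in> Poly_Mapping.keys v.
                 Poly_Mapping.lookup v w \<odot>\<^bsub>B\<^esub> (fst w \<otimes>\<^bsub>B\<^esub> m \<otimes>\<^bsub>B\<^esub> snd w)) ` u)),
      grade = grade B\<rparr>"

definition env_right :: "('k :: field, 'b) graded_module \<Rightarrow> (('k, 'b) env, 'b) graded_module" where
  "env_right B =
     \<lparr>carrier = carrier B, mult = mult B, one = one B, zero = zero B, add = add B,
      smult = (\<lambda>u m. the_elem ((\<lambda>v. \<Oplus>\<^bsub>B\<^esub>w \<in> Poly_Mapping.keys v.
                 Poly_Mapping.lookup v w \<odot>\<^bsub>B\<^esub> (snd w \<otimes>\<^bsub>B\<^esub> m \<otimes>\<^bsub>B\<^esub> fst w)) ` u)),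
      grade = grade B\<rparr>"


section \<open>Projective resolutions and Ext\<close>

definition lmod_hom ::
    "('r, 'z) ring_scheme \<Rightarrow> ('r, 'm, 'y) module_scheme \<Rightarrow> ('r, 'n, 'x) module_scheme
     \<Rightarrow> ('m \<Rightarrow> 'n) set" where
  "lmod_hom R M N = {h \<in> carrier M \<rightarrow>\<^sub>E carrier N.
     (\<forall>x \<in> carrier M. \<forall>y \<in> carrier M. h (x \<oplus>\<^bsub>M\<^esub> y) = h x \<oplus>\<^bsub>N\<^esub> h y) \<and>
     (\<forall>r \<in> carrier R. \<forall>x \<in> carrier M. h (r \<odot>\<^bsub>M\<^esub> x) = r \<odot>\<^bsub>N\<^esub> h x)}"

definition graded_hom ::
    "('r, 'z) ring_scheme \<Rightarrow> ('r, 'm) graded_module \<Rightarrow> ('r, 'n) graded_module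
     \<Rightarrow> ('m \<Rightarrow> 'n) set" where
  "graded_hom R M N = {h \<in> lmod_hom R M N. \<forall>n. h ` grade M n \<subseteq> grade N n}"

definition graded_isomorphic ::
    "('r, 'z) ring_scheme \<Rightarrow> ('r, 'm) graded_module \<Rightarrow> ('r, 'n) graded_module \<Rightarrow> bool" where
  "graded_isomorphic R M N \<longleftrightarrow>
     (\<exists>h \<in> lmod_hom R M N. bij_betw h (carrier M) (carrier N) \<and>
        (\<forall>n. h ` grade M n = grade N n))"

definition finitely_generated ::
    "('r, 'z) ring_scheme \<Rightarrow> ('r, 'm, 'y) module_scheme \<Rightarrow> bool" where
  "finitely_generated R M \<longleftrightarrow> (\<exists>S. finite S \<and> S \<subseteq> carrier M \<and>
     (\<forall>m \<in> carrier M. \<exists>c \<in> S \<rightarrow> carrier R. m = (\<Oplus>\<^bsub>M\<^esub>s \<in> S. c s \<odot>\<^bsub>M\<^esub> s)))"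

definition free_module :: "('r, 'z) ring_scheme \<Rightarrow> 's set \<Rightarrow> ('r, 's \<Rightarrow> 'r) module" where
  "free_module R S =
     \<lparr>carrier = {f. (\<forall>s \<in> S. f s \<in> carrier R) \<and> (\<forall>s. s \<notin> S \<longrightarrow> f s = \<zero>\<^bsub>R\<^esub>) \<and>
                    finite {s. f s \<noteq> \<zero>\<^bsub>R\<^esub>}},
      mult = undefined, one = undefined,
      zero = (\<lambda>s. \<zero>\<^bsub>R\<^esub>),
      add = (\<lambda>f g s. f s \<oplus>\<^bsub>R\<^esub> g s),
      smult = (\<lambda>r f s. r \<otimes>\<^bsub>R\<^esub> f s)\<rparr>"

text \<open>
  Projective modules are the direct summands of free modules.  Basis sets inside the type \<open>'m\<close> of
  module elements suffice, since every module is a quotient of the free module on its own carrier.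
\<close>

definition projective :: "('r, 'z) ring_scheme \<Rightarrow> ('r, 'm, 'y) module_scheme \<Rightarrow> bool" where
  "projective R M \<longleftrightarrow> left_module R M \<and>
     (\<exists>S :: 'm set. \<exists>\<iota> \<in> lmod_hom R M (free_module R S). \<exists>\<pi> \<in> lmod_hom R (free_module R S) M.
        \<forall>m \<in> carrier M. \<pi> (\<iota> m) = m)"

text \<open>
  A graded projective resolution
  \<open>\<dots> \<rightarrow> P 2 \<rightarrow>\<^bsub>\<delta> 1\<^esub> P 1 \<rightarrow>\<^bsub>\<delta> 0\<^esub> P 0 \<rightarrow>\<^bsub>\<epsilon>\<^esub> M \<rightarrow> 0\<close>
  with maps of degree 0.
\<close>

definition graded_projective_resolution ::
    "('k, 'r) graded_module \<Rightarrow> ('r, 'm) graded_module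
     \<Rightarrow> (nat \<Rightarrow> ('r, 'p) graded_module) \<Rightarrow> (nat \<Rightarrow> 'p \<Rightarrow> 'p) \<Rightarrow> ('p \<Rightarrow> 'm) \<Rightarrow> bool" where
  "graded_projective_resolution R M P \<delta> \<epsilon> \<longleftrightarrow>
     (\<forall>i. graded_left_module R (P i) \<and> projective R (P i)) \<and>
     (\<forall>i. \<delta> i \<in> graded_hom R (P (Suc i)) (P i)) \<and>
     \<epsilon> \<in> graded_hom R (P 0) M \<and>
     \<epsilon> ` carrier (P 0) = carrier M \<and>
     \<delta> 0 ` carrier (P 1) = {x \<in> carrier (P 0). \<epsilon> x = \<zero>\<^bsub>M\<^esub>} \<and>
     (\<forall>i. \<delta> (Suc i) ` carrier (P (Suc (Suc i))) = {x \<in> carrier (P (Suc i)). \<delta> i x = \<zero>\<^bsub>P i\<^esub>})"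

text \<open>
  \<open>Hom\<^sub>R(M, R)\<close> as a right \<open>R\<close>-module (a left module over \<open>opp R\<close>) via right multiplication on the
  target; its degree \<open>n\<close> part consists of the homomorphisms raising degrees by \<open>n\<close>.
\<close>

definition hom_dual ::
    "('k, 'r) graded_module \<Rightarrow> ('r, 'm) graded_module \<Rightarrow> ('r, 'm \<Rightarrow> 'r) graded_module" where
  "hom_dual R M =
     (let RR = \<lparr>carrier = carrier R, mult = mult R, one = one R, zero = zero R, add = add R,
                smult = mult R\<rparr> in
     \<lparr>carrier = lmod_hom R M RR,
      mult = undefined, one = undefined,
      zero = (\<lambda>x \<in> carrier M. \<zero>\<^bsub>R\<^esub>),
      add = (\<lambda>\<phi> \<psi>. \<lambda>x \<in> carrier M. \<phi> x \<oplus>\<^bsub>R\<^esub> \<psi> x),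
      smult = (\<lambda>r \<phi>. \<lambda>x \<in> carrier M. \<phi> x \<otimes>\<^bsub>R\<^esub> r),
      grade = (\<lambda>n. {\<phi> \<in> lmod_hom R M RR. \<forall>j. \<phi> ` grade M j \<subseteq> grade R (j + n)})\<rparr>)"

definition subquotient ::
    "('r, 'm) graded_module \<Rightarrow> 'm set \<Rightarrow> 'm set \<Rightarrow> ('r, 'm set) graded_module" where
  "subquotient M Z I =
     \<lparr>carrier = (\<lambda>z. I +>\<^bsub>M\<^esub> z) ` Z,
      mult = undefined, one = undefined,
      zero = I,
      add = set_add M,
      smult = (\<lambda>r X. \<Union>x \<in> X. I +>\<^bsub>M\<^esub> (r \<odot>\<^bsub>M\<^esub> x)),
      grade = (\<lambda>n. (\<lambda>z. I +>\<^bsub>M\<^esub> z) ` (Z \<inter> grade M n))\<rparr>"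

definition codiff :: "(nat \<Rightarrow> ('r, 'p) graded_module) \<Rightarrow> (nat \<Rightarrow> 'p \<Rightarrow> 'p) \<Rightarrow> nat
    \<Rightarrow> ('p \<Rightarrow> 'r) \<Rightarrow> ('p \<Rightarrow> 'r)" where
  "codiff P \<delta> i \<phi> = compose (carrier (P (Suc i))) \<phi> (\<delta> i)"

definition cocycles where
  "cocycles R P \<delta> i = {\<phi> \<in> carrier (hom_dual R (P i)).
     codiff P \<delta> i \<phi> = \<zero>\<^bsub>hom_dual R (P (Suc i))\<^esub>}"

fun coboundaries where
  "coboundaries R P \<delta> 0 = {\<zero>\<^bsub>hom_dual R (P 0)\<^esub>}"
| "coboundaries R P \<delta> (Suc i) = codiff P \<delta> i ` carrier (hom_dual R (P i))"

text \<open>\<open>Ext\<^sup>i\<^sub>R(M, R) = H\<^sup>i(Hom\<^sub>R(P, R))\<close>, computed from a projective resolution \<open>P\<close> of \<open>M\<close>.\<close>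

definition Ext :: "('k, 'r) graded_module \<Rightarrow> (nat \<Rightarrow> ('r, 'p) graded_module)
    \<Rightarrow> (nat \<Rightarrow> 'p \<Rightarrow> 'p) \<Rightarrow> nat \<Rightarrow> ('r, ('p \<Rightarrow> 'r) set) graded_module" where
  "Ext R P \<delta> i = subquotient (hom_dual R (P i)) (cocycles R P \<delta> i) (coboundaries R P \<delta> i)"


section \<open>Graded Calabi--Yau algebras\<close>

text \<open>
  The conditions on Ext are imposed for every graded projective resolution of \<open>B\<close>, so that they do not
  depend on a choice.  The terms of a resolution live in the type of sequences in \<open>B\<^sup>e\<close>, which has
  room for a copy of every countably generated projective \<open>B\<^sup>e\<close>-module.
\<close>

definition graded_calabi_yau :: "nat \<Rightarrow> ('k :: field, 'b) graded_module \<Rightarrow> bool" where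
  "graded_calabi_yau d B \<longleftrightarrow> graded_algebra B \<and>
     (\<exists>(P :: nat \<Rightarrow> (('k, 'b) env, nat \<Rightarrow> ('k, 'b) env) graded_module) \<delta> \<epsilon>.
        graded_projective_resolution (enveloping B) (env_left B) P \<delta> \<epsilon> \<and>
        (\<forall>i. finitely_generated (enveloping B) (P i)) \<and>
        (\<exists>n. \<forall>i > n. carrier (P i) = {\<zero>\<^bsub>P i\<^esub>})) \<and>
     (\<exists>l. \<forall>(P :: nat \<Rightarrow> (('k, 'b) env, nat \<Rightarrow> ('k, 'b) env) graded_module) \<delta> \<epsilon>.
        graded_projective_resolution (enveloping B) (env_left B) P \<delta> \<epsilon> \<longrightarrow>
        (\<forall>i. i \<noteq> d \<longrightarrow> carrier (Ext (enveloping B) P \<delta> i) = {\<zero>\<^bsub>Ext (enveloping B) P \<delta> i\<^esub>}) \<and>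
        graded_isomorphic (opp (enveloping B)) (Ext (enveloping B) P \<delta> d) (shift l (env_right B)))"


section \<open>Quantum generalized Heisenberg algebras\<close>

datatype gen = X | Y | T

definition free_algebra :: "('k :: field, gen list \<Rightarrow>\<^sub>0 'k) graded_module" where
  "free_algebra =
     monoid_algebra \<lparr>carrier = UNIV, mult = (@), one = []\<rparr> (\<lambda>n. {w. int (length w) = n})"

definition var :: "gen \<Rightarrow> gen list \<Rightarrow>\<^sub>0 'k :: field" where
  "var a = Poly_Mapping.single [a] 1"

definition poly_eval :: "('k :: field, 'b) graded_module \<Rightarrow> 'k poly \<Rightarrow> 'b \<Rightarrow> 'b" where
  "poly_eval A h a = (\<Oplus>\<^bsub>A\<^esub>i \<in> {..degree h}. coeff h i \<odot>\<^bsub>A\<^esub> (a [^]\<^bsub>A\<^esub> i))"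

text \<open>
  The defining relations \<open>t x = x f\<close>, \<open>y t = f y\<close>, \<open>y x - q x y = g\<close>.  The grading is the image of the
  word-length grading, with \<open>deg x = deg y = deg t = 1\<close>; whether it is a genuine grading of the
  quotient depends on \<open>f\<close> and \<open>g\<close> and is part of \<^const>\<open>graded_algebra\<close>.
\<close>

definition heisenberg_relations ::
    "'k :: field \<Rightarrow> 'k poly \<Rightarrow> 'k poly \<Rightarrow> (gen list \<Rightarrow>\<^sub>0 'k) set" where
  "heisenberg_relations q f g =
     (let F = free_algebra; x = var X; y = var Y; t = var T in
      {t \<otimes>\<^bsub>F\<^esub> x \<ominus>\<^bsub>F\<^esub> x \<otimes>\<^bsub>F\<^esub> poly_eval F f t,
       y \<otimes>\<^bsub>F\<^esub> t \<ominus>\<^bsub>F\<^esub> poly_eval F f t \<otimes>\<^bsub>F\<^esub> y,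
       (y \<otimes>\<^bsub>F\<^esub> x \<ominus>\<^bsub>F\<^esub> q \<odot>\<^bsub>F\<^esub> (x \<otimes>\<^bsub>F\<^esub> y)) \<ominus>\<^bsub>F\<^esub> poly_eval F g t})"

definition quantum_heisenberg ::
    "'k :: field \<Rightarrow> 'k poly \<Rightarrow> 'k poly \<Rightarrow> ('k, (gen list \<Rightarrow>\<^sub>0 'k) set) graded_module" where
  "quantum_heisenberg q f g =
     quot_algebra free_algebra (genideal free_algebra (heisenberg_relations q f g))"

end

(*
  The monomials x^i t^j y^k form a basis of the algebra B: the relations rewrite every word into
  normal form, and the left regular representation in these coordinates can be written down
  explicitly. The candidate resolution of B is the Koszul complex of free bimodules

    0 -> BB -> BB^3 -> BB^3 -> BB -> B -> 0,   BB = enveloping algebra of B,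

  on generators of degrees 3, 2, 1, 0, whose middle matrix consists of the noncommutative second
  derivatives of a superpotential. Its exactness is proved in coordinates: multiplication by an entry
  a (v (x) 1) + b (1 (x) v) with b nonzero raises the exponent of v in the right factor and leaves a
  term of lower exponent, so one can divide by it with remainder. Division by y is only needed where
  x no longer occurs in the right factor, and there c plays no role. Transposing the matrices
  amounts to exchanging the two tensor factors up to sign, so the same exactness statements compute
  the cohomology of the dual complex: it vanishes except in degree 3, where it is B shifted by 3.
  The comparison theorem carries this over to an arbitrary graded projective resolution.
*)
theory Submission
  imports Defs
begin

section \<open>Additive maps on finitely supported functions\<close>

text \<open>Rescaled with \<open>q = inverse p\<close>, the relations are
  \<open>t y - q y t\<close>, \<open>y x - q x y - c t^2\<close> and \<open>x t - q t x\<close>.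
  They arise by deleting a leading x, t or y from W = x t y + t y x + y x t - q (x y t + t x y + y t
  x) - c t^3, which is invariant under cyclic rotation of its letters. This is where
  \<open>f = p t\<close> and \<open>q = inverse p\<close> interact: cyclic invariance makes the
  matrix of second derivatives symmetric up to exchanging the tensor factors, so the top Ext is B
  itself and not B twisted by an automorphism. Since W is cubic with quadratic derivatives, the
  generators sit in degrees 0 to 3, whence the shift.

  In the monomial basis only left multiplication by a generator is ever computed. Elements of
  \<open>B \<otimes> B\<close> are expanded in the right factor alone, where left multiplication has
  a visible leading term; about right multiplication in the left factor nothing is used except that
  it satisfies the relations. The divisions see it only as a term of lower order.\<close>

lemma poly_mapping_add_induct [case_names zero single add]:
  assumes "P 0"
    and "\<And>a x. a \<in> Poly_Mapping.keys u \<Longrightarrow> P (Poly_Mapping.single a x)"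
    and "\<And>v w. P v \<Longrightarrow> P w \<Longrightarrow> P (v + w)"
  shows "P (u :: 'a \<Rightarrow>\<^sub>0 'v :: ab_group_add)"
  using assms(2)
proof (induction u rule: update_induct)
  case const
  show ?case by (rule assms(1))
next
  case (update u a x)
  have k: "Poly_Mapping.keys (Poly_Mapping.update a x u) = insert a (Poly_Mapping.keys u)"
    using update by (simp add: keys_update)
  have "Poly_Mapping.update a x u = u + Poly_Mapping.single a x"
    using update(1) by (intro poly_mapping_eqI)
      (auto simp: lookup_update lookup_add lookup_single not_in_keys_iff_lookup_eq_zero)
  moreover have "P u" using update k by auto
  moreover have "P (Poly_Mapping.single a x)" using update(4) k by auto
  ultimately show ?case using assms(3) by simp
qed

lemma additive_eqI:
  assumes "additive F" and "additive G"
    and "\<And>a x. F (Poly_Mapping.single a x) = G (Poly_Mapping.single a x)"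
  shows "F (u :: 'a \<Rightarrow>\<^sub>0 'v :: ab_group_add) = G u"
  by (induction u rule: poly_mapping_add_induct)
    (use assms in \<open>auto simp: additive.zero additive.add\<close>)

text \<open>The universal property of a direct sum of copies of \<open>'v\<close>. The coefficients
  form an arbitrary abelian group, so that they may themselves be finitely supported functions;
  tensor products are modelled in this way.\<close>

definition extend :: "('a \<Rightarrow> 'v \<Rightarrow> 'w) \<Rightarrow> ('a \<Rightarrow>\<^sub>0 'v :: ab_group_add) \<Rightarrow> 'w :: ab_group_add" where
  "extend f u = (\<Sum>a \<in> Poly_Mapping.keys u. f a (Poly_Mapping.lookup u a))"

lemma extend_additive: "(\<And>a. additive (f a)) \<Longrightarrow> additive (extend f)"
  unfolding extend_def additive_def
  by (intro allI setsum_keys_plus_distrib) (auto simp: additive.zero additive.intro)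

lemma extend_single [simp]: "additive (f a) \<Longrightarrow> extend f (Poly_Mapping.single a x) = f a x"
  by (cases "x = 0") (auto simp: extend_def additive.zero)

lemma additive_comp: "additive f \<Longrightarrow> additive g \<Longrightarrow> additive (\<lambda>x. f (g x))"
  by (simp add: additive_def)

lemma additive_single: "additive (Poly_Mapping.single a)"
  by (simp add: additive_def single_add)

lemma additive_id: "additive (\<lambda>x. x)"
  by (simp add: additive_def)

definition pscale :: "('k \<Rightarrow> 'v \<Rightarrow> 'v :: zero) \<Rightarrow> 'k \<Rightarrow> ('a \<Rightarrow>\<^sub>0 'v) \<Rightarrow> 'a \<Rightarrow>\<^sub>0 'v" where
  "pscale s k = Poly_Mapping.map (s k)"

lemma lookup_pscale: "vector_space s \<Longrightarrow>
    Poly_Mapping.lookup (pscale s k u) a = s k (Poly_Mapping.lookup u a)"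
proof -
  assume "vector_space s"
  then interpret vector_space s .
  show ?thesis by (simp add: pscale_def map.rep_eq when_def)
qed

lemma pscale_single [simp]: "vector_space s \<Longrightarrow>
    pscale s k (Poly_Mapping.single a x) = Poly_Mapping.single a (s k x)"
proof -
  assume vs: "vector_space s"
  then interpret vector_space s .
  show ?thesis by (intro poly_mapping_eqI) (auto simp: lookup_pscale [OF vs] lookup_single when_def)
qed

lemma vector_space_pscale: "vector_space s \<Longrightarrow> vector_space (pscale s)"
  unfolding vector_space_def module_def
  by (intro conjI allI poly_mapping_eqI)
    (simp_all add: lookup_pscale lookup_add vector_space_def module_def)

lemma vector_space_mult: "vector_space ((*) :: 'k :: field \<Rightarrow> 'k \<Rightarrow> 'k)"
  by unfold_locales (auto simp: algebra_simps)

section \<open>The left regular representation in the monomial basis\<close>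

type_synonym mon = "nat \<times> nat \<times> nat"

text \<open>From \<open>y x = q x y + c t^2\<close> one gets
  \<open>y x^(i+1) = q x (y x^i) + c t^2 x^i\<close>, and moving \<open>t^2\<close> past
  \<open>x^i\<close> costs \<open>p^(2i)\<close>. This is the recursion.\<close>

fun skew :: "'k :: field \<Rightarrow> 'k \<Rightarrow> nat \<Rightarrow> 'k" where
  "skew p q 0 = 0"
| "skew p q (Suc i) = (p ^ i) ^ 2 + q * skew p q i"

text \<open>
  The triple \<open>(i, j, k)\<close> stands for the monomial \<open>x\<^sup>i t\<^sup>j y\<^sup>k\<close>; in the algebra one has
  \<open>y x\<^sup>i = q\<^sup>i x\<^sup>i y + c (skew i) x\<^sup>i\<^sup>-\<^sup>1 t\<^sup>2\<close>, and \<open>skew 0 = 0\<close> makes the truncated \<open>i - 1\<close> harmless.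
\<close>

fun lmul_mon :: "('k :: field \<Rightarrow> 'v :: ab_group_add \<Rightarrow> 'v) \<Rightarrow> 'k \<Rightarrow> 'k \<Rightarrow> 'k \<Rightarrow> gen \<Rightarrow> mon
    \<Rightarrow> 'v \<Rightarrow> mon \<Rightarrow>\<^sub>0 'v" where
  "lmul_mon s p q c X (i, j, k) a = Poly_Mapping.single (Suc i, j, k) a"
| "lmul_mon s p q c T (i, j, k) a = Poly_Mapping.single (i, Suc j, k) (s (p ^ i) a)"
| "lmul_mon s p q c Y (i, j, k) a = Poly_Mapping.single (i, j, Suc k) (s (q ^ i * p ^ j) a)
     + Poly_Mapping.single (i - 1, j + 2, k) (s (c * skew p q i) a)"

definition lmul where
  "lmul s p q c g = extend (lmul_mon s p q c g)"

text \<open>The coefficient space is arbitrary because the operators are used twice: with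
  coefficients in the field they are left multiplication in the algebra, with coefficients in the
  coordinate space of the algebra they act on the right factor of
  \<open>B \<otimes> B\<close>.\<close>

locale skew_rep = vector_space s
  for s :: "'k :: field \<Rightarrow> 'v :: ab_group_add \<Rightarrow> 'v" +
  fixes p q c :: 'k
  assumes pq: "p * q = 1"
begin

lemma p_nz: "p \<noteq> 0" and q_nz: "q \<noteq> 0"
  using pq by auto

lemma vs: "vector_space s" ..

abbreviation "S \<equiv> (pscale s :: 'k \<Rightarrow> (mon \<Rightarrow>\<^sub>0 'v) \<Rightarrow> mon \<Rightarrow>\<^sub>0 'v)"

sublocale S: vector_space S
  by (rule vector_space_pscale) (rule vs)

abbreviation "L \<equiv> lmul s p q c"

lemma additive_lmul_mon: "additive (lmul_mon s p q c g m)"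
  by (cases m; cases g)
    (auto simp: additive_def single_add scale_right_distrib algebra_simps)

lemma additive_L: "additive (L g)"
  unfolding lmul_def by (intro extend_additive additive_lmul_mon)

lemma L_single [simp]: "L g (Poly_Mapping.single m a) = lmul_mon s p q c g m a"
  unfolding lmul_def by (intro extend_single additive_lmul_mon)

lemmas L_add [simp] = additive.add [OF additive_L]
lemmas L_zero [simp] = additive.zero [OF additive_L]
lemmas L_diff [simp] = additive.diff [OF additive_L]
lemmas L_minus [simp] = additive.minus [OF additive_L]

lemma L_scale: "L g (S k u) = S k (L g u)"
proof (rule additive_eqI [of "\<lambda>u. L g (S k u)" "\<lambda>u. S k (L g u)"])
  show "L g (S k (Poly_Mapping.single m a)) = S k (L g (Poly_Mapping.single m a))" for m a
    by (cases m; cases g) (auto simp: vs S.scale_right_distrib scale_scale mult_ac)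
qed (auto simp: additive_def S.scale_right_distrib)

text \<open>Here and in the next two lemmas the operators are seen to respect the defining
  relations. This replaces a confluence check: the free algebra acts, the relations act as zero, and
  so distinct combinations of normal monomials stay distinct in the quotient.\<close>

lemma L_rel1: "L T (L X u) = S p (L X (L T u))"
proof (rule additive_eqI [of "\<lambda>u. L T (L X u)" "\<lambda>u. S p (L X (L T u))"])
  show "L T (L X (Poly_Mapping.single m a)) = S p (L X (L T (Poly_Mapping.single m a)))" for m a
    by (cases m) (auto simp: vs scale_scale)
qed (auto simp: additive_def S.scale_right_distrib)

lemma L_rel2: "L Y (L T u) = S p (L T (L Y u))"
proof (rule additive_eqI [of "\<lambda>u. L Y (L T u)" "\<lambda>u. S p (L T (L Y u))"])
  show "L Y (L T (Poly_Mapping.single m a)) = S p (L T (L Y (Poly_Mapping.single m a)))" for m a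
  proof (cases m)
    case (fields i j k)
    then show ?thesis
      \<comment> \<open>For \<open>i = 0\<close> the second monomial of \<open>L Y\<close> carries
        the coefficient \<open>skew 0 = 0\<close>; for \<open>i > 0\<close> the outer factor p
        completes \<open>p ^ (i - 1)\<close> to \<open>p ^ i\<close>.\<close>
      by (cases i) (auto simp: vs scale_scale S.scale_right_distrib mult_ac)
  qed
qed (auto simp: additive_def S.scale_right_distrib)

lemma L_rel3: "L Y (L X u) = S q (L X (L Y u)) + S c (L T (L T u))"
proof (rule additive_eqI [of "\<lambda>u. L Y (L X u)" "\<lambda>u. S q (L X (L Y u)) + S c (L T (L T u))"])
  show "L Y (L X (Poly_Mapping.single m a))
    = S q (L X (L Y (Poly_Mapping.single m a))) + S c (L T (L T (Poly_Mapping.single m a)))" for m a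
  proof (cases m)
    case (fields i j k)
    then show ?thesis
      \<comment> \<open>The monomial \<open>(i, j + 2, k)\<close> collects \<open>q * skew i\<close>
        from the first summand and \<open>(p ^ i) ^ 2\<close> from the second: the recursion of
        \<open>skew\<close>.\<close>
      by (cases i) (auto simp: vs scale_scale S.scale_right_distrib mult_ac power2_eq_square
          single_add [symmetric] scale_left_distrib [symmetric] distrib_left add_ac)
  qed
qed (auto simp: additive_def S.scale_right_distrib add_ac)

lemma lookup_LX: "Poly_Mapping.lookup (L X u) (i, j, k)
    = (if i = 0 then 0 else Poly_Mapping.lookup u (i - 1, j, k))"
proof (induction u rule: poly_mapping_add_induct)
  case (single m a)
  then show ?case by (cases m) (auto simp: lookup_single when_def)
qed (auto simp: lookup_add)

lemma lookup_LT: "Poly_Mapping.lookup (L T u) (i, j, k)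
    = (if j = 0 then 0 else s (p ^ i) (Poly_Mapping.lookup u (i, j - 1, k)))"
proof (induction u rule: poly_mapping_add_induct)
  case (single m a)
  then show ?case by (cases m) (auto simp: lookup_single when_def)
qed (auto simp: lookup_add scale_right_distrib)

lemma lookup_LY: "Poly_Mapping.lookup (L Y u) (i, j, k)
    = (if k = 0 then 0 else s (q ^ i * p ^ j) (Poly_Mapping.lookup u (i, j, k - 1)))
      + (if j < 2 then 0 else s (c * skew p q (Suc i)) (Poly_Mapping.lookup u (Suc i, j - 2, k)))"
proof (induction u rule: poly_mapping_add_induct)
  case (single m a)
  obtain i' j' k' where m: "m = (i', j', k')" by (cases m)
  show ?case
  proof (cases i')
    case 0
    then show ?thesis unfolding m by (auto simp: lookup_single when_def lookup_add)
  next
    case (Suc n)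
    \<comment> \<open>The guard \<open>\<not> j < 2\<close> is what makes the truncated
      \<open>j - 2\<close> equivalent to adding 2 on the other side.\<close>
    have "(n, Suc (Suc j'), k') = (i, j, k) \<longleftrightarrow> (Suc n, j', k') = (Suc i, j - 2, k) \<and> \<not> j < 2"
      by auto
    then show ?thesis unfolding m Suc
      by (cases k) (auto simp: lookup_single when_def lookup_add)
  qed
qed (auto simp: lookup_add scale_right_distrib)

end

section \<open>Exactness in coordinates\<close>

text \<open>A nonzero function has a key of maximal rank. Its partner of higher rank is no key, so
  the coefficient there is zero, which forces the coefficient at the key to be zero too.\<close>

lemma support_descent:
  fixes u :: "'a \<Rightarrow>\<^sub>0 'v :: ab_group_add" and rank :: "'a \<Rightarrow> nat"
  assumes "\<And>m. m \<in> Poly_Mapping.keys u \<Longrightarrow>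
      \<exists>m'. rank m < rank m' \<and> (Poly_Mapping.lookup u m' = 0 \<longrightarrow> Poly_Mapping.lookup u m = 0)"
  shows "u = 0"
proof (rule ccontr)
  assume "u \<noteq> 0"
  then have ne: "Poly_Mapping.keys u \<noteq> {}" by (metis keys_eq_empty poly_mapping_eqI
        lookup_zero not_in_keys_iff_lookup_eq_zero empty_iff)
  define r where "r = Max (rank ` Poly_Mapping.keys u)"
  have "r \<in> rank ` Poly_Mapping.keys u" unfolding r_def using ne by (intro Max_in) auto
  then obtain m where m: "m \<in> Poly_Mapping.keys u" "rank m = r" by auto
  obtain m' where m': "rank m < rank m'"
    "Poly_Mapping.lookup u m' = 0 \<longrightarrow> Poly_Mapping.lookup u m = 0" using assms m by blast
  have "m' \<notin> Poly_Mapping.keys u"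
  proof
    assume "m' \<in> Poly_Mapping.keys u"
    then have "rank m' \<le> r" unfolding r_def by (intro Max_ge) auto
    then show False using m' m by simp
  qed
  then show False using m m' by (simp add: in_keys_iff)
qed

text \<open>Each step trades a monomial for a multiple of \<open>F\<close> and a monomial of smaller
  rank, so iteration ends in rank 0. The set \<open>A\<close> remembers which variables have already
  been removed; a division must not bring them back.\<close>

lemma division_with_remainder:
  fixes F :: "('a \<Rightarrow>\<^sub>0 'v) \<Rightarrow> 'a \<Rightarrow>\<^sub>0 'v :: ab_group_add" and rank :: "'a \<Rightarrow> nat"
  assumes F: "additive F"
    and step: "\<And>m v. m \<in> A \<Longrightarrow> rank m \<noteq> 0 \<Longrightarrow> \<exists>m' w v'. m' \<in> A \<and> rank m' < rank m \<and>
      Poly_Mapping.single m v = F (Poly_Mapping.single m' w) + Poly_Mapping.single m' v'"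
    and "Poly_Mapping.keys u \<subseteq> A"
  shows "\<exists>a b. u = F a + b \<and> Poly_Mapping.keys a \<subseteq> A \<and>
    Poly_Mapping.keys b \<subseteq> A \<inter> {m. rank m = 0}"
proof -
  let ?P = "\<lambda>u. \<exists>a b. u = F a + b \<and> Poly_Mapping.keys a \<subseteq> A \<and>
    Poly_Mapping.keys b \<subseteq> A \<inter> {m. rank m = 0}"
  have sum: "?P (v + w)" if v: "?P v" and w: "?P w" for v w
  proof -
    from v obtain a b where "v = F a + b" "Poly_Mapping.keys a \<subseteq> A"
      "Poly_Mapping.keys b \<subseteq> A \<inter> {m. rank m = 0}" by blast
    moreover from w obtain a' b' where "w = F a' + b'" "Poly_Mapping.keys a' \<subseteq> A"
      "Poly_Mapping.keys b' \<subseteq> A \<inter> {m. rank m = 0}" by blast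
    ultimately show ?thesis using keys_add [of a a'] keys_add [of b b']
      by (intro exI [of _ "a + a'"] exI [of _ "b + b'"]) (auto simp: additive.add [OF F])
  qed
  have mono: "?P (Poly_Mapping.single m v)" if "m \<in> A" for m v
    using that
  proof (induction "rank m" arbitrary: m v rule: less_induct)
    case less
    show ?case
    proof (cases "rank m = 0")
      case True
      then show ?thesis using less
        by (intro exI [of _ 0] exI [of _ "Poly_Mapping.single m v"]) (auto simp: additive.zero [OF F])
    next
      case False
      then obtain m' w v' where m': "m' \<in> A" "rank m' < rank m"
        "Poly_Mapping.single m v = F (Poly_Mapping.single m' w) + Poly_Mapping.single m' v'"
        using step less by blast
      have "?P (F (Poly_Mapping.single m' w))"
        using m' by (intro exI [of _ "Poly_Mapping.single m' w"] exI [of _ 0]) auto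
      moreover have "?P (Poly_Mapping.single m' v')" using less m' by blast
      ultimately show ?thesis unfolding m'(3) by (rule sum)
    qed
  qed
  show ?thesis
  proof (induction u rule: poly_mapping_add_induct)
    case zero
    show ?case by (intro exI [of _ 0]) (simp add: additive.zero [OF F])
  next
    case (single m v)
    then show ?case using mono assms(3) by blast
  next
    case (add v w)
    then show ?case by (rule sum)
  qed
qed

text \<open>
  Here \<open>'v\<close> plays the role of the algebra \<open>B\<close>, with \<open>\<rho> g\<close> the right multiplication by \<open>g\<close>, and a
  finitely supported function from monomials to \<open>'v\<close> is an element of \<open>B \<otimes> B\<close>: the index is the
  monomial in the right factor.  The inner bimodule structure thus acts through \<open>L\<close> on the index
  and through \<open>R\<close> on the value.
\<close>

locale bimodule_coords = skew_rep s p q c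
  for s :: "'k :: field \<Rightarrow> 'v :: ab_group_add \<Rightarrow> 'v" and p q c :: 'k +
  fixes \<rho> :: "gen \<Rightarrow> 'v \<Rightarrow> 'v"
  assumes \<rho>_add: "additive (\<rho> g)"
    and \<rho>_scale: "\<rho> g (s k a) = s k (\<rho> g a)"
    and \<rho>_rel1: "\<rho> X (\<rho> T a) = s p (\<rho> T (\<rho> X a))"
    and \<rho>_rel2: "\<rho> T (\<rho> Y a) = s p (\<rho> Y (\<rho> T a))"
    and \<rho>_rel3: "\<rho> X (\<rho> Y a) = s q (\<rho> Y (\<rho> X a)) + s c (\<rho> T (\<rho> T a))"
begin

lemmas \<rho>_zero [simp] = additive.zero [OF \<rho>_add]

definition R :: "gen \<Rightarrow> (mon \<Rightarrow>\<^sub>0 'v) \<Rightarrow> mon \<Rightarrow>\<^sub>0 'v" where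
  "R g = extend (\<lambda>m a. Poly_Mapping.single m (\<rho> g a))"

lemma additive_R: "additive (R g)"
  unfolding R_def by (intro extend_additive additive_comp [OF additive_single \<rho>_add])

lemma R_single [simp]: "R g (Poly_Mapping.single m a) = Poly_Mapping.single m (\<rho> g a)"
  unfolding R_def by (intro extend_single additive_comp [OF additive_single \<rho>_add])

lemmas R_add [simp] = additive.add [OF additive_R]
lemmas R_zero [simp] = additive.zero [OF additive_R]
lemmas R_diff [simp] = additive.diff [OF additive_R]
lemmas R_minus [simp] = additive.minus [OF additive_R]

lemma lookup_R [simp]: "Poly_Mapping.lookup (R g u) m = \<rho> g (Poly_Mapping.lookup u m)"
  by (induction u rule: poly_mapping_add_induct)
    (auto simp: lookup_add lookup_single when_def additive.add [OF \<rho>_add])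

lemma lookup_S [simp]: "Poly_Mapping.lookup (S k u) m = s k (Poly_Mapping.lookup u m)"
  by (rule lookup_pscale [OF vs])

lemma R_scale: "R g (S k u) = S k (R g u)"
  by (rule poly_mapping_eqI) (simp add: \<rho>_scale)

lemma R_L: "R g (L h u) = L h (R g u)"
proof (rule additive_eqI [of "\<lambda>u. R g (L h u)" "\<lambda>u. L h (R g u)"])
  show "R g (L h (Poly_Mapping.single m a)) = L h (R g (Poly_Mapping.single m a))" for m a
    by (cases m; cases h) (auto simp: \<rho>_scale)
qed (auto simp: additive_def)

lemma R_rel: "R X (R T u) = S p (R T (R X u))" "R T (R Y u) = S p (R Y (R T u))"
    "R X (R Y u) = S q (R Y (R X u)) + S c (R T (R T u))"
  by (auto intro!: poly_mapping_eqI simp: lookup_add \<rho>_rel1 \<rho>_rel2 \<rho>_rel3)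

text \<open>Right multiplication by the entry
  \<open>\<alpha> (g \<otimes> 1) + \<beta> (1 \<otimes> g)\<close>: the inner bimodule structure
  multiplies the left factor on its right and the right factor on its left.\<close>

definition op :: "gen \<Rightarrow> 'k \<Rightarrow> 'k \<Rightarrow> (mon \<Rightarrow>\<^sub>0 'v) \<Rightarrow> mon \<Rightarrow>\<^sub>0 'v" where
  "op g \<alpha> \<beta> u = S \<alpha> (R g u) + S \<beta> (L g u)"

lemma additive_op: "additive (op g \<alpha> \<beta>)"
  by (simp add: additive_def op_def S.scale_right_distrib)

lemmas op_add = additive.add [OF additive_op]
lemmas op_zero [simp] = additive.zero [OF additive_op]
lemmas op_diff = additive.diff [OF additive_op]
lemmas op_minus = additive.minus [OF additive_op]

lemma lookup_opX: "Poly_Mapping.lookup (op X \<alpha> \<beta> u) (i, j, k) =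
    s \<alpha> (\<rho> X (Poly_Mapping.lookup u (i, j, k)))
      + s \<beta> (if i = 0 then 0 else Poly_Mapping.lookup u (i - 1, j, k))"
  by (simp add: op_def lookup_add lookup_LX)

lemma lookup_opT: "Poly_Mapping.lookup (op T \<alpha> \<beta> u) (i, j, k) =
    s \<alpha> (\<rho> T (Poly_Mapping.lookup u (i, j, k)))
      + s \<beta> (if j = 0 then 0 else s (p ^ i) (Poly_Mapping.lookup u (i, j - 1, k)))"
  by (simp add: op_def lookup_add lookup_LT)

lemma lookup_opY: "Poly_Mapping.lookup (op Y \<alpha> \<beta> u) (i, j, k) =
    s \<alpha> (\<rho> Y (Poly_Mapping.lookup u (i, j, k)))
      + s \<beta> ((if k = 0 then 0 else s (q ^ i * p ^ j) (Poly_Mapping.lookup u (i, j, k - 1)))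
      + (if j < 2 then 0 else s (c * skew p q (Suc i)) (Poly_Mapping.lookup u (Suc i, j - 2, k))))"
  by (simp add: op_def lookup_add lookup_LY)

abbreviation "supp \<equiv> Poly_Mapping.keys :: (mon \<Rightarrow>\<^sub>0 'v) \<Rightarrow> mon set"
abbreviation "Zx \<equiv> {m :: mon. fst m = 0}"
abbreviation "Zt \<equiv> {m :: mon. fst (snd m) = 0}"
abbreviation "Zy \<equiv> {m :: mon. snd (snd m) = 0}"

lemma supp_iff: "supp u \<subseteq> A \<longleftrightarrow> (\<forall>m. m \<notin> A \<longrightarrow> Poly_Mapping.lookup u m = 0)"
  by (auto simp: in_keys_iff)

text \<open>At exponent \<open>i + 1\<close> the result consists of \<open>\<beta>\<close> times the
  coefficient of u at \<open>i\<close> and a term that depends only on the coefficient at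
  \<open>i + 1\<close>, so the highest x-exponent of u would survive. Admitting results supported on
  \<open>Zx\<close>, and not just zero, turns this into uniqueness of the remainder in
  \<open>opX_div\<close>.\<close>

lemma opX_inj:
  assumes "\<beta> \<noteq> 0" and "supp (op X \<alpha> \<beta> u) \<subseteq> Zx"
  shows "u = 0"
proof (rule support_descent [of _ "fst"])
  fix m :: mon
  obtain i j k where m: "m = (i, j, k)" by (cases m)
  have "Poly_Mapping.lookup (op X \<alpha> \<beta> u) (Suc i, j, k) = 0"
    using assms(2) by (auto simp: supp_iff)
  then show "\<exists>m'. fst m < fst m' \<and> (Poly_Mapping.lookup u m' = 0 \<longrightarrow> Poly_Mapping.lookup u m = 0)"
    unfolding m lookup_opX using assms(1)
    by (intro exI [of _ "(Suc i, j, k)"]) auto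
qed

lemma opT_inj:
  assumes "\<beta> \<noteq> 0" and "supp (op T \<alpha> \<beta> u) \<subseteq> Zt"
  shows "u = 0"
proof (rule support_descent [of _ "\<lambda>m. fst (snd m)"])
  fix m :: mon
  obtain i j k where m: "m = (i, j, k)" by (cases m)
  have "Poly_Mapping.lookup (op T \<alpha> \<beta> u) (i, Suc j, k) = 0"
    using assms(2) by (auto simp: supp_iff)
  then show "\<exists>m'. fst (snd m) < fst (snd m') \<and>
      (Poly_Mapping.lookup u m' = 0 \<longrightarrow> Poly_Mapping.lookup u m = 0)"
    unfolding m lookup_opT using assms(1) p_nz
    by (intro exI [of _ "(i, Suc j, k)"]) auto
qed

text \<open>The argument tests the coordinates \<open>(0, 0, Suc k)\<close>. The c-term of
  \<open>lookup_opY\<close> needs a t-exponent of at least 2 and does not reach them.\<close>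

lemma opY_inj:
  assumes "\<beta> \<noteq> 0" and "supp u \<subseteq> Zx \<inter> Zt" and "op Y \<alpha> \<beta> u = 0"
  shows "u = 0"
proof (rule support_descent [of _ "\<lambda>m. snd (snd m)"])
  fix m :: mon
  assume "m \<in> supp u"
  then obtain k where m: "m = (0, 0, k)" using assms(2) by (cases m) force
  have "Poly_Mapping.lookup (op Y \<alpha> \<beta> u) (0, 0, Suc k) = 0"
    using assms(3) by simp
  then show "\<exists>m'. snd (snd m) < snd (snd m') \<and>
      (Poly_Mapping.lookup u m' = 0 \<longrightarrow> Poly_Mapping.lookup u m = 0)"
    unfolding m lookup_opY using assms(1)
    by (intro exI [of _ "(0, 0, Suc k)"]) auto
qed

lemma opX_div:
  assumes "\<beta> \<noteq> 0" and "supp u \<subseteq> A" and A: "\<And>i j k. (Suc i, j, k) \<in> A \<Longrightarrow> (i, j, k) \<in> A"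
  shows "\<exists>a b. u = op X \<alpha> \<beta> a + b \<and> supp a \<subseteq> A \<and> supp b \<subseteq> A \<inter> Zx"
proof (rule division_with_remainder [OF additive_op _ assms(2)])
  fix m :: mon and v
  assume m: "m \<in> A" "fst m \<noteq> 0"
  then obtain i j k where m': "m = (Suc i, j, k)" by (cases m) (auto simp: gr0_conv_Suc)
  show "\<exists>m' w v'. m' \<in> A \<and> fst m' < fst m \<and>
      Poly_Mapping.single m v = op X \<alpha> \<beta> (Poly_Mapping.single m' w) + Poly_Mapping.single m' v'"
    using assms m m'
    \<comment> \<open>The quotient is chosen such that the summand with \<open>\<beta>\<close>
      reproduces the given monomial; the summand with \<open>\<alpha>\<close> has the smaller
      exponent and is passed on with opposite sign.\<close>
    by (intro exI [of _ "(i, j, k)"] exI [of _ "s (inverse \<beta>) v"]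
        exI [of _ "- s \<alpha> (\<rho> X (s (inverse \<beta>) v))"])
      (auto simp: op_def vs single_uminus)
qed

lemma opT_div:
  assumes "\<beta> \<noteq> 0" and "supp u \<subseteq> A" and A: "\<And>i j k. (i, Suc j, k) \<in> A \<Longrightarrow> (i, j, k) \<in> A"
  shows "\<exists>a b. u = op T \<alpha> \<beta> a + b \<and> supp a \<subseteq> A \<and> supp b \<subseteq> A \<inter> Zt"
proof (rule division_with_remainder [OF additive_op _ assms(2)])
  fix m :: mon and v
  assume m: "m \<in> A" "fst (snd m) \<noteq> 0"
  then obtain i j k where m': "m = (i, Suc j, k)" by (cases m) (auto simp: gr0_conv_Suc)
  have [simp]: "\<beta> * (p ^ i * (inverse \<beta> * inverse (p ^ i))) = 1"
    using assms(1) p_nz by (simp add: field_simps)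
  show "\<exists>m' w v'. m' \<in> A \<and> fst (snd m') < fst (snd m) \<and>
      Poly_Mapping.single m v = op T \<alpha> \<beta> (Poly_Mapping.single m' w) + Poly_Mapping.single m' v'"
    using assms m m' p_nz
    by (intro exI [of _ "(i, j, k)"] exI [of _ "s (inverse (\<beta> * p ^ i)) v"]
        exI [of _ "- s \<alpha> (\<rho> T (s (inverse (\<beta> * p ^ i)) v))"])
      (auto simp: op_def vs single_uminus)
qed

text \<open>On monomials without x and t, left multiplication by y merely shifts the last exponent:
  the powers of p and q are 1 and \<open>skew 0 = 0\<close>.\<close>

lemma opY_div:
  assumes "\<beta> \<noteq> 0" and "supp u \<subseteq> Zx \<inter> Zt"
  shows "\<exists>a b. u = op Y \<alpha> \<beta> a + b \<and> supp a \<subseteq> Zx \<inter> Zt \<and> supp b \<subseteq> Zx \<inter> Zt \<inter> Zy"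
proof (rule division_with_remainder [OF additive_op _ assms(2)])
  fix m :: mon and v
  assume m: "m \<in> Zx \<inter> Zt" "snd (snd m) \<noteq> 0"
  then obtain k where m': "m = (0, 0, Suc k)" by (cases m) (auto simp: gr0_conv_Suc)
  show "\<exists>m' w v'. m' \<in> Zx \<inter> Zt \<and> snd (snd m') < snd (snd m) \<and>
      Poly_Mapping.single m v = op Y \<alpha> \<beta> (Poly_Mapping.single m' w) + Poly_Mapping.single m' v'"
    using assms m m' p_nz
    by (intro exI [of _ "(0, 0, k)"] exI [of _ "s (inverse \<beta>) v"]
        exI [of _ "- s \<alpha> (\<rho> Y (s (inverse \<beta>) v))"])
      (auto simp: op_def vs single_uminus)
qed

section \<open>The Koszul differentials in coordinates and their exactness\<close>

definition d1 :: "(gen \<Rightarrow> mon \<Rightarrow>\<^sub>0 'v) \<Rightarrow> mon \<Rightarrow>\<^sub>0 'v" where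
  "d1 a = op X 1 (- 1) (a X) + op T 1 (- 1) (a T) + op Y 1 (- 1) (a Y)"

text \<open>The coefficients \<open>b X\<close>, \<open>b T\<close>, \<open>b Y\<close> belong to
  the relations \<open>t y - q y t\<close>, \<open>y x - q x y - c t^2\<close>,
  \<open>x t - q t x\<close>. A term \<open>u g w\<close> of a relation contributes the entry
  \<open>u \<otimes> w\<close> to the component g.\<close>

fun d2 :: "(gen \<Rightarrow> mon \<Rightarrow>\<^sub>0 'v) \<Rightarrow> gen \<Rightarrow> mon \<Rightarrow>\<^sub>0 'v" where
  "d2 b X = op Y 1 (- q) (b T) + op T (- q) 1 (b Y)"
| "d2 b T = op Y (- q) 1 (b X) + op T (- c) (- c) (b T) + op X 1 (- q) (b Y)"
| "d2 b Y = op T 1 (- q) (b X) + op X (- q) 1 (b T)"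

definition d3 :: "(mon \<Rightarrow>\<^sub>0 'v) \<Rightarrow> gen \<Rightarrow> mon \<Rightarrow>\<^sub>0 'v" where
  "d3 a g = op g 1 (- 1) a"

lemma qp: "q * p = 1" using pq by (simp add: mult.commute)

lemmas op_expand = op_def S.scale_right_distrib S.scale_right_diff_distrib R_scale L_scale R_L R_rel
  L_rel1 L_rel2 L_rel3 S.scale_scale pq qp mult_ac S.scale_minus_left S.scale_minus_right

text \<open>Multiplying the derivative by g with \<open>g \<otimes> 1 - 1 \<otimes> g\<close> turns
  a term \<open>u g w\<close> into \<open>u g \<otimes> w - u \<otimes> g w\<close>. Summed over all
  letters this telescopes to \<open>r \<otimes> 1 - 1 \<otimes> r\<close>, which vanishes for a
  relation r.\<close>

lemma d1_d2: "d1 (d2 b) = 0"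
  by (simp add: d1_def op_expand)

text \<open>By cyclic symmetry the entries of the component g are also the derivatives of the
  relation dual to g with the tensor factors exchanged, so the same telescoping applies.\<close>

lemma d2_d3: "d2 (d3 a) g = 0"
  by (cases g) (simp_all add: d3_def op_expand)

lemma d1_diff: "d1 (\<lambda>g. a g - b g) = d1 a - d1 b"
  by (simp add: d1_def op_diff)

lemma d2_diff: "d2 (\<lambda>g. a g - b g) g = d2 a g - d2 b g"
  by (cases g) (simp_all add: op_diff)

lemma d2_add: "d2 (\<lambda>g. a g + b g) g = d2 a g + d2 b g"
  by (cases g) (simp_all add: op_add)

lemma d3_inj: "d3 a T = 0 \<Longrightarrow> a = 0"
  using opT_inj [of "- 1" 1 a] by (simp add: d3_def)

text \<open>A boundary is subtracted to leave in the T component only the remainder r modulo t. Of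
  the three equations those with index \<open>Y\<close> and \<open>X\<close> are used, because they
  involve only division by t and x once r is under control. The first gives \<open>b' X = 0\<close>
  and \<open>r = 0\<close>, the second \<open>b' Y = 0\<close>.\<close>

lemma exact_d2_d3:
  assumes b: "\<And>g. d2 b g = 0"
  shows "\<exists>a. \<forall>g. b g = d3 a g"
proof -
  obtain a r where a: "b T = op T 1 (- 1) a + r" "supp r \<subseteq> Zt"
    using opT_div [of "- 1" "b T" UNIV 1] by auto
  define b' where "b' g = b g - d3 a g" for g
  have b'T: "b' T = r" by (simp add: b'_def d3_def a)
  have d2b': "d2 b' g = 0" for g
    unfolding b'_def d2_diff d2_d3 b by simp
  have 1: "op T 1 (- q) (b' X) + op X (- q) 1 r = 0"
    using d2b' [of Y] by (simp add: b'T)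
  have "supp (op X (- q) 1 r) \<subseteq> Zt"
    using a(2) by (auto simp: supp_iff lookup_opX)
  moreover have "op T 1 (- q) (b' X) = - op X (- q) 1 r"
    using 1 by (simp add: eq_neg_iff_add_eq_0)
  ultimately have "supp (op T 1 (- q) (b' X)) \<subseteq> Zt" by simp
  then have b'X: "b' X = 0" by (rule opT_inj [rotated]) (simp add: q_nz)
  then have "op X (- q) 1 r = 0" using 1 by simp
  then have r: "r = 0" using opX_inj [of 1 "- q" r] by simp
  then have "op T (- q) 1 (b' Y) = 0" using d2b' [of X] b'T by simp
  then have "b' Y = 0" using opT_inj [of 1 "- q" "b' Y"] by simp
  then have "b' g = 0" for g using b'T b'X r by (cases g) auto
  then show ?thesis by (auto simp: b'_def)
qed

text \<open>Boundaries are used to push the Y component into monomials without x and t and the T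
  component into monomials without x. For such a normalised cycle the three summands of
  \<open>d1\<close> have separate leading terms, so they vanish one after the other, in the order x,
  t, y.\<close>

lemma exact_d1_d2:
  assumes a: "d1 a = 0"
  shows "\<exists>b. \<forall>g. a g = d2 b g"
proof -
  \<comment> \<open>The divisors used on \<open>a Y\<close> are the two coefficients of
    \<open>d2 b Y\<close>, namely those of \<open>b X\<close> and \<open>b T\<close>.\<close>
  obtain bX r1 where 1: "a Y = op T 1 (- q) bX + r1" "supp r1 \<subseteq> Zt"
    using opT_div [of "- q" "a Y" UNIV 1] q_nz by auto
  obtain bT r2 where 2: "r1 = op X (- q) 1 bT + r2" "supp r2 \<subseteq> Zx \<inter> Zt"
    using opX_div [of 1 r1 Zt "- q"] 1(2) by (auto simp: Int_commute)
  let ?b1 = "(\<lambda>_. 0)(X := bX, T := bT)"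
  define a1 where "a1 g = a g - d2 ?b1 g" for g
  \<comment> \<open>\<open>b Y\<close> does not occur in \<open>d2 b Y\<close>, so correcting the T
    component with it leaves the normalised Y component untouched.\<close>
  obtain bY r3 where 3: "a1 T = op X 1 (- q) bY + r3" "supp r3 \<subseteq> Zx"
    using opX_div [of "- q" "a1 T" UNIV 1] q_nz by auto
  let ?b2 = "(\<lambda>_. 0)(Y := bY)"
  define a2 where "a2 g = a1 g - d2 ?b2 g" for g
  have a2T: "a2 T = r3" using 3 by (simp add: a2_def)
  have a2Y: "a2 Y = r2" by (simp add: a2_def a1_def 1 2)
  have d1a2: "d1 a2 = 0"
    unfolding a2_def a1_def d1_diff d1_d2 a by simp
  then have e: "op X 1 (- 1) (a2 X) = - (op T 1 (- 1) r3 + op Y 1 (- 1) r2)"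
    unfolding eq_neg_iff_add_eq_0 d1_def a2T a2Y by (simp only: add.assoc)
  have "supp (op T 1 (- 1) r3 + op Y 1 (- 1) r2) \<subseteq> Zx"
    using 2(2) 3(2) by (auto simp: supp_iff lookup_add lookup_opT lookup_opY)
  then have "supp (op X 1 (- 1) (a2 X)) \<subseteq> Zx" unfolding e keys_minus .
  then have a2X: "a2 X = 0" by (rule opX_inj [rotated]) simp
  then have e: "op T 1 (- 1) r3 = - op Y 1 (- 1) r2"
    using e by (simp add: neg_eq_iff_add_eq_0 eq_neg_iff_add_eq_0 add.commute)
  \<comment> \<open>Multiplication by y creates \<open>t^2\<close> only at the cost of an x in the
    right factor, and \<open>r2\<close> has none.\<close>
  have "supp (op Y 1 (- 1) r2) \<subseteq> Zt"
    using 2(2) by (auto simp: supp_iff lookup_opY)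
  then have r3: "r3 = 0" using opT_inj [of "- 1" 1 r3] e by simp
  then have "op Y 1 (- 1) r2 = 0" using e by simp
  then have "r2 = 0" using opY_inj [of "- 1" r2] 2(2) by auto
  then have "a2 g = 0" for g using a2X a2T a2Y r3 by (cases g) auto
  then have "a g = d2 (\<lambda>g. ?b1 g + ?b2 g) g" for g
    unfolding d2_add by (metis a1_def a2_def add.commute diff_add_cancel diff_0_right diff_eq_eq
        eq_iff_diff_eq_0)
  then show ?thesis by blast
qed

text \<open>Division by x, t and y in this order leaves a multiple of the constant monomial in the
  right factor. Later divisions keep the exponents that are already zero at zero.\<close>

lemma exact_d1: "\<exists>a r. u = d1 a + Poly_Mapping.single (0, 0, 0) r"
proof -
  obtain aX r1 where 1: "u = op X 1 (- 1) aX + r1" "supp r1 \<subseteq> Zx"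
    using opX_div [of "- 1" u UNIV 1] by auto
  obtain aT r2 where 2: "r1 = op T 1 (- 1) aT + r2" "supp r2 \<subseteq> Zx \<inter> Zt"
    using opT_div [of "- 1" r1 Zx 1] 1(2) by auto
  obtain aY r3 where 3: "r2 = op Y 1 (- 1) aY + r3" "supp r3 \<subseteq> Zx \<inter> Zt \<inter> Zy"
    using opY_div [of "- 1" r2 1] 2(2) by auto
  have "r3 = Poly_Mapping.single (0, 0, 0) (Poly_Mapping.lookup r3 (0, 0, 0))"
    using 3(2) by (intro poly_mapping_eqI)
      (auto simp: lookup_single when_def in_keys_iff subset_iff)
  then have "u = d1 (\<lambda>g. case g of X \<Rightarrow> aX | T \<Rightarrow> aT | Y \<Rightarrow> aY)
      + Poly_Mapping.single (0, 0, 0) (Poly_Mapping.lookup r3 (0, 0, 0))"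
    using 1 2 3 by (simp add: d1_def add.assoc)
  then show ?thesis by blast
qed

end

section \<open>Monoid algebras, quotients and enveloping algebras\<close>

text \<open>Testing only indices that occur in u lets conditions on the support, such as membership
  in a carrier or a degree, enter the comparison.\<close>

lemma additive_eqI_keys:
  assumes "additive F" and "additive G"
    and "\<And>a x. a \<in> Poly_Mapping.keys u \<Longrightarrow> F (Poly_Mapping.single a x) = G (Poly_Mapping.single a x)"
  shows "F (u :: 'a \<Rightarrow>\<^sub>0 'v :: ab_group_add) = G u"
  by (induction u rule: poly_mapping_add_induct)
    (use assms in \<open>auto simp: additive.zero additive.add\<close>)

text \<open>The algebra is tied to \<open>monoid_algebra\<close> by an equation, so that the facts
  apply verbatim to constants defined in this way, such as \<open>free_algebra\<close>, as well as
  to the term itself.\<close>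

context
  fixes G :: "('g, 'z) monoid_scheme" and D :: "int \<Rightarrow> 'g set" and A :: "('k :: field, 'g \<Rightarrow>\<^sub>0 'k) graded_module"
  assumes G: "monoid G" and A_def: "A = monoid_algebra G D"
begin

interpretation G: monoid G by (rule G)

lemma ma_carrier: "u \<in> carrier A \<longleftrightarrow> Poly_Mapping.keys u \<subseteq> carrier G"
  and ma_add [simp]: "u \<oplus>\<^bsub>A\<^esub> v = u + v"
  and ma_zero [simp]: "\<zero>\<^bsub>A\<^esub> = 0"
  and ma_one: "\<one>\<^bsub>A\<^esub> = Poly_Mapping.single \<one>\<^bsub>G\<^esub> 1"
  and ma_smult: "k \<odot>\<^bsub>A\<^esub> u = pscale (*) k u"
  and ma_grade: "u \<in> grade A n \<longleftrightarrow> Poly_Mapping.keys u \<subseteq> carrier G \<inter> D n"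
  by (simp_all add: A_def monoid_algebra_def pscale_def)

lemma ma_mult: "u \<otimes>\<^bsub>A\<^esub> v
    = extend (\<lambda>a x. extend (\<lambda>b y. Poly_Mapping.single (a \<otimes>\<^bsub>G\<^esub> b) (x * y)) v) u"
  by (simp add: A_def monoid_algebra_def extend_def)

lemma ma_mult_inner:
  "additive (\<lambda>v. extend (\<lambda>b y. Poly_Mapping.single (a \<otimes>\<^bsub>G\<^esub> b) (x * (y :: 'k))) v)"
  "additive (\<lambda>x. extend (\<lambda>b y. Poly_Mapping.single (a \<otimes>\<^bsub>G\<^esub> b) (x * (y :: 'k))) v)"
proof -
  have *: "Poly_Mapping.single b (x * (y + z)) = Poly_Mapping.single b (x * y) + Poly_Mapping.single b (x * z)"
    "Poly_Mapping.single b ((y + z) * x) = Poly_Mapping.single b (y * x) + Poly_Mapping.single b (z * x)"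
    for b :: 'g and x y z :: 'k
    by (simp_all only: distrib_left distrib_right single_add)
  show "additive (\<lambda>v. extend (\<lambda>b y. Poly_Mapping.single (a \<otimes>\<^bsub>G\<^esub> b) (x * (y :: 'k))) v)"
    by (rule extend_additive) (simp only: additive_def * simp_thms)
  show "additive (\<lambda>x. extend (\<lambda>b y. Poly_Mapping.single (a \<otimes>\<^bsub>G\<^esub> b) (x * (y :: 'k))) v)"
    by (simp only: additive_def extend_def * sum.distrib simp_thms)
qed

lemma ma_mult_additive_right: "additive (\<lambda>v. u \<otimes>\<^bsub>A\<^esub> v)"
  unfolding ma_mult using additive.add [OF ma_mult_inner(1)]
  by (simp add: additive_def extend_def sum.distrib)

lemma ma_mult_additive_left: "additive (\<lambda>u. u \<otimes>\<^bsub>A\<^esub> v)"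
  unfolding ma_mult by (rule extend_additive) (rule ma_mult_inner(2))

lemma ma_mult_single [simp]:
  "Poly_Mapping.single a x \<otimes>\<^bsub>A\<^esub> Poly_Mapping.single b y = Poly_Mapping.single (a \<otimes>\<^bsub>G\<^esub> b) (x * y)"
proof -
  have "additive (\<lambda>y. Poly_Mapping.single (a \<otimes>\<^bsub>G\<^esub> b) (x * (y :: 'k)))" for a b x
    by (simp only: additive_def single_add distrib_left simp_thms)
  moreover have "additive (\<lambda>x. Poly_Mapping.single (a \<otimes>\<^bsub>G\<^esub> b) (x * (y :: 'k)))" for a b y
    by (simp only: additive_def single_add distrib_right simp_thms)
  ultimately show ?thesis by (simp add: ma_mult ma_mult_inner(2))
qed

lemma ma_mult_add_left: "(u + v) \<otimes>\<^bsub>A\<^esub> w = u \<otimes>\<^bsub>A\<^esub> w + v \<otimes>\<^bsub>A\<^esub> w"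
  by (rule additive.add [OF ma_mult_additive_left])

lemma ma_mult_add_right: "w \<otimes>\<^bsub>A\<^esub> (u + v) = w \<otimes>\<^bsub>A\<^esub> u + w \<otimes>\<^bsub>A\<^esub> v"
  by (rule additive.add [OF ma_mult_additive_right])

lemma ma_mult_zero: "0 \<otimes>\<^bsub>A\<^esub> w = 0" "w \<otimes>\<^bsub>A\<^esub> 0 = 0"
  by (rule additive.zero [OF ma_mult_additive_left], rule additive.zero [OF ma_mult_additive_right])

lemma ma_add_closed: "u \<in> carrier A \<Longrightarrow> v \<in> carrier A \<Longrightarrow> u + v \<in> carrier A"
  using keys_add [of u v] by (auto simp: ma_carrier)

lemma ma_mult_closed:
  assumes "u \<in> carrier A" and "v \<in> carrier A"
  shows "u \<otimes>\<^bsub>A\<^esub> v \<in> carrier A"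
proof (induction u rule: poly_mapping_add_induct)
  case zero
  show ?case by (simp add: ma_mult_zero ma_carrier)
next
  case (single a x)
  then have a: "a \<in> carrier G" using assms by (auto simp: ma_carrier)
  show ?case
  proof (induction v rule: poly_mapping_add_induct)
    case zero
    show ?case by (simp add: ma_mult_zero ma_carrier)
  next
    case (single b y)
    then have "b \<in> carrier G" using assms by (auto simp: ma_carrier)
    then show ?case using a by (simp add: ma_carrier)
  qed (simp add: ma_mult_add_right ma_add_closed)
qed (simp add: ma_mult_add_left ma_add_closed)

lemma ma_assoc:
  assumes "u \<in> carrier A" and "v \<in> carrier A" and "w \<in> carrier A"
  shows "u \<otimes>\<^bsub>A\<^esub> v \<otimes>\<^bsub>A\<^esub> w = u \<otimes>\<^bsub>A\<^esub> (v \<otimes>\<^bsub>A\<^esub> w)"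
proof (rule additive_eqI_keys [of "\<lambda>u. u \<otimes>\<^bsub>A\<^esub> v \<otimes>\<^bsub>A\<^esub> w"])
  fix a and x :: 'k assume a: "a \<in> Poly_Mapping.keys u"
  let ?a = "Poly_Mapping.single a x"
  show "?a \<otimes>\<^bsub>A\<^esub> v \<otimes>\<^bsub>A\<^esub> w = ?a \<otimes>\<^bsub>A\<^esub> (v \<otimes>\<^bsub>A\<^esub> w)"
  proof (rule additive_eqI_keys [of "\<lambda>v. ?a \<otimes>\<^bsub>A\<^esub> v \<otimes>\<^bsub>A\<^esub> w"])
    fix b and y :: 'k assume b: "b \<in> Poly_Mapping.keys v"
    let ?b = "Poly_Mapping.single b y"
    show "?a \<otimes>\<^bsub>A\<^esub> ?b \<otimes>\<^bsub>A\<^esub> w = ?a \<otimes>\<^bsub>A\<^esub> (?b \<otimes>\<^bsub>A\<^esub> w)"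
    proof (rule additive_eqI_keys [of "\<lambda>w. ?a \<otimes>\<^bsub>A\<^esub> ?b \<otimes>\<^bsub>A\<^esub> w"])
      fix d and z :: 'k assume "d \<in> Poly_Mapping.keys w"
      then show "?a \<otimes>\<^bsub>A\<^esub> ?b \<otimes>\<^bsub>A\<^esub> Poly_Mapping.single d z
          = ?a \<otimes>\<^bsub>A\<^esub> (?b \<otimes>\<^bsub>A\<^esub> Poly_Mapping.single d z)"
        using a b assms by (simp add: ma_carrier subset_iff G.m_assoc mult.assoc)
    qed (simp_all add: additive_def ma_mult_add_right)
  qed (simp_all add: additive_def ma_mult_add_right ma_mult_add_left)
qed (simp_all add: additive_def ma_mult_add_left)

lemma ma_one_mult:
  assumes "u \<in> carrier A"
  shows "\<one>\<^bsub>A\<^esub> \<otimes>\<^bsub>A\<^esub> u = u" "u \<otimes>\<^bsub>A\<^esub> \<one>\<^bsub>A\<^esub> = u"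
proof -
  show "\<one>\<^bsub>A\<^esub> \<otimes>\<^bsub>A\<^esub> u = u"
    by (rule additive_eqI_keys [of "\<lambda>u. \<one>\<^bsub>A\<^esub> \<otimes>\<^bsub>A\<^esub> u" "\<lambda>u. u"])
      (use assms in \<open>auto simp: additive_def ma_mult_add_right ma_one ma_carrier\<close>)
  show "u \<otimes>\<^bsub>A\<^esub> \<one>\<^bsub>A\<^esub> = u"
    by (rule additive_eqI_keys [of "\<lambda>u. u \<otimes>\<^bsub>A\<^esub> \<one>\<^bsub>A\<^esub>" "\<lambda>u. u"])
      (use assms in \<open>auto simp: additive_def ma_mult_add_left ma_one ma_carrier\<close>)
qed

lemma ma_pscale_mult:
  "pscale (*) k u \<otimes>\<^bsub>A\<^esub> v = pscale (*) k (u \<otimes>\<^bsub>A\<^esub> v)" "u \<otimes>\<^bsub>A\<^esub> pscale (*) k v = pscale (*) k (u \<otimes>\<^bsub>A\<^esub> v)"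
proof -
  interpret S: vector_space "pscale (*) :: 'k \<Rightarrow> ('g \<Rightarrow>\<^sub>0 'k) \<Rightarrow> 'g \<Rightarrow>\<^sub>0 'k"
    by (intro vector_space_pscale vector_space_mult)
  have *: "pscale (*) k (Poly_Mapping.single a x) \<otimes>\<^bsub>A\<^esub> v = pscale (*) k (Poly_Mapping.single a x \<otimes>\<^bsub>A\<^esub> v)
    \<and> Poly_Mapping.single a x \<otimes>\<^bsub>A\<^esub> pscale (*) k v = pscale (*) k (Poly_Mapping.single a x \<otimes>\<^bsub>A\<^esub> v)" for a x
    by (induction v rule: poly_mapping_add_induct)
      (auto simp: vector_space_mult S.scale_right_distrib ma_mult_add_right ma_mult_zero mult_ac)
  show "pscale (*) k u \<otimes>\<^bsub>A\<^esub> v = pscale (*) k (u \<otimes>\<^bsub>A\<^esub> v)" "u \<otimes>\<^bsub>A\<^esub> pscale (*) k v = pscale (*) k (u \<otimes>\<^bsub>A\<^esub> v)"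
    by (induction u rule: poly_mapping_add_induct)
      (simp_all add: * S.scale_right_distrib ma_mult_add_left ma_mult_zero)
qed

lemma ma_k_algebra: "k_algebra A"
proof -
  interpret S: vector_space "pscale (*) :: 'k \<Rightarrow> ('g \<Rightarrow>\<^sub>0 'k) \<Rightarrow> 'g \<Rightarrow>\<^sub>0 'k"
    by (intro vector_space_pscale vector_space_mult)
  have "abelian_group A"
  proof (rule abelian_groupI)
    fix u assume "u \<in> carrier A"
    then show "\<exists>v\<in>carrier A. v \<oplus>\<^bsub>A\<^esub> u = \<zero>\<^bsub>A\<^esub>"
      by (intro bexI [of _ "- u"]) (auto simp: ma_carrier keys_minus)
  qed (use ma_add_closed in \<open>auto simp: ma_carrier add_ac\<close>)
  moreover have "monoid A"
    by (rule monoidI) (auto simp: ma_mult_closed ma_assoc ma_one_mult, simp add: ma_one ma_carrier)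
  ultimately have "ring A"
    by (intro ringI) (auto simp: ma_mult_add_left ma_mult_add_right)
  moreover have "Poly_Mapping.keys (pscale (*) k u) \<subseteq> Poly_Mapping.keys u" for k and u :: "'g \<Rightarrow>\<^sub>0 'k"
    by (auto simp: in_keys_iff lookup_pscale vector_space_mult)
  ultimately show ?thesis
    by (intro k_algebra.intro k_algebra_axioms.intro)
      (auto simp: ma_smult ma_carrier S.scale_right_distrib S.scale_left_distrib ma_pscale_mult)
qed

end

text \<open>\<open>quot_algebra\<close> copies the operations of the factor ring into a record of
  another type; the ring laws have to be carried across.\<close>

lemma ring_cong:
  assumes "ring P" and "carrier Q = carrier P" and "mult Q = mult P" and "one Q = one P"
    and "zero Q = zero P" and "add Q = add P"
  shows "ring Q"
proof -
  interpret P: ring P by fact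
  have "abelian_group Q"
    by (intro abelian_groupI) (auto simp: assms P.a_ac P.add.l_inv_ex)
  moreover have "monoid Q"
    using P.monoid_axioms unfolding monoid_def assms by simp
  ultimately show ?thesis
    by (intro ringI) (auto simp: assms P.l_distr P.r_distr)
qed

locale algebra_quotient = k_algebra A + ideal I A
  for A :: "('k :: field, 'b) graded_module" (structure) and I
begin

abbreviation "Q \<equiv> quot_algebra A I"
abbreviation "cls x \<equiv> I +> x"

lemma cls_eq: "x \<in> carrier A \<Longrightarrow> y \<in> carrier A \<Longrightarrow> cls x = cls y \<longleftrightarrow> x \<ominus> y \<in> I"
  using quotient_eq_iff_same_a_r_cos [OF ideal_axioms] by auto

lemma cls_self: "x \<in> carrier A \<Longrightarrow> x \<in> cls x"
  by (rule a_rcos_self)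

lemma cls_eqI: "x \<in> carrier A \<Longrightarrow> y \<in> cls x \<Longrightarrow> cls y = cls x"
  by (metis a_repr_independence' )

lemma Q_carrier: "carrier Q = cls ` carrier A"
  by (auto simp: quot_algebra_def FactRing_def A_RCOSETS_def')

lemma Q_add: "x \<in> carrier A \<Longrightarrow> y \<in> carrier A \<Longrightarrow> cls x \<oplus>\<^bsub>Q\<^esub> cls y = cls (x \<oplus> y)"
  by (simp add: quot_algebra_def FactRing_def a_rcos_sum)

lemma Q_mult: "x \<in> carrier A \<Longrightarrow> y \<in> carrier A \<Longrightarrow> cls x \<otimes>\<^bsub>Q\<^esub> cls y = cls (x \<otimes> y)"
  by (simp add: quot_algebra_def FactRing_def rcoset_mult_add)

lemma Q_one: "\<one>\<^bsub>Q\<^esub> = cls \<one>"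
  by (simp add: quot_algebra_def FactRing_def)

lemma Q_zero: "\<zero>\<^bsub>Q\<^esub> = cls \<zero>"
  by (simp add: quot_algebra_def FactRing_def a_coset_add_zero a_subset)

lemma Q_smult:
  assumes "x \<in> carrier A"
  shows "k \<odot>\<^bsub>Q\<^esub> cls x = cls (k \<odot> x)"
proof -
  have *: "cls (k \<odot> y) = cls (k \<odot> x)" if y: "y \<in> cls x" for y
  proof -
    have yc: "y \<in> carrier A" using assms y a_elemrcos_carrier by blast
    have "y \<ominus> x \<in> I" using cls_eqI [OF assms y] cls_eq yc assms by blast
    \<comment> \<open>A ring ideal of an algebra is a subspace, since scaling by k is multiplication
      by \<open>k \<odot> \<one>\<close>.\<close>
    then have "(k \<odot> \<one>) \<otimes> (y \<ominus> x) \<in> I" by (simp add: I_l_closed scal_closed)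
    moreover have "(k \<odot> \<one>) \<otimes> (y \<ominus> x) = k \<odot> y \<ominus> k \<odot> x"
      using yc assms by (simp add: minus_eq r_distr r_minus scal_mult_l scal_closed)
    ultimately show ?thesis using yc assms cls_eq scal_closed by simp
  qed
  have "k \<odot>\<^bsub>Q\<^esub> cls x = (\<Union>y \<in> cls x. cls (k \<odot> y))" by (simp add: quot_algebra_def)
  also have "\<dots> = cls (k \<odot> x)" using * cls_self [OF assms] by blast
  finally show ?thesis .
qed

lemma Q_grade: "grade Q n = cls ` grade A n"
  by (simp add: quot_algebra_def)

lemma Q_k_algebra: "k_algebra Q"
proof -
  have "ring Q"
    by (rule ring_cong [OF quotient_is_ring]) (simp_all add: quot_algebra_def)
  then show ?thesis
    by (intro k_algebra.intro k_algebra_axioms.intro)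
      (auto simp: Q_carrier Q_smult Q_add Q_mult scal_closed scal_l_distr scal_r_distr scal_assoc
        scal_one scal_mult_l scal_mult_r)
qed

end

lemma opp_simps [simp]:
  "carrier (opp A) = carrier A" "mult (opp A) = (\<lambda>x y. y \<otimes>\<^bsub>A\<^esub> x)" "one (opp A) = one A"
  "zero (opp A) = zero A" "add (opp A) = add A" "smult (opp A) = smult A" "grade (opp A) = grade A"
  by (simp_all add: opp_def)

section \<open>The enveloping algebra and its universal property\<close>

locale enveloping_algebra = k_algebra B for B :: "('k :: field, 'b) graded_module" (structure)
begin

abbreviation "Bpairs \<equiv> B \<times>\<times> opp B"
abbreviation "Bfree \<equiv> monoid_algebra Bpairs (\<lambda>n. \<Union>i. grade B i \<times> grade B (n - i)) :: ('k, 'b \<times> 'b \<Rightarrow>\<^sub>0 'k) graded_module"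
abbreviation "Brel \<equiv> genideal Bfree (tensor_relations B (opp B))"
abbreviation "BB \<equiv> enveloping B"

lemma BB_eq: "BB = quot_algebra Bfree Brel"
  by (simp add: enveloping_def tensor_algebra_def Let_def)

lemma monoid_Bpairs: "monoid Bpairs"
proof -
  have "monoid (opp B)" by (rule monoidI) (auto simp: m_assoc)
  then show ?thesis using DirProd_monoid monoid_axioms by blast
qed

lemma Bpairs_simps [simp]: "carrier Bpairs = carrier B \<times> carrier B"
  "(a, c) \<otimes>\<^bsub>Bpairs\<^esub> (a', c') = (a \<otimes> a', c' \<otimes> c)" "\<one>\<^bsub>Bpairs\<^esub> = (\<one>, \<one>)"
  by (simp_all add: DirProd_def)

lemmas free_simps = ma_add [OF monoid_Bpairs refl] ma_zero [OF monoid_Bpairs refl]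
  ma_mult_single [OF monoid_Bpairs refl]
lemmas free_carrier = ma_carrier [OF monoid_Bpairs refl]

lemmas free_add_closed [simp] = ma_add_closed [OF monoid_Bpairs refl]

lemma rel_carrier: "tensor_relations B (opp B) \<subseteq> carrier Bfree"
proof -
  have "u \<in> carrier Bfree \<Longrightarrow> v \<in> carrier Bfree \<Longrightarrow> u - v \<in> carrier Bfree" for u v
    using keys_diff [of u v] by (auto simp: free_carrier)
  then show ?thesis
    unfolding tensor_relations_def by (auto simp: free_carrier scal_closed)
qed

sublocale Q: algebra_quotient Bfree Brel
proof -
  interpret F: k_algebra Bfree by (rule ma_k_algebra [OF monoid_Bpairs refl])
  show "algebra_quotient Bfree Brel"
    by (intro algebra_quotient.intro F.k_algebra_axioms F.genideal_ideal rel_carrier)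
qed

text \<open>The target is only an abelian group. Linearity over the field is replaced by balancing a
  scalar between the factors, which is all that the scalar relations of the tensor product ask
  for.\<close>

definition biadditive :: "('b \<Rightarrow> 'b \<Rightarrow> 'v :: ab_group_add) \<Rightarrow> bool" where
  "biadditive \<beta> \<longleftrightarrow>
    (\<forall>a \<in> carrier B. \<forall>a' \<in> carrier B. \<forall>c \<in> carrier B. \<beta> (a \<oplus> a') c = \<beta> a c + \<beta> a' c) \<and>
    (\<forall>a \<in> carrier B. \<forall>c \<in> carrier B. \<forall>c' \<in> carrier B. \<beta> a (c \<oplus> c') = \<beta> a c + \<beta> a c') \<and>
    (\<forall>k. \<forall>a \<in> carrier B. \<forall>c \<in> carrier B. \<beta> (k \<odot> a) c = \<beta> a (k \<odot> c))"

lemma biadditiveD: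
  assumes "biadditive \<beta>" and "a \<in> carrier B" and "c \<in> carrier B"
  shows "a' \<in> carrier B \<Longrightarrow> \<beta> (a \<oplus> a') c = \<beta> a c + \<beta> a' c"
    and "c' \<in> carrier B \<Longrightarrow> \<beta> a (c \<oplus> c') = \<beta> a c + \<beta> a c'"
    and "\<beta> (k \<odot> a) c = \<beta> a (k \<odot> c)"
  using assms unfolding biadditive_def by blast+

text \<open>The coefficient is absorbed into the left factor. Pairs outside the carrier go to 0 so
  that every summand is additive in its coefficient without side conditions.\<close>

definition lift :: "('b \<Rightarrow> 'b \<Rightarrow> 'v :: ab_group_add) \<Rightarrow> ('b \<times> 'b \<Rightarrow>\<^sub>0 'k) \<Rightarrow> 'v" where
  "lift \<beta> = extend (\<lambda>w k. if w \<in> carrier Bpairs then \<beta> (k \<odot> fst w) (snd w) else 0)"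

lemma lift_summand_additive:
  assumes "biadditive \<beta>"
  shows "additive (\<lambda>k. if w \<in> carrier Bpairs then \<beta> (k \<odot> fst w) (snd w) else 0)"
  using assms by (cases w) (auto simp: additive_def scal_l_distr biadditiveD(1) scal_closed)

lemma lift_additive: "biadditive \<beta> \<Longrightarrow> additive (lift \<beta>)"
  unfolding lift_def by (intro extend_additive lift_summand_additive)

lemma lift_single: "biadditive \<beta> \<Longrightarrow> a \<in> carrier B \<Longrightarrow> c \<in> carrier B \<Longrightarrow>
    lift \<beta> (Poly_Mapping.single (a, c) k) = \<beta> (k \<odot> a) c"
  using lift_summand_additive [of \<beta> "(a, c)"] by (simp add: lift_def)

text \<open>Multiplication by a pure tensor turns the lift of one biadditive map into the lift of
  another. Hence the common kernel of all lifts is closed under multiplication.\<close>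

lemma lift_mult_left:
  fixes \<beta> :: "'b \<Rightarrow> 'b \<Rightarrow> 'v :: ab_group_add" and k :: 'k
  assumes \<beta>: "biadditive \<beta>" and "a \<in> carrier B" and "c \<in> carrier B" and v: "v \<in> carrier Bfree"
  defines "\<beta>' \<equiv> \<lambda>a' c'. \<beta> (k \<odot> (a \<otimes> a')) (c' \<otimes> c)"
  shows "biadditive \<beta>'" and "lift \<beta> (Poly_Mapping.single (a, c) k \<otimes>\<^bsub>Bfree\<^esub> v) = lift \<beta>' v"
proof -
  note [simp] = assms(2,3)
  show \<beta>': "biadditive \<beta>'"
    unfolding biadditive_def \<beta>'_def
    by (auto simp: r_distr l_distr scal_r_distr scal_mult_r scal_mult_l scal_closed biadditiveD [OF \<beta>]
        scal_assoc [symmetric] mult.commute)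
  show "lift \<beta> (Poly_Mapping.single (a, c) k \<otimes>\<^bsub>Bfree\<^esub> v) = lift \<beta>' v"
  proof (rule additive_eqI_keys)
    show "additive (\<lambda>v. lift \<beta> (Poly_Mapping.single (a, c) k \<otimes>\<^bsub>Bfree\<^esub> v))"
      by (intro additive_comp [OF lift_additive [OF \<beta>]] ma_mult_additive_right [OF monoid_Bpairs refl])
    show "additive (lift \<beta>')" by (rule lift_additive [OF \<beta>'])
    fix w l assume "w \<in> Poly_Mapping.keys v"
    then obtain a' c' where w: "w = (a', c')" "a' \<in> carrier B" "c' \<in> carrier B"
      using v by (cases w) (auto simp: free_carrier)
    then show "lift \<beta> (Poly_Mapping.single (a, c) k \<otimes>\<^bsub>Bfree\<^esub> Poly_Mapping.single w l)
      = lift \<beta>' (Poly_Mapping.single w l)"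
      by (simp add: free_simps lift_single [OF \<beta>] lift_single [OF \<beta>'])
        (simp add: \<beta>'_def scal_mult_r scal_closed scal_assoc)
  qed
qed

lemma lift_mult_right:
  fixes \<beta> :: "'b \<Rightarrow> 'b \<Rightarrow> 'v :: ab_group_add" and k :: 'k
  assumes \<beta>: "biadditive \<beta>" and "a \<in> carrier B" and "c \<in> carrier B" and v: "v \<in> carrier Bfree"
  defines "\<beta>' \<equiv> \<lambda>a' c'. \<beta> (k \<odot> (a' \<otimes> a)) (c \<otimes> c')"
  shows "biadditive \<beta>'" and "lift \<beta> (v \<otimes>\<^bsub>Bfree\<^esub> Poly_Mapping.single (a, c) k) = lift \<beta>' v"
proof -
  note [simp] = assms(2,3)
  show \<beta>': "biadditive \<beta>'"
    unfolding biadditive_def \<beta>'_def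
    by (auto simp: r_distr l_distr scal_r_distr scal_mult_r scal_mult_l scal_closed biadditiveD [OF \<beta>]
        scal_assoc [symmetric] mult.commute)
  show "lift \<beta> (v \<otimes>\<^bsub>Bfree\<^esub> Poly_Mapping.single (a, c) k) = lift \<beta>' v"
  proof (rule additive_eqI_keys)
    show "additive (\<lambda>v. lift \<beta> (v \<otimes>\<^bsub>Bfree\<^esub> Poly_Mapping.single (a, c) k))"
      by (intro additive_comp [OF lift_additive [OF \<beta>]] ma_mult_additive_left [OF monoid_Bpairs refl])
    show "additive (lift \<beta>')" by (rule lift_additive [OF \<beta>'])
    fix w l assume "w \<in> Poly_Mapping.keys v"
    then obtain a' c' where w: "w = (a', c')" "a' \<in> carrier B" "c' \<in> carrier B"
      using v by (cases w) (auto simp: free_carrier)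
    then show "lift \<beta> (Poly_Mapping.single w l \<otimes>\<^bsub>Bfree\<^esub> Poly_Mapping.single (a, c) k)
      = lift \<beta>' (Poly_Mapping.single w l)"
      by (simp add: free_simps lift_single [OF \<beta>] lift_single [OF \<beta>'])
        (simp add: \<beta>'_def scal_mult_l scal_closed scal_assoc mult.commute)
  qed
qed

lemma lift_relations:
  assumes \<beta>: "biadditive \<beta>" and "v \<in> tensor_relations B (opp B)"
  shows "lift \<beta> v = 0"
  using assms(2) unfolding tensor_relations_def
  by (auto simp: additive.diff [OF lift_additive [OF \<beta>]] lift_single [OF \<beta>] scal_one scal_closed
      biadditiveD [OF \<beta>])

text \<open>The relations generate an ideal, so vanishing on the generators does not suffice for a
  merely additive map. The kernel of a single lift need not be an ideal either, as multiplication
  changes \<open>\<beta>\<close>; the common kernel of all of them is one.\<close>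

lemma lift_eq_0:
  fixes \<beta> :: "'b \<Rightarrow> 'b \<Rightarrow> 'v :: ab_group_add"
  assumes "biadditive \<beta>" and "v \<in> Brel"
  shows "lift \<beta> v = 0"
proof -
  let ?J = "{v \<in> carrier Bfree. \<forall>\<beta> :: 'b \<Rightarrow> 'b \<Rightarrow> 'v. biadditive \<beta> \<longrightarrow> lift \<beta> v = 0}"
  have "ideal ?J Bfree"
  proof (rule idealI)
    show "ring Bfree" by (rule Q.ring_axioms)
    show "subgroup ?J (add_monoid Bfree)"
    proof (rule Q.add.subgroupI)
      show "?J \<noteq> {}" by (auto intro!: exI [of _ 0] simp: free_carrier additive.zero lift_additive)
      fix v assume v: "v \<in> ?J"
      then have "\<ominus>\<^bsub>Bfree\<^esub> v = - v"
        by (intro Q.minus_equality) (auto simp: free_simps free_carrier keys_minus)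
      then show "\<ominus>\<^bsub>Bfree\<^esub> v \<in> ?J"
        using v by (auto simp: free_carrier keys_minus additive.minus lift_additive)
    next
      fix v w assume "v \<in> ?J" "w \<in> ?J"
      then show "v \<oplus>\<^bsub>Bfree\<^esub> w \<in> ?J"
        by (auto simp: free_simps additive.add lift_additive)
    qed auto
    fix v w assume v: "v \<in> ?J" and w: "w \<in> carrier Bfree"
    have "lift \<beta> (w \<otimes>\<^bsub>Bfree\<^esub> v) = 0 \<and> lift \<beta> (v \<otimes>\<^bsub>Bfree\<^esub> w) = 0"
      if \<beta>: "biadditive \<beta>" for \<beta> :: "'b \<Rightarrow> 'b \<Rightarrow> 'v"
    proof (induction w rule: poly_mapping_add_induct)
      case zero
      show ?case using \<beta>
        by (simp add: ma_mult_zero [OF monoid_Bpairs refl] additive.zero lift_additive)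
    next
      case (single z k)
      then obtain a c where z: "z = (a, c)" and ac: "a \<in> carrier B" "c \<in> carrier B"
        using w by (cases z) (auto simp: free_carrier)
      have vc: "v \<in> carrier Bfree" and 0: "\<And>\<beta> :: 'b \<Rightarrow> 'b \<Rightarrow> 'v. biadditive \<beta> \<Longrightarrow> lift \<beta> v = 0"
        using v by auto
      show ?case
        unfolding z lift_mult_left(2) [OF \<beta> ac vc] lift_mult_right(2) [OF \<beta> ac vc]
        by (intro conjI 0 lift_mult_left(1) [OF \<beta> ac vc] lift_mult_right(1) [OF \<beta> ac vc])
    next
      case (add w w')
      then show ?case using \<beta>
        by (simp add: ma_mult_add_left [OF monoid_Bpairs refl]
            ma_mult_add_right [OF monoid_Bpairs refl] additive.add lift_additive)
    qed
    then show "w \<otimes>\<^bsub>Bfree\<^esub> v \<in> ?J" "v \<otimes>\<^bsub>Bfree\<^esub> w \<in> ?J" using v w by auto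
  qed
  moreover have "tensor_relations B (opp B) \<subseteq> ?J"
    using rel_carrier lift_relations by auto
  ultimately have "Brel \<subseteq> ?J" by (rule Q.genideal_minimal)
  then show ?thesis using assms by auto
qed

lemma lift_cls:
  assumes \<beta>: "biadditive \<beta>" and v: "v \<in> carrier Bfree" and w: "w \<in> Q.cls v"
  shows "lift \<beta> w = lift \<beta> v"
proof -
  obtain z where "z \<in> Brel" "w = z + v"
    using w by (auto simp: a_r_coset_def' free_simps)
  then show ?thesis using lift_eq_0 [OF \<beta>] by (simp add: additive.add [OF lift_additive [OF \<beta>]])
qed

definition Lift :: "('b \<Rightarrow> 'b \<Rightarrow> 'v :: ab_group_add) \<Rightarrow> ('k, 'b) env \<Rightarrow> 'v" where
  "Lift \<beta> u = the_elem (lift \<beta> ` u)"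

lemma Lift_cls: "biadditive \<beta> \<Longrightarrow> v \<in> carrier Bfree \<Longrightarrow> Lift \<beta> (Q.cls v) = lift \<beta> v"
proof -
  assume *: "biadditive \<beta>" "v \<in> carrier Bfree"
  have "lift \<beta> ` Q.cls v \<subseteq> {lift \<beta> v}" using lift_cls [OF *] by blast
  moreover have "lift \<beta> v \<in> lift \<beta> ` Q.cls v" using Q.cls_self [OF *(2)] by blast
  ultimately have "lift \<beta> ` Q.cls v = {lift \<beta> v}" by blast
  then show ?thesis by (simp add: Lift_def)
qed

lemma Lift_add: "biadditive \<beta> \<Longrightarrow> u \<in> carrier BB \<Longrightarrow> v \<in> carrier BB \<Longrightarrow>
    Lift \<beta> (u \<oplus>\<^bsub>BB\<^esub> v) = Lift \<beta> u + Lift \<beta> v"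
  unfolding BB_eq Q.Q_carrier
  by (auto simp: Q.Q_add Lift_cls free_simps additive.add lift_additive)

definition tens :: "'b \<Rightarrow> 'b \<Rightarrow> ('k, 'b) env" where
  "tens a c = Q.cls (Poly_Mapping.single (a, c) 1)"

lemma single_in_free [simp]: "a \<in> carrier B \<Longrightarrow> c \<in> carrier B \<Longrightarrow> Poly_Mapping.single (a, c) k \<in> carrier Bfree"
  by (simp add: free_carrier)

lemma tens_closed [simp]: "a \<in> carrier B \<Longrightarrow> c \<in> carrier B \<Longrightarrow> tens a c \<in> carrier BB"
  by (simp add: tens_def BB_eq Q.Q_carrier)

lemma Lift_tens: "biadditive \<beta> \<Longrightarrow> a \<in> carrier B \<Longrightarrow> c \<in> carrier B \<Longrightarrow> Lift \<beta> (tens a c) = \<beta> a c"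
  by (simp add: tens_def Lift_cls lift_single scal_one)

lemma free_minus: "u \<in> carrier Bfree \<Longrightarrow> v \<in> carrier Bfree \<Longrightarrow> u \<ominus>\<^bsub>Bfree\<^esub> v = u - v"
proof -
  assume *: "u \<in> carrier Bfree" "v \<in> carrier Bfree"
  then have "\<ominus>\<^bsub>Bfree\<^esub> v = - v"
    by (intro Q.minus_equality) (auto simp: free_simps free_carrier keys_minus)
  then show ?thesis by (simp add: a_minus_def free_simps)
qed

lemma rel_in: "v \<in> tensor_relations B (opp B) \<Longrightarrow> v \<in> Brel"
  using Q.genideal_self [OF rel_carrier] by auto

lemma rel_intros:
  assumes "a \<in> carrier B" "a' \<in> carrier B" "c \<in> carrier B" "c' \<in> carrier B"
  shows "Poly_Mapping.single (a \<oplus> a', c) 1 - Poly_Mapping.single (a, c) 1 - Poly_Mapping.single (a', c) 1 \<in> Brel"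
    and "Poly_Mapping.single (a, c \<oplus> c') 1 - Poly_Mapping.single (a, c) 1 - Poly_Mapping.single (a, c') 1 \<in> Brel"
    and "Poly_Mapping.single (k \<odot> a, c) 1 - Poly_Mapping.single (a, c) k \<in> Brel"
    and "Poly_Mapping.single (a, k \<odot> c) 1 - Poly_Mapping.single (a, c) k \<in> Brel"
  by (rule rel_in; unfold tensor_relations_def opp_simps; use assms in blast)+

lemma tens_scale:
  assumes "a \<in> carrier B" and "c \<in> carrier B"
  shows "Q.cls (Poly_Mapping.single (a, c) k) = tens (k \<odot> a) c"
    and "Q.cls (Poly_Mapping.single (a, c) k) = tens a (k \<odot> c)"
proof -
  note rel = rel_intros [OF assms(1) assms(1) assms(2) assms(2)]
  show "Q.cls (Poly_Mapping.single (a, c) k) = tens (k \<odot> a) c"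
    unfolding tens_def using assms rel by (subst eq_commute) (simp add: Q.cls_eq free_minus scal_closed)
  show "Q.cls (Poly_Mapping.single (a, c) k) = tens a (k \<odot> c)"
    unfolding tens_def using assms rel by (subst eq_commute) (simp add: Q.cls_eq free_minus scal_closed)
qed

lemma tens_add:
  assumes "a \<in> carrier B" "a' \<in> carrier B" "c \<in> carrier B" "c' \<in> carrier B"
  shows "tens (a \<oplus> a') c = tens a c \<oplus>\<^bsub>BB\<^esub> tens a' c"
    and "tens a (c \<oplus> c') = tens a c \<oplus>\<^bsub>BB\<^esub> tens a c'"
proof -
  show "tens (a \<oplus> a') c = tens a c \<oplus>\<^bsub>BB\<^esub> tens a' c"
    unfolding tens_def BB_eq using assms rel_intros [OF assms]
    by (simp add: Q.cls_eq free_minus free_add_closed Q.Q_add free_simps diff_diff_eq)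
  show "tens a (c \<oplus> c') = tens a c \<oplus>\<^bsub>BB\<^esub> tens a c'"
    unfolding tens_def BB_eq using assms rel_intros [OF assms]
    by (simp add: Q.cls_eq free_minus free_add_closed Q.Q_add free_simps diff_diff_eq)
qed

lemma tens_mult:
  "a \<in> carrier B \<Longrightarrow> a' \<in> carrier B \<Longrightarrow> c \<in> carrier B \<Longrightarrow> c' \<in> carrier B \<Longrightarrow>
    tens a c \<otimes>\<^bsub>BB\<^esub> tens a' c' = tens (a \<otimes> a') (c' \<otimes> c)"
  unfolding tens_def BB_eq by (simp add: Q.Q_mult free_simps)

lemma BB_one: "\<one>\<^bsub>BB\<^esub> = tens \<one> \<one>"
  unfolding tens_def BB_eq by (simp add: Q.Q_one ma_one [OF monoid_Bpairs refl])

lemma BB_ring: "ring BB"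
  using Q.Q_k_algebra unfolding BB_eq k_algebra_def by blast

text \<open>Coefficients are absorbed into the left factor, so sums of pure tensors exhaust the
  quotient and no scalar case is needed.\<close>

lemma BB_induct [consumes 1, case_names zero tens add]:
  assumes "u \<in> carrier BB"
    and zero: "P \<zero>\<^bsub>BB\<^esub>"
    and tens: "\<And>a c. a \<in> carrier B \<Longrightarrow> c \<in> carrier B \<Longrightarrow> P (tens a c)"
    and add: "\<And>u v. u \<in> carrier BB \<Longrightarrow> v \<in> carrier BB \<Longrightarrow> P u \<Longrightarrow> P v \<Longrightarrow> P (u \<oplus>\<^bsub>BB\<^esub> v)"
  shows "P u"
proof -
  obtain w where w: "w \<in> carrier Bfree" "u = Q.cls w" using assms(1) by (auto simp: BB_eq Q.Q_carrier)
  have "w \<in> carrier Bfree \<and> P (Q.cls w)"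
  proof (induction w rule: poly_mapping_add_induct)
    case zero
    show ?case using assms(2) by (simp add: BB_eq Q.Q_zero free_simps free_carrier)
  next
    case (single z k)
    then obtain a c where "z = (a, c)" "a \<in> carrier B" "c \<in> carrier B"
      using w by (cases z) (auto simp: free_carrier)
    then show ?case using tens by (simp add: tens_scale(1) scal_closed)
  next
    case (add v v')
    then show ?case
      using assms(4) [of "Q.cls v" "Q.cls v'"]
      by (auto simp: BB_eq Q.Q_carrier Q.Q_add free_simps)
  qed
  then show ?thesis using w by simp
qed

text \<open>Absorbing a coefficient must not change the degree. As no grading of B is assumed in
  this locale, stability under scalars appears as a premise.\<close>

lemma BB_grade_induct [consumes 1, case_names zero tens add]:
  assumes "u \<in> grade BB n"
    and scal: "\<And>i a k. a \<in> grade B i \<Longrightarrow> k \<odot> a \<in> grade B i"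
    and zero: "P \<zero>\<^bsub>BB\<^esub>"
    and tens: "\<And>a c i. a \<in> carrier B \<Longrightarrow> c \<in> carrier B \<Longrightarrow> a \<in> grade B i \<Longrightarrow> c \<in> grade B (n - i) \<Longrightarrow> P (tens a c)"
    and add: "\<And>u v. u \<in> carrier BB \<Longrightarrow> v \<in> carrier BB \<Longrightarrow> P u \<Longrightarrow> P v \<Longrightarrow> P (u \<oplus>\<^bsub>BB\<^esub> v)"
  shows "P u"
proof -
  obtain w where w: "w \<in> grade Bfree n" "u = Q.cls w" using assms(1) by (auto simp: BB_eq Q.Q_grade)
  have "w \<in> carrier Bfree \<and> P (Q.cls w)"
  proof (induction w rule: poly_mapping_add_induct)
    case zero
    show ?case using assms(3) by (simp add: BB_eq Q.Q_zero free_simps free_carrier)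
  next
    case (single z k)
    then obtain a c i where "z = (a, c)" "a \<in> carrier B" "c \<in> carrier B" "a \<in> grade B i" "c \<in> grade B (n - i)"
      using w unfolding ma_grade [OF monoid_Bpairs refl] Bpairs_simps by (cases z) blast
    then show ?case using tens [of "k \<odot> a" c i] scal [of a i k] by (simp add: tens_scale(1) scal_closed)
  next
    case (add v v')
    then show ?case
      using assms(5) [of "Q.cls v" "Q.cls v'"]
      by (auto simp: BB_eq Q.Q_carrier Q.Q_add free_simps)
  qed
  then show ?thesis using w by simp
qed

lemma tens_grade: "a \<in> carrier B \<Longrightarrow> c \<in> carrier B \<Longrightarrow> a \<in> grade B i \<Longrightarrow> c \<in> grade B (n - i) \<Longrightarrow>
    tens a c \<in> grade BB n"
  unfolding tens_def BB_eq Q.Q_grade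
  by (intro imageI) (auto simp: ma_grade [OF monoid_Bpairs refl])

lemma BB_grade_subset: "u \<in> grade BB n \<Longrightarrow> u \<in> carrier BB"
  unfolding BB_eq Q.Q_grade Q.Q_carrier by (auto simp: ma_grade [OF monoid_Bpairs refl] free_carrier)

lemma BB_grade_add: "u \<in> grade BB n \<Longrightarrow> v \<in> grade BB n \<Longrightarrow> u \<oplus>\<^bsub>BB\<^esub> v \<in> grade BB n"
  and BB_grade_zero: "\<zero>\<^bsub>BB\<^esub> \<in> grade BB n"
proof -
  have *: "w \<in> grade Bfree n \<Longrightarrow> w \<in> carrier Bfree" for w
    by (auto simp: ma_grade [OF monoid_Bpairs refl] free_carrier)
  have **: "v \<in> grade Bfree n \<Longrightarrow> w \<in> grade Bfree n \<Longrightarrow> v + w \<in> grade Bfree n" for v w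
    using keys_add [of v w] by (auto simp: ma_grade [OF monoid_Bpairs refl])
  show "u \<in> grade BB n \<Longrightarrow> v \<in> grade BB n \<Longrightarrow> u \<oplus>\<^bsub>BB\<^esub> v \<in> grade BB n"
    unfolding BB_eq Q.Q_grade using * ** by (auto simp: Q.Q_add free_simps)
  show "\<zero>\<^bsub>BB\<^esub> \<in> grade BB n"
    unfolding BB_eq Q.Q_grade Q.Q_zero by (intro imageI) (simp add: free_simps ma_grade [OF monoid_Bpairs refl])
qed

end

section \<open>Graded groups and modules\<close>

context abelian_group
begin

lemma finsum_mono_neutral:
  assumes "finite A" and "S \<subseteq> A" and "\<And>i. i \<in> A - S \<Longrightarrow> f i = \<zero>" and "\<And>i. i \<in> A \<Longrightarrow> f i \<in> carrier G"
  shows "finsum G f A = finsum G f S"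
proof -
  have "finsum G f A = finsum G f (S \<union> (A - S))" using assms(2) by (simp add: Un_absorb1)
  also have "\<dots> = finsum G f S \<oplus> finsum G f (A - S)"
    using assms by (intro finsum_Un_disjoint) (auto intro: finite_subset)
  also have "finsum G f (A - S) = \<zero>" using assms(3) by (intro add.finprod_one_eqI) auto
  also have "finsum G f S \<oplus> \<zero> = finsum G f S"
    using assms by (intro r_zero finsum_closed) auto
  finally show ?thesis .
qed

lemma hom_zero_minus:
  assumes "abelian_group N" and "\<And>x. x \<in> carrier G \<Longrightarrow> h x \<in> carrier N"
    and "\<And>x y. x \<in> carrier G \<Longrightarrow> y \<in> carrier G \<Longrightarrow> h (x \<oplus> y) = h x \<oplus>\<^bsub>N\<^esub> h y"
  shows "h \<zero> = \<zero>\<^bsub>N\<^esub>" and "x \<in> carrier G \<Longrightarrow> h (\<ominus> x) = \<ominus>\<^bsub>N\<^esub> h x"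
    and "x \<in> carrier G \<Longrightarrow> y \<in> carrier G \<Longrightarrow> h (x \<ominus> y) = h x \<ominus>\<^bsub>N\<^esub> h y"
proof -
  interpret N: abelian_group N by fact
  have "h \<zero> \<oplus>\<^bsub>N\<^esub> h \<zero> = h \<zero>" using assms(3) [of \<zero> \<zero>] by simp
  then show 0: "h \<zero> = \<zero>\<^bsub>N\<^esub>" using assms(2) N.add.r_cancel_one' by force
  have m: "h (\<ominus> x) = \<ominus>\<^bsub>N\<^esub> h x" if "x \<in> carrier G" for x
    using assms(2) assms(3) [of "\<ominus> x" x] that 0
    by (intro N.minus_equality [symmetric]) (auto simp: l_neg)
  then show "x \<in> carrier G \<Longrightarrow> h (\<ominus> x) = \<ominus>\<^bsub>N\<^esub> h x" .
  show "x \<in> carrier G \<Longrightarrow> y \<in> carrier G \<Longrightarrow> h (x \<ominus> y) = h x \<ominus>\<^bsub>N\<^esub> h y"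
    using assms(3) [of x "\<ominus> y"] m by (simp add: a_minus_def)
qed

lemma hom_finsum:
  assumes N: "abelian_group N" and h: "\<And>x. x \<in> carrier G \<Longrightarrow> h x \<in> carrier N"
    "\<And>x y. x \<in> carrier G \<Longrightarrow> y \<in> carrier G \<Longrightarrow> h (x \<oplus> y) = h x \<oplus>\<^bsub>N\<^esub> h y"
    and "finite A" and "\<And>i. i \<in> A \<Longrightarrow> f i \<in> carrier G"
  shows "h (finsum G f A) = finsum N (\<lambda>i. h (f i)) A"
proof -
  interpret N: abelian_group N by fact
  show ?thesis
    using assms(4,5)
  proof (induction A rule: finite_induct)
  case empty
  then show ?case using hom_zero_minus(1) [OF N h] by simp
next
  case (insert a A)
  then show ?case using h by (simp add: Pi_def)
qed
qed

end

lemma subgroup_add: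
  assumes "subgroup H (add_monoid M)"
  shows "\<zero>\<^bsub>M\<^esub> \<in> H" and "x \<in> H \<Longrightarrow> y \<in> H \<Longrightarrow> x \<oplus>\<^bsub>M\<^esub> y \<in> H" and "x \<in> H \<Longrightarrow> x \<in> carrier M"
  using assms subgroup.one_closed subgroup.m_closed subgroup.subset by fastforce+

text \<open>Uniqueness of homogeneous decompositions comes from the projections: applying
  \<open>pr n\<close> to any decomposition returns its n-th term.\<close>

lemma graded_group_projI:
  assumes M: "abelian_group M"
    and grade: "\<And>n. subgroup (grade M n) (add_monoid M)"
    and pr: "\<And>n x. x \<in> carrier M \<Longrightarrow> pr n x \<in> grade M n"
      "\<And>n x y. x \<in> carrier M \<Longrightarrow> y \<in> carrier M \<Longrightarrow> pr n (x \<oplus>\<^bsub>M\<^esub> y) = pr n x \<oplus>\<^bsub>M\<^esub> pr n y"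
      "\<And>m n x. x \<in> grade M n \<Longrightarrow> pr m x = (if m = n then x else \<zero>\<^bsub>M\<^esub>)"
    and sum: "\<And>x. x \<in> carrier M \<Longrightarrow> \<exists>N. finite N \<and> (\<forall>n. n \<notin> N \<longrightarrow> pr n x = \<zero>\<^bsub>M\<^esub>) \<and> x = (\<Oplus>\<^bsub>M\<^esub>n\<in>N. pr n x)"
  shows "graded_group M"
proof -
  interpret abelian_group M by fact
  have gc: "x \<in> grade M n \<Longrightarrow> x \<in> carrier M" for x n
    using subgroup_add(3) [OF grade] .
  have "\<exists>!c. (\<forall>n. c n \<in> grade M n) \<and> finite {n. c n \<noteq> \<zero>\<^bsub>M\<^esub>} \<and> x = (\<Oplus>\<^bsub>M\<^esub>n\<in>{n. c n \<noteq> \<zero>\<^bsub>M\<^esub>}. c n)"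
    if x: "x \<in> carrier M" for x
  proof (rule ex1I [of _ "\<lambda>n. pr n x"])
    obtain N where N: "finite N" "\<forall>n. n \<notin> N \<longrightarrow> pr n x = \<zero>\<^bsub>M\<^esub>" "x = (\<Oplus>\<^bsub>M\<^esub>n\<in>N. pr n x)"
      using sum [OF x] by blast
    have sub: "{n. pr n x \<noteq> \<zero>\<^bsub>M\<^esub>} \<subseteq> N" using N(2) by blast
    have "(\<Oplus>\<^bsub>M\<^esub>n\<in>N. pr n x) = (\<Oplus>\<^bsub>M\<^esub>n\<in>{n. pr n x \<noteq> \<zero>\<^bsub>M\<^esub>}. pr n x)"
      using pr(1) [OF x] gc by (intro finsum_mono_neutral [OF N(1) sub]) auto
    then have "x = (\<Oplus>\<^bsub>M\<^esub>n\<in>{n. pr n x \<noteq> \<zero>\<^bsub>M\<^esub>}. pr n x)"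
      by (rule trans [OF N(3)])
    then show "(\<forall>n. pr n x \<in> grade M n) \<and> finite {n. pr n x \<noteq> \<zero>\<^bsub>M\<^esub>} \<and>
        x = (\<Oplus>\<^bsub>M\<^esub>n\<in>{n. pr n x \<noteq> \<zero>\<^bsub>M\<^esub>}. pr n x)"
      using pr(1) [OF x] finite_subset [OF sub N(1)] by simp
    fix c assume c: "(\<forall>n. c n \<in> grade M n) \<and> finite {n. c n \<noteq> \<zero>\<^bsub>M\<^esub>} \<and> x = (\<Oplus>\<^bsub>M\<^esub>n\<in>{n. c n \<noteq> \<zero>\<^bsub>M\<^esub>}. c n)"
    let ?S = "{n. c n \<noteq> \<zero>\<^bsub>M\<^esub>}"
    show "c = (\<lambda>n. pr n x)"
    proof
      fix n
      have fin: "finite (insert n ?S)" using c by simp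
      have cc: "c m \<in> carrier M" for m using c gc by blast
      have "x = finsum M c ?S" using c by simp
      \<comment> \<open>The index n is adjoined so that its term can be singled out even if
        \<open>c n\<close> is zero.\<close>
      also have "\<dots> = finsum M c (insert n ?S)"
        using cc by (intro finsum_mono_neutral [OF fin, symmetric]) auto
      finally have "pr n x = pr n (finsum M c (insert n ?S))" by (rule arg_cong)
      also have "\<dots> = (\<Oplus>\<^bsub>M\<^esub>m\<in>insert n ?S. pr n (c m))"
        by (rule hom_finsum [OF M _ _ fin]) (use pr(2) gc [OF pr(1)] cc in auto)
      also have "\<dots> = (\<Oplus>\<^bsub>M\<^esub>m\<in>{n}. pr n (c m))"
      proof (rule finsum_mono_neutral [OF fin])
        fix i assume "i \<in> insert n ?S - {n}"
        then show "pr n (c i) = \<zero>\<^bsub>M\<^esub>" using c pr(3) [of "c i" i n] by auto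
      qed (use gc [OF pr(1)] cc in auto)
      also have "\<dots> = pr n (c n)"
        using gc [OF pr(1) [OF cc [of n]], of n] by (simp add: Pi_def)
      also have "\<dots> = c n" using c pr(3) [of "c n" n n] by simp
      finally show "c n = pr n x" by simp
    qed
  qed
  then show ?thesis unfolding graded_group_def using M grade by blast
qed

definition component :: "('a, 'b) graded_module \<Rightarrow> 'b \<Rightarrow> int \<Rightarrow> 'b" where
  "component M x = (THE c. (\<forall>n. c n \<in> grade M n) \<and> finite {n. c n \<noteq> \<zero>\<^bsub>M\<^esub>} \<and>
    x = (\<Oplus>\<^bsub>M\<^esub>n\<in>{n. c n \<noteq> \<zero>\<^bsub>M\<^esub>}. c n))"

context
  fixes M :: "('a, 'b) graded_module"
  assumes M: "graded_group M"
begin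

interpretation abelian_group M using M by (simp add: graded_group_def)

lemma grade_subgroup: "subgroup (grade M n) (add_monoid M)"
  using M by (simp add: graded_group_def)

lemma grade_carrier: "x \<in> grade M n \<Longrightarrow> x \<in> carrier M"
  by (rule subgroup_add(3) [OF grade_subgroup])

lemma component_all:
  assumes "x \<in> carrier M"
  shows "component M x n \<in> grade M n" and "finite {n. component M x n \<noteq> \<zero>\<^bsub>M\<^esub>}"
    and "x = (\<Oplus>\<^bsub>M\<^esub>n\<in>{n. component M x n \<noteq> \<zero>\<^bsub>M\<^esub>}. component M x n)"
proof -
  have "\<exists>!c. (\<forall>n. c n \<in> grade M n) \<and> finite {n. c n \<noteq> \<zero>\<^bsub>M\<^esub>} \<and> x = (\<Oplus>\<^bsub>M\<^esub>n\<in>{n. c n \<noteq> \<zero>\<^bsub>M\<^esub>}. c n)"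
    using M assms unfolding graded_group_def by blast
  from theI' [OF this] show "component M x n \<in> grade M n" and "finite {n. component M x n \<noteq> \<zero>\<^bsub>M\<^esub>}"
    and "x = (\<Oplus>\<^bsub>M\<^esub>n\<in>{n. component M x n \<noteq> \<zero>\<^bsub>M\<^esub>}. component M x n)"
    unfolding component_def by blast+
qed

lemma component_carrier: "x \<in> carrier M \<Longrightarrow> component M x n \<in> carrier M"
  using component_all(1) grade_carrier by blast

lemma component_unique:
  assumes "x \<in> carrier M" and "\<And>n. c n \<in> grade M n" and N: "finite N" "\<And>n. n \<notin> N \<Longrightarrow> c n = \<zero>\<^bsub>M\<^esub>"
    and x: "x = (\<Oplus>\<^bsub>M\<^esub>n\<in>N. c n)"
  shows "component M x = c"
proof -
  have sub: "{n. c n \<noteq> \<zero>\<^bsub>M\<^esub>} \<subseteq> N" using N by blast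
  have "x = (\<Oplus>\<^bsub>M\<^esub>n\<in>{n. c n \<noteq> \<zero>\<^bsub>M\<^esub>}. c n)"
    using x finsum_mono_neutral [OF N(1) sub, of c] assms(2) grade_carrier by auto
  moreover have "finite {n. c n \<noteq> \<zero>\<^bsub>M\<^esub>}" using sub N(1) by (rule finite_subset)
  moreover have "\<exists>!c. (\<forall>n. c n \<in> grade M n) \<and> finite {n. c n \<noteq> \<zero>\<^bsub>M\<^esub>} \<and> x = (\<Oplus>\<^bsub>M\<^esub>n\<in>{n. c n \<noteq> \<zero>\<^bsub>M\<^esub>}. c n)"
    using M assms(1) unfolding graded_group_def by blast
  ultimately show ?thesis unfolding component_def using assms(2) by (intro the1_equality) auto
qed

lemma component_sum:
  assumes "x \<in> carrier M" and "finite N" and "{n. component M x n \<noteq> \<zero>\<^bsub>M\<^esub>} \<subseteq> N"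
  shows "x = (\<Oplus>\<^bsub>M\<^esub>n\<in>N. component M x n)"
  using component_all(3) [OF assms(1)] finsum_mono_neutral [OF assms(2,3), of "component M x"] component_carrier assms
  by auto

lemma component_add:
  assumes x: "x \<in> carrier M" and y: "y \<in> carrier M"
  shows "component M (x \<oplus>\<^bsub>M\<^esub> y) n = component M x n \<oplus>\<^bsub>M\<^esub> component M y n"
proof -
  let ?N = "{n. component M x n \<noteq> \<zero>\<^bsub>M\<^esub>} \<union> {n. component M y n \<noteq> \<zero>\<^bsub>M\<^esub>}"
  have N: "finite ?N" using component_all(2) x y by simp
  have "x \<oplus>\<^bsub>M\<^esub> y = (\<Oplus>\<^bsub>M\<^esub>n\<in>?N. component M x n) \<oplus>\<^bsub>M\<^esub> (\<Oplus>\<^bsub>M\<^esub>n\<in>?N. component M y n)"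
    using component_sum [OF x N] component_sum [OF y N] by simp
  also have "\<dots> = (\<Oplus>\<^bsub>M\<^esub>n\<in>?N. component M x n \<oplus>\<^bsub>M\<^esub> component M y n)"
    using x y by (intro finsum_addf [symmetric]) (auto simp: component_carrier)
  finally have "component M (x \<oplus>\<^bsub>M\<^esub> y) = (\<lambda>n. component M x n \<oplus>\<^bsub>M\<^esub> component M y n)"
    using x y by (intro component_unique [OF a_closed _ N])
      (auto intro!: subgroup_add(2) [OF grade_subgroup] component_all(1))
  then show ?thesis by simp
qed

lemma component_homogeneous:
  assumes "x \<in> grade M n"
  shows "component M x m = (if m = n then x else \<zero>\<^bsub>M\<^esub>)"
proof -
  have "component M x = (\<lambda>m. if m = n then x else \<zero>\<^bsub>M\<^esub>)"
    using assms by (intro component_unique [of _ _ "{n}"])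
      (auto simp: grade_carrier subgroup_add(1) [OF grade_subgroup])
  then show ?thesis by simp
qed

lemma component_zero: "component M \<zero>\<^bsub>M\<^esub> n = \<zero>\<^bsub>M\<^esub>"
  using component_homogeneous [of "\<zero>\<^bsub>M\<^esub>" n n] subgroup_add(1) [OF grade_subgroup] by simp

lemma homogeneous_induct [consumes 1, case_names homogeneous add]:
  assumes "x \<in> carrier M"
    and hom: "\<And>n x. x \<in> grade M n \<Longrightarrow> P x"
    and add: "\<And>x y. x \<in> carrier M \<Longrightarrow> y \<in> carrier M \<Longrightarrow> P x \<Longrightarrow> P y \<Longrightarrow> P (x \<oplus>\<^bsub>M\<^esub> y)"
  shows "P x"
proof -
  have "P (\<Oplus>\<^bsub>M\<^esub>n\<in>N. component M x n)" if "finite N" for N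
    using that
  proof (induction N rule: finite_induct)
    case empty
    then show ?case using hom subgroup_add(1) [OF grade_subgroup] by simp
  next
    case (insert n N)
    have "P (component M x n)" using component_all(1) [OF assms(1)] by (rule hom)
    then show ?case using insert assms(1)
      by (simp add: component_carrier Pi_def add)
  qed
  then show ?thesis using component_all(2,3) [OF assms(1)] by metis
qed

end

text \<open>Of an additive map between graded groups only the part that preserves degrees is kept.
  It serves to make an ungraded lift graded.\<close>

definition degree_zero_part ::
    "('a, 'm) graded_module \<Rightarrow> ('c, 'n) graded_module \<Rightarrow> ('m \<Rightarrow> 'n) \<Rightarrow> 'm \<Rightarrow> 'n" where
  "degree_zero_part M N h = (\<lambda>x \<in> carrier M.
     \<Oplus>\<^bsub>N\<^esub>n \<in> {n. component M x n \<noteq> \<zero>\<^bsub>M\<^esub>}. component N (h (component M x n)) n)"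

context
  fixes M :: "('a, 'm) graded_module" and N :: "('c, 'n) graded_module" and h
  assumes M: "graded_group M" and N: "graded_group N"
    and h: "\<And>x. x \<in> carrier M \<Longrightarrow> h x \<in> carrier N"
      "\<And>x y. x \<in> carrier M \<Longrightarrow> y \<in> carrier M \<Longrightarrow> h (x \<oplus>\<^bsub>M\<^esub> y) = h x \<oplus>\<^bsub>N\<^esub> h y"
begin

interpretation M: abelian_group M using M by (simp add: graded_group_def)
interpretation N: abelian_group N using N by (simp add: graded_group_def)

lemma dzp_summand: "x \<in> carrier M \<Longrightarrow> component N (h (component M x n)) n \<in> carrier N"
  by (intro component_carrier [OF N] h(1) component_carrier [OF M])

lemma h_zero: "h \<zero>\<^bsub>M\<^esub> = \<zero>\<^bsub>N\<^esub>"
  by (rule M.hom_zero_minus(1) [OF N.abelian_group_axioms h])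

lemma dzp_closed: "x \<in> carrier M \<Longrightarrow> degree_zero_part M N h x \<in> carrier N"
  by (simp add: degree_zero_part_def dzp_summand N.finsum_closed Pi_def)

lemma dzp_superset:
  assumes "x \<in> carrier M" and "finite S" and "{n. component M x n \<noteq> \<zero>\<^bsub>M\<^esub>} \<subseteq> S"
  shows "degree_zero_part M N h x = (\<Oplus>\<^bsub>N\<^esub>n \<in> S. component N (h (component M x n)) n)"
  using assms N.finsum_mono_neutral [OF assms(2,3), of "\<lambda>n. component N (h (component M x n)) n"]
  by (auto simp: degree_zero_part_def dzp_summand h_zero component_zero [OF N])

lemma dzp_add:
  assumes x: "x \<in> carrier M" and y: "y \<in> carrier M"
  shows "degree_zero_part M N h (x \<oplus>\<^bsub>M\<^esub> y) = degree_zero_part M N h x \<oplus>\<^bsub>N\<^esub> degree_zero_part M N h y"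
proof -
  let ?S = "{n. component M x n \<noteq> \<zero>\<^bsub>M\<^esub>} \<union> {n. component M y n \<noteq> \<zero>\<^bsub>M\<^esub>}"
  have S: "finite ?S" using component_all(2) [OF M] x y by simp
  have "{n. component M (x \<oplus>\<^bsub>M\<^esub> y) n \<noteq> \<zero>\<^bsub>M\<^esub>} \<subseteq> ?S" using x y by (auto simp: component_add [OF M])
  then have "degree_zero_part M N h (x \<oplus>\<^bsub>M\<^esub> y) = (\<Oplus>\<^bsub>N\<^esub>n \<in> ?S. component N (h (component M (x \<oplus>\<^bsub>M\<^esub> y) n)) n)"
    using x y S by (intro dzp_superset) auto
  also have "\<dots> = (\<Oplus>\<^bsub>N\<^esub>n \<in> ?S. component N (h (component M x n)) n \<oplus>\<^bsub>N\<^esub> component N (h (component M y n)) n)"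
    using x y by (intro N.finsum_cong')
      (auto simp: component_add [OF M] component_add [OF N] h component_carrier [OF M] dzp_summand)
  also have "\<dots> = degree_zero_part M N h x \<oplus>\<^bsub>N\<^esub> degree_zero_part M N h y"
    using x y S by (subst (1 2) dzp_superset [OF _ S]) (auto intro!: N.finsum_addf simp: dzp_summand)
  finally show ?thesis .
qed

lemma dzp_homogeneous:
  assumes "x \<in> grade M n"
  shows "degree_zero_part M N h x = component N (h x) n"
proof -
  have "{m. component M x m \<noteq> \<zero>\<^bsub>M\<^esub>} \<subseteq> {n}" by (auto simp: component_homogeneous [OF M assms])
  then show ?thesis
    using dzp_superset [of x "{n}"] grade_carrier [OF M assms] dzp_summand [of x n]
    by (simp add: component_homogeneous [OF M assms])
qed

end

section \<open>Homomorphisms and lifting\<close>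

lemma lmod_homD:
  assumes "h \<in> lmod_hom R M N"
  shows "x \<in> carrier M \<Longrightarrow> h x \<in> carrier N"
    and "x \<in> carrier M \<Longrightarrow> y \<in> carrier M \<Longrightarrow> h (x \<oplus>\<^bsub>M\<^esub> y) = h x \<oplus>\<^bsub>N\<^esub> h y"
    and "r \<in> carrier R \<Longrightarrow> x \<in> carrier M \<Longrightarrow> h (r \<odot>\<^bsub>M\<^esub> x) = r \<odot>\<^bsub>N\<^esub> h x"
    and "x \<notin> carrier M \<Longrightarrow> h x = undefined"
  using assms by (auto simp: lmod_hom_def)

lemma lmod_homI:
  assumes "\<And>x. x \<in> carrier M \<Longrightarrow> h x \<in> carrier N"
    and "\<And>x y. x \<in> carrier M \<Longrightarrow> y \<in> carrier M \<Longrightarrow> x \<oplus>\<^bsub>M\<^esub> y \<in> carrier M \<Longrightarrow> h (x \<oplus>\<^bsub>M\<^esub> y) = h x \<oplus>\<^bsub>N\<^esub> h y"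
    and "\<And>r x. r \<in> carrier R \<Longrightarrow> x \<in> carrier M \<Longrightarrow> r \<odot>\<^bsub>M\<^esub> x \<in> carrier M \<Longrightarrow> h (r \<odot>\<^bsub>M\<^esub> x) = r \<odot>\<^bsub>N\<^esub> h x"
    and "\<And>x y. x \<in> carrier M \<Longrightarrow> y \<in> carrier M \<Longrightarrow> x \<oplus>\<^bsub>M\<^esub> y \<in> carrier M"
    and "\<And>r x. r \<in> carrier R \<Longrightarrow> x \<in> carrier M \<Longrightarrow> r \<odot>\<^bsub>M\<^esub> x \<in> carrier M"
  shows "(\<lambda>x \<in> carrier M. h x) \<in> lmod_hom R M N"
  using assms by (auto simp: lmod_hom_def)

context left_module
begin

lemma smult_zero_right: "r \<in> carrier R \<Longrightarrow> r \<odot>\<^bsub>M\<^esub> \<zero>\<^bsub>M\<^esub> = \<zero>\<^bsub>M\<^esub>"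
  by (rule M.hom_zero_minus(1)) (auto simp: smult_closed smult_r_distr M.abelian_group_axioms)

lemma smult_zero_left: "x \<in> carrier M \<Longrightarrow> \<zero>\<^bsub>R\<^esub> \<odot>\<^bsub>M\<^esub> x = \<zero>\<^bsub>M\<^esub>"
  by (rule R.hom_zero_minus(1) [of M "\<lambda>r. r \<odot>\<^bsub>M\<^esub> x"])
    (auto simp: smult_closed smult_l_distr M.abelian_group_axioms)

lemma smult_minus: "r \<in> carrier R \<Longrightarrow> x \<in> carrier M \<Longrightarrow> y \<in> carrier M \<Longrightarrow>
    r \<odot>\<^bsub>M\<^esub> (x \<ominus>\<^bsub>M\<^esub> y) = r \<odot>\<^bsub>M\<^esub> x \<ominus>\<^bsub>M\<^esub> r \<odot>\<^bsub>M\<^esub> y"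
  by (rule M.hom_zero_minus(3)) (auto simp: smult_closed smult_r_distr M.abelian_group_axioms)

lemma smult_finsum:
  assumes "r \<in> carrier R" and "finite A" and "\<And>i. i \<in> A \<Longrightarrow> f i \<in> carrier M"
  shows "r \<odot>\<^bsub>M\<^esub> finsum M f A = (\<Oplus>\<^bsub>M\<^esub>i\<in>A. r \<odot>\<^bsub>M\<^esub> f i)"
  using assms by (intro M.hom_finsum) (auto simp: smult_closed smult_r_distr M.abelian_group_axioms)

end

lemma lmod_hom_compose:
  assumes "left_module R L" and f: "f \<in> lmod_hom R L M" and g: "g \<in> lmod_hom R M N"
  shows "compose (carrier L) g f \<in> lmod_hom R L N"
proof -
  interpret left_module R L by fact
  show ?thesis unfolding compose_def
    by (rule lmod_homI)
      (auto simp: lmod_homD [OF f] lmod_homD [OF g] smult_closed)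
qed

lemma lmod_hom_zero_minus:
  assumes "left_module R M" and "left_module R N" and f: "f \<in> lmod_hom R M N"
  shows "f \<zero>\<^bsub>M\<^esub> = \<zero>\<^bsub>N\<^esub>"
    and "x \<in> carrier M \<Longrightarrow> y \<in> carrier M \<Longrightarrow> f (x \<ominus>\<^bsub>M\<^esub> y) = f x \<ominus>\<^bsub>N\<^esub> f y"
proof -
  interpret M: left_module R M by fact
  interpret N: left_module R N by fact
  show "f \<zero>\<^bsub>M\<^esub> = \<zero>\<^bsub>N\<^esub>"
    by (rule M.M.hom_zero_minus(1)) (auto simp: lmod_homD [OF f] N.M.abelian_group_axioms)
  show "x \<in> carrier M \<Longrightarrow> y \<in> carrier M \<Longrightarrow> f (x \<ominus>\<^bsub>M\<^esub> y) = f x \<ominus>\<^bsub>N\<^esub> f y"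
    by (rule M.M.hom_zero_minus(3)) (auto simp: lmod_homD [OF f] N.M.abelian_group_axioms)
qed

lemma (in abelian_group) minus_add_swap:
  "a \<in> carrier G \<Longrightarrow> b \<in> carrier G \<Longrightarrow> c \<in> carrier G \<Longrightarrow> d \<in> carrier G \<Longrightarrow>
    (a \<oplus> b) \<ominus> (c \<oplus> d) = (a \<ominus> c) \<oplus> (b \<ominus> d)"
  by (simp add: a_minus_def minus_add a_ac)

lemma lmod_hom_diff:
  assumes "left_module R M" and "left_module R N" and f: "f \<in> lmod_hom R M N" and g: "g \<in> lmod_hom R M N"
  shows "(\<lambda>x \<in> carrier M. f x \<ominus>\<^bsub>N\<^esub> g x) \<in> lmod_hom R M N"
proof -
  interpret M: left_module R M by fact
  interpret N: left_module R N by fact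
  show ?thesis
    by (rule lmod_homI)
      (auto simp: lmod_homD [OF f] lmod_homD [OF g] M.smult_closed N.smult_minus N.M.minus_add_swap)
qed

section \<open>Free modules and lifting along projective modules\<close>

definition unit_vec :: "('r, 'z) ring_scheme \<Rightarrow> 's \<Rightarrow> 's \<Rightarrow> 'r" where
  "unit_vec R s = (\<lambda>t. if t = s then \<one>\<^bsub>R\<^esub> else \<zero>\<^bsub>R\<^esub>)"

context ring
begin

lemma free_simps:
  "carrier (free_module R S) = {f. (\<forall>s \<in> S. f s \<in> carrier R) \<and> (\<forall>s. s \<notin> S \<longrightarrow> f s = \<zero>) \<and> finite {s. f s \<noteq> \<zero>}}"
  "zero (free_module R S) = (\<lambda>s. \<zero>)"
  "add (free_module R S) = (\<lambda>f g s. f s \<oplus> g s)"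
  "smult (free_module R S) = (\<lambda>r f s. r \<otimes> f s)"
  by (simp_all add: free_module_def)

lemma free_val: "f \<in> carrier (free_module R S) \<Longrightarrow> f s \<in> carrier R"
  by (cases "s \<in> S") (auto simp: free_simps)

lemma free_finite: "f \<in> carrier (free_module R S) \<Longrightarrow> finite {s. f s \<noteq> \<zero>}"
  by (simp add: free_simps)

lemma free_add_closed:
  assumes "f \<in> carrier (free_module R S)" and "g \<in> carrier (free_module R S)"
  shows "f \<oplus>\<^bsub>free_module R S\<^esub> g \<in> carrier (free_module R S)"
proof -
  have "{s. f s \<oplus> g s \<noteq> \<zero>} \<subseteq> {s. f s \<noteq> \<zero>} \<union> {s. g s \<noteq> \<zero>}" by auto
  moreover have "finite ({s. f s \<noteq> \<zero>} \<union> {s. g s \<noteq> \<zero>})" using assms by (simp add: free_simps)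
  ultimately have "finite {s. f s \<oplus> g s \<noteq> \<zero>}" by (rule finite_subset)
  then show ?thesis using assms by (simp add: free_simps)
qed

lemma free_smult_closed:
  assumes "r \<in> carrier R" and "f \<in> carrier (free_module R S)"
  shows "r \<odot>\<^bsub>free_module R S\<^esub> f \<in> carrier (free_module R S)"
proof -
  have "{s. r \<otimes> f s \<noteq> \<zero>} \<subseteq> {s. f s \<noteq> \<zero>}" using assms by auto
  moreover have "finite {s. f s \<noteq> \<zero>}" using assms by (simp add: free_simps)
  ultimately have "finite {s. r \<otimes> f s \<noteq> \<zero>}" by (rule finite_subset)
  then show ?thesis using assms by (simp add: free_simps)
qed

lemma free_left_module: "left_module R (free_module R S)"
proof -
  have "abelian_group (free_module R S)"
  proof (rule abelian_groupI)
    fix f assume f: "f \<in> carrier (free_module R S)"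
    have "(\<lambda>s. \<ominus> f s) \<in> carrier (free_module R S)"
    proof -
      have "{s. \<ominus> f s \<noteq> \<zero>} \<subseteq> {s. f s \<noteq> \<zero>}" by auto
      then have "finite {s. \<ominus> f s \<noteq> \<zero>}" using free_finite [OF f] finite_subset by blast
      then show ?thesis using f by (simp add: free_simps)
    qed
    then show "\<exists>g\<in>carrier (free_module R S). g \<oplus>\<^bsub>free_module R S\<^esub> f = \<zero>\<^bsub>free_module R S\<^esub>"
      using free_val [OF f] by (intro bexI [of _ "\<lambda>s. \<ominus> f s"]) (auto simp: free_simps l_neg)
  next
    fix f g assume "f \<in> carrier (free_module R S)" "g \<in> carrier (free_module R S)"
    then show "f \<oplus>\<^bsub>free_module R S\<^esub> g \<in> carrier (free_module R S)" by (rule free_add_closed)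
  next
    show "\<zero>\<^bsub>free_module R S\<^esub> \<in> carrier (free_module R S)" by (simp add: free_simps)
  qed (auto simp: free_simps(2-) free_val a_ac)
  then show ?thesis
    by (intro left_module.intro left_module_axioms.intro ring_axioms free_smult_closed)
      (auto simp: free_simps(2-) free_val l_distr r_distr m_assoc)
qed

lemma unit_vec_closed: "s \<in> S \<Longrightarrow> unit_vec R s \<in> carrier (free_module R S)"
  by (auto simp: free_simps unit_vec_def)

lemma free_hom_expand:
  assumes N: "left_module R N" and k: "k \<in> lmod_hom R (free_module R S) N"
    and f: "f \<in> carrier (free_module R S)" and A: "finite A" "A \<subseteq> S" "{s. f s \<noteq> \<zero>} \<subseteq> A"
  shows "k f = (\<Oplus>\<^bsub>N\<^esub>s\<in>A. f s \<odot>\<^bsub>N\<^esub> k (unit_vec R s))"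
  using A f
proof (induction A arbitrary: f rule: finite_induct)
  case empty
  then have "f = \<zero>\<^bsub>free_module R S\<^esub>" by (auto simp: free_simps(2))
  then show ?case using lmod_hom_zero_minus(1) [OF free_left_module N k]
      abelian_monoid.finsum_empty N left_module.axioms(2) abelian_group.axioms(1)
    by (metis)
next
  case (insert a A)
  interpret N: left_module R N by fact
  let ?g = "f(a := \<zero>)"
  have a: "a \<in> S" using insert by blast
  have "{s. ?g s \<noteq> \<zero>} \<subseteq> {s. f s \<noteq> \<zero>}" by auto
  then have "finite {s. ?g s \<noteq> \<zero>}" using free_finite [OF insert(6)] finite_subset by blast
  then have g: "?g \<in> carrier (free_module R S)" using insert(6) by (auto simp: free_simps)
  have u: "unit_vec R a \<in> carrier (free_module R S)" using a by (rule unit_vec_closed)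
  have fa: "f a \<in> carrier R" by (rule free_val [OF insert(6)])
  have "f = (f a \<odot>\<^bsub>free_module R S\<^esub> unit_vec R a) \<oplus>\<^bsub>free_module R S\<^esub> ?g"
    using free_val [OF insert(6)] by (auto simp: free_simps(2-) unit_vec_def)
  then have "k f = f a \<odot>\<^bsub>N\<^esub> k (unit_vec R a) \<oplus>\<^bsub>N\<^esub> k ?g"
    using lmod_homD(2) [OF k free_smult_closed [OF fa u] g] lmod_homD(3) [OF k fa u] by simp
  also have "k ?g = (\<Oplus>\<^bsub>N\<^esub>s\<in>A. ?g s \<odot>\<^bsub>N\<^esub> k (unit_vec R s))"
    by (intro insert.IH g) (use insert in auto)
  also have "\<dots> = (\<Oplus>\<^bsub>N\<^esub>s\<in>A. f s \<odot>\<^bsub>N\<^esub> k (unit_vec R s))"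
    using insert free_val [OF insert(6)]
    by (intro N.M.finsum_cong') (auto intro!: N.smult_closed lmod_homD(1) [OF k] unit_vec_closed)
  finally show ?case
    using insert(1,2,4) by (subst N.M.finsum_insert)
      (auto intro!: N.smult_closed lmod_homD(1) [OF k] unit_vec_closed free_val [OF insert(6)])
qed

lemma free_hom_exists:
  assumes N: "left_module R N" and n: "\<And>s. s \<in> S \<Longrightarrow> n s \<in> carrier N"
  shows "\<exists>k \<in> lmod_hom R (free_module R S) N. \<forall>s \<in> S. k (unit_vec R s) = n s"
proof -
  interpret N: left_module R N by fact
  interpret F: left_module R "free_module R S" by (rule free_left_module)
  define k where "k f = (\<Oplus>\<^bsub>N\<^esub>s\<in>{s. f s \<noteq> \<zero>}. f s \<odot>\<^bsub>N\<^esub> n s)" for f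
  have sub: "{s. f s \<noteq> \<zero>} \<subseteq> S" if "f \<in> carrier (free_module R S)" for f
    using that by (auto simp: free_simps)
  have k: "k f = (\<Oplus>\<^bsub>N\<^esub>s\<in>A. f s \<odot>\<^bsub>N\<^esub> n s)"
    if "f \<in> carrier (free_module R S)" "finite A" "{s. f s \<noteq> \<zero>} \<subseteq> A" "A \<subseteq> S" for f A
    unfolding k_def using that n free_val [OF that(1)]
    by (intro N.M.finsum_mono_neutral [symmetric])
      (auto intro!: N.smult_closed simp: subset_iff N.smult_zero_left)
  have closed: "k f \<in> carrier N" if "f \<in> carrier (free_module R S)" for f
    unfolding k_def using n sub [OF that] free_val [OF that]
    by (intro N.M.finsum_closed) (auto intro!: N.smult_closed)
  have add: "k (f \<oplus>\<^bsub>free_module R S\<^esub> g) = k f \<oplus>\<^bsub>N\<^esub> k g"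
    if f: "f \<in> carrier (free_module R S)" and g: "g \<in> carrier (free_module R S)" for f g
  proof -
    let ?A = "{s. f s \<noteq> \<zero>} \<union> {s. g s \<noteq> \<zero>}"
    have A: "finite ?A" "?A \<subseteq> S" using f g sub free_finite by auto
    have "k (f \<oplus>\<^bsub>free_module R S\<^esub> g) = (\<Oplus>\<^bsub>N\<^esub>s\<in>?A. (f \<oplus>\<^bsub>free_module R S\<^esub> g) s \<odot>\<^bsub>N\<^esub> n s)"
      using A by (intro k F.M.a_closed f g) (auto simp: free_simps(3))
    also have "\<dots> = (\<Oplus>\<^bsub>N\<^esub>s\<in>?A. f s \<odot>\<^bsub>N\<^esub> n s \<oplus>\<^bsub>N\<^esub> g s \<odot>\<^bsub>N\<^esub> n s)"
      using A n free_val [OF f] free_val [OF g]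
      by (intro N.M.finsum_cong') (auto simp: free_simps(3) N.smult_l_distr subset_iff intro!: N.smult_closed)
    also have "\<dots> = k f \<oplus>\<^bsub>N\<^esub> k g"
      using A n free_val [OF f] free_val [OF g]
      by (subst (1 2) k [OF _ A(1) _ A(2)])
        (auto simp: f g subset_iff intro!: N.smult_closed N.M.finsum_addf)
    finally show ?thesis .
  qed
  have smult: "k (r \<odot>\<^bsub>free_module R S\<^esub> f) = r \<odot>\<^bsub>N\<^esub> k f"
    if r: "r \<in> carrier R" and f: "f \<in> carrier (free_module R S)" for r f
  proof -
    let ?A = "{s. f s \<noteq> \<zero>}"
    have A: "finite ?A" "?A \<subseteq> S" using f sub free_finite by auto
    have "k (r \<odot>\<^bsub>free_module R S\<^esub> f) = (\<Oplus>\<^bsub>N\<^esub>s\<in>?A. (r \<odot>\<^bsub>free_module R S\<^esub> f) s \<odot>\<^bsub>N\<^esub> n s)"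
      using A r f by (intro k F.smult_closed) (auto simp: free_simps(4))
    also have "\<dots> = (\<Oplus>\<^bsub>N\<^esub>s\<in>?A. r \<odot>\<^bsub>N\<^esub> (f s \<odot>\<^bsub>N\<^esub> n s))"
      using A n r free_val [OF f]
      by (intro N.M.finsum_cong') (auto simp: free_simps(4) N.smult_assoc subset_iff intro!: N.smult_closed)
    also have "\<dots> = r \<odot>\<^bsub>N\<^esub> k f"
      unfolding k_def using A n free_val [OF f]
      by (intro N.smult_finsum [symmetric] r) (auto simp: subset_iff intro!: N.smult_closed)
    finally show ?thesis .
  qed
  have "k (unit_vec R s) = n s" if "s \<in> S" for s
  proof -
    have "k (unit_vec R s) = (\<Oplus>\<^bsub>N\<^esub>t\<in>{s}. unit_vec R s t \<odot>\<^bsub>N\<^esub> n t)"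
      using that by (intro k unit_vec_closed) (auto simp: unit_vec_def)
    then show ?thesis using that n by (simp add: unit_vec_def N.smult_one)
  qed
  moreover have "(\<lambda>f \<in> carrier (free_module R S). k f) \<in> lmod_hom R (free_module R S) N"
    by (rule lmod_homI) (auto simp: closed add smult F.smult_closed)
  ultimately show ?thesis
    by (intro bexI [of _ "\<lambda>f \<in> carrier (free_module R S). k f"] ballI)
      (simp_all add: unit_vec_closed)
qed

text \<open>Preimages are chosen for the images of the unit vectors of the free cover and extended
  by freeness; the inclusion of P then restricts the result. The hypothesis is containment of images
  and not surjectivity of g, because the lemma is applied to differentials, which hit only a
  kernel.\<close>

lemma projective_lift:
  fixes P :: "('a, 'm, 'z) module_scheme"
  assumes P: "projective R P" and N': "left_module R N'" and N: "left_module R N"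
    and f: "f \<in> lmod_hom R P N" and g: "g \<in> lmod_hom R N' N" and im: "f ` carrier P \<subseteq> g ` carrier N'"
  shows "\<exists>h \<in> lmod_hom R P N'. \<forall>x \<in> carrier P. g (h x) = f x"
proof -
  obtain S :: "'m set" and \<iota> \<pi> where \<iota>: "\<iota> \<in> lmod_hom R P (free_module R S)" and \<pi>: "\<pi> \<in> lmod_hom R (free_module R S) P"
    and \<pi>\<iota>: "\<And>m. m \<in> carrier P \<Longrightarrow> \<pi> (\<iota> m) = m"
    using P unfolding projective_def by blast
  have PM: "left_module R P" using P by (simp add: projective_def)
  have "\<exists>n. \<forall>s \<in> S. n s \<in> carrier N' \<and> g (n s) = f (\<pi> (unit_vec R s))"
  proof (rule bchoice, rule ballI)
    fix s assume "s \<in> S"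
    then have "\<pi> (unit_vec R s) \<in> carrier P" by (intro lmod_homD(1) [OF \<pi>] unit_vec_closed)
    then show "\<exists>y. y \<in> carrier N' \<and> g y = f (\<pi> (unit_vec R s))" using im by (metis image_iff image_subset_iff)
  qed
  then obtain n where n: "\<And>s. s \<in> S \<Longrightarrow> n s \<in> carrier N'" "\<And>s. s \<in> S \<Longrightarrow> g (n s) = f (\<pi> (unit_vec R s))"
    by blast
  obtain k where k: "k \<in> lmod_hom R (free_module R S) N'" "\<And>s. s \<in> S \<Longrightarrow> k (unit_vec R s) = n s"
    using free_hom_exists [OF N', of S n] n(1) by blast
  interpret N: left_module R N by fact
  have 1: "compose (carrier (free_module R S)) g k \<in> lmod_hom R (free_module R S) N"
    by (rule lmod_hom_compose [OF free_left_module k(1) g])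
  have 2: "compose (carrier (free_module R S)) f \<pi> \<in> lmod_hom R (free_module R S) N"
    by (rule lmod_hom_compose [OF free_left_module \<pi> f])
  have eq: "g (k F) = f (\<pi> F)" if F: "F \<in> carrier (free_module R S)" for F
  proof -
    have A: "finite {s. F s \<noteq> \<zero>}" "{s. F s \<noteq> \<zero>} \<subseteq> S" using F by (auto simp: free_simps)
    have u: "compose (carrier (free_module R S)) g k (unit_vec R s)
        = compose (carrier (free_module R S)) f \<pi> (unit_vec R s)" if "F s \<noteq> \<zero>" for s
      using that A(2) n(2) k(2) unit_vec_closed [of s S] by (auto simp: compose_def)
    have "compose (carrier (free_module R S)) g k F = compose (carrier (free_module R S)) f \<pi> F"
      unfolding free_hom_expand [OF N 1 F A subset_refl] free_hom_expand [OF N 2 F A subset_refl]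
      using A(2) by (intro N.M.finsum_cong')
        (auto simp: u intro!: N.smult_closed free_val [OF F] lmod_homD(1) [OF 2] unit_vec_closed)
    then show ?thesis using F by (simp add: compose_def)
  qed
  show ?thesis
    using eq \<pi>\<iota> lmod_homD(1) [OF \<iota>]
    by (intro bexI [OF _ lmod_hom_compose [OF PM \<iota> k(1)]]) (auto simp: compose_def)
qed

end

section \<open>The comparison theorem\<close>

lemma graded_left_moduleD:
  assumes "graded_left_module R M"
  shows "left_module R M" and "graded_group M" and "ring R" and "abelian_group M"
    and "r \<in> grade R i \<Longrightarrow> x \<in> grade M j \<Longrightarrow> r \<odot>\<^bsub>M\<^esub> x \<in> grade M (i + j)"
  using assms by (auto simp: graded_left_module_def left_module_def)

lemma graded_homD:
  assumes "h \<in> graded_hom R M N"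
  shows "h \<in> lmod_hom R M N" and "x \<in> grade M n \<Longrightarrow> h x \<in> grade N n"
  using assms by (auto simp: graded_hom_def)

lemma component_smult:
  assumes R: "graded_group R" and M: "graded_left_module R M"
    and r: "r \<in> grade R i" and x: "x \<in> carrier M"
  shows "component M (r \<odot>\<^bsub>M\<^esub> x) (i + n) = r \<odot>\<^bsub>M\<^esub> component M x n"
proof -
  note gM = graded_left_moduleD(2) [OF M]
  interpret left_module R M by (rule graded_left_moduleD(1) [OF M])
  have rc: "r \<in> carrier R" by (rule grade_carrier [OF R r])
  show ?thesis
    using x
  proof (induction x rule: homogeneous_induct [OF gM, consumes 1, case_names homogeneous add])
    case (homogeneous j x)
    then show ?case
      using component_homogeneous [OF gM graded_left_moduleD(5) [OF M r homogeneous], of "i + n"]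
        component_homogeneous [OF gM homogeneous, of n] smult_zero_right [OF rc] by simp
  next
    case (add x y)
    then show ?case
      by (simp add: smult_r_distr rc component_add [OF gM] smult_closed component_carrier [OF gM])
  qed
qed

lemma component_hom:
  assumes M: "graded_left_module R M" and N: "graded_left_module R N"
    and h: "h \<in> graded_hom R M N" and x: "x \<in> carrier M"
  shows "component N (h x) n = h (component M x n)"
proof -
  note gM = graded_left_moduleD(2) [OF M] and gN = graded_left_moduleD(2) [OF N]
  note hh = graded_homD(1) [OF h]
  show ?thesis
    using x
  proof (induction x rule: homogeneous_induct [OF gM, consumes 1, case_names homogeneous add])
    case (homogeneous j x)
    then show ?case
      using component_homogeneous [OF gN graded_homD(2) [OF h homogeneous], of n]
        component_homogeneous [OF gM homogeneous, of n]
        lmod_hom_zero_minus(1) [OF graded_left_moduleD(1) [OF M] graded_left_moduleD(1) [OF N] hh] by simp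
  next
    case (add x y)
    then show ?case
      by (simp add: component_add [OF gM] component_add [OF gN] lmod_homD [OF hh] component_carrier [OF gM])
  qed
qed

text \<open>An ungraded lift h exists by projectivity. Since f and g preserve degrees, taking the
  component of degree n in \<open>g (h x) = f x\<close> for homogeneous x shows that the degree zero
  part of h is still a lift.\<close>

lemma graded_projective_lift:
  assumes R: "ring R" "graded_group R" and P: "graded_left_module R P" "projective R P"
    and N': "graded_left_module R N'" and N: "graded_left_module R N"
    and f: "f \<in> graded_hom R P N" and g: "g \<in> graded_hom R N' N" and im: "f ` carrier P \<subseteq> g ` carrier N'"
  shows "\<exists>h \<in> graded_hom R P N'. \<forall>x \<in> carrier P. g (h x) = f x"
proof -
  note gP = graded_left_moduleD(2) [OF P(1)] and gN' = graded_left_moduleD(2) [OF N']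
    and gN = graded_left_moduleD(2) [OF N]
  interpret P: left_module R P by (rule graded_left_moduleD(1) [OF P(1)])
  interpret N': left_module R N' by (rule graded_left_moduleD(1) [OF N'])
  interpret N: left_module R N by (rule graded_left_moduleD(1) [OF N])
  note fh = graded_homD(1) [OF f] and gh = graded_homD(1) [OF g]
  obtain h where h: "h \<in> lmod_hom R P N'" and gh_f: "\<And>x. x \<in> carrier P \<Longrightarrow> g (h x) = f x"
    using ring.projective_lift [OF R(1) P(2) N'.left_module_axioms N.left_module_axioms fh gh im] by blast
  let ?h = "degree_zero_part P N' h"
  have closed: "?h x \<in> carrier N'" if "x \<in> carrier P" for x
    by (rule dzp_closed [OF gP gN' _ _ that]) (auto simp: lmod_homD [OF h])
  have dadd: "?h (x \<oplus>\<^bsub>P\<^esub> y) = ?h x \<oplus>\<^bsub>N'\<^esub> ?h y" if "x \<in> carrier P" "y \<in> carrier P" for x y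
    by (rule dzp_add [OF gP gN' _ _ that]) (auto simp: lmod_homD [OF h])
  have homog: "?h x = component N' (h x) n" if "x \<in> grade P n" for x n
    by (rule dzp_homogeneous [OF gP gN' _ _ that]) (auto simp: lmod_homD [OF h])
  have smult: "?h (r \<odot>\<^bsub>P\<^esub> x) = r \<odot>\<^bsub>N'\<^esub> ?h x" if r: "r \<in> carrier R" and x: "x \<in> carrier P" for r x
    using r
  proof (induction r rule: homogeneous_induct [OF R(2), consumes 1, case_names homogeneous add])
    case (homogeneous i r)
    have rc: "r \<in> carrier R" by (rule grade_carrier [OF R(2) homogeneous])
    show ?case using x
    proof (induction x rule: homogeneous_induct [OF gP, consumes 1, case_names homogeneous add])
      case (homogeneous j x)
      have xc: "x \<in> carrier P" by (rule grade_carrier [OF gP homogeneous])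
      have "?h (r \<odot>\<^bsub>P\<^esub> x) = component N' (r \<odot>\<^bsub>N'\<^esub> h x) (i + j)"
        using homog [OF graded_left_moduleD(5) [OF P(1) \<open>r \<in> grade R i\<close> homogeneous]]
          lmod_homD(3) [OF h rc xc] by simp
      also have "\<dots> = r \<odot>\<^bsub>N'\<^esub> ?h x"
        using component_smult [OF R(2) N' \<open>r \<in> grade R i\<close> lmod_homD(1) [OF h xc]]
          homog [OF homogeneous] by simp
      finally show ?case .
    next
      case (add x y)
      then show ?case by (simp add: P.smult_r_distr rc dadd P.smult_closed N'.smult_r_distr closed)
    qed
  next
    case (add r s)
    then show ?case by (simp add: P.smult_l_distr x dadd P.smult_closed N'.smult_l_distr closed)
  qed
  have "restrict ?h (carrier P) \<in> lmod_hom R P N'"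
    by (rule lmod_homI) (simp_all add: closed dadd smult P.smult_closed)
  moreover have "restrict ?h (carrier P) = ?h" by (simp add: degree_zero_part_def fun_eq_iff)
  ultimately have "?h \<in> lmod_hom R P N'" by simp
  moreover have "?h x \<in> grade N' n" if "x \<in> grade P n" for x n
    using homog [OF that] component_all(1) [OF gN' lmod_homD(1) [OF h grade_carrier [OF gP that]]] by simp
  ultimately have hg: "?h \<in> graded_hom R P N'" by (auto simp: graded_hom_def)
  have "g (?h x) = f x" if "x \<in> carrier P" for x
    using that
  proof (induction x rule: homogeneous_induct [OF gP, consumes 1, case_names homogeneous add])
    case (homogeneous n x)
    have xc: "x \<in> carrier P" by (rule grade_carrier [OF gP homogeneous])
    have "g (?h x) = component N (g (h x)) n"
      using homog [OF homogeneous] component_hom [OF N' N g lmod_homD(1) [OF h xc]] by simp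
    also have "\<dots> = f x"
      using gh_f [OF xc] component_homogeneous [OF gN graded_homD(2) [OF f homogeneous], of n] by simp
    finally show ?case .
  next
    case (add x y)
    then show ?case by (simp add: dadd lmod_homD [OF gh] lmod_homD [OF fh] closed)
  qed
  then show ?thesis using hg by blast
qed

section \<open>Resolutions, chain maps over the identity, null homotopies\<close>

locale resolution =
  fixes R :: "('k, 'r) graded_module" and M :: "('r, 'm) graded_module"
    and P :: "nat \<Rightarrow> ('r, 'p) graded_module" and \<delta> \<epsilon>
  assumes ring: "ring R" and graded_R: "graded_group R" and M: "graded_left_module R M"
    and res: "graded_projective_resolution R M P \<delta> \<epsilon>"
begin

lemma P: "graded_left_module R (P i)" "projective R (P i)"
  and diff: "\<delta> i \<in> graded_hom R (P (Suc i)) (P i)"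
  and aug: "\<epsilon> \<in> graded_hom R (P 0) M"
  and aug_surj: "\<epsilon> ` carrier (P 0) = carrier M"
  and exact0: "\<delta> 0 ` carrier (P (Suc 0)) = {x \<in> carrier (P 0). \<epsilon> x = \<zero>\<^bsub>M\<^esub>}"
  and exact: "\<delta> (Suc i) ` carrier (P (Suc (Suc i))) = {x \<in> carrier (P (Suc i)). \<delta> i x = \<zero>\<^bsub>P i\<^esub>}"
  using res by (auto simp: graded_projective_resolution_def)

lemma P_lm: "left_module R (P i)" by (rule graded_left_moduleD(1) [OF P(1)])
lemma M_lm: "left_module R M" by (rule graded_left_moduleD(1) [OF M])

lemmas diff_lm = graded_homD(1) [OF diff] and aug_lm = graded_homD(1) [OF aug]

lemma aug_diff: "x \<in> carrier (P (Suc 0)) \<Longrightarrow> \<epsilon> (\<delta> 0 x) = \<zero>\<^bsub>M\<^esub>"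
  using exact0 by blast

lemma diff_diff: "x \<in> carrier (P (Suc (Suc i))) \<Longrightarrow> \<delta> i (\<delta> (Suc i) x) = \<zero>\<^bsub>P i\<^esub>"
  using exact by blast

end

lemma graded_hom_compose:
  assumes "graded_left_module R L" and "f \<in> graded_hom R L M" and "g \<in> graded_hom R M N"
  shows "compose (carrier L) g f \<in> graded_hom R L N"
  using lmod_hom_compose [OF graded_left_moduleD(1) [OF assms(1)] graded_homD(1) [OF assms(2)] graded_homD(1) [OF assms(3)]]
    graded_homD(2) [OF assms(2)] graded_homD(2) [OF assms(3)] grade_carrier [OF graded_left_moduleD(2) [OF assms(1)]]
  by (auto simp: graded_hom_def compose_def)

lemma chain_map_exists:
  assumes "resolution R M P \<delta> \<epsilon>" and "resolution R M Q \<delta>' \<epsilon>'"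
  shows "\<exists>\<phi>. (\<forall>i. \<phi> i \<in> graded_hom R (P i) (Q i)) \<and> (\<forall>x \<in> carrier (P 0). \<epsilon>' (\<phi> 0 x) = \<epsilon> x) \<and>
    (\<forall>i. \<forall>x \<in> carrier (P (Suc i)). \<delta>' i (\<phi> (Suc i) x) = \<phi> i (\<delta> i x))"
proof -
  interpret P: resolution R M P \<delta> \<epsilon> by fact
  interpret Q: resolution R M Q \<delta>' \<epsilon>' by fact
  \<comment> \<open>The last conjunct is the invariant that makes the next lift possible: the
    composite with the differential already lands in the image of the following one.\<close>
  let ?good = "\<lambda>n \<phi>. \<phi> \<in> graded_hom R (P n) (Q n) \<and> (n = 0 \<longrightarrow> (\<forall>x \<in> carrier (P 0). \<epsilon>' (\<phi> x) = \<epsilon> x)) \<and>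
    (\<forall>x \<in> carrier (P (Suc n)). \<phi> (\<delta> n x) \<in> \<delta>' n ` carrier (Q (Suc n)))"
  have "\<exists>\<phi>. \<forall>n. ?good n (\<phi> n) \<and> (\<forall>x \<in> carrier (P (Suc n)). \<delta>' n (\<phi> (Suc n) x) = \<phi> n (\<delta> n x))"
  proof (rule dependent_nat_choice)
    have "\<epsilon> ` carrier (P 0) \<subseteq> \<epsilon>' ` carrier (Q 0)" by (simp add: P.aug_surj Q.aug_surj)
    then obtain \<phi> where \<phi>: "\<phi> \<in> graded_hom R (P 0) (Q 0)" "\<forall>x \<in> carrier (P 0). \<epsilon>' (\<phi> x) = \<epsilon> x"
      using graded_projective_lift [OF P.ring P.graded_R P.P Q.P(1) P.M P.aug Q.aug] by blast
    moreover have "\<phi> (\<delta> 0 x) \<in> \<delta>' 0 ` carrier (Q (Suc 0))" if "x \<in> carrier (P (Suc 0))" for x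
      using \<phi> that lmod_homD(1) [OF P.diff_lm that] lmod_homD(1) [OF graded_homD(1) [OF \<phi>(1)]] P.aug_diff
      by (simp add: Q.exact0)
    ultimately show "\<exists>\<phi>. ?good 0 \<phi>" by blast
  next
    fix \<phi> n assume good: "?good n \<phi>"
    have "compose (carrier (P (Suc n))) \<phi> (\<delta> n) \<in> graded_hom R (P (Suc n)) (Q n)"
      using good by (intro graded_hom_compose [OF P.P(1) P.diff]) blast
    moreover have "compose (carrier (P (Suc n))) \<phi> (\<delta> n) ` carrier (P (Suc n)) \<subseteq> \<delta>' n ` carrier (Q (Suc n))"
      using good by (auto simp: compose_def)
    ultimately obtain \<phi>' where \<phi>': "\<phi>' \<in> graded_hom R (P (Suc n)) (Q (Suc n))"
      "\<forall>x \<in> carrier (P (Suc n)). \<delta>' n (\<phi>' x) = compose (carrier (P (Suc n))) \<phi> (\<delta> n) x"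
      using graded_projective_lift [OF P.ring P.graded_R P.P Q.P(1) Q.P(1) _ Q.diff] by blast
    have eq: "\<delta>' n (\<phi>' x) = \<phi> (\<delta> n x)" if "x \<in> carrier (P (Suc n))" for x
      using \<phi>'(2) that by (simp add: compose_def)
    have "\<phi>' (\<delta> (Suc n) x) \<in> \<delta>' (Suc n) ` carrier (Q (Suc (Suc n)))" if x: "x \<in> carrier (P (Suc (Suc n)))" for x
    proof -
      have y: "\<delta> (Suc n) x \<in> carrier (P (Suc n))" by (rule lmod_homD(1) [OF P.diff_lm x])
      have "\<delta>' n (\<phi>' (\<delta> (Suc n) x)) = \<phi> \<zero>\<^bsub>P n\<^esub>" using eq [OF y] P.diff_diff [OF x] by simp
      also have "\<dots> = \<zero>\<^bsub>Q n\<^esub>"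
        using good by (intro lmod_hom_zero_minus(1) [OF P.P_lm Q.P_lm]) (blast dest: graded_homD(1))
      finally show ?thesis
        using lmod_homD(1) [OF graded_homD(1) [OF \<phi>'(1)] y] by (simp add: Q.exact)
    qed
    then show "\<exists>\<phi>'. ?good (Suc n) \<phi>' \<and> (\<forall>x \<in> carrier (P (Suc n)). \<delta>' n (\<phi>' x) = \<phi> (\<delta> n x))"
      using \<phi>'(1) eq by blast
  qed
  then obtain \<phi> where \<phi>: "\<forall>n. ?good n (\<phi> n) \<and>
    (\<forall>x \<in> carrier (P (Suc n)). \<delta>' n (\<phi> (Suc n) x) = \<phi> n (\<delta> n x))" ..
  show ?thesis
  proof (intro exI [of _ \<phi>] conjI allI)
    show "\<phi> i \<in> graded_hom R (P i) (Q i)" for i using spec [OF \<phi>, of i] by (elim conjE)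
    show "\<forall>x \<in> carrier (P 0). \<epsilon>' (\<phi> 0 x) = \<epsilon> x" using spec [OF \<phi>, of 0] by simp
    show "\<forall>x \<in> carrier (P (Suc i)). \<delta>' i (\<phi> (Suc i) x) = \<phi> i (\<delta> i x)" for i
      using spec [OF \<phi>, of i] by (elim conjE)
  qed
qed

text \<open>The homotopy is not asked to preserve degrees. It serves only to exhibit coboundaries,
  and these are formed from all homomorphisms.\<close>

lemma null_homotopy_exists:
  assumes "resolution R M P \<delta> \<epsilon>"
    and \<alpha>: "\<And>i. \<alpha> i \<in> lmod_hom R (P i) (P i)"
    and \<alpha>0: "\<forall>x \<in> carrier (P 0). \<epsilon> (\<alpha> 0 x) = \<zero>\<^bsub>M\<^esub>"
    and \<alpha>\<delta>: "\<forall>i. \<forall>x \<in> carrier (P (Suc i)). \<delta> i (\<alpha> (Suc i) x) = \<alpha> i (\<delta> i x)"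
  shows "\<exists>h. (\<forall>i. h i \<in> lmod_hom R (P i) (P (Suc i))) \<and> (\<forall>x \<in> carrier (P 0). \<alpha> 0 x = \<delta> 0 (h 0 x)) \<and>
    (\<forall>i. \<forall>x \<in> carrier (P (Suc i)). \<alpha> (Suc i) x = \<delta> (Suc i) (h (Suc i) x) \<oplus>\<^bsub>P (Suc i)\<^esub> h i (\<delta> i x))"
proof -
  interpret P: resolution R M P \<delta> \<epsilon> by fact
  have \<alpha>\<delta>: "\<delta> i (\<alpha> (Suc i) x) = \<alpha> i (\<delta> i x)" if "x \<in> carrier (P (Suc i))" for i x
    using \<alpha>\<delta> that by blast
  \<comment> \<open>The last conjunct places \<open>\<alpha> - h \<delta>\<close> in the kernel of
    the differential, hence in the image of the next one, through which it is then lifted.\<close>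
  let ?good = "\<lambda>n h. h \<in> lmod_hom R (P n) (P (Suc n)) \<and> (n = 0 \<longrightarrow> (\<forall>x \<in> carrier (P 0). \<alpha> 0 x = \<delta> 0 (h x))) \<and>
    (\<forall>x \<in> carrier (P (Suc n)). \<delta> n (\<alpha> (Suc n) x \<ominus>\<^bsub>P (Suc n)\<^esub> h (\<delta> n x)) = \<zero>\<^bsub>P n\<^esub>)"
  have "\<exists>h. \<forall>n. ?good n (h n) \<and>
    (\<forall>x \<in> carrier (P (Suc n)). \<alpha> (Suc n) x = \<delta> (Suc n) (h (Suc n) x) \<oplus>\<^bsub>P (Suc n)\<^esub> h n (\<delta> n x))"
  proof (rule dependent_nat_choice)
    interpret P0: left_module R "P 0" by (rule P.P_lm)
    have "\<alpha> 0 ` carrier (P 0) \<subseteq> \<delta> 0 ` carrier (P (Suc 0))"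
      using \<alpha>0 lmod_homD(1) [OF \<alpha>] by (auto simp: P.exact0)
    then obtain h where h: "h \<in> lmod_hom R (P 0) (P (Suc 0))" "\<forall>x \<in> carrier (P 0). \<delta> 0 (h x) = \<alpha> 0 x"
      using ring.projective_lift [OF P.ring P.P(2) P.P_lm P.P_lm \<alpha> P.diff_lm] by blast
    have "\<delta> 0 (\<alpha> (Suc 0) x \<ominus>\<^bsub>P (Suc 0)\<^esub> h (\<delta> 0 x)) = \<zero>\<^bsub>P 0\<^esub>" if x: "x \<in> carrier (P (Suc 0))" for x
    proof -
      have dx: "\<delta> 0 x \<in> carrier (P 0)" by (rule lmod_homD(1) [OF P.diff_lm x])
      have "\<delta> 0 (\<alpha> (Suc 0) x \<ominus>\<^bsub>P (Suc 0)\<^esub> h (\<delta> 0 x)) = \<alpha> 0 (\<delta> 0 x) \<ominus>\<^bsub>P 0\<^esub> \<alpha> 0 (\<delta> 0 x)"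
        using lmod_hom_zero_minus(2) [OF P.P_lm P.P_lm P.diff_lm lmod_homD(1) [OF \<alpha> x] lmod_homD(1) [OF h(1) dx]]
          h(2) dx \<alpha>\<delta> [OF x] by simp
      then show ?thesis using lmod_homD(1) [OF \<alpha> dx] by (simp add: a_minus_def P0.M.r_neg)
    qed
    then show "\<exists>h. ?good 0 h" using h by (intro exI [of _ h]) auto
  next
    fix h n assume good: "?good n h"
    then have h: "h \<in> lmod_hom R (P n) (P (Suc n))" by blast
    interpret Pn: left_module R "P n" by (rule P.P_lm)
    interpret PS: left_module R "P (Suc n)" by (rule P.P_lm)
    let ?hd = "compose (carrier (P (Suc n))) h (\<delta> n)"
    let ?\<beta> = "\<lambda>x \<in> carrier (P (Suc n)). \<alpha> (Suc n) x \<ominus>\<^bsub>P (Suc n)\<^esub> ?hd x"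
    have hd: "?hd \<in> lmod_hom R (P (Suc n)) (P (Suc n))"
      by (rule lmod_hom_compose [OF P.P_lm P.diff_lm h])
    have \<beta>: "?\<beta> \<in> lmod_hom R (P (Suc n)) (P (Suc n))"
      by (rule lmod_hom_diff [OF P.P_lm P.P_lm \<alpha> hd])
    have "?\<beta> ` carrier (P (Suc n)) \<subseteq> \<delta> (Suc n) ` carrier (P (Suc (Suc n)))"
    proof
      fix y assume "y \<in> ?\<beta> ` carrier (P (Suc n))"
      then obtain x where x: "x \<in> carrier (P (Suc n))" "y = ?\<beta> x" by blast
      then have "\<delta> n y = \<zero>\<^bsub>P n\<^esub>" using good by (simp add: compose_def)
      then show "y \<in> \<delta> (Suc n) ` carrier (P (Suc (Suc n)))"
        using lmod_homD(1) [OF \<beta> x(1)] x(2) unfolding P.exact by simp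
    qed
    then obtain h' where h': "h' \<in> lmod_hom R (P (Suc n)) (P (Suc (Suc n)))"
      and dh': "\<And>x. x \<in> carrier (P (Suc n)) \<Longrightarrow> \<delta> (Suc n) (h' x) = ?\<beta> x"
      using ring.projective_lift [OF P.ring P.P(2) P.P_lm P.P_lm \<beta> P.diff_lm] by blast
    have dx: "\<delta> n x \<in> carrier (P n)" if "x \<in> carrier (P (Suc n))" for x
      by (rule lmod_homD(1) [OF P.diff_lm that])
    have eq: "\<alpha> (Suc n) x = \<delta> (Suc n) (h' x) \<oplus>\<^bsub>P (Suc n)\<^esub> h (\<delta> n x)" if x: "x \<in> carrier (P (Suc n))" for x
      using dh' [OF x] x lmod_homD(1) [OF \<alpha> x] lmod_homD(1) [OF h dx [OF x]]
      by (simp add: compose_def a_minus_def PS.M.a_assoc PS.M.l_neg)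
    have "\<delta> (Suc n) (\<alpha> (Suc (Suc n)) x \<ominus>\<^bsub>P (Suc (Suc n))\<^esub> h' (\<delta> (Suc n) x)) = \<zero>\<^bsub>P (Suc n)\<^esub>"
      if x: "x \<in> carrier (P (Suc (Suc n)))" for x
    proof -
      let ?y = "\<delta> (Suc n) x"
      have y: "?y \<in> carrier (P (Suc n))" by (rule lmod_homD(1) [OF P.diff_lm x])
      have hy: "h (\<delta> n ?y) = \<zero>\<^bsub>P (Suc n)\<^esub>"
        using P.diff_diff [OF x] lmod_hom_zero_minus(1) [OF P.P_lm P.P_lm h] by simp
      have \<alpha>y: "\<alpha> (Suc n) ?y \<in> carrier (P (Suc n))" by (rule lmod_homD(1) [OF \<alpha> y])
      have "\<delta> (Suc n) (h' ?y) = \<alpha> (Suc n) ?y"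
        using dh' [OF y] y hy \<alpha>y by (simp add: compose_def a_minus_def)
      then show ?thesis
        using lmod_hom_zero_minus(2) [OF P.P_lm P.P_lm P.diff_lm lmod_homD(1) [OF \<alpha> x] lmod_homD(1) [OF h' y]]
          \<alpha>\<delta> [OF x] \<alpha>y by (simp add: a_minus_def PS.M.r_neg)
    qed
    then show "\<exists>h'. ?good (Suc n) h' \<and>
      (\<forall>x \<in> carrier (P (Suc n)). \<alpha> (Suc n) x = \<delta> (Suc n) (h' x) \<oplus>\<^bsub>P (Suc n)\<^esub> h (\<delta> n x))"
      using h' eq by blast
  qed
  then obtain h where h: "\<forall>n. ?good n (h n) \<and>
    (\<forall>x \<in> carrier (P (Suc n)). \<alpha> (Suc n) x = \<delta> (Suc n) (h (Suc n) x) \<oplus>\<^bsub>P (Suc n)\<^esub> h n (\<delta> n x))" ..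
  show ?thesis
  proof (intro exI [of _ h] conjI allI)
    show "h i \<in> lmod_hom R (P i) (P (Suc i))" for i using spec [OF h, of i] by (elim conjE)
    show "\<forall>x \<in> carrier (P 0). \<alpha> 0 x = \<delta> 0 (h 0 x)" using spec [OF h, of 0] by simp
    show "\<forall>x \<in> carrier (P (Suc i)). \<alpha> (Suc i) x = \<delta> (Suc i) (h (Suc i) x) \<oplus>\<^bsub>P (Suc i)\<^esub> h i (\<delta> i x)" for i
      using spec [OF h, of i] by (elim conjE)
  qed
qed

section \<open>Ext does not depend on the resolution\<close>

lemma (in abelian_group) minus_eq_zero_iff:
  "a \<in> carrier G \<Longrightarrow> b \<in> carrier G \<Longrightarrow> a \<ominus> b = \<zero> \<longleftrightarrow> a = b"
  by (metis a_minus_def a_inv_closed minus_equality minus_minus r_neg)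

text \<open>A name for the record bound by \<open>let\<close> in \<open>hom_dual\<close>, so that
  the ring can be treated as a left module over itself.\<close>

definition self_module :: "('k, 'r) graded_module \<Rightarrow> ('r, 'r) module" where
  "self_module R = \<lparr>carrier = carrier R, mult = mult R, one = one R, zero = zero R, add = add R, smult = mult R\<rparr>"

lemma self_module_simps [simp]:
  "carrier (self_module R) = carrier R" "zero (self_module R) = zero R"
  "add (self_module R) = add R" "smult (self_module R) = mult R"
  by (simp_all add: self_module_def)

lemma self_left_module: "ring R \<Longrightarrow> left_module R (self_module R)"
proof -
  assume "ring R"
  then interpret ring R .
  have "abelian_group (self_module R)"
    by (rule abelian_groupI) (auto simp: a_ac intro: add.l_inv_ex)
  then show ?thesis
    by (intro left_module.intro left_module_axioms.intro ring_axioms) (auto simp: l_distr r_distr m_assoc)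
qed

lemma self_module_minus:
  assumes "ring R" and "x \<in> carrier R" and "y \<in> carrier R"
  shows "x \<ominus>\<^bsub>self_module R\<^esub> y = x \<ominus>\<^bsub>R\<^esub> y"
proof -
  interpret ring R by fact
  interpret self: left_module R "self_module R" by (rule self_left_module) fact
  have "\<ominus>\<^bsub>self_module R\<^esub> y = \<ominus>\<^bsub>R\<^esub> y"
    using assms by (intro self.M.minus_equality) (auto simp: l_neg)
  then show ?thesis by (simp add: a_minus_def)
qed

lemma hom_dual_simps:
  "carrier (hom_dual R M) = lmod_hom R M (self_module R)"
  "zero (hom_dual R M) = (\<lambda>x \<in> carrier M. \<zero>\<^bsub>R\<^esub>)"
  "add (hom_dual R M) = (\<lambda>\<phi> \<psi>. \<lambda>x \<in> carrier M. \<phi> x \<oplus>\<^bsub>R\<^esub> \<psi> x)"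
  "smult (hom_dual R M) = (\<lambda>r \<phi>. \<lambda>x \<in> carrier M. \<phi> x \<otimes>\<^bsub>R\<^esub> r)"
  "grade (hom_dual R M) n = {\<phi> \<in> lmod_hom R M (self_module R). \<forall>j. \<phi> ` grade M j \<subseteq> grade R (j + n)}"
  by (simp_all add: hom_dual_def Let_def self_module_def)

context
  fixes R :: "('k, 'r) graded_module" and M :: "('r, 'm) graded_module"
  assumes R: "ring R" and M: "left_module R M"
begin

interpretation ring R by (rule R)
interpretation M: left_module R M by (rule M)

lemma hom_dual_val:
  assumes "z \<in> lmod_hom R M (self_module R)"
  shows "x \<in> carrier M \<Longrightarrow> z x \<in> carrier R"
    and "x \<in> carrier M \<Longrightarrow> y \<in> carrier M \<Longrightarrow> z (x \<oplus>\<^bsub>M\<^esub> y) = z x \<oplus>\<^bsub>R\<^esub> z y"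
    and "r \<in> carrier R \<Longrightarrow> x \<in> carrier M \<Longrightarrow> z (r \<odot>\<^bsub>M\<^esub> x) = r \<otimes>\<^bsub>R\<^esub> z x"
    and "z \<zero>\<^bsub>M\<^esub> = \<zero>\<^bsub>R\<^esub>"
  using lmod_homD [OF assms] lmod_hom_zero_minus(1) [OF M self_left_module [OF R] assms] by auto

lemma hom_dual_closed:
  assumes z: "z \<in> lmod_hom R M (self_module R)" and w: "w \<in> lmod_hom R M (self_module R)"
  shows "(\<lambda>x \<in> carrier M. \<zero>\<^bsub>R\<^esub>) \<in> lmod_hom R M (self_module R)"
    and "(\<lambda>x \<in> carrier M. z x \<oplus>\<^bsub>R\<^esub> w x) \<in> lmod_hom R M (self_module R)"
    and "(\<lambda>x \<in> carrier M. \<ominus>\<^bsub>R\<^esub> z x) \<in> lmod_hom R M (self_module R)"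
    and "r \<in> carrier R \<Longrightarrow> (\<lambda>x \<in> carrier M. z x \<otimes>\<^bsub>R\<^esub> r) \<in> lmod_hom R M (self_module R)"
  by (rule lmod_homI; simp add: hom_dual_val [OF z] hom_dual_val [OF w] M.smult_closed a_ac minus_add
      r_distr l_distr r_minus m_assoc)+

lemma hom_dual_abelian_group: "abelian_group (hom_dual R M)"
proof (rule abelian_groupI)
  fix z assume "z \<in> carrier (hom_dual R M)"
  then have z: "z \<in> lmod_hom R M (self_module R)" by (simp add: hom_dual_simps)
  show "\<exists>w\<in>carrier (hom_dual R M). w \<oplus>\<^bsub>hom_dual R M\<^esub> z = \<zero>\<^bsub>hom_dual R M\<^esub>"
    using hom_dual_closed(3) [OF z z]
    by (intro bexI [of _ "\<lambda>x \<in> carrier M. \<ominus>\<^bsub>R\<^esub> z x"])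
      (auto simp: hom_dual_simps fun_eq_iff hom_dual_val [OF z] l_neg)
  show "\<zero>\<^bsub>hom_dual R M\<^esub> \<oplus>\<^bsub>hom_dual R M\<^esub> z = z"
    using lmod_homD(4) [OF z] hom_dual_val [OF z] by (auto simp: hom_dual_simps fun_eq_iff)
  fix w assume "w \<in> carrier (hom_dual R M)"
  then have w: "w \<in> lmod_hom R M (self_module R)" by (simp add: hom_dual_simps)
  show "z \<oplus>\<^bsub>hom_dual R M\<^esub> w \<in> carrier (hom_dual R M)"
    using hom_dual_closed(2) [OF z w] by (simp add: hom_dual_simps)
  show "z \<oplus>\<^bsub>hom_dual R M\<^esub> w = w \<oplus>\<^bsub>hom_dual R M\<^esub> z"
    by (auto simp: hom_dual_simps fun_eq_iff hom_dual_val [OF z] hom_dual_val [OF w] a_ac)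
  fix v assume "v \<in> carrier (hom_dual R M)"
  then have v: "v \<in> lmod_hom R M (self_module R)" by (simp add: hom_dual_simps)
  show "z \<oplus>\<^bsub>hom_dual R M\<^esub> w \<oplus>\<^bsub>hom_dual R M\<^esub> v = z \<oplus>\<^bsub>hom_dual R M\<^esub> (w \<oplus>\<^bsub>hom_dual R M\<^esub> v)"
    by (auto simp: hom_dual_simps fun_eq_iff hom_dual_val [OF z] hom_dual_val [OF w] hom_dual_val [OF v] a_ac)
next
  show "\<zero>\<^bsub>hom_dual R M\<^esub> \<in> carrier (hom_dual R M)"
    unfolding hom_dual_simps by (rule lmod_homI) (auto simp: M.smult_closed)
qed

lemma hom_dual_minus:
  assumes z: "z \<in> lmod_hom R M (self_module R)" and w: "w \<in> lmod_hom R M (self_module R)"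
  shows "z \<ominus>\<^bsub>hom_dual R M\<^esub> w = (\<lambda>x \<in> carrier M. z x \<ominus>\<^bsub>R\<^esub> w x)"
    and "\<ominus>\<^bsub>hom_dual R M\<^esub> w = (\<lambda>x \<in> carrier M. \<ominus>\<^bsub>R\<^esub> w x)"
proof -
  interpret D: abelian_group "hom_dual R M" by (rule hom_dual_abelian_group)
  show *: "\<ominus>\<^bsub>hom_dual R M\<^esub> w = (\<lambda>x \<in> carrier M. \<ominus>\<^bsub>R\<^esub> w x)"
    using w hom_dual_closed(3) [OF w w]
    by (intro D.minus_equality) (auto simp: hom_dual_simps fun_eq_iff hom_dual_val [OF w] l_neg)
  show "z \<ominus>\<^bsub>hom_dual R M\<^esub> w = (\<lambda>x \<in> carrier M. z x \<ominus>\<^bsub>R\<^esub> w x)"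
    unfolding a_minus_def * by (auto simp: hom_dual_simps fun_eq_iff)
qed

end

section \<open>Cohomology of the dual complex\<close>

context resolution
begin

abbreviation "RR \<equiv> self_module R"
abbreviation "Z i \<equiv> cocycles R P \<delta> i"
abbreviation "I i \<equiv> coboundaries R P \<delta> i"
abbreviation "D i \<equiv> hom_dual R (P i)"

lemma cocycles_iff: "z \<in> Z i \<longleftrightarrow> z \<in> lmod_hom R (P i) RR \<and> (\<forall>x \<in> carrier (P (Suc i)). z (\<delta> i x) = \<zero>\<^bsub>R\<^esub>)"
  by (auto simp: cocycles_def codiff_def hom_dual_simps compose_def fun_eq_iff restrict_def)

lemma coboundaries_Suc_iff: "z \<in> I (Suc i) \<longleftrightarrow> (\<exists>v \<in> lmod_hom R (P i) RR. z = compose (carrier (P (Suc i))) v (\<delta> i))"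
  by (auto simp: codiff_def hom_dual_simps)

lemma coboundaries_0_iff: "z \<in> I 0 \<longleftrightarrow> z = (\<lambda>x \<in> carrier (P 0). \<zero>\<^bsub>R\<^esub>)"
  by (simp add: hom_dual_simps)

lemmas val = hom_dual_val [OF ring P_lm]

lemma zero_hom: "(\<lambda>x \<in> carrier (P i). \<zero>\<^bsub>R\<^esub>) \<in> lmod_hom R (P i) RR"
  using abelian_group.axioms(1) [OF hom_dual_abelian_group [OF ring P_lm [of i]]]
    abelian_monoid.zero_closed by (fastforce simp: hom_dual_simps)

lemma coboundaries_subset: "I i \<subseteq> Z i"
proof (cases i)
  case 0
  then show ?thesis
    using zero_hom lmod_homD(1) [OF diff_lm] by (auto simp: coboundaries_0_iff cocycles_iff simp del: coboundaries.simps)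
next
  case (Suc k)
  then show ?thesis
    using lmod_hom_compose [OF P_lm diff_lm] diff_diff lmod_homD(1) [OF diff_lm] val(4)
    by (auto simp: coboundaries_Suc_iff cocycles_iff compose_def simp del: coboundaries.simps)
qed

lemma Z_hom: "z \<in> Z i \<Longrightarrow> z \<in> lmod_hom R (P i) RR"
  by (simp add: cocycles_iff)

lemma I_hom: "z \<in> I i \<Longrightarrow> z \<in> lmod_hom R (P i) RR"
  using coboundaries_subset Z_hom by blast

lemma Z_closed:
  assumes z: "z \<in> Z i" and w: "w \<in> Z i"
  shows "(\<lambda>x \<in> carrier (P i). z x \<oplus>\<^bsub>R\<^esub> w x) \<in> Z i"
    and "(\<lambda>x \<in> carrier (P i). \<ominus>\<^bsub>R\<^esub> z x) \<in> Z i"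
    and "r \<in> carrier R \<Longrightarrow> (\<lambda>x \<in> carrier (P i). z x \<otimes>\<^bsub>R\<^esub> r) \<in> Z i"
proof -
  interpret R: ring R by (rule ring)
  note c = hom_dual_closed [OF ring P_lm Z_hom [OF z] Z_hom [OF w]]
  show "(\<lambda>x \<in> carrier (P i). z x \<oplus>\<^bsub>R\<^esub> w x) \<in> Z i" "(\<lambda>x \<in> carrier (P i). \<ominus>\<^bsub>R\<^esub> z x) \<in> Z i"
    "r \<in> carrier R \<Longrightarrow> (\<lambda>x \<in> carrier (P i). z x \<otimes>\<^bsub>R\<^esub> r) \<in> Z i"
    using z w c lmod_homD(1) [OF diff_lm] by (auto simp: cocycles_iff)
qed

lemma I_closed:
  assumes z: "z \<in> I i" and w: "w \<in> I i"
  shows "(\<lambda>x \<in> carrier (P i). z x \<oplus>\<^bsub>R\<^esub> w x) \<in> I i"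
    and "(\<lambda>x \<in> carrier (P i). \<ominus>\<^bsub>R\<^esub> z x) \<in> I i"
    and "r \<in> carrier R \<Longrightarrow> (\<lambda>x \<in> carrier (P i). z x \<otimes>\<^bsub>R\<^esub> r) \<in> I i"
proof -
  interpret R: ring R by (rule ring)
  have "(\<lambda>x \<in> carrier (P i). z x \<oplus>\<^bsub>R\<^esub> w x) \<in> I i \<and> (\<lambda>x \<in> carrier (P i). \<ominus>\<^bsub>R\<^esub> z x) \<in> I i \<and>
    (r \<in> carrier R \<longrightarrow> (\<lambda>x \<in> carrier (P i). z x \<otimes>\<^bsub>R\<^esub> r) \<in> I i)"
  proof (cases i)
    case 0
    then show ?thesis
      using z w unfolding 0 coboundaries_0_iff by (auto simp: fun_eq_iff)
  next
    case (Suc k)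
    then obtain v u where v: "v \<in> lmod_hom R (P k) RR" "z = compose (carrier (P (Suc k))) v (\<delta> k)"
      and u: "u \<in> lmod_hom R (P k) RR" "w = compose (carrier (P (Suc k))) u (\<delta> k)"
      using z w unfolding Suc coboundaries_Suc_iff by blast
    note c = hom_dual_closed [OF ring P_lm v(1) u(1)]
    show ?thesis
      unfolding Suc coboundaries_Suc_iff
      by (intro conjI impI bexI [OF _ c(2)] bexI [OF _ c(3)] bexI [OF _ c(4)])
        (simp_all add: v u compose_def fun_eq_iff lmod_homD(1) [OF diff_lm])
  qed
  then show "(\<lambda>x \<in> carrier (P i). z x \<oplus>\<^bsub>R\<^esub> w x) \<in> I i" "(\<lambda>x \<in> carrier (P i). \<ominus>\<^bsub>R\<^esub> z x) \<in> I i"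
    "r \<in> carrier R \<Longrightarrow> (\<lambda>x \<in> carrier (P i). z x \<otimes>\<^bsub>R\<^esub> r) \<in> I i" by auto
qed

lemma zero_in_I: "(\<lambda>x \<in> carrier (P i). \<zero>\<^bsub>R\<^esub>) \<in> I i"
proof (cases i)
  case 0
  then show ?thesis by (simp add: coboundaries_0_iff del: coboundaries.simps)
next
  case (Suc k)
  show ?thesis unfolding Suc coboundaries_Suc_iff
    by (rule bexI [OF _ zero_hom [of k]]) (simp add: compose_def fun_eq_iff lmod_homD(1) [OF diff_lm])
qed

lemma I_abelian_subgroup: "abelian_subgroup (I i) (D i)"
proof -
  interpret D: abelian_group "D i" by (rule hom_dual_abelian_group [OF ring P_lm])
  have "subgroup (I i) (add_monoid (D i))"
  proof (rule D.add.subgroupI)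
    fix z assume z: "z \<in> I i"
    show "\<ominus>\<^bsub>D i\<^esub> z \<in> I i"
      using I_closed(2) [OF z z] hom_dual_minus(2) [OF ring P_lm I_hom [OF z] I_hom [OF z]] by simp
    fix w assume w: "w \<in> I i"
    show "z \<oplus>\<^bsub>D i\<^esub> w \<in> I i" using I_closed(1) [OF z w] by (simp add: hom_dual_simps)
  qed (use I_hom zero_in_I in \<open>auto simp: hom_dual_simps\<close>)
  then show ?thesis by (intro abelian_subgroupI3 additive_subgroup.intro D.abelian_group_axioms)
qed

abbreviation "ecls i z \<equiv> I i +>\<^bsub>D i\<^esub> z"

lemma ecls_eq:
  assumes z: "z \<in> Z i" and w: "w \<in> Z i"
  shows "ecls i z = ecls i w \<longleftrightarrow> (\<lambda>x \<in> carrier (P i). z x \<ominus>\<^bsub>R\<^esub> w x) \<in> I i"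
proof -
  interpret I: abelian_subgroup "I i" "D i" by (rule I_abelian_subgroup)
  have zc: "z \<in> carrier (D i)" "w \<in> carrier (D i)" using z w Z_hom by (auto simp: hom_dual_simps)
  have "ecls i z = ecls i w \<longleftrightarrow> z \<in> ecls i w"
    using zc I.a_rcos_self I.a_repr_independence' by metis
  also have "\<dots> \<longleftrightarrow> z \<ominus>\<^bsub>D i\<^esub> w \<in> I i"
    using I.a_rcos_module [OF zc(2,1)] by (simp add: a_minus_def)
  finally show ?thesis by (simp add: hom_dual_minus(1) [OF ring P_lm Z_hom [OF z] Z_hom [OF w]])
qed

lemma Ext_simps:
  "carrier (Ext R P \<delta> i) = ecls i ` Z i" "\<zero>\<^bsub>Ext R P \<delta> i\<^esub> = I i"
  "grade (Ext R P \<delta> i) n = ecls i ` (Z i \<inter> grade (D i) n)"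
  by (simp_all add: Ext_def subquotient_def)

lemma Ext_add:
  assumes "z \<in> Z i" and "w \<in> Z i"
  shows "ecls i z \<oplus>\<^bsub>Ext R P \<delta> i\<^esub> ecls i w = ecls i (\<lambda>x \<in> carrier (P i). z x \<oplus>\<^bsub>R\<^esub> w x)"
proof -
  interpret I: abelian_subgroup "I i" "D i" by (rule I_abelian_subgroup)
  have zc: "z \<in> carrier (D i)" "w \<in> carrier (D i)" using assms Z_hom by (auto simp: hom_dual_simps)
  show ?thesis using I.a_rcos_sum [OF zc] by (simp add: Ext_def subquotient_def hom_dual_simps)
qed

text \<open>The scalar multiple of a class is defined as a union of cosets over all representatives.
  They coincide because coboundaries are stable under right multiplication.\<close>

lemma Ext_smult:
  assumes z: "z \<in> Z i" and r: "r \<in> carrier R"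
  shows "r \<odot>\<^bsub>Ext R P \<delta> i\<^esub> ecls i z = ecls i (\<lambda>x \<in> carrier (P i). z x \<otimes>\<^bsub>R\<^esub> r)"
proof -
  interpret R: ring R by (rule ring)
  interpret I: abelian_subgroup "I i" "D i" by (rule I_abelian_subgroup)
  have zc: "z \<in> carrier (D i)" using assms Z_hom by (auto simp: hom_dual_simps)
  let ?m = "\<lambda>y. \<lambda>x \<in> carrier (P i). y x \<otimes>\<^bsub>R\<^esub> r"
  have *: "ecls i (?m y) = ecls i (?m z)" if y: "y \<in> ecls i z" for y
  proof -
    obtain b where b: "b \<in> I i" "y = (\<lambda>x \<in> carrier (P i). b x \<oplus>\<^bsub>R\<^esub> z x)"
      using y by (auto simp: a_r_coset_def' hom_dual_simps)
    have y: "y \<in> Z i" unfolding b(2) using Z_closed(1) coboundaries_subset b(1) z by blast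
    have "(\<lambda>x \<in> carrier (P i). ?m y x \<ominus>\<^bsub>R\<^esub> ?m z x) = ?m b"
      using val(1) [OF I_hom [OF b(1)]] val(1) [OF Z_hom [OF z]] r
      by (auto simp: b(2) fun_eq_iff R.l_distr a_minus_def R.a_assoc R.r_neg)
    then show ?thesis
      using I_closed(3) [OF b(1) b(1) r] ecls_eq [OF Z_closed(3) [OF y y r] Z_closed(3) [OF z z r]] by simp
  qed
  have "r \<odot>\<^bsub>Ext R P \<delta> i\<^esub> ecls i z = (\<Union>y \<in> ecls i z. ecls i (?m y))"
    by (simp add: Ext_def subquotient_def hom_dual_simps)
  also have "\<dots> = ecls i (?m z)" using * I.a_rcos_self [OF zc] by blast
  finally show ?thesis .
qed

lemma Ext_trivial:
  assumes "Z i \<subseteq> I i"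
  shows "carrier (Ext R P \<delta> i) = {\<zero>\<^bsub>Ext R P \<delta> i\<^esub>}"
proof -
  interpret I: abelian_subgroup "I i" "D i" by (rule I_abelian_subgroup)
  have "ecls i z = I i" if "z \<in> Z i" for z
    using that assms I.a_rcos_const by blast
  moreover have "Z i \<noteq> {}" using zero_in_I coboundaries_subset by blast
  ultimately show ?thesis unfolding Ext_simps by auto
qed

end

section \<open>Pulling cocycles back along chain maps\<close>

locale chain_map = P: resolution R M P \<delta> \<epsilon> + Q: resolution R M Q \<delta>' \<epsilon>'
  for R :: "('k, 'r) graded_module" and M :: "('r, 'm) graded_module"
    and P :: "nat \<Rightarrow> ('r, 'p) graded_module" and \<delta> \<epsilon>
    and Q :: "nat \<Rightarrow> ('r, 'q) graded_module" and \<delta>' \<epsilon>' +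
  fixes \<psi> :: "nat \<Rightarrow> 'q \<Rightarrow> 'p"
  assumes \<psi>: "\<psi> i \<in> graded_hom R (Q i) (P i)"
    and \<psi>\<delta>: "x \<in> carrier (Q (Suc i)) \<Longrightarrow> \<delta> i (\<psi> (Suc i) x) = \<psi> i (\<delta>' i x)"
begin

lemmas \<psi>_lm = graded_homD(1) [OF \<psi>]
lemmas \<psi>_closed = lmod_homD(1) [OF \<psi>_lm]

definition pull where "pull i z = compose (carrier (Q i)) z (\<psi> i)"

lemma pull_hom: "z \<in> lmod_hom R (P i) P.RR \<Longrightarrow> pull i z \<in> lmod_hom R (Q i) P.RR"
  unfolding pull_def by (rule lmod_hom_compose [OF Q.P_lm \<psi>_lm])

lemma pull_val: "x \<in> carrier (Q i) \<Longrightarrow> pull i z x = z (\<psi> i x)"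
  by (simp add: pull_def compose_def)

lemma pull_cocycle: "z \<in> P.Z i \<Longrightarrow> pull i z \<in> Q.Z i"
  using pull_hom \<psi>_closed by (auto simp: P.cocycles_iff Q.cocycles_iff pull_val lmod_homD(1) [OF Q.diff_lm] \<psi>\<delta> [symmetric])

lemma pull_coboundary:
  assumes "z \<in> P.I i"
  shows "pull i z \<in> Q.I i"
proof (cases i)
  case 0
  then show ?thesis
    using assms \<psi>_closed unfolding 0 P.coboundaries_0_iff Q.coboundaries_0_iff
    by (auto simp: fun_eq_iff pull_def compose_def)
next
  case (Suc k)
  then obtain v where v: "v \<in> lmod_hom R (P k) P.RR" "z = compose (carrier (P (Suc k))) v (\<delta> k)"
    using assms unfolding Suc P.coboundaries_Suc_iff by blast
  show ?thesis unfolding Suc Q.coboundaries_Suc_iff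
    by (rule bexI [OF _ pull_hom [OF v(1)]])
      (simp add: v(2) pull_def compose_def fun_eq_iff lmod_homD(1) [OF Q.diff_lm] \<psi>_closed \<psi>\<delta>)
qed

lemma pull_grade: "z \<in> grade (P.D i) n \<Longrightarrow> pull i z \<in> grade (Q.D i) n"
  using pull_hom graded_homD(2) [OF \<psi>] grade_carrier [OF graded_left_moduleD(2) [OF Q.P(1)]]
  by (fastforce simp: hom_dual_simps pull_val image_subset_iff)

end

text \<open>Inside this locale only \<open>\<psi> \<phi>\<close> is compared with the identity. The
  other composite is covered by interpreting the locale with the roles of P and Q exchanged.\<close>

locale homotopy_inverse = chain_map R M P \<delta> \<epsilon> Q \<delta>' \<epsilon>' \<psi> + rev: chain_map R M Q \<delta>' \<epsilon>' P \<delta> \<epsilon> \<phi>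
  for R :: "('k, 'r) graded_module" and M :: "('r, 'm) graded_module"
    and P :: "nat \<Rightarrow> ('r, 'p) graded_module" and \<delta> \<epsilon>
    and Q :: "nat \<Rightarrow> ('r, 'q) graded_module" and \<delta>' \<epsilon>' \<psi> \<phi> +
  assumes \<psi>\<epsilon>: "x \<in> carrier (Q 0) \<Longrightarrow> \<epsilon> (\<psi> 0 x) = \<epsilon>' x"
    and \<phi>\<epsilon>: "y \<in> carrier (P 0) \<Longrightarrow> \<epsilon>' (\<phi> 0 y) = \<epsilon> y"
begin

lemma homotopy: "\<exists>h. (\<forall>i. h i \<in> lmod_hom R (P i) (P (Suc i))) \<and>
    (\<forall>x \<in> carrier (P 0). \<psi> 0 (\<phi> 0 x) \<ominus>\<^bsub>P 0\<^esub> x = \<delta> 0 (h 0 x)) \<and>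
    (\<forall>i. \<forall>x \<in> carrier (P (Suc i)). \<psi> (Suc i) (\<phi> (Suc i) x) \<ominus>\<^bsub>P (Suc i)\<^esub> x
      = \<delta> (Suc i) (h (Suc i) x) \<oplus>\<^bsub>P (Suc i)\<^esub> h i (\<delta> i x))"
proof -
  let ?c = "\<lambda>i. compose (carrier (P i)) (\<psi> i) (\<phi> i)"
  let ?id = "\<lambda>i. \<lambda>x \<in> carrier (P i). x"
  let ?\<alpha> = "\<lambda>i. \<lambda>x \<in> carrier (P i). ?c i x \<ominus>\<^bsub>P i\<^esub> ?id i x"
  have c: "?c i \<in> lmod_hom R (P i) (P i)" for i
    by (rule lmod_hom_compose [OF P.P_lm rev.\<psi>_lm \<psi>_lm])
  have id: "?id i \<in> lmod_hom R (P i) (P i)" for i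
  proof -
    interpret left_module R "P i" by (rule P.P_lm)
    show ?thesis by (rule lmod_homI) (auto simp: smult_closed)
  qed
  have \<alpha>: "?\<alpha> i \<in> lmod_hom R (P i) (P i)" for i
    by (rule lmod_hom_diff [OF P.P_lm P.P_lm c id])
  have \<alpha>_eq: "?\<alpha> i x = \<psi> i (\<phi> i x) \<ominus>\<^bsub>P i\<^esub> x" if "x \<in> carrier (P i)" for i x
    using that by (simp add: compose_def)
  have cl: "\<psi> i (\<phi> i x) \<in> carrier (P i)" if "x \<in> carrier (P i)" for i x
    using that \<psi>_closed rev.\<psi>_closed by blast
  have 0: "\<forall>x \<in> carrier (P 0). \<epsilon> (?\<alpha> 0 x) = \<zero>\<^bsub>M\<^esub>"
  proof
    fix x assume x: "x \<in> carrier (P 0)"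
    interpret M: left_module R M by (rule P.M_lm)
    show "\<epsilon> (?\<alpha> 0 x) = \<zero>\<^bsub>M\<^esub>"
      using lmod_hom_zero_minus(2) [OF P.P_lm P.M_lm P.aug_lm cl [OF x] x] lmod_homD(1) [OF P.aug_lm x]
        \<psi>\<epsilon> [OF rev.\<psi>_closed [OF x]] \<phi>\<epsilon> [OF x] by (simp add: x a_minus_def M.M.r_neg compose_def)
  qed
  have S: "\<forall>i. \<forall>x \<in> carrier (P (Suc i)). \<delta> i (?\<alpha> (Suc i) x) = ?\<alpha> i (\<delta> i x)"
  proof (intro allI ballI)
    fix i x assume x: "x \<in> carrier (P (Suc i))"
    show "\<delta> i (?\<alpha> (Suc i) x) = ?\<alpha> i (\<delta> i x)"
      using lmod_hom_zero_minus(2) [OF P.P_lm P.P_lm P.diff_lm cl [OF x] x] lmod_homD(1) [OF P.diff_lm x]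
        \<psi>\<delta> [OF rev.\<psi>_closed [OF x]] rev.\<psi>\<delta> [OF x] by (simp add: x compose_def)
  qed
  obtain h where h: "\<forall>i. h i \<in> lmod_hom R (P i) (P (Suc i))" "\<forall>x \<in> carrier (P 0). ?\<alpha> 0 x = \<delta> 0 (h 0 x)"
    "\<forall>i. \<forall>x \<in> carrier (P (Suc i)). ?\<alpha> (Suc i) x = \<delta> (Suc i) (h (Suc i) x) \<oplus>\<^bsub>P (Suc i)\<^esub> h i (\<delta> i x)"
    using null_homotopy_exists [OF P.resolution_axioms, of ?\<alpha>, OF \<alpha> 0 S]
    by (elim exE conjE)
  show ?thesis using h by (intro exI [of _ h]) (simp add: compose_def)
qed

text \<open>The difference is z applied to \<open>\<delta> h + h \<delta>\<close>. A cocycle kills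
  the first summand, and what remains is \<open>z h\<close> composed with the differential. In
  degree 0 the second summand is absent, so the difference is zero, as the definition of
  \<open>coboundaries\<close> there demands.\<close>

lemma pull_pull:
  assumes z: "z \<in> P.Z i"
  shows "(\<lambda>x \<in> carrier (P i). rev.pull i (pull i z) x \<ominus>\<^bsub>R\<^esub> z x) \<in> P.I i"
proof -
  interpret R: ring R by (rule P.ring)
  note zh = P.Z_hom [OF z]
  obtain h where h: "\<And>i. h i \<in> lmod_hom R (P i) (P (Suc i))"
    "\<And>x. x \<in> carrier (P 0) \<Longrightarrow> \<psi> 0 (\<phi> 0 x) \<ominus>\<^bsub>P 0\<^esub> x = \<delta> 0 (h 0 x)"
    "\<And>i x. x \<in> carrier (P (Suc i)) \<Longrightarrow> \<psi> (Suc i) (\<phi> (Suc i) x) \<ominus>\<^bsub>P (Suc i)\<^esub> x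
      = \<delta> (Suc i) (h (Suc i) x) \<oplus>\<^bsub>P (Suc i)\<^esub> h i (\<delta> i x)"
    using homotopy by metis
  have cl: "\<psi> i (\<phi> i x) \<in> carrier (P i)" if "x \<in> carrier (P i)" for x
    using that \<psi>_closed rev.\<psi>_closed by blast
  have e: "rev.pull i (pull i z) x \<ominus>\<^bsub>R\<^esub> z x = z (\<psi> i (\<phi> i x) \<ominus>\<^bsub>P i\<^esub> x)" if x: "x \<in> carrier (P i)" for x
    using lmod_hom_zero_minus(2) [OF P.P_lm self_left_module [OF P.ring] zh cl [OF x] x]
    by (simp add: rev.pull_val pull_val x rev.\<psi>_closed self_module_minus P.ring P.val(1) [OF zh] cl)
  have z\<delta>: "z (\<delta> i x) = \<zero>\<^bsub>R\<^esub>" if "x \<in> carrier (P (Suc i))" for x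
    using z that by (simp add: P.cocycles_iff)
  show ?thesis
  proof (cases i)
    case 0
    have "rev.pull i (pull i z) x \<ominus>\<^bsub>R\<^esub> z x = \<zero>\<^bsub>R\<^esub>" if x: "x \<in> carrier (P i)" for x
      using e [OF x] h(2) [of x] x z\<delta> [OF lmod_homD(1) [OF h(1) x]] by (simp add: 0)
    then have "(\<lambda>x \<in> carrier (P i). rev.pull i (pull i z) x \<ominus>\<^bsub>R\<^esub> z x) = (\<lambda>x \<in> carrier (P i). \<zero>\<^bsub>R\<^esub>)"
      by (auto simp: fun_eq_iff)
    then show ?thesis using P.zero_in_I by simp
  next
    case (Suc k)
    have hz: "compose (carrier (P k)) z (h k) \<in> lmod_hom R (P k) P.RR"
      using lmod_hom_compose [OF P.P_lm h(1) zh [unfolded Suc]] .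
    have "rev.pull i (pull i z) x \<ominus>\<^bsub>R\<^esub> z x = z (h k (\<delta> k x))" if x: "x \<in> carrier (P i)" for x
    proof -
      have x': "x \<in> carrier (P (Suc k))" using x Suc by simp
      have dx: "\<delta> k x \<in> carrier (P k)" by (rule lmod_homD(1) [OF P.diff_lm x'])
      have hx: "h (Suc k) x \<in> carrier (P (Suc (Suc k)))" by (rule lmod_homD(1) [OF h(1) x'])
      have "z (\<delta> (Suc k) (h (Suc k) x) \<oplus>\<^bsub>P (Suc k)\<^esub> h k (\<delta> k x)) = z (\<delta> (Suc k) (h (Suc k) x)) \<oplus>\<^bsub>R\<^esub> z (h k (\<delta> k x))"
        by (rule P.val(2) [OF zh [unfolded Suc] lmod_homD(1) [OF P.diff_lm hx] lmod_homD(1) [OF h(1) dx]])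
      then show ?thesis
        using e [OF x] h(3) [OF x'] z\<delta> [unfolded Suc, OF hx] P.val(1) [OF zh [unfolded Suc] lmod_homD(1) [OF h(1) dx]]
        by (simp add: Suc)
    qed
    then show ?thesis unfolding Suc P.coboundaries_Suc_iff
      by (intro bexI [OF _ hz]) (simp add: compose_def fun_eq_iff lmod_homD(1) [OF P.diff_lm] restrict_def)
  qed
qed

text \<open>Pulling back and forth returns z up to a coboundary, and the round trip of z is itself a
  coboundary once its first half is.\<close>

lemma coboundary_of_pull:
  assumes z: "z \<in> P.Z i" and "pull i z \<in> Q.I i"
  shows "z \<in> P.I i"
proof -
  interpret R: ring R by (rule P.ring)
  let ?w = "rev.pull i (pull i z)"
  let ?u = "\<lambda>x \<in> carrier (P i). ?w x \<ominus>\<^bsub>R\<^esub> z x"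
  have w: "?w \<in> P.I i" by (rule rev.pull_coboundary [OF assms(2)])
  have u: "?u \<in> P.I i" by (rule pull_pull [OF z])
  have "z = (\<lambda>x \<in> carrier (P i). ?w x \<oplus>\<^bsub>R\<^esub> (\<lambda>x \<in> carrier (P i). \<ominus>\<^bsub>R\<^esub> ?u x) x)"
  proof
    fix x
    show "z x = (\<lambda>x \<in> carrier (P i). ?w x \<oplus>\<^bsub>R\<^esub> (\<lambda>x \<in> carrier (P i). \<ominus>\<^bsub>R\<^esub> ?u x) x) x"
      using lmod_homD(4) [OF P.Z_hom [OF z]] P.val(1) [OF P.Z_hom [OF z]] P.val(1) [OF P.I_hom [OF w]]
      by (cases "x \<in> carrier (P i)") (auto simp: a_minus_def R.minus_add R.a_assoc [symmetric] R.r_neg)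
  qed
  then show ?thesis using P.I_closed(1) [OF w P.I_closed(2) [OF u u]] by simp
qed

lemma Ext_trivial_transfer:
  assumes "Q.Z i \<subseteq> Q.I i"
  shows "carrier (Ext R P \<delta> i) = {\<zero>\<^bsub>Ext R P \<delta> i\<^esub>}"
  using assms pull_cocycle coboundary_of_pull by (intro P.Ext_trivial) blast

end

lemma homotopy_inverse_exists:
  assumes P: "resolution R M P \<delta> \<epsilon>" and Q: "resolution R M Q \<delta>' \<epsilon>'"
  shows "\<exists>\<psi> \<phi>. homotopy_inverse R M P \<delta> \<epsilon> Q \<delta>' \<epsilon>' \<psi> \<phi> \<and> homotopy_inverse R M Q \<delta>' \<epsilon>' P \<delta> \<epsilon> \<phi> \<psi>"
proof -
  obtain \<phi> where \<phi>: "\<forall>i. \<phi> i \<in> graded_hom R (P i) (Q i)" "\<forall>x \<in> carrier (P 0). \<epsilon>' (\<phi> 0 x) = \<epsilon> x"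
    "\<forall>i. \<forall>x \<in> carrier (P (Suc i)). \<delta>' i (\<phi> (Suc i) x) = \<phi> i (\<delta> i x)"
    using chain_map_exists [OF P Q] by (elim exE conjE)
  obtain \<psi> where \<psi>: "\<forall>i. \<psi> i \<in> graded_hom R (Q i) (P i)" "\<forall>x \<in> carrier (Q 0). \<epsilon> (\<psi> 0 x) = \<epsilon>' x"
    "\<forall>i. \<forall>x \<in> carrier (Q (Suc i)). \<delta> i (\<psi> (Suc i) x) = \<psi> i (\<delta>' i x)"
    using chain_map_exists [OF Q P] by (elim exE conjE)
  have 1: "chain_map R M P \<delta> \<epsilon> Q \<delta>' \<epsilon>' \<psi>"
    using P Q \<psi> by (intro chain_map.intro chain_map_axioms.intro) auto
  have 2: "chain_map R M Q \<delta>' \<epsilon>' P \<delta> \<epsilon> \<phi>"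
    using P Q \<phi> by (intro chain_map.intro chain_map_axioms.intro) auto
  show ?thesis
    using 1 2 \<phi>(2) \<psi>(2)
    by (intro exI [of _ \<psi>] exI [of _ \<phi>] conjI homotopy_inverse.intro homotopy_inverse_axioms.intro) auto
qed

text \<open>The cohomology of the known complex Q enters as a map \<open>\<eta>\<close> on cocycles
  whose kernel is the coboundaries. Composing it with the pullback gives a map on cocycles of P that
  descends to Ext, so no isomorphism between two quotient modules has to be built.\<close>

lemma Ext_iso_transfer:
  assumes hi: "homotopy_inverse R M P \<delta> \<epsilon> Q \<delta>' \<epsilon>' \<psi> \<phi>" and ih: "homotopy_inverse R M Q \<delta>' \<epsilon>' P \<delta> \<epsilon> \<phi> \<psi>"
    and N: "abelian_group N"
    and \<eta>_add: "\<And>z w. z \<in> cocycles R Q \<delta>' d \<Longrightarrow> w \<in> cocycles R Q \<delta>' d \<Longrightarrow>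
      \<eta> (\<lambda>x \<in> carrier (Q d). z x \<oplus>\<^bsub>R\<^esub> w x) = \<eta> z \<oplus>\<^bsub>N\<^esub> \<eta> w"
    and \<eta>_smult: "\<And>z r. z \<in> cocycles R Q \<delta>' d \<Longrightarrow> r \<in> carrier R \<Longrightarrow>
      \<eta> (\<lambda>x \<in> carrier (Q d). z x \<otimes>\<^bsub>R\<^esub> r) = r \<odot>\<^bsub>N\<^esub> \<eta> z"
    and \<eta>_kernel: "\<And>z. z \<in> cocycles R Q \<delta>' d \<Longrightarrow> \<eta> z = \<zero>\<^bsub>N\<^esub> \<longleftrightarrow> z \<in> coboundaries R Q \<delta>' d"
    and \<eta>_surj: "\<eta> ` cocycles R Q \<delta>' d = carrier N"
    and \<eta>_grade: "\<And>n. \<eta> ` (cocycles R Q \<delta>' d \<inter> grade (hom_dual R (Q d)) n) = grade N n"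
  shows "graded_isomorphic (opp R) (Ext R P \<delta> d) N"
proof -
  interpret homotopy_inverse R M P \<delta> \<epsilon> Q \<delta>' \<epsilon>' \<psi> \<phi> by fact
  interpret ih: homotopy_inverse R M Q \<delta>' \<epsilon>' P \<delta> \<epsilon> \<phi> \<psi> by fact
  interpret N: abelian_group N by fact
  interpret R: ring R by (rule P.ring)
  let ?E = "Ext R P \<delta> d"
  define g where "g z = \<eta> (pull d z)" for z
  have gc: "g z \<in> carrier N" if "z \<in> P.Z d" for z
    unfolding g_def using \<eta>_surj pull_cocycle [OF that] by blast
  have \<eta>_diff: "\<eta> (\<lambda>x \<in> carrier (Q d). z x \<ominus>\<^bsub>R\<^esub> w x) = \<eta> z \<ominus>\<^bsub>N\<^esub> \<eta> w"
    if z: "z \<in> Q.Z d" and w: "w \<in> Q.Z d" for z w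
  proof -
    let ?u = "\<lambda>x \<in> carrier (Q d). z x \<ominus>\<^bsub>R\<^esub> w x"
    have u: "?u \<in> Q.Z d"
      using Q.Z_closed(1) [OF z Q.Z_closed(2) [OF w w]] by (simp add: a_minus_def cong: restrict_cong)
    have "(\<lambda>x \<in> carrier (Q d). ?u x \<oplus>\<^bsub>R\<^esub> w x) = z"
      using Q.val(1) [OF Q.Z_hom [OF z]] Q.val(1) [OF Q.Z_hom [OF w]] lmod_homD(4) [OF Q.Z_hom [OF z]]
      by (auto simp: fun_eq_iff a_minus_def R.a_assoc R.l_neg)
    then have "\<eta> z = \<eta> ?u \<oplus>\<^bsub>N\<^esub> \<eta> w" using \<eta>_add [OF u w] by simp
    moreover have "\<eta> ?u \<in> carrier N" "\<eta> w \<in> carrier N" using \<eta>_surj u w by auto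
    ultimately show ?thesis by (simp add: a_minus_def N.a_assoc N.r_neg)
  qed
  have g_eq: "g z = g w \<longleftrightarrow> P.ecls d z = P.ecls d w" if z: "z \<in> P.Z d" and w: "w \<in> P.Z d" for z w
  proof -
    let ?u = "\<lambda>x \<in> carrier (P d). z x \<ominus>\<^bsub>R\<^esub> w x"
    have u: "?u \<in> P.Z d"
      using P.Z_closed(1) [OF z P.Z_closed(2) [OF w w]] by (simp add: a_minus_def cong: restrict_cong)
    have "pull d ?u = (\<lambda>x \<in> carrier (Q d). pull d z x \<ominus>\<^bsub>R\<^esub> pull d w x)"
      using \<psi>_closed by (auto simp: fun_eq_iff pull_def compose_def)
    then have "g ?u = g z \<ominus>\<^bsub>N\<^esub> g w"
      unfolding g_def using \<eta>_diff [OF pull_cocycle [OF z] pull_cocycle [OF w]] by simp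
    then have "g z = g w \<longleftrightarrow> g ?u = \<zero>\<^bsub>N\<^esub>"
      using gc [OF z] gc [OF w] by (auto simp: N.minus_eq_zero_iff)
    also have "\<dots> \<longleftrightarrow> pull d ?u \<in> Q.I d"
      unfolding g_def by (rule \<eta>_kernel [OF pull_cocycle [OF u]])
    also have "\<dots> \<longleftrightarrow> ?u \<in> P.I d"
      using coboundary_of_pull [OF u] pull_coboundary by blast
    also have "\<dots> \<longleftrightarrow> P.ecls d z = P.ecls d w" using P.ecls_eq [OF z w] by simp
    finally show ?thesis .
  qed
  \<comment> \<open>The representative is arbitrary; by \<open>g_eq\<close> the value depends on the
    class only, and different classes have different values.\<close>
  define h where "h = (\<lambda>X \<in> carrier ?E. g (SOME z. z \<in> P.Z d \<and> X = P.ecls d z))"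
  have h: "h (P.ecls d z) = g z" if z: "z \<in> P.Z d" for z
  proof -
    let ?z = "SOME z'. z' \<in> P.Z d \<and> P.ecls d z = P.ecls d z'"
    have *: "?z \<in> P.Z d \<and> P.ecls d z = P.ecls d ?z"
      by (rule someI [of _ z]) (use z in simp)
    have gz: "g ?z = g z"
      using g_eq [OF conjunct1 [OF *] z] conjunct2 [OF *] by (rule iffD2 [OF _ sym])
    have "P.ecls d z \<in> carrier ?E" unfolding P.Ext_simps using z by (rule imageI)
    then have "h (P.ecls d z) = g ?z" unfolding h_def by (rule restrict_apply')
    then show ?thesis by (rule trans [OF _ gz])
  qed
  \<comment> \<open>The preimage is the pullback in the other direction. The round trip changes w by
    a coboundary, which \<open>\<eta>\<close> does not see, and pullbacks preserve degrees.\<close>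
  have lift: "\<exists>z \<in> P.Z d. (w \<in> grade (Q.D d) n \<longrightarrow> z \<in> grade (P.D d) n) \<and> g z = \<eta> w" if w: "w \<in> Q.Z d" for w n
  proof (intro bexI conjI impI)
    show zc: "rev.pull d w \<in> P.Z d" by (rule rev.pull_cocycle [OF w])
    show "w \<in> grade (Q.D d) n \<Longrightarrow> rev.pull d w \<in> grade (P.D d) n" by (rule rev.pull_grade)
    have "(\<lambda>x \<in> carrier (Q d). pull d (rev.pull d w) x \<ominus>\<^bsub>R\<^esub> w x) \<in> Q.I d" by (rule ih.pull_pull [OF w])
    then have "\<eta> (pull d (rev.pull d w)) \<ominus>\<^bsub>N\<^esub> \<eta> w = \<zero>\<^bsub>N\<^esub>"
      using \<eta>_diff [OF pull_cocycle [OF zc] w] \<eta>_kernel Q.coboundaries_subset by (metis subsetD)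
    moreover have "\<eta> (pull d (rev.pull d w)) \<in> carrier N" "\<eta> w \<in> carrier N"
      using \<eta>_surj w pull_cocycle [OF zc] by auto
    ultimately show "g (rev.pull d w) = \<eta> w" by (simp add: g_def N.minus_eq_zero_iff)
  qed
  have img: "h ` (P.ecls d ` A) = g ` A" if "A \<subseteq> P.Z d" for A
    using h that by (auto simp: image_image intro!: image_cong)
  have carr: "g ` P.Z d = carrier N"
    using gc lift \<eta>_surj by (auto simp: image_iff) (metis imageE)
  have grade: "h ` grade ?E n = grade N n" for n
  proof -
    have "g ` (P.Z d \<inter> grade (P.D d) n) = \<eta> ` (Q.Z d \<inter> grade (Q.D d) n)"
    proof (intro equalityI image_subsetI)
      fix z assume "z \<in> P.Z d \<inter> grade (P.D d) n"
      then show "g z \<in> \<eta> ` (Q.Z d \<inter> grade (Q.D d) n)"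
        unfolding g_def using pull_cocycle pull_grade by blast
    next
      fix w assume "w \<in> Q.Z d \<inter> grade (Q.D d) n"
      then show "\<eta> w \<in> g ` (P.Z d \<inter> grade (P.D d) n)" using lift [of w n] by (metis IntD1 IntD2 IntI image_eqI)
    qed
    then show ?thesis unfolding P.Ext_simps using img \<eta>_grade by simp
  qed
  have "h \<in> lmod_hom (opp R) ?E N"
    unfolding lmod_hom_def
  proof (intro CollectI conjI ballI)
    show "h \<in> carrier ?E \<rightarrow>\<^sub>E carrier N"
    proof (rule PiE_I)
      fix X assume "X \<in> carrier ?E"
      then show "h X \<in> carrier N" using h gc by (auto simp: P.Ext_simps)
    qed (simp add: h_def)
    fix X assume "X \<in> carrier ?E"
    then obtain z where z: "z \<in> P.Z d" "X = P.ecls d z" by (auto simp: P.Ext_simps)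
    {
      fix Y assume "Y \<in> carrier ?E"
      then obtain w where w: "w \<in> P.Z d" "Y = P.ecls d w" by (auto simp: P.Ext_simps)
      have "pull d (\<lambda>x \<in> carrier (P d). z x \<oplus>\<^bsub>R\<^esub> w x) = (\<lambda>x \<in> carrier (Q d). pull d z x \<oplus>\<^bsub>R\<^esub> pull d w x)"
        using \<psi>_closed by (auto simp: fun_eq_iff pull_def compose_def)
      then show "h (X \<oplus>\<^bsub>?E\<^esub> Y) = h X \<oplus>\<^bsub>N\<^esub> h Y"
        unfolding z w P.Ext_add [OF z(1) w(1)] h [OF z(1)] h [OF w(1)] h [OF P.Z_closed(1) [OF z(1) w(1)]]
        using \<eta>_add [OF pull_cocycle [OF z(1)] pull_cocycle [OF w(1)]] by (simp add: g_def)
    }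
    fix r assume "r \<in> carrier (opp R)"
    then have r: "r \<in> carrier R" by simp
    have "pull d (\<lambda>x \<in> carrier (P d). z x \<otimes>\<^bsub>R\<^esub> r) = (\<lambda>x \<in> carrier (Q d). pull d z x \<otimes>\<^bsub>R\<^esub> r)"
      using \<psi>_closed by (auto simp: fun_eq_iff pull_def compose_def)
    then show "h (r \<odot>\<^bsub>?E\<^esub> X) = r \<odot>\<^bsub>N\<^esub> h X"
      unfolding z P.Ext_smult [OF z(1) r] h [OF z(1)] h [OF P.Z_closed(3) [OF z(1) z(1) r]]
      using \<eta>_smult [OF pull_cocycle [OF z(1)] r] by (simp add: g_def)
  qed
  moreover have "bij_betw h (carrier ?E) (carrier N)"
  proof (rule bij_betw_imageI)
    show "inj_on h (carrier ?E)"
      by (rule inj_onI) (auto simp: P.Ext_simps h g_eq)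
    show "h ` carrier ?E = carrier N" unfolding P.Ext_simps using img carr by simp
  qed
  ultimately show ?thesis unfolding graded_isomorphic_def using grade by blast
qed

section \<open>Algebras with a homogeneous basis\<close>

text \<open>Gradings of whole types, given by projections. Coordinate spaces are full types, so no
  carrier appears until \<open>graded_group_coords\<close> transports the grading along a
  bijection.\<close>

locale type_grading =
  fixes pr :: "int \<Rightarrow> 'v :: ab_group_add \<Rightarrow> 'v"
  assumes pr_additive: "additive (pr n)"
    and pr_pr: "pr m (pr n v) = (if m = n then pr n v else 0)"
    and pr_sum: "\<exists>N. finite N \<and> (\<forall>n. n \<notin> N \<longrightarrow> pr n v = 0) \<and> v = (\<Sum>n\<in>N. pr n v)"

lemma coords_finsum:
  assumes "abelian_group M" and "\<And>x y. x \<in> carrier M \<Longrightarrow> y \<in> carrier M \<Longrightarrow> \<kappa> (x \<oplus>\<^bsub>M\<^esub> y) = \<kappa> x + \<kappa> y"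
    and "finite A" and "\<And>i. i \<in> A \<Longrightarrow> f i \<in> carrier M"
  shows "\<kappa> (finsum M f A) = (\<Sum>i\<in>A. \<kappa> (f i) :: 'v :: ab_group_add)"
proof -
  interpret abelian_group M by fact
  have "\<kappa> \<zero>\<^bsub>M\<^esub> = 0" using assms(2) [of "\<zero>\<^bsub>M\<^esub>" "\<zero>\<^bsub>M\<^esub>"] by simp
  with assms(3,4) show ?thesis
    by (induction A rule: finite_induct) (simp_all add: assms(2) Pi_def)
qed

lemma coords_zero:
  assumes "abelian_group M" and "\<And>x y. x \<in> carrier M \<Longrightarrow> y \<in> carrier M \<Longrightarrow> \<kappa> (x \<oplus>\<^bsub>M\<^esub> y) = \<kappa> x + \<kappa> y"
  shows "\<kappa> \<zero>\<^bsub>M\<^esub> = (0 :: 'v :: ab_group_add)"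
proof -
  interpret abelian_group M by fact
  show ?thesis using assms(2) [of "\<zero>\<^bsub>M\<^esub>" "\<zero>\<^bsub>M\<^esub>"] by simp
qed

lemma graded_group_coords:
  fixes \<kappa> :: "'b \<Rightarrow> 'v :: ab_group_add"
  assumes "type_grading pr" and M: "abelian_group M" and bij: "bij_betw \<kappa> (carrier M) UNIV"
    and add: "\<And>x y. x \<in> carrier M \<Longrightarrow> y \<in> carrier M \<Longrightarrow> \<kappa> (x \<oplus>\<^bsub>M\<^esub> y) = \<kappa> x + \<kappa> y"
    and grade: "\<And>n. grade M n = {x \<in> carrier M. pr n (\<kappa> x) = \<kappa> x}"
  shows "graded_group M"
proof -
  interpret type_grading pr by fact
  interpret abelian_group M by fact
  note pr_add = additive.add [OF pr_additive] and pr_0 = additive.zero [OF pr_additive]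
  note inj = bij_betw_imp_inj_on [OF bij]
  note z = coords_zero [OF M add]
  define kinv where "kinv = inv_into (carrier M) \<kappa>"
  have inv_c [simp]: "kinv v \<in> carrier M" for v unfolding kinv_def
    using bij by (intro inv_into_into) (simp add: bij_betw_def)
  have \<kappa>_inv [simp]: "\<kappa> (kinv v) = v" for v unfolding kinv_def
    using bij by (intro f_inv_into_f) (simp add: bij_betw_def)
  have eq: "x = y \<longleftrightarrow> \<kappa> x = \<kappa> y" if "x \<in> carrier M" "y \<in> carrier M" for x y
    using inj that by (auto dest: inj_onD)
  have pr_idem: "pr n (pr n v) = pr n v" for n v by (simp add: pr_pr)
  show ?thesis
  proof (rule graded_group_projI [where pr = "\<lambda>n x. kinv (pr n (\<kappa> x))"])
    fix n
    show "subgroup (grade M n) (add_monoid M)"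
    proof (rule add.subgroupI)
      fix a assume a: "a \<in> grade M n"
      have "\<kappa> (\<ominus>\<^bsub>M\<^esub> a) + \<kappa> a = 0" using a add [of "\<ominus>\<^bsub>M\<^esub> a" a] by (simp add: grade l_neg z)
      then have "\<kappa> (\<ominus>\<^bsub>M\<^esub> a) = - \<kappa> a" by (simp add: eq_neg_iff_add_eq_0)
      then show "\<ominus>\<^bsub>M\<^esub> a \<in> grade M n" using a by (simp add: grade additive.minus [OF pr_additive])
    qed (auto simp: grade add pr_add z pr_0 intro!: exI [of _ "\<zero>\<^bsub>M\<^esub>"])
  next
    fix x assume x: "x \<in> carrier M"
    obtain N where N: "finite N" "\<forall>n. n \<notin> N \<longrightarrow> pr n (\<kappa> x) = 0" "\<kappa> x = (\<Sum>n\<in>N. pr n (\<kappa> x))"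
      using pr_sum by blast
    have "\<kappa> (\<Oplus>\<^bsub>M\<^esub>n\<in>N. kinv (pr n (\<kappa> x))) = \<kappa> x"
      using N(3) by (simp add: coords_finsum [OF M add N(1)])
    then have "x = (\<Oplus>\<^bsub>M\<^esub>n\<in>N. kinv (pr n (\<kappa> x)))" using x by (subst eq) auto
    moreover have "kinv 0 = \<zero>\<^bsub>M\<^esub>" by (simp add: eq z)
    ultimately show "\<exists>N. finite N \<and> (\<forall>n. n \<notin> N \<longrightarrow> kinv (pr n (\<kappa> x)) = \<zero>\<^bsub>M\<^esub>) \<and> x = (\<Oplus>\<^bsub>M\<^esub>n\<in>N. kinv (pr n (\<kappa> x)))"
      using N by auto
  next
    fix m n x assume "x \<in> grade M n"
    then show "kinv (pr m (\<kappa> x)) = (if m = n then x else \<zero>\<^bsub>M\<^esub>)"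
      using pr_pr [of m n "\<kappa> x"] by (auto simp: grade eq z)
  qed (auto simp: M grade pr_idem add eq pr_add)
qed

text \<open>The total degree adds the degree of the index to that of the coefficient. One
  application to the trivial grading \<open>pr0\<close> grades B, a second one grades
  \<open>B \<otimes> B\<close>.\<close>

definition pgrade :: "(int \<Rightarrow> 'v \<Rightarrow> 'v) \<Rightarrow> ('n \<Rightarrow> int) \<Rightarrow> int \<Rightarrow> ('n \<Rightarrow>\<^sub>0 'v) \<Rightarrow> 'n \<Rightarrow>\<^sub>0 'v :: ab_group_add" where
  "pgrade pr dg n = extend (\<lambda>m v. Poly_Mapping.single m (pr (n - dg m) v))"

context type_grading
begin

lemma pgrade_additive: "additive (pgrade pr dg n)"
  unfolding pgrade_def by (intro extend_additive additive_comp [OF additive_single pr_additive])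

lemma pgrade_single: "pgrade pr dg n (Poly_Mapping.single m v) = Poly_Mapping.single m (pr (n - dg m) v)"
  unfolding pgrade_def by (intro extend_single additive_comp [OF additive_single pr_additive])

lemma lookup_pgrade: "Poly_Mapping.lookup (pgrade pr dg n w) m = pr (n - dg m) (Poly_Mapping.lookup w m)"
  by (induction w rule: poly_mapping_add_induct)
    (auto simp: additive.zero [OF pgrade_additive] additive.add [OF pgrade_additive] additive.zero [OF pr_additive]
      additive.add [OF pr_additive] pgrade_single lookup_add lookup_single when_def)

lemma type_grading_pgrade: "type_grading (pgrade pr dg)"
proof (rule type_grading.intro)
  show "additive (pgrade pr dg n)" for n by (rule pgrade_additive)
  show "pgrade pr dg m (pgrade pr dg n v) = (if m = n then pgrade pr dg n v else 0)" for m n v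
    by (rule poly_mapping_eqI) (simp add: lookup_pgrade pr_pr)
  show "\<exists>N. finite N \<and> (\<forall>n. n \<notin> N \<longrightarrow> pgrade pr dg n w = 0) \<and> w = (\<Sum>n\<in>N. pgrade pr dg n w)" for w
  proof -
    obtain N where N: "\<And>v. finite (N v) \<and> (\<forall>n. n \<notin> N v \<longrightarrow> pr n v = 0) \<and> v = (\<Sum>n\<in>N v. pr n v)"
      using pr_sum by metis
    \<comment> \<open>All total degrees that can occur: degrees of coefficients shifted by the
      degree of their index. Only finitely many indices carry a coefficient.\<close>
    define K where "K = (\<Union>m \<in> Poly_Mapping.keys w. (\<lambda>n. n + dg m) ` N (Poly_Mapping.lookup w m))"
    have K: "finite K" unfolding K_def using N by auto
    have out: "pr (n - dg m) (Poly_Mapping.lookup w m) = 0" if "n \<notin> K" for n m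
    proof (cases "m \<in> Poly_Mapping.keys w")
      case True
      have "n - dg m \<notin> N (Poly_Mapping.lookup w m)"
      proof
        assume "n - dg m \<in> N (Poly_Mapping.lookup w m)"
        then have "n - dg m + dg m \<in> K" unfolding K_def using True by blast
        then show False using that by simp
      qed
      then show ?thesis using N by blast
    next
      case False
      then show ?thesis by (simp add: in_keys_iff additive.zero [OF pr_additive])
    qed
    have "Poly_Mapping.lookup w m = (\<Sum>n\<in>K. pr (n - dg m) (Poly_Mapping.lookup w m))" for m
    proof -
      let ?v = "Poly_Mapping.lookup w m"
      have "(\<Sum>n\<in>K. pr (n - dg m) ?v) = (\<Sum>n\<in>K \<union> (\<lambda>n. n + dg m) ` N ?v. pr (n - dg m) ?v)"
        using K N out by (intro sum.mono_neutral_left) auto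
      also have "\<dots> = (\<Sum>n\<in>(\<lambda>n. n + dg m) ` N ?v. pr (n - dg m) ?v)"
      proof (intro sum.mono_neutral_right ballI)
        fix n assume "n \<in> K \<union> (\<lambda>n. n + dg m) ` N ?v - (\<lambda>n. n + dg m) ` N ?v"
        then have "n - dg m \<notin> N ?v" by (auto simp: image_iff)
        then show "pr (n - dg m) ?v = 0" using N by blast
      qed (use K N in auto)
      also have "\<dots> = (\<Sum>n\<in>N ?v. pr n ?v)"
        by (subst sum.reindex) (auto simp: inj_on_def)
      also have "\<dots> = ?v" using N [of ?v] by simp
      finally show ?thesis by simp
    qed
    then have "w = (\<Sum>n\<in>K. pgrade pr dg n w)"
      by (intro poly_mapping_eqI) (simp add: lookup_sum lookup_pgrade)
    moreover have "pgrade pr dg n w = 0" if "n \<notin> K" for n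
      using out [OF that] by (intro poly_mapping_eqI) (simp add: lookup_pgrade)
    ultimately show ?thesis using K by blast
  qed
qed

end

definition pr0 :: "int \<Rightarrow> 'v \<Rightarrow> 'v :: ab_group_add" where "pr0 n x = (if n = 0 then x else 0)"

lemma type_grading_pr0: "type_grading (pr0 :: int \<Rightarrow> 'v \<Rightarrow> 'v :: ab_group_add)"
proof
  show "\<exists>N. finite N \<and> (\<forall>n. n \<notin> N \<longrightarrow> pr0 n v = 0) \<and> v = (\<Sum>n\<in>N. pr0 n v)" for v :: 'v
    by (rule exI [of _ "{0}"]) (auto simp: pr0_def)
qed (auto simp: pr0_def additive_def)

lemma pgrade_pr0_iff:
  "pgrade pr0 dg n w = w \<longleftrightarrow> Poly_Mapping.keys w \<subseteq> {m. dg m = n}"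
proof -
  interpret type_grading pr0 by (rule type_grading_pr0)
  show ?thesis
    by (auto simp: poly_mapping_eq_iff fun_eq_iff lookup_pgrade pr0_def in_keys_iff split: if_splits)
qed

text \<open>The outer product of two coordinate vectors, with \<open>\<gamma>\<close> providing the
  indices and \<open>\<alpha>\<close> the coefficients.\<close>

definition tensor :: "('n \<Rightarrow>\<^sub>0 'k :: field) \<Rightarrow> ('m \<Rightarrow>\<^sub>0 'k) \<Rightarrow> 'n \<Rightarrow>\<^sub>0 ('m \<Rightarrow>\<^sub>0 'k)" where
  "tensor \<gamma> \<alpha> = extend (\<lambda>m k. Poly_Mapping.single m (pscale (*) k \<alpha>)) \<gamma>"

lemma pscale_additive:
  "additive (pscale (*) k :: ('a \<Rightarrow>\<^sub>0 'k :: field) \<Rightarrow> _)" "additive (\<lambda>k. pscale (*) k (\<alpha> :: 'a \<Rightarrow>\<^sub>0 'k :: field))"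
proof -
  interpret vector_space "pscale (*) :: 'k \<Rightarrow> ('a \<Rightarrow>\<^sub>0 'k) \<Rightarrow> _"
    by (intro vector_space_pscale vector_space_mult)
  show "additive (pscale (*) k :: ('a \<Rightarrow>\<^sub>0 'k :: field) \<Rightarrow> _)" "additive (\<lambda>k. pscale (*) k (\<alpha> :: 'a \<Rightarrow>\<^sub>0 'k :: field))"
    by (auto simp: additive_def scale_right_distrib scale_left_distrib)
qed

lemma tensor_additive1: "additive (\<lambda>\<gamma>. tensor \<gamma> \<alpha>)"
  unfolding tensor_def by (intro extend_additive additive_comp [OF additive_single pscale_additive(2)])

lemma tensor_additive2: "additive (\<lambda>\<alpha>. tensor \<gamma> \<alpha>)"
  unfolding tensor_def additive_def extend_def
  by (simp add: additive.add [OF pscale_additive(1)] single_add sum.distrib)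

lemma tensor_single: "tensor (Poly_Mapping.single m k) \<alpha> = Poly_Mapping.single m (pscale (*) k \<alpha>)"
  unfolding tensor_def by (intro extend_single additive_comp [OF additive_single pscale_additive(2)])

lemma tensor_pscale:
  fixes \<gamma> :: "'n \<Rightarrow>\<^sub>0 'k :: field" and \<alpha> :: "'m \<Rightarrow>\<^sub>0 'k"
  shows "tensor (pscale (*) l \<gamma>) \<alpha> = tensor \<gamma> (pscale (*) l \<alpha>)"
proof (rule additive_eqI [of "\<lambda>\<gamma>. tensor (pscale (*) l \<gamma>) \<alpha>" "\<lambda>\<gamma>. tensor \<gamma> (pscale (*) l \<alpha>)"])
  show "tensor (pscale (*) l (Poly_Mapping.single a x)) \<alpha> = tensor (Poly_Mapping.single a x) (pscale (*) l \<alpha>)" for a x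
proof -
      interpret vector_space "pscale (*) :: 'k \<Rightarrow> ('m \<Rightarrow>\<^sub>0 'k) \<Rightarrow> _"
        by (intro vector_space_pscale vector_space_mult)
      show "tensor (pscale (*) l (Poly_Mapping.single a x)) \<alpha> = tensor (Poly_Mapping.single a x) (pscale (*) l \<alpha>)"
        by (simp add: tensor_single vector_space_mult mult.commute)
    qed
qed (intro tensor_additive1 additive_comp [OF tensor_additive1 pscale_additive(1)])+

definition swap :: "('n \<Rightarrow>\<^sub>0 ('m \<Rightarrow>\<^sub>0 'k :: field)) \<Rightarrow> 'm \<Rightarrow>\<^sub>0 ('n \<Rightarrow>\<^sub>0 'k)" where
  "swap = extend (\<lambda>m. extend (\<lambda>n k. Poly_Mapping.single n (Poly_Mapping.single m k)))"

lemma swap_additive: "additive swap"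
  unfolding swap_def by (intro extend_additive additive_comp [OF additive_single additive_single])

lemma swap_single: "swap (Poly_Mapping.single m (Poly_Mapping.single n k)) = Poly_Mapping.single n (Poly_Mapping.single m k)"
proof -
  have *: "additive (\<lambda>k. Poly_Mapping.single n (Poly_Mapping.single m k))" for n :: 'a and m :: 'b
    by (intro additive_comp [OF additive_single additive_single])
  show ?thesis unfolding swap_def by (subst extend_single) (auto intro: extend_additive * simp: *)
qed

lemma additive_eqI2:
  assumes "additive F" and "additive G"
    and "\<And>a b x. F (Poly_Mapping.single a (Poly_Mapping.single b x)) = G (Poly_Mapping.single a (Poly_Mapping.single b x))"
  shows "F (u :: 'a \<Rightarrow>\<^sub>0 ('b \<Rightarrow>\<^sub>0 'v :: ab_group_add)) = G u"
proof (rule additive_eqI [OF assms(1,2)])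
  fix a x
  show "F (Poly_Mapping.single a x) = G (Poly_Mapping.single a x)"
    by (rule additive_eqI [of "\<lambda>x. F (Poly_Mapping.single a x)" "\<lambda>x. G (Poly_Mapping.single a x)"])
      (auto intro: additive_comp [OF _ additive_single] assms)
qed

lemma swap_swap: "swap (swap w) = w"
  by (rule additive_eqI2 [of "\<lambda>w. swap (swap w)" "\<lambda>w. w"])
    (simp_all add: swap_single additive_comp swap_additive additive_id)

lemma swap_tensor:
  fixes \<gamma> :: "'n \<Rightarrow>\<^sub>0 'k :: field" and \<alpha> :: "'m \<Rightarrow>\<^sub>0 'k"
  shows "swap (tensor \<gamma> \<alpha>) = tensor \<alpha> \<gamma>"
proof (rule additive_eqI [of "\<lambda>\<gamma>. swap (tensor \<gamma> \<alpha>)" "\<lambda>\<gamma>. tensor \<alpha> \<gamma>"])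
  fix m :: 'n and k :: 'k
  show "swap (tensor (Poly_Mapping.single m k) \<alpha>) = tensor \<alpha> (Poly_Mapping.single m k)"
  proof (rule additive_eqI [of "\<lambda>\<alpha>. swap (tensor (Poly_Mapping.single m k) \<alpha>)" "\<lambda>\<alpha>. tensor \<alpha> (Poly_Mapping.single m k)"])
    show "swap (tensor (Poly_Mapping.single m k) (Poly_Mapping.single a x)) = tensor (Poly_Mapping.single a x) (Poly_Mapping.single m k)" for a x
      by (simp add: tensor_single swap_single vector_space_mult mult.commute)
  qed (intro tensor_additive1 additive_comp [OF swap_additive tensor_additive2])+
qed (intro tensor_additive2 additive_comp [OF swap_additive tensor_additive1])+

lemma bij_swap: "bij swap"
  by (rule o_bij [of swap]) (auto simp: fun_eq_iff swap_swap)

text \<open>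
  An algebra \<open>B\<close> with a chosen homogeneous basis indexed by \<open>'n\<close>; \<open>\<kappa>\<close> sends an element to its
  coordinates and \<open>dg\<close> gives the degrees of the basis elements.
\<close>

locale based_algebra = enveloping_algebra B for B :: "('k :: field, 'b) graded_module" (structure) +
  fixes \<kappa> :: "'b \<Rightarrow> 'n \<Rightarrow>\<^sub>0 'k" and dg :: "'n \<Rightarrow> int"
  assumes \<kappa>_bij: "bij_betw \<kappa> (carrier B) UNIV"
    and \<kappa>_add: "a \<in> carrier B \<Longrightarrow> b \<in> carrier B \<Longrightarrow> \<kappa> (a \<oplus> b) = \<kappa> a + \<kappa> b"
    and \<kappa>_scale: "a \<in> carrier B \<Longrightarrow> \<kappa> (k \<odot> a) = pscale (*) k (\<kappa> a)"
    and B_grade: "grade B i = {a \<in> carrier B. Poly_Mapping.keys (\<kappa> a) \<subseteq> {m. dg m = i}}"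
    and one_grade: "\<one> \<in> grade B 0"
    and mult_grade: "a \<in> grade B i \<Longrightarrow> b \<in> grade B j \<Longrightarrow> a \<otimes> b \<in> grade B (i + j)"
begin

sublocale P: vector_space "pscale (*) :: 'k \<Rightarrow> ('n \<Rightarrow>\<^sub>0 'k) \<Rightarrow> _"
  by (intro vector_space_pscale vector_space_mult)

lemma B_group: "abelian_group B" ..

definition kinv :: "('n \<Rightarrow>\<^sub>0 'k) \<Rightarrow> 'b" where "kinv = inv_into (carrier B) \<kappa>"

lemma kinv_closed [simp]: "kinv v \<in> carrier B"
  unfolding kinv_def using \<kappa>_bij by (intro inv_into_into) (simp add: bij_betw_def)

lemma \<kappa>_kinv [simp]: "\<kappa> (kinv v) = v"
  unfolding kinv_def using \<kappa>_bij by (intro f_inv_into_f) (simp add: bij_betw_def)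

lemma \<kappa>_eqI: "a \<in> carrier B \<Longrightarrow> b \<in> carrier B \<Longrightarrow> \<kappa> a = \<kappa> b \<Longrightarrow> a = b"
  using bij_betw_imp_inj_on [OF \<kappa>_bij] by (auto dest: inj_onD)

lemma kinv_\<kappa> [simp]: "a \<in> carrier B \<Longrightarrow> kinv (\<kappa> a) = a"
  by (rule \<kappa>_eqI) simp_all

lemma grade_pr: "grade B i = {a \<in> carrier B. pgrade pr0 dg i (\<kappa> a) = \<kappa> a}"
  by (simp add: B_grade pgrade_pr0_iff)

lemma grade_closed: "a \<in> grade B i \<Longrightarrow> a \<in> carrier B"
  by (simp add: B_grade)

sublocale M1: type_grading "pgrade pr0 dg :: int \<Rightarrow> ('n \<Rightarrow>\<^sub>0 'k) \<Rightarrow> _"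
  by (rule type_grading.type_grading_pgrade [OF type_grading_pr0])

sublocale M2: type_grading "pgrade (pgrade pr0 dg) dg :: int \<Rightarrow> ('n \<Rightarrow>\<^sub>0 ('n \<Rightarrow>\<^sub>0 'k)) \<Rightarrow> _"
  by (rule M1.type_grading_pgrade)

lemma grade_add_closed: "a \<in> grade B i \<Longrightarrow> b \<in> grade B i \<Longrightarrow> a \<oplus> b \<in> grade B i"
  by (simp add: grade_pr \<kappa>_add additive.add [OF M1.pr_additive])

lemma B_graded_group: "graded_group B"
  by (rule graded_group_coords [OF M1.type_grading_axioms B_group \<kappa>_bij \<kappa>_add grade_pr])

lemma scal_grade: "a \<in> grade B i \<Longrightarrow> k \<odot> a \<in> grade B i"
  by (auto simp: B_grade \<kappa>_scale scal_closed in_keys_iff lookup_pscale vector_space_mult subset_iff)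

lemma grade_induct [consumes 1, case_names zero tens add]:
  assumes "u \<in> grade BB n" and "P \<zero>\<^bsub>BB\<^esub>"
    and "\<And>a c i. a \<in> carrier B \<Longrightarrow> c \<in> carrier B \<Longrightarrow> a \<in> grade B i \<Longrightarrow> c \<in> grade B (n - i) \<Longrightarrow> P (tens a c)"
    and "\<And>u v. u \<in> carrier BB \<Longrightarrow> v \<in> carrier BB \<Longrightarrow> P u \<Longrightarrow> P v \<Longrightarrow> P (u \<oplus>\<^bsub>BB\<^esub> v)"
  shows "P u"
  using assms(1) by (rule BB_grade_induct) (auto intro: scal_grade assms)

lemma tens_add1: "a \<in> carrier B \<Longrightarrow> a' \<in> carrier B \<Longrightarrow> c \<in> carrier B \<Longrightarrow>
    tens (a \<oplus> a') c = tens a c \<oplus>\<^bsub>BB\<^esub> tens a' c"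
  by (rule tens_add(1))

lemma tens_add2: "a \<in> carrier B \<Longrightarrow> c \<in> carrier B \<Longrightarrow> c' \<in> carrier B \<Longrightarrow>
    tens a (c \<oplus> c') = tens a c \<oplus>\<^bsub>BB\<^esub> tens a c'"
  by (rule tens_add(2))

lemma B_graded_algebra: "graded_algebra B"
  unfolding graded_algebra_def
  using k_algebra_axioms B_graded_group one_grade mult_grade scal_grade by blast

text \<open>The right tensor factor supplies the index and the left one the coefficient. These are
  the coordinates in which right multiplication by a matrix entry becomes \<open>op\<close>.\<close>

definition \<Theta> :: "('k, 'b) env \<Rightarrow> 'n \<Rightarrow>\<^sub>0 ('n \<Rightarrow>\<^sub>0 'k)" where
  "\<Theta> = Lift (\<lambda>a c. tensor (\<kappa> c) (\<kappa> a))"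

text \<open>The same with the roles of the factors exchanged. It is adapted to left multiplication
  by matrix entries, which is how the dual complex is formed.\<close>

definition \<Theta>' :: "('k, 'b) env \<Rightarrow> 'n \<Rightarrow>\<^sub>0 ('n \<Rightarrow>\<^sub>0 'k)" where
  "\<Theta>' u = swap (\<Theta> u)"

lemma biadditive_tensor: "biadditive (\<lambda>a c. tensor (\<kappa> c) (\<kappa> a))"
  by (auto simp: biadditive_def \<kappa>_add \<kappa>_scale additive.add [OF tensor_additive1]
      additive.add [OF tensor_additive2] tensor_pscale)

lemma \<Theta>_tens: "a \<in> carrier B \<Longrightarrow> c \<in> carrier B \<Longrightarrow> \<Theta> (tens a c) = tensor (\<kappa> c) (\<kappa> a)"
  unfolding \<Theta>_def by (rule Lift_tens [OF biadditive_tensor])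

lemma \<Theta>'_tens: "a \<in> carrier B \<Longrightarrow> c \<in> carrier B \<Longrightarrow> \<Theta>' (tens a c) = tensor (\<kappa> a) (\<kappa> c)"
  by (simp add: \<Theta>'_def \<Theta>_tens swap_tensor)

lemma \<Theta>_add: "u \<in> carrier BB \<Longrightarrow> v \<in> carrier BB \<Longrightarrow> \<Theta> (u \<oplus>\<^bsub>BB\<^esub> v) = \<Theta> u + \<Theta> v"
  unfolding \<Theta>_def by (rule Lift_add [OF biadditive_tensor])

lemma \<Theta>'_add: "u \<in> carrier BB \<Longrightarrow> v \<in> carrier BB \<Longrightarrow> \<Theta>' (u \<oplus>\<^bsub>BB\<^esub> v) = \<Theta>' u + \<Theta>' v"
  by (simp add: \<Theta>'_def \<Theta>_add additive.add [OF swap_additive])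

sublocale BB: ring BB by (rule BB_ring)

lemmas \<Theta>_zero [simp] = coords_zero [OF BB.is_abelian_group \<Theta>_add]
lemmas \<Theta>'_zero [simp] = coords_zero [OF BB.is_abelian_group \<Theta>'_add]

abbreviation "bas m \<equiv> kinv (Poly_Mapping.single m 1)"

lemma tens_bas_surj: "\<Theta> (tens (kinv v) (bas m)) = Poly_Mapping.single m v"
  by (simp add: \<Theta>_tens tensor_single)

text \<open>The inverse of \<open>\<Theta>\<close>: each element of the enveloping algebra has a
  unique expansion over the basis in its right factor, with left factors as coefficients.\<close>

definition \<Psi> :: "('n \<Rightarrow>\<^sub>0 ('n \<Rightarrow>\<^sub>0 'k)) \<Rightarrow> ('k, 'b) env" where
  "\<Psi> w = (\<Oplus>\<^bsub>BB\<^esub>m\<in>Poly_Mapping.keys w. tens (kinv (Poly_Mapping.lookup w m)) (bas m))"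

lemma kinv_add: "kinv (v + w) = kinv v \<oplus> kinv w"
  by (rule \<kappa>_eqI) (simp_all add: \<kappa>_add)

lemma kinv_zero: "kinv 0 = \<zero>"
  by (rule \<kappa>_eqI) (simp_all add: coords_zero [OF B_group \<kappa>_add])

lemma tens_zero: "c \<in> carrier B \<Longrightarrow> tens \<zero> c = \<zero>\<^bsub>BB\<^esub>"
  using tens_add(1) [of \<zero> \<zero> c c] BB.add.r_cancel_one' [of "tens \<zero> c" "tens \<zero> c"] by simp

lemma \<Psi>_superset:
  assumes "finite A" and "Poly_Mapping.keys w \<subseteq> A"
  shows "\<Psi> w = (\<Oplus>\<^bsub>BB\<^esub>m\<in>A. tens (kinv (Poly_Mapping.lookup w m)) (bas m))"
  unfolding \<Psi>_def using assms
  by (intro BB.finsum_mono_neutral [symmetric]) (auto simp: in_keys_iff kinv_zero tens_zero)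

lemma \<Psi>_closed: "\<Psi> w \<in> carrier BB"
  unfolding \<Psi>_def by (intro BB.finsum_closed) auto

lemma \<Psi>_add: "\<Psi> (v + w) = \<Psi> v \<oplus>\<^bsub>BB\<^esub> \<Psi> w"
proof -
  let ?A = "Poly_Mapping.keys v \<union> Poly_Mapping.keys w"
  have A: "finite ?A" by simp
  have "\<Psi> (v + w) = (\<Oplus>\<^bsub>BB\<^esub>m\<in>?A. tens (kinv (Poly_Mapping.lookup (v + w) m)) (bas m))"
    by (rule \<Psi>_superset [OF A keys_add])
  also have "\<dots> = (\<Oplus>\<^bsub>BB\<^esub>m\<in>?A. tens (kinv (Poly_Mapping.lookup v m)) (bas m) \<oplus>\<^bsub>BB\<^esub> tens (kinv (Poly_Mapping.lookup w m)) (bas m))"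
    by (rule BB.finsum_cong') (simp_all add: lookup_add kinv_add tens_add1)
  also have "\<dots> = \<Psi> v \<oplus>\<^bsub>BB\<^esub> \<Psi> w"
    by (subst (1 2) \<Psi>_superset [OF A]) (auto intro!: BB.finsum_addf)
  finally show ?thesis .
qed

lemma \<Psi>_single: "\<Psi> (Poly_Mapping.single m v) = tens (kinv v) (bas m)"
  using \<Psi>_superset [of "{m}" "Poly_Mapping.single m v"] by (simp add: Pi_def)

lemma tens_balanced: "a \<in> carrier B \<Longrightarrow> c \<in> carrier B \<Longrightarrow> tens (k \<odot> a) c = tens a (k \<odot> c)"
  using tens_scale [of a c k] by simp

lemma tens_zero_right: "c \<in> carrier B \<Longrightarrow> tens c \<zero> = \<zero>\<^bsub>BB\<^esub>"
  using tens_add(2) [of c c \<zero> \<zero>] BB.add.r_cancel_one' [of "tens c \<zero>" "tens c \<zero>"] by simp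

lemma \<Psi>_tensor:
  assumes "a \<in> carrier B"
  shows "\<Psi> (tensor \<gamma> (\<kappa> a)) = tens a (kinv \<gamma>)"
proof (induction \<gamma> rule: poly_mapping_add_induct)
  case zero
  have "\<Psi> 0 = \<zero>\<^bsub>BB\<^esub>" by (simp add: \<Psi>_def)
  then show ?case using assms by (simp add: additive.zero [OF tensor_additive1] kinv_zero tens_zero_right)
next
  case (single m k)
  have "kinv (pscale (*) k (\<kappa> a)) = k \<odot> a"
    using assms by (intro \<kappa>_eqI) (simp_all add: \<kappa>_scale scal_closed)
  moreover have "kinv (Poly_Mapping.single m k) = k \<odot> bas m"
    by (intro \<kappa>_eqI) (simp_all add: \<kappa>_scale scal_closed vector_space_mult)
  ultimately show ?case using assms by (simp add: tensor_single \<Psi>_single tens_balanced)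
next
  case (add v w)
  then show ?case using assms by (simp add: additive.add [OF tensor_additive1] \<Psi>_add kinv_add tens_add2)
qed

lemma \<Psi>_\<Theta>: "u \<in> carrier BB \<Longrightarrow> \<Psi> (\<Theta> u) = u"
proof (induction u rule: BB_induct)
  case zero
  then show ?case by (simp add: \<Psi>_def)
qed (simp_all add: \<Theta>_tens \<Psi>_tensor \<Theta>_add \<Psi>_add)

lemma \<Theta>_\<Psi>: "\<Theta> (\<Psi> w) = w"
proof (induction w rule: poly_mapping_add_induct)
  case zero
  then show ?case by (simp add: \<Psi>_def)
qed (simp_all add: \<Psi>_single tens_bas_surj \<Psi>_add \<Theta>_add \<Psi>_closed)

lemma \<Theta>_bij: "bij_betw \<Theta> (carrier BB) UNIV"
  by (rule bij_betwI [of _ _ _ \<Psi>]) (auto simp: \<Psi>_\<Theta> \<Theta>_\<Psi> \<Psi>_closed)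

lemma \<Theta>'_bij: "bij_betw \<Theta>' (carrier BB) UNIV"
  using bij_betw_trans [OF \<Theta>_bij bij_swap] by (simp add: \<Theta>'_def [abs_def] comp_def)

lemma \<Theta>_inj: "u \<in> carrier BB \<Longrightarrow> v \<in> carrier BB \<Longrightarrow> \<Theta> u = \<Theta> v \<Longrightarrow> u = v"
  by (metis \<Psi>_\<Theta>)

lemma \<Theta>'_inj: "u \<in> carrier BB \<Longrightarrow> v \<in> carrier BB \<Longrightarrow> \<Theta>' u = \<Theta>' v \<Longrightarrow> u = v"
  using bij_betw_imp_inj_on [OF \<Theta>'_bij] by (auto dest: inj_onD)

lemma \<Theta>'_surj: "\<exists>u \<in> carrier BB. \<Theta>' u = w"
  using bij_betw_imp_surj_on [OF \<Theta>'_bij] by (metis UNIV_I imageE)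

lemma BB_grade_eq: "grade BB n = {u \<in> carrier BB. pgrade (pgrade pr0 dg) dg n (\<Theta> u) = \<Theta> u}"
proof (intro equalityI subsetI)
  fix u assume u: "u \<in> grade BB n"
  have "pgrade (pgrade pr0 dg) dg n (\<Theta> u) = \<Theta> u"
    using u
  proof (induction u rule: grade_induct)
    case (tens a c i)
    have a: "pgrade pr0 dg i (\<kappa> a) = \<kappa> a" and c: "Poly_Mapping.keys (\<kappa> c) \<subseteq> {m. dg m = n - i}"
      using tens by (auto simp: B_grade pgrade_pr0_iff)
    have ak: "pgrade pr0 dg i (pscale (*) k (\<kappa> a)) = pscale (*) k (\<kappa> a)" for k
      using scal_grade [OF tens(3), of k] tens(1) by (simp add: grade_pr \<kappa>_scale)
    have "pgrade (pgrade pr0 dg) dg n (tensor \<gamma> (\<kappa> a)) = tensor \<gamma> (\<kappa> a)"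
      if "Poly_Mapping.keys \<gamma> \<subseteq> {m. dg m = n - i}" for \<gamma>
    proof (rule additive_eqI_keys [of "\<lambda>\<gamma>. pgrade (pgrade pr0 dg) dg n (tensor \<gamma> (\<kappa> a))" "\<lambda>\<gamma>. tensor \<gamma> (\<kappa> a)"])
      fix m and x :: 'k assume "m \<in> Poly_Mapping.keys \<gamma>"
      then have "dg m = n - i" using that by blast
      then show "pgrade (pgrade pr0 dg) dg n (tensor (Poly_Mapping.single m x) (\<kappa> a)) = tensor (Poly_Mapping.single m x) (\<kappa> a)"
        by (simp add: tensor_single M1.pgrade_single ak)
    qed (intro tensor_additive1 additive_comp [OF M2.pr_additive tensor_additive1])+
    then show ?case using c tens by (simp add: \<Theta>_tens)
  qed (auto simp: \<Theta>_add additive.add [OF M2.pr_additive] additive.zero [OF M2.pr_additive])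
  then show "u \<in> {u \<in> carrier BB. pgrade (pgrade pr0 dg) dg n (\<Theta> u) = \<Theta> u}"
    using BB_grade_subset [OF u] by simp
next
  \<comment> \<open>Every projection to degree n is hit by an element of \<open>grade BB n\<close>.
    For u with homogeneous coordinates the projection changes nothing, and injectivity of
    \<open>\<Theta>\<close> identifies u with that element.\<close>
  have ex: "\<exists>u \<in> grade BB n. \<Theta> u = pgrade (pgrade pr0 dg) dg n w" for w
  proof (induction w rule: poly_mapping_add_induct)
    case zero
    then show ?case using BB_grade_zero by (auto simp: additive.zero [OF M2.pr_additive] intro!: bexI [of _ "\<zero>\<^bsub>BB\<^esub>"])
  next
    case (single m v)
    let ?v = "pgrade pr0 dg (n - dg m) v"
    have "kinv ?v \<in> grade B (n - dg m)" by (simp add: grade_pr M1.pr_pr)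
    moreover have "bas m \<in> grade B (n - (n - dg m))" by (simp add: B_grade del: diff_diff_eq2)
    ultimately have "tens (kinv ?v) (bas m) \<in> grade BB n" by (intro tens_grade [of _ _ "n - dg m"]) simp_all
    then show ?case by (intro bexI [of _ "tens (kinv ?v) (bas m)"]) (simp_all add: tens_bas_surj M1.pgrade_single)
  next
    case (add v w)
    then obtain u u' where "u \<in> grade BB n" "\<Theta> u = pgrade (pgrade pr0 dg) dg n v"
      "u' \<in> grade BB n" "\<Theta> u' = pgrade (pgrade pr0 dg) dg n w" by blast
    then show ?case
      by (intro bexI [of _ "u \<oplus>\<^bsub>BB\<^esub> u'"])
        (simp_all add: BB_grade_add \<Theta>_add BB_grade_subset additive.add [OF M2.pr_additive])
  qed
  fix u assume u: "u \<in> {u \<in> carrier BB. pgrade (pgrade pr0 dg) dg n (\<Theta> u) = \<Theta> u}"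
  obtain u' where u': "u' \<in> grade BB n" "\<Theta> u' = pgrade (pgrade pr0 dg) dg n (\<Theta> u)" using ex by blast
  then have "u = u'" using u BB_grade_subset by (intro \<Theta>_inj) auto
  then show "u \<in> grade BB n" using u' by simp
qed

lemma BB_graded_group: "graded_group BB"
  by (rule graded_group_coords [OF M2.type_grading_axioms BB.is_abelian_group \<Theta>_bij \<Theta>_add BB_grade_eq])

lemma BB_mult_grade:
  assumes "u \<in> grade BB m" and "v \<in> grade BB n"
  shows "u \<otimes>\<^bsub>BB\<^esub> v \<in> grade BB (m + n)"
  using assms(1)
proof (induction u rule: grade_induct)
  case zero
  then show ?case using BB_grade_subset [OF assms(2)] BB_grade_zero by simp
next
  case (tens a c i)
  show ?case
    using assms(2)
  proof (induction v rule: grade_induct)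
    case zero
    then show ?case using tens BB_grade_zero by simp
  next
    case (tens a' c' j)
    have "a \<otimes> a' \<in> grade B (i + j)" using tens \<open>a \<in> grade B i\<close> mult_grade by blast
    moreover have "c' \<otimes> c \<in> grade B (m + n - (i + j))"
      using mult_grade [OF tens(4) \<open>c \<in> grade B (m - i)\<close>] by (simp add: algebra_simps)
    ultimately show ?case
      using tens \<open>a \<in> carrier B\<close> \<open>c \<in> carrier B\<close> by (simp add: tens_mult tens_grade)
  next
    case (add u v)
    then show ?case using tens by (simp add: BB.r_distr BB_grade_add)
  qed
next
  case (add u v)
  then show ?case using BB_grade_subset [OF assms(2)] by (simp add: BB.l_distr BB_grade_add)
qed

section \<open>The algebra as a module over its enveloping algebra\<close>

lemma \<kappa>_finsum: "finite A \<Longrightarrow> (\<And>i. i \<in> A \<Longrightarrow> f i \<in> carrier B) \<Longrightarrow> \<kappa> (finsum B f A) = (\<Sum>i\<in>A. \<kappa> (f i))"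
  by (rule coords_finsum [OF B_group \<kappa>_add])

text \<open>The common shape of both module structures on B: sending the pair to
  \<open>a m c\<close> gives the left structure, to \<open>c m a\<close> the right one.\<close>

definition act :: "('b \<Rightarrow> 'b \<Rightarrow> 'b) \<Rightarrow> ('k, 'b) env \<Rightarrow> 'b" where
  "act F u = the_elem ((\<lambda>v. \<Oplus>w \<in> Poly_Mapping.keys v. Poly_Mapping.lookup v w \<odot> F (fst w) (snd w)) ` u)"

context
  fixes F :: "'b \<Rightarrow> 'b \<Rightarrow> 'b"
  assumes F_closed: "a \<in> carrier B \<Longrightarrow> c \<in> carrier B \<Longrightarrow> F a c \<in> carrier B"
    and F_add1: "a \<in> carrier B \<Longrightarrow> b \<in> carrier B \<Longrightarrow> c \<in> carrier B \<Longrightarrow> F (a \<oplus> b) c = F a c \<oplus> F b c"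
    and F_add2: "a \<in> carrier B \<Longrightarrow> b \<in> carrier B \<Longrightarrow> c \<in> carrier B \<Longrightarrow> F a (b \<oplus> c) = F a b \<oplus> F a c"
    and F_scale1: "a \<in> carrier B \<Longrightarrow> c \<in> carrier B \<Longrightarrow> F (k \<odot> a) c = k \<odot> F a c"
    and F_scale2: "a \<in> carrier B \<Longrightarrow> c \<in> carrier B \<Longrightarrow> F a (k \<odot> c) = k \<odot> F a c"
begin

lemma biadditive_F: "biadditive (\<lambda>a c. \<kappa> (F a c))"
  by (auto simp: biadditive_def F_add1 F_add2 F_scale1 F_scale2 \<kappa>_add F_closed)

text \<open>In coordinates the sum over a representative is the lift of a biadditive map, and lifts
  are constant on classes. This justifies \<open>the_elem\<close>.\<close>

lemma act_cls:
  assumes v: "v \<in> carrier Bfree"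
  shows "act F (Q.cls v) \<in> carrier B" and "\<kappa> (act F (Q.cls v)) = lift (\<lambda>a c. \<kappa> (F a c)) v"
proof -
  let ?s = "\<lambda>v. \<Oplus>w \<in> Poly_Mapping.keys v. Poly_Mapping.lookup v w \<odot> F (fst w) (snd w)"
  have s: "?s v \<in> carrier B \<and> \<kappa> (?s v) = lift (\<lambda>a c. \<kappa> (F a c)) v" if v: "v \<in> carrier Bfree" for v
  proof -
    have c: "w \<in> Poly_Mapping.keys v \<Longrightarrow> fst w \<in> carrier B \<and> snd w \<in> carrier B" for w
      using v by (auto simp: free_carrier)
    have "\<kappa> (?s v) = (\<Sum>w \<in> Poly_Mapping.keys v. \<kappa> (Poly_Mapping.lookup v w \<odot> F (fst w) (snd w)))"
      using c by (intro \<kappa>_finsum) (auto simp: F_closed scal_closed)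
    also have "\<dots> = lift (\<lambda>a c. \<kappa> (F a c)) v"
      unfolding lift_def extend_def using c by (intro sum.cong) (auto simp: F_scale1 mem_Times_iff)
    finally show ?thesis using c by (auto intro!: finsum_closed simp: F_closed scal_closed)
  qed
  have "?s w = ?s v" if "w \<in> Q.cls v" for w
  proof -
    have "w \<in> carrier Bfree" using that Q.a_elemrcos_carrier [OF v] by simp
    then show ?thesis
      using s [of w] s [OF v] lift_cls [OF biadditive_F v that] by (intro \<kappa>_eqI) auto
  qed
  then have "?s ` Q.cls v \<subseteq> {?s v}" by blast
  moreover have "?s v \<in> ?s ` Q.cls v" using Q.cls_self [OF v] by (rule imageI)
  ultimately have "?s ` Q.cls v = {?s v}" by blast
  then have "act F (Q.cls v) = ?s v" by (simp add: act_def)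
  then show "act F (Q.cls v) \<in> carrier B" and "\<kappa> (act F (Q.cls v)) = lift (\<lambda>a c. \<kappa> (F a c)) v"
    using s [OF v] by auto
qed

lemma act_closed: "u \<in> carrier BB \<Longrightarrow> act F u \<in> carrier B"
  unfolding BB_eq Q.Q_carrier using act_cls(1) by blast

lemma \<kappa>_act: "u \<in> carrier BB \<Longrightarrow> \<kappa> (act F u) = Lift (\<lambda>a c. \<kappa> (F a c)) u"
  unfolding BB_eq Q.Q_carrier using act_cls(2) Lift_cls [OF biadditive_F] by auto

lemma act_tens: "a \<in> carrier B \<Longrightarrow> c \<in> carrier B \<Longrightarrow> act F (tens a c) = F a c"
  by (rule \<kappa>_eqI) (simp_all add: act_closed F_closed \<kappa>_act Lift_tens [OF biadditive_F])

lemma act_add: "u \<in> carrier BB \<Longrightarrow> v \<in> carrier BB \<Longrightarrow> act F (u \<oplus>\<^bsub>BB\<^esub> v) = act F u \<oplus> act F v"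
  by (rule \<kappa>_eqI) (simp_all add: act_closed \<kappa>_act \<kappa>_add Lift_add [OF biadditive_F])

lemma act_zero: "act F \<zero>\<^bsub>BB\<^esub> = \<zero>"
  using act_add [of "\<zero>\<^bsub>BB\<^esub>" "\<zero>\<^bsub>BB\<^esub>"] act_closed [of "\<zero>\<^bsub>BB\<^esub>"] by (simp add: add.r_cancel_one')

end

lemma env_simps [simp]:
  "carrier (env_left B) = carrier B" "add (env_left B) = add B" "zero (env_left B) = zero B"
  "grade (env_left B) = grade B" "smult (env_left B) u m = act (\<lambda>a c. a \<otimes> m \<otimes> c) u"
  "carrier (env_right B) = carrier B" "add (env_right B) = add B" "zero (env_right B) = zero B"
  "grade (env_right B) = grade B" "smult (env_right B) u m = act (\<lambda>a c. c \<otimes> m \<otimes> a) u"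
  by (simp_all add: env_left_def env_right_def act_def)

context
  fixes m assumes m: "m \<in> carrier B"
begin

lemma left_closed: "u \<in> carrier BB \<Longrightarrow> act (\<lambda>a c. a \<otimes> m \<otimes> c) u \<in> carrier B"
  and left_tens: "a \<in> carrier B \<Longrightarrow> c \<in> carrier B \<Longrightarrow> act (\<lambda>a c. a \<otimes> m \<otimes> c) (tens a c) = a \<otimes> m \<otimes> c"
  and left_add: "u \<in> carrier BB \<Longrightarrow> v \<in> carrier BB \<Longrightarrow>
    act (\<lambda>a c. a \<otimes> m \<otimes> c) (u \<oplus>\<^bsub>BB\<^esub> v) = act (\<lambda>a c. a \<otimes> m \<otimes> c) u \<oplus> act (\<lambda>a c. a \<otimes> m \<otimes> c) v"
  and left_zero: "act (\<lambda>a c. a \<otimes> m \<otimes> c) \<zero>\<^bsub>BB\<^esub> = \<zero>"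
  using m by (auto intro!: act_closed act_tens act_add act_zero simp: l_distr r_distr scal_mult_l scal_mult_r scal_closed)

lemma right_closed: "u \<in> carrier BB \<Longrightarrow> act (\<lambda>a c. c \<otimes> m \<otimes> a) u \<in> carrier B"
  and right_tens: "a \<in> carrier B \<Longrightarrow> c \<in> carrier B \<Longrightarrow> act (\<lambda>a c. c \<otimes> m \<otimes> a) (tens a c) = c \<otimes> m \<otimes> a"
  and right_add: "u \<in> carrier BB \<Longrightarrow> v \<in> carrier BB \<Longrightarrow>
    act (\<lambda>a c. c \<otimes> m \<otimes> a) (u \<oplus>\<^bsub>BB\<^esub> v) = act (\<lambda>a c. c \<otimes> m \<otimes> a) u \<oplus> act (\<lambda>a c. c \<otimes> m \<otimes> a) v"
  and right_zero: "act (\<lambda>a c. c \<otimes> m \<otimes> a) \<zero>\<^bsub>BB\<^esub> = \<zero>"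
  using m by (auto intro!: act_closed act_tens act_add act_zero simp: l_distr r_distr scal_mult_l scal_mult_r scal_closed)

end

lemma env_left_module: "left_module BB (env_left B)"
proof -
  have "abelian_group (env_left B)"
    by (rule abelian_groupI) (auto simp: a_ac intro: add.l_inv_ex)
  moreover have "left_module_axioms BB (env_left B)"
  proof (rule left_module_axioms.intro; unfold env_simps)
    fix u x assume u: "u \<in> carrier BB" and x: "x \<in> carrier B"
    show "act (\<lambda>a c. a \<otimes> x \<otimes> c) u \<in> carrier B" by (rule left_closed [OF x u])
    {
      fix y assume y: "y \<in> carrier B"
      show "act (\<lambda>a c. a \<otimes> (x \<oplus> y) \<otimes> c) u = act (\<lambda>a c. a \<otimes> x \<otimes> c) u \<oplus> act (\<lambda>a c. a \<otimes> y \<otimes> c) u"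
        using u x y
        by (induction u rule: BB_induct)
          (simp_all add: left_zero left_tens left_add left_closed l_distr r_distr a_ac)
    }
    fix v assume v: "v \<in> carrier BB"
    show "act (\<lambda>a c. a \<otimes> x \<otimes> c) (u \<oplus>\<^bsub>BB\<^esub> v) = act (\<lambda>a c. a \<otimes> x \<otimes> c) u \<oplus> act (\<lambda>a c. a \<otimes> x \<otimes> c) v"
      by (rule left_add [OF x u v])
    show "act (\<lambda>a c. a \<otimes> x \<otimes> c) (u \<otimes>\<^bsub>BB\<^esub> v) = act (\<lambda>a c. a \<otimes> act (\<lambda>a c. a \<otimes> x \<otimes> c) v \<otimes> c) u"
      using u
    proof (induction u rule: BB_induct)
      case (tens a c)
      show ?case
        using v
        by (induction v rule: BB_induct)
          (use tens x in \<open>simp_all add: left_zero left_tens left_add left_closed tens_mult l_distr r_distr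
            BB.r_distr m_assoc\<close>)
    qed (use v x in \<open>simp_all add: left_zero left_add left_closed BB.l_distr\<close>)
  next
    fix x assume "x \<in> carrier B"
    then show "act (\<lambda>a c. a \<otimes> x \<otimes> c) \<one>\<^bsub>BB\<^esub> = x" by (simp add: BB_one left_tens)
  qed
  ultimately show ?thesis by (intro left_module.intro BB_ring)
qed

lemma env_left_graded: "graded_left_module BB (env_left B)"
  unfolding graded_left_module_def
proof (intro conjI allI ballI)
  show "left_module BB (env_left B)" by (rule env_left_module)
  then have "abelian_group (env_left B)" by (simp add: left_module_def)
  then show "graded_group (env_left B)"
    by (rule graded_group_coords [OF M1.type_grading_axioms]) (auto simp: \<kappa>_bij \<kappa>_add grade_pr)
  fix i j u x assume u: "u \<in> grade BB i" and x: "x \<in> grade (env_left B) j"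
  then have x: "x \<in> grade B j" by simp
  have xc: "x \<in> carrier B" by (rule grade_closed [OF x])
  show "u \<odot>\<^bsub>env_left B\<^esub> x \<in> grade (env_left B) (i + j)"
    unfolding env_simps using u
  proof (induction u rule: grade_induct)
    case zero
    then show ?case using xc by (simp add: left_zero B_grade coords_zero [OF B_group \<kappa>_add])
  next
    case (tens a c k)
    have "a \<otimes> x \<otimes> c \<in> grade B (k + j + (i - k))" using tens x by (intro mult_grade)
    then show ?case using tens xc by (simp add: left_tens add.commute)
  next
    case (add u v)
    then show ?case using xc by (simp add: left_add grade_add_closed)
  qed
qed

text \<open>In a product the left factor acts first, as befits a right module; read over
  \<open>opp BB\<close> this is the module law for the target of Ext.\<close>

lemma right_mult:
  assumes x: "x \<in> carrier B" and u: "u \<in> carrier BB" and v: "v \<in> carrier BB"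
  shows "act (\<lambda>a c. c \<otimes> x \<otimes> a) (u \<otimes>\<^bsub>BB\<^esub> v) = act (\<lambda>a c. c \<otimes> act (\<lambda>a c. c \<otimes> x \<otimes> a) u \<otimes> a) v"
  using v
proof (induction v rule: BB_induct)
  case (tens a c)
  show ?case
    using u
    by (induction u rule: BB_induct)
      (use tens x in \<open>simp_all add: right_zero right_tens right_add right_closed tens_mult l_distr r_distr
        BB.l_distr m_assoc\<close>)
qed (use u x in \<open>simp_all add: right_zero right_add right_closed BB.r_distr\<close>)

lemma right_grade:
  assumes u: "u \<in> grade BB i" and x: "x \<in> grade B j"
  shows "act (\<lambda>a c. c \<otimes> x \<otimes> a) u \<in> grade B (i + j)"
proof -
  have xc: "x \<in> carrier B" by (rule grade_closed [OF x])
  show ?thesis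
    using u
  proof (induction u rule: grade_induct)
    case zero
    then show ?case using xc by (simp add: right_zero B_grade coords_zero [OF B_group \<kappa>_add])
  next
    case (tens a c k)
    have "c \<otimes> x \<otimes> a \<in> grade B (i - k + j + k)" using tens x by (intro mult_grade)
    then show ?case using tens xc by (simp add: right_tens add.commute)
  next
    case (add u v)
    then show ?case using xc by (simp add: right_add grade_add_closed)
  qed
qed

end

section \<open>Complexes of free modules given by matrices\<close>

lemma lmod_hom_cong:
  assumes "carrier M = carrier M'" "add M = add M'" "smult M = smult M'"
    and "carrier N = carrier N'" "add N = add N'" "smult N = smult N'"
  shows "lmod_hom R M N = lmod_hom R M' N'"
  unfolding lmod_hom_def assms ..

text \<open>
  The \<open>i\<close>-th term is free of rank \<open>rk i\<close> on generators of degree \<open>i\<close>; its elements are row vectors,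
  on which the differential is multiplication by the matrix \<open>mat i\<close> from the right.
\<close>

locale matrix_complex = ring R for R :: "('k, 'r) graded_module" (structure) +
  fixes rk :: "nat \<Rightarrow> nat" and mat :: "nat \<Rightarrow> nat \<Rightarrow> nat \<Rightarrow> 'r"
  assumes graded_R: "graded_group R"
    and mult_grade: "r \<in> grade R m \<Longrightarrow> s \<in> grade R n \<Longrightarrow> r \<otimes> s \<in> grade R (m + n)"
    and one_not_zero: "\<one> \<noteq> \<zero>"
    and mat_grade: "a < rk (Suc i) \<Longrightarrow> b < rk i \<Longrightarrow> mat i a b \<in> grade R 1"
begin

abbreviation "Fr i \<equiv> free_module R {..<rk i}"

definition Pm :: "nat \<Rightarrow> ('r, nat \<Rightarrow> 'r) graded_module" where
  "Pm i = \<lparr>carrier = carrier (Fr i), mult = undefined, one = undefined, zero = zero (Fr i), add = add (Fr i),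
     smult = smult (Fr i), grade = (\<lambda>n. {f \<in> carrier (Fr i). \<forall>s < rk i. f s \<in> grade R (n - int i)})\<rparr>"

definition dm :: "nat \<Rightarrow> (nat \<Rightarrow> 'r) \<Rightarrow> nat \<Rightarrow> 'r" where
  "dm i = (\<lambda>f \<in> carrier (Pm (Suc i)). \<lambda>s. if s < rk i then \<Oplus>a \<in> {..<rk (Suc i)}. f a \<otimes> mat i a s else \<zero>)"

lemma Fr_carrier: "f \<in> carrier (Fr i) \<longleftrightarrow> (\<forall>s < rk i. f s \<in> carrier R) \<and> (\<forall>s. \<not> s < rk i \<longrightarrow> f s = \<zero>)"
proof -
  have "finite {s. f s \<noteq> \<zero>}" if "\<forall>s. \<not> s < rk i \<longrightarrow> f s = \<zero>"
    by (rule finite_subset [of _ "{..<rk i}"]) (use that in auto)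
  then show ?thesis by (auto simp: free_simps)
qed

lemma Pm_simps:
  "carrier (Pm i) = carrier (Fr i)" "zero (Pm i) = zero (Fr i)" "add (Pm i) = add (Fr i)"
  "smult (Pm i) = smult (Fr i)" "grade (Pm i) n = {f \<in> carrier (Fr i). \<forall>s < rk i. f s \<in> grade R (n - int i)}"
  by (simp_all add: Pm_def)

lemma Pm_carrier: "f \<in> carrier (Pm i) \<longleftrightarrow> (\<forall>s < rk i. f s \<in> carrier R) \<and> (\<forall>s. \<not> s < rk i \<longrightarrow> f s = \<zero>)"
  by (simp add: Pm_simps Fr_carrier)

lemma Pm_val [simp]: "f \<in> carrier (Pm i) \<Longrightarrow> f s \<in> carrier R"
  by (cases "s < rk i") (auto simp: Pm_carrier)

lemma mat_closed: "a < rk (Suc i) \<Longrightarrow> b < rk i \<Longrightarrow> mat i a b \<in> carrier R"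
  by (rule grade_carrier [OF graded_R mat_grade])

lemma Pm_hom_eq: "lmod_hom R (Pm i) N = lmod_hom R (Fr i) N"
  by (rule lmod_hom_cong) (simp_all add: Pm_simps)

lemma Pm_lm: "left_module R (Pm i)"
proof -
  interpret F: left_module R "Fr i" by (rule free_left_module)
  have "abelian_group (Pm i)"
    by (rule abelian_groupI) (auto simp: Pm_simps F.M.a_ac intro: F.M.add.l_inv_ex)
  then show ?thesis
    by (intro left_module.intro left_module_axioms.intro ring_axioms)
      (auto simp: Pm_simps F.smult_closed F.smult_l_distr F.smult_r_distr F.smult_assoc F.smult_one)
qed

lemma Pm_group: "abelian_group (Pm i)"
  using Pm_lm by (simp add: left_module_def)

lemma Pm_finsum_val:
  assumes "finite A" and "\<And>j. j \<in> A \<Longrightarrow> g j \<in> carrier (Pm i)"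
  shows "finsum (Pm i) g A s = (\<Oplus>j\<in>A. g j s)"
  by (rule abelian_group.hom_finsum [OF Pm_group is_abelian_group _ _ assms(1), where h = "\<lambda>f. f s"])
    (use assms in \<open>auto simp: Pm_simps(3) free_simps(3)\<close>)

lemma grade_sub: "r \<in> grade R n \<Longrightarrow> r \<in> carrier R"
  by (rule grade_carrier [OF graded_R])

lemmas R_sub = grade_subgroup [OF graded_R]

lemma grade_finsum:
  assumes "finite A" and "\<And>j. j \<in> A \<Longrightarrow> g j \<in> grade R n"
  shows "(\<Oplus>j\<in>A. g j) \<in> grade R n"
  using assms
proof (induction A rule: finite_induct)
  case empty
  then show ?case by (simp add: subgroup_add(1) [OF R_sub])
next
  case (insert x F)
  have "g j \<in> carrier R" if "j \<in> insert x F" for j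
    using insert.prems [OF that] by (rule grade_sub)
  then have "finsum R g (insert x F) = g x \<oplus> finsum R g F"
    using insert.hyps by (intro finsum_insert) auto
  then show ?case using insert by (auto intro: subgroup_add(2) [OF R_sub])
qed

lemma grade_neg: "r \<in> grade R n \<Longrightarrow> \<ominus> r \<in> grade R n"
  using subgroup.m_inv_closed [OF R_sub] by (simp add: a_inv_def)

lemma Pm_neg:
  assumes "f \<in> carrier (Pm i)"
  shows "\<ominus>\<^bsub>Pm i\<^esub> f = (\<lambda>s. \<ominus> f s)"
proof (rule abelian_group.minus_equality [OF Pm_group])
  show "(\<lambda>s. \<ominus> f s) \<oplus>\<^bsub>Pm i\<^esub> f = \<zero>\<^bsub>Pm i\<^esub>"
    using assms by (auto simp: Pm_simps(2,3) free_simps(2,3) l_neg)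
  show "(\<lambda>s. \<ominus> f s) \<in> carrier (Pm i)" using assms by (auto simp: Pm_carrier)
qed (rule assms)

lemma Pm_graded_group: "graded_group (Pm i)"
proof -
  interpret F: left_module R "Pm i" by (rule Pm_lm)
  define pr where "pr n f = (\<lambda>s. if s < rk i then component R (f s) (n - int i) else \<zero>)" for n and f :: "nat \<Rightarrow> 'r"
  have prc: "pr n f \<in> carrier (Pm i)" if "f \<in> carrier (Pm i)" for n f
    using that by (auto simp: pr_def Pm_carrier component_carrier [OF graded_R])
  show ?thesis
  proof (rule graded_group_projI [where pr = pr])
    fix n
    show "subgroup (grade (Pm i) n) (add_monoid (Pm i))"
    proof (rule F.M.add.subgroupI)
      show "grade (Pm i) n \<subseteq> carrier (Pm i)" by (auto simp: Pm_simps)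
      have "\<zero>\<^bsub>Pm i\<^esub> \<in> grade (Pm i) n"
        using F.M.zero_closed by (auto simp: Pm_simps free_simps(2) subgroup_add(1) [OF R_sub])
      then show "grade (Pm i) n \<noteq> {}" by blast
      fix f assume f: "f \<in> grade (Pm i) n"
      then have fc: "f \<in> carrier (Pm i)" by (simp add: Pm_simps)
      show "\<ominus>\<^bsub>Pm i\<^esub> f \<in> grade (Pm i) n"
        using f F.M.a_inv_closed [OF fc] by (simp add: Pm_neg [OF fc]) (simp add: Pm_simps grade_neg)
      fix g assume g: "g \<in> grade (Pm i) n"
      then have gc: "g \<in> carrier (Pm i)" by (simp add: Pm_simps)
      show "f \<oplus>\<^bsub>Pm i\<^esub> g \<in> grade (Pm i) n"
        using f g F.M.a_closed [OF fc gc]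
        by (auto simp: Pm_simps free_simps(3) intro: subgroup_add(2) [OF R_sub])
    qed
  next
    show "pr n f \<in> grade (Pm i) n" if "f \<in> carrier (Pm i)" for n f
      using prc [OF that] that by (auto simp: Pm_simps(1,5) pr_def component_all(1) [OF graded_R] free_val)
    show "pr n (f \<oplus>\<^bsub>Pm i\<^esub> g) = pr n f \<oplus>\<^bsub>Pm i\<^esub> pr n g"
      if "f \<in> carrier (Pm i)" "g \<in> carrier (Pm i)" for n f g
      using that by (auto simp: pr_def Pm_simps(3) free_simps(3) component_add [OF graded_R] fun_eq_iff)
    show "pr m f = (if m = n then f else \<zero>\<^bsub>Pm i\<^esub>)" if "f \<in> grade (Pm i) n" for m n f
      using that by (auto simp: pr_def Pm_simps Fr_carrier free_simps(2) fun_eq_iff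
          component_homogeneous [OF graded_R, of _ "n - int i"])
    fix f assume f: "f \<in> carrier (Pm i)"
    define N where "N = (\<Union>s \<in> {..<rk i}. (\<lambda>n. n + int i) ` {n. component R (f s) n \<noteq> \<zero>})"
    have N: "finite N" unfolding N_def using f component_all(2) [OF graded_R] by auto
    have out: "component R (f s) (n - int i) = \<zero>" if "n \<notin> N" "s < rk i" for n s
    proof (rule ccontr)
      assume "component R (f s) (n - int i) \<noteq> \<zero>"
      then have "n - int i + int i \<in> N" unfolding N_def using that(2) by blast
      then show False using that(1) by simp
    qed
    have "f s = (\<Oplus>n\<in>N. pr n f s)" for s
    proof (cases "s < rk i")
      case True
      have fs: "f s \<in> carrier R" using f by simp
      let ?h = "\<lambda>n. n - int i"
      have "{n. component R (f s) n \<noteq> \<zero>} \<subseteq> ?h ` N"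
      proof
        fix n assume n: "n \<in> {n. component R (f s) n \<noteq> \<zero>}"
        then have "n + int i \<in> N" unfolding N_def using True by blast
        then show "n \<in> ?h ` N" by (intro image_eqI [of _ _ "n + int i"]) auto
      qed
      then have "f s = (\<Oplus>n\<in>?h ` N. component R (f s) n)"
        using N by (intro component_sum [OF graded_R fs]) auto
      also have "\<dots> = (\<Oplus>n\<in>N. component R (f s) (n - int i))"
        using fs by (intro finsum_reindex) (auto simp: component_carrier [OF graded_R] inj_on_def)
      finally show ?thesis using True by (simp add: pr_def)
    next
      case False
      then show ?thesis using f N by (simp add: pr_def Pm_carrier)
    qed
    then have "f = (\<Oplus>\<^bsub>Pm i\<^esub>n\<in>N. pr n f)"
      using Pm_finsum_val [OF N, of "\<lambda>n. pr n f"] prc [OF f] by (auto simp: fun_eq_iff)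
    moreover have "pr n f = \<zero>\<^bsub>Pm i\<^esub>" if "n \<notin> N" for n
      using out [OF that] by (auto simp: pr_def Pm_simps(2) free_simps(2))
    ultimately show "\<exists>N. finite N \<and> (\<forall>n. n \<notin> N \<longrightarrow> pr n f = \<zero>\<^bsub>Pm i\<^esub>) \<and> f = (\<Oplus>\<^bsub>Pm i\<^esub>n\<in>N. pr n f)"
      using N by blast
  qed (rule Pm_group)
qed

lemma Pm_graded: "graded_left_module R (Pm i)"
  unfolding graded_left_module_def
proof (intro conjI Pm_lm Pm_graded_group allI ballI)
  fix m n r f assume r: "r \<in> grade R m" and f: "f \<in> grade (Pm i) n"
  interpret F: left_module R "Pm i" by (rule Pm_lm)
  have fc: "f \<in> carrier (Pm i)" using f by (simp add: Pm_simps)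
  show "r \<odot>\<^bsub>Pm i\<^esub> f \<in> grade (Pm i) (m + n)"
    using F.smult_closed [OF grade_sub [OF r] fc] f mult_grade [OF r]
    by (fastforce simp: Pm_simps free_simps(4) add_diff_eq [symmetric])
qed

abbreviation "e \<equiv> unit_vec R :: nat \<Rightarrow> nat \<Rightarrow> 'r"

lemma e_inj: "inj e"
  using one_not_zero by (auto simp: inj_def unit_vec_def fun_eq_iff split: if_splits)

lemma e_closed: "s < rk i \<Longrightarrow> e s \<in> carrier (Pm i)"
  using unit_vec_closed [of s "{..<rk i}"] by (simp add: Pm_simps)

lemma e_grade: "\<one> \<in> grade R 0 \<Longrightarrow> s < rk i \<Longrightarrow> e s \<in> grade (Pm i) (int i)"
  using e_closed [of s i] subgroup_add(1) [OF R_sub] by (auto simp: Pm_simps unit_vec_def)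

lemma Pm_expand:
  assumes N: "left_module R N" and k: "k \<in> lmod_hom R (Pm i) N" and f: "f \<in> carrier (Pm i)"
  shows "k f = (\<Oplus>\<^bsub>N\<^esub>s\<in>{..<rk i}. f s \<odot>\<^bsub>N\<^esub> k (e s))"
  using f k by (intro free_hom_expand [OF N, of k "{..<rk i}"]) (auto simp: Pm_hom_eq Pm_simps Fr_carrier)

text \<open>The basis set required by \<open>projective\<close> has to live in the type of module
  elements. The unit vectors serve as their own labels, and they are distinct because
  \<open>\<one> \<noteq> \<zero>\<close>.\<close>

lemma Pm_projective: "projective R (Pm i)"
proof -
  let ?S = "e ` {..<rk i}"
  define idx where "idx = inv_into {..<rk i} e"
  have idx: "idx (e s) = s" if "s < rk i" for s
    unfolding idx_def using that e_inj by (intro inv_into_f_f) (auto intro: inj_on_subset)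
  define \<iota> where "\<iota> f = (\<lambda>x. if x \<in> ?S then f (idx x) else \<zero>)" for f :: "nat \<Rightarrow> 'r"
  define \<pi> where "\<pi> F = (\<lambda>s. if s < rk i then F (e s) else \<zero>)" for F :: "(nat \<Rightarrow> 'r) \<Rightarrow> 'r"
  interpret F: left_module R "Pm i" by (rule Pm_lm)
  interpret S: left_module R "free_module R ?S" by (rule free_left_module)
  have \<iota>c: "\<iota> f \<in> carrier (free_module R ?S)" if f: "f \<in> carrier (Pm i)" for f
  proof -
    have "finite {x. \<iota> f x \<noteq> \<zero>}" by (rule finite_subset [of _ ?S]) (auto simp: \<iota>_def)
    then show ?thesis using f by (auto simp: free_simps \<iota>_def)
  qed
  have \<pi>c: "\<pi> F \<in> carrier (Pm i)" if "F \<in> carrier (free_module R ?S)" for F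
    using free_val [OF that] by (auto simp: \<pi>_def Pm_carrier)
  have "(\<lambda>f \<in> carrier (Pm i). \<iota> f) \<in> lmod_hom R (Pm i) (free_module R ?S)"
    by (rule lmod_homI) (auto simp: \<iota>c F.smult_closed, auto simp: \<iota>_def Pm_simps free_simps(3,4) fun_eq_iff)
  moreover have "(\<lambda>F \<in> carrier (free_module R ?S). \<pi> F) \<in> lmod_hom R (free_module R ?S) (Pm i)"
    by (rule lmod_homI) (auto simp: \<pi>c S.smult_closed, auto simp: \<pi>_def Pm_simps free_simps(3,4) fun_eq_iff)
  moreover have "\<pi> (\<iota> f) = f" if "f \<in> carrier (Pm i)" for f
    using that idx by (auto simp: \<pi>_def \<iota>_def Pm_carrier fun_eq_iff)
  ultimately show ?thesis
    unfolding projective_def using \<iota>c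
    by (intro conjI Pm_lm exI [of _ ?S] bexI [of _ "\<lambda>f \<in> carrier (Pm i). \<iota> f"]
        bexI [of _ "\<lambda>F \<in> carrier (free_module R ?S). \<pi> F"]) auto
qed

lemma Pm_finitely_generated: "finitely_generated R (Pm i)"
proof -
  interpret F: left_module R "Pm i" by (rule Pm_lm)
  have inj: "inj_on e {..<rk i}" using e_inj by (rule inj_on_subset) simp
  have "\<exists>c \<in> e ` {..<rk i} \<rightarrow> carrier R. f = (\<Oplus>\<^bsub>Pm i\<^esub>s\<in>e ` {..<rk i}. c s \<odot>\<^bsub>Pm i\<^esub> s)" if f: "f \<in> carrier (Pm i)" for f
  proof
    let ?c = "\<lambda>x. f (inv_into {..<rk i} e x)"
    show "?c \<in> e ` {..<rk i} \<rightarrow> carrier R" using f by auto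
    have "(\<lambda>x \<in> carrier (Pm i). x) \<in> lmod_hom R (Pm i) (Pm i)"
      by (rule lmod_homI) (auto simp: F.smult_closed)
    from Pm_expand [OF Pm_lm this f] have "f = (\<Oplus>\<^bsub>Pm i\<^esub>s\<in>{..<rk i}. f s \<odot>\<^bsub>Pm i\<^esub> (\<lambda>x \<in> carrier (Pm i). x) (e s))"
      using f by simp
    also have "\<dots> = (\<Oplus>\<^bsub>Pm i\<^esub>s\<in>{..<rk i}. ?c (e s) \<odot>\<^bsub>Pm i\<^esub> e s)"
      using f by (intro F.M.finsum_cong') (auto simp: e_closed F.smult_closed inv_into_f_f [OF inj])
    also have "\<dots> = (\<Oplus>\<^bsub>Pm i\<^esub>s\<in>e ` {..<rk i}. ?c s \<odot>\<^bsub>Pm i\<^esub> s)"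
      using f by (intro F.M.finsum_reindex [symmetric] inj) (auto simp: F.smult_closed e_closed)
    finally show "f = (\<Oplus>\<^bsub>Pm i\<^esub>s\<in>e ` {..<rk i}. ?c s \<odot>\<^bsub>Pm i\<^esub> s)" .
  qed
  then show ?thesis
    unfolding finitely_generated_def by (intro exI [of _ "e ` {..<rk i}"]) (auto simp: e_closed)
qed

lemma dm_val: "f \<in> carrier (Pm (Suc i)) \<Longrightarrow> s < rk i \<Longrightarrow> dm i f s = (\<Oplus>a \<in> {..<rk (Suc i)}. f a \<otimes> mat i a s)"
  by (simp add: dm_def)

lemma dm_closed: "f \<in> carrier (Pm (Suc i)) \<Longrightarrow> dm i f \<in> carrier (Pm i)"
  by (auto simp: dm_def Pm_carrier [of _ i] mat_closed intro!: finsum_closed)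

lemma dm_graded: "dm i \<in> graded_hom R (Pm (Suc i)) (Pm i)"
proof -
  interpret F: left_module R "Pm (Suc i)" by (rule Pm_lm)
  have "dm i \<in> lmod_hom R (Pm (Suc i)) (Pm i)"
    unfolding lmod_hom_def
  proof (intro CollectI conjI ballI PiE_I)
    show "dm i f = undefined" if "f \<notin> carrier (Pm (Suc i))" for f using that by (simp add: dm_def)
    fix f assume f: "f \<in> carrier (Pm (Suc i))"
    show "dm i f \<in> carrier (Pm i)" by (rule dm_closed [OF f])
    show "dm i (f \<oplus>\<^bsub>Pm (Suc i)\<^esub> g) = dm i f \<oplus>\<^bsub>Pm i\<^esub> dm i g" if g: "g \<in> carrier (Pm (Suc i))" for g
    proof
      fix s
      have "(\<Oplus>a \<in> {..<rk (Suc i)}. (f a \<oplus> g a) \<otimes> mat i a s)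
        = (\<Oplus>a \<in> {..<rk (Suc i)}. f a \<otimes> mat i a s \<oplus> g a \<otimes> mat i a s)" if "s < rk i"
        using f g that by (intro finsum_cong') (auto simp: l_distr mat_closed)
      then show "dm i (f \<oplus>\<^bsub>Pm (Suc i)\<^esub> g) s = (dm i f \<oplus>\<^bsub>Pm i\<^esub> dm i g) s"
        using f g F.M.a_closed [OF f g]
        by (auto simp: dm_def Pm_simps(3) free_simps(3) mat_closed finsum_addf)
    qed
    show "dm i (r \<odot>\<^bsub>Pm (Suc i)\<^esub> f) = r \<odot>\<^bsub>Pm i\<^esub> dm i f" if r: "r \<in> carrier R" for r
    proof
      fix s
      have "(\<Oplus>a \<in> {..<rk (Suc i)}. r \<otimes> f a \<otimes> mat i a s)
        = (\<Oplus>a \<in> {..<rk (Suc i)}. r \<otimes> (f a \<otimes> mat i a s))" if "s < rk i"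
        using f r that by (intro finsum_cong') (auto simp: m_assoc mat_closed)
      then show "dm i (r \<odot>\<^bsub>Pm (Suc i)\<^esub> f) s = (r \<odot>\<^bsub>Pm i\<^esub> dm i f) s"
        using f r F.smult_closed [OF r f]
        by (auto simp: dm_def Pm_simps(4) free_simps(4) mat_closed finsum_rdistr)
    qed
  qed
  moreover have "dm i f \<in> grade (Pm i) n" if f: "f \<in> grade (Pm (Suc i)) n" for f n
  proof -
    have fc: "f \<in> carrier (Pm (Suc i))" using f by (simp add: Pm_simps)
    have "f a \<otimes> mat i a s \<in> grade R (n - int i)" if "a < rk (Suc i)" "s < rk i" for a s
      using mult_grade [of "f a" "n - int (Suc i)" "mat i a s" 1] f mat_grade that
      by (simp add: Pm_simps)
    then show ?thesis
      using dm_closed [OF fc] by (auto simp: Pm_simps dm_val [OF fc] intro!: grade_finsum)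
  qed
  ultimately show ?thesis by (auto simp: graded_hom_def)
qed

lemma dm_image_iff: "g \<in> dm i ` carrier (Pm (Suc i)) \<longleftrightarrow> g \<in> carrier (Pm i) \<and>
    (\<exists>f. (\<forall>a < rk (Suc i). f a \<in> carrier R) \<and> (\<forall>s < rk i. g s = (\<Oplus>a \<in> {..<rk (Suc i)}. f a \<otimes> mat i a s)))"
proof (intro iffI conjI)
  assume "g \<in> dm i ` carrier (Pm (Suc i))"
  then obtain f where f: "f \<in> carrier (Pm (Suc i))" "g = dm i f" by blast
  then show "g \<in> carrier (Pm i)" by (simp add: dm_closed)
  show "\<exists>f. (\<forall>a < rk (Suc i). f a \<in> carrier R) \<and> (\<forall>s < rk i. g s = (\<Oplus>a \<in> {..<rk (Suc i)}. f a \<otimes> mat i a s))"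
    using f dm_val by (intro exI [of _ f]) auto
next
  assume "g \<in> carrier (Pm i) \<and> (\<exists>f. (\<forall>a < rk (Suc i). f a \<in> carrier R) \<and> (\<forall>s < rk i. g s = (\<Oplus>a \<in> {..<rk (Suc i)}. f a \<otimes> mat i a s)))"
  then obtain f where g: "g \<in> carrier (Pm i)" and f: "\<forall>a < rk (Suc i). f a \<in> carrier R"
    "\<forall>s < rk i. g s = (\<Oplus>a \<in> {..<rk (Suc i)}. f a \<otimes> mat i a s)" by blast
  \<comment> \<open>Elements of \<open>Pm\<close> vanish beyond the rank, while the given
    coefficients are arbitrary there, so they are cut off.\<close>
  let ?f = "\<lambda>a. if a < rk (Suc i) then f a else \<zero>"
  have fc: "?f \<in> carrier (Pm (Suc i))" using f by (simp add: Pm_carrier)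
  have "(\<Oplus>a \<in> {..<rk (Suc i)}. ?f a \<otimes> mat i a s) = (\<Oplus>a \<in> {..<rk (Suc i)}. f a \<otimes> mat i a s)" if "s < rk i" for s
    using f that by (intro finsum_cong') (auto simp: mat_closed)
  then have "dm i ?f = g" using f g fc by (auto simp: dm_def Pm_carrier [of _ i] fun_eq_iff)
  then show "g \<in> dm i ` carrier (Pm (Suc i))" using fc by blast
qed

lemma dm_kernel_iff: "f \<in> carrier (Pm (Suc i)) \<Longrightarrow> dm i f = \<zero>\<^bsub>Pm i\<^esub> \<longleftrightarrow>
    (\<forall>s < rk i. (\<Oplus>a \<in> {..<rk (Suc i)}. f a \<otimes> mat i a s) = \<zero>)"
  by (auto simp: dm_def Pm_simps(2) free_simps(2) fun_eq_iff)

section \<open>Homomorphisms as columns and the dual complex\<close>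

definition hom_of :: "nat \<Rightarrow> (nat \<Rightarrow> 'r) \<Rightarrow> (nat \<Rightarrow> 'r) \<Rightarrow> 'r" where
  "hom_of i w = (\<lambda>f \<in> carrier (Pm i). \<Oplus>s \<in> {..<rk i}. f s \<otimes> w s)"

lemma hom_of_hom:
  assumes w: "\<And>s. s < rk i \<Longrightarrow> w s \<in> carrier R"
  shows "hom_of i w \<in> lmod_hom R (Pm i) (self_module R)" and "s < rk i \<Longrightarrow> hom_of i w (e s) = w s"
proof -
  obtain k where k: "k \<in> lmod_hom R (Fr i) (self_module R)" "\<And>s. s < rk i \<Longrightarrow> k (e s) = w s"
    using free_hom_exists [OF self_left_module [OF ring_axioms], of "{..<rk i}" w] w by auto
  have "k = hom_of i w"
  proof
    fix f
    show "k f = hom_of i w f"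
    proof (cases "f \<in> carrier (Pm i)")
      case True
      have "k f = (\<Oplus>\<^bsub>self_module R\<^esub>s\<in>{..<rk i}. f s \<otimes> k (e s))"
        using Pm_expand [OF self_left_module [OF ring_axioms] _ True, of k] k(1) by (simp add: Pm_hom_eq)
      \<comment> \<open>Both sums unfold to the same fold, because \<open>self_module R\<close>
        shares carrier, zero and addition with R.\<close>
      also have "\<dots> = (\<Oplus>s\<in>{..<rk i}. f s \<otimes> k (e s))"
        by (simp add: finsum_def finprod_def self_module_def)
      also have "\<dots> = hom_of i w f"
        using True w k(2) by (auto simp: hom_of_def intro!: finsum_cong')
      finally show ?thesis .
    next
      case False
      then show ?thesis using lmod_homD(4) [OF k(1)] by (simp add: hom_of_def Pm_simps)
    qed
  qed
  then show "hom_of i w \<in> lmod_hom R (Pm i) (self_module R)" and "s < rk i \<Longrightarrow> hom_of i w (e s) = w s"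
    using k by (auto simp: Pm_hom_eq)
qed

lemma hom_eq_hom_of:
  assumes z: "z \<in> lmod_hom R (Pm i) (self_module R)"
  shows "z = hom_of i (\<lambda>s. z (e s))"
proof
  interpret F: left_module R "Pm i" by (rule Pm_lm)
  fix f
  show "z f = hom_of i (\<lambda>s. z (e s)) f"
  proof (cases "f \<in> carrier (Pm i)")
    case True
    have "z f = (\<Oplus>\<^bsub>self_module R\<^esub>s\<in>{..<rk i}. f s \<otimes> z (e s))"
      using Pm_expand [OF self_left_module [OF ring_axioms] z True] by simp
    also have "\<dots> = (\<Oplus>s\<in>{..<rk i}. f s \<otimes> z (e s))"
      by (simp add: finsum_def finprod_def self_module_def)
    finally show ?thesis using True by (simp add: hom_of_def)
  next
    case False
    then show ?thesis using lmod_homD(4) [OF z] by (simp add: hom_of_def)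
  qed
qed

lemma hom_eqI:
  assumes z: "z \<in> lmod_hom R (Pm i) (self_module R)" and w: "w \<in> lmod_hom R (Pm i) (self_module R)"
    and eq: "\<And>s. s < rk i \<Longrightarrow> z (e s) = w (e s)"
  shows "z = w"
proof -
  have "hom_of i (\<lambda>s. z (e s)) = hom_of i (\<lambda>s. w (e s))"
    unfolding hom_of_def using eq lmod_homD(1) [OF w] e_closed
    by (intro restrict_ext finsum_cong') auto
  then show ?thesis using hom_eq_hom_of [OF z] hom_eq_hom_of [OF w] by simp
qed

text \<open>A homomorphism is the column of its values on the basis, and composing it with the
  differential multiplies this column by the matrix from the left. The dual complex thus consists of
  columns, against rows in the original one.\<close>

lemma hom_dm_e:
  assumes z: "z \<in> lmod_hom R (Pm i) (self_module R)" and a: "a < rk (Suc i)"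
  shows "z (dm i (e a)) = (\<Oplus>s \<in> {..<rk i}. mat i a s \<otimes> z (e s))"
proof -
  note ea = e_closed [OF a]
  have "z (dm i (e a)) = (\<Oplus>s \<in> {..<rk i}. dm i (e a) s \<otimes> z (e s))"
    using fun_cong [OF hom_eq_hom_of [OF z], of "dm i (e a)"] dm_closed [OF ea]
    by (simp add: hom_of_def)
  also have "\<dots> = (\<Oplus>s \<in> {..<rk i}. mat i a s \<otimes> z (e s))"
  proof (rule finsum_cong')
    fix s assume s: "s \<in> {..<rk i}"
    have "dm i (e a) s = (\<Oplus>b \<in> {..<rk (Suc i)}. if a = b then mat i a s else \<zero>)"
      using s ea by (simp add: dm_val) (rule finsum_cong', auto simp: unit_vec_def mat_closed a)
    also have "\<dots> = mat i a s"
      using s a by (intro finsum_singleton) (auto simp: mat_closed)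
    finally show "dm i (e a) s \<otimes> z (e s) = mat i a s \<otimes> z (e s)" by simp
  qed (use lmod_homD(1) [OF z] e_closed mat_closed [OF a] in auto)
  finally show ?thesis .
qed

end

context matrix_complex
begin

definition aug :: "('r, 'm) graded_module \<Rightarrow> 'm \<Rightarrow> (nat \<Rightarrow> 'r) \<Rightarrow> 'm" where
  "aug M m0 = (\<lambda>f \<in> carrier (Pm 0). f 0 \<odot>\<^bsub>M\<^esub> m0)"

lemma matrix_resolution:
  assumes M: "graded_left_module R M" and m0: "m0 \<in> grade M 0" and rk0: "rk 0 = 1"
    and surj: "\<And>m. m \<in> carrier M \<Longrightarrow> \<exists>u \<in> carrier R. u \<odot>\<^bsub>M\<^esub> m0 = m"
    and ex0: "\<And>u. u \<in> carrier R \<Longrightarrow> u \<odot>\<^bsub>M\<^esub> m0 = \<zero>\<^bsub>M\<^esub> \<longleftrightarrow>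
      (\<exists>f. (\<forall>a < rk 1. f a \<in> carrier R) \<and> u = (\<Oplus>a \<in> {..<rk 1}. f a \<otimes> mat 0 a 0))"
    and ex: "\<And>i f. (\<And>a. a < rk (Suc i) \<Longrightarrow> f a \<in> carrier R) \<Longrightarrow>
      (\<forall>s < rk i. (\<Oplus>a \<in> {..<rk (Suc i)}. f a \<otimes> mat i a s) = \<zero>) \<longleftrightarrow>
      (\<exists>g. (\<forall>b < rk (Suc (Suc i)). g b \<in> carrier R) \<and>
        (\<forall>a < rk (Suc i). f a = (\<Oplus>b \<in> {..<rk (Suc (Suc i))}. g b \<otimes> mat (Suc i) b a)))"
  shows "graded_projective_resolution R M Pm dm (aug M m0)"
proof -
  interpret M: left_module R M by (rule graded_left_moduleD(1) [OF M])
  interpret P0: left_module R "Pm 0" by (rule Pm_lm)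
  have m0c: "m0 \<in> carrier M" by (rule grade_carrier [OF graded_left_moduleD(2) [OF M] m0])
  have "aug M m0 \<in> lmod_hom R (Pm 0) M"
    unfolding aug_def
    by (rule lmod_homI) (auto simp: m0c M.smult_closed P0.smult_closed,
        auto simp: Pm_simps(3,4) free_simps(3,4) M.smult_l_distr M.smult_assoc m0c)
  moreover have "aug M m0 f \<in> grade M n" if "f \<in> grade (Pm 0) n" for f n
    using that graded_left_moduleD(5) [OF M _ m0, of "f 0" n] by (auto simp: aug_def Pm_simps rk0)
  ultimately have aug: "aug M m0 \<in> graded_hom R (Pm 0) M" by (auto simp: graded_hom_def)
  have P0: "(\<lambda>s. if s = 0 then u else \<zero>) \<in> carrier (Pm 0)" if "u \<in> carrier R" for u
    using that by (simp add: Pm_carrier rk0)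
  have "aug M m0 ` carrier (Pm 0) = carrier M"
  proof (intro equalityI subsetI)
    fix m assume "m \<in> carrier M"
    then obtain u where u: "u \<in> carrier R" "u \<odot>\<^bsub>M\<^esub> m0 = m" using surj by blast
    then show "m \<in> aug M m0 ` carrier (Pm 0)"
      by (intro image_eqI [OF _ P0 [OF u(1)]]) (simp add: aug_def P0)
  qed (auto simp: aug_def m0c M.smult_closed)
  moreover have "dm 0 ` carrier (Pm 1) = {x \<in> carrier (Pm 0). aug M m0 x = \<zero>\<^bsub>M\<^esub>}"
  proof (rule Set.set_eqI)
    fix g
    have "g \<in> dm 0 ` carrier (Pm (Suc 0)) \<longleftrightarrow> g \<in> carrier (Pm 0) \<and>
      (\<exists>f. (\<forall>a < rk 1. f a \<in> carrier R) \<and> g 0 = (\<Oplus>a \<in> {..<rk 1}. f a \<otimes> mat 0 a 0))"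
      unfolding dm_image_iff rk0 by simp
    then show "g \<in> dm 0 ` carrier (Pm 1) \<longleftrightarrow> g \<in> {x \<in> carrier (Pm 0). aug M m0 x = \<zero>\<^bsub>M\<^esub>}"
      using ex0 [of "g 0"] by (auto simp: aug_def)
  qed
  moreover have "dm (Suc i) ` carrier (Pm (Suc (Suc i))) = {x \<in> carrier (Pm (Suc i)). dm i x = \<zero>\<^bsub>Pm i\<^esub>}" for i
  proof (rule Set.set_eqI)
    fix g
    show "g \<in> dm (Suc i) ` carrier (Pm (Suc (Suc i))) \<longleftrightarrow> g \<in> {x \<in> carrier (Pm (Suc i)). dm i x = \<zero>\<^bsub>Pm i\<^esub>}"
      using ex [of i g] dm_kernel_iff [of g i] unfolding dm_image_iff by (auto simp: Pm_val)
  qed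
  ultimately show ?thesis
    unfolding graded_projective_resolution_def
    using Pm_graded Pm_projective dm_graded aug by simp
qed

lemma cocycle_iff_col:
  assumes z: "z \<in> lmod_hom R (Pm i) (self_module R)"
  shows "z \<in> cocycles R Pm dm i \<longleftrightarrow> (\<forall>a < rk (Suc i). (\<Oplus>s \<in> {..<rk i}. mat i a s \<otimes> z (e s)) = \<zero>)"
proof -
  have zd: "compose (carrier (Pm (Suc i))) z (dm i) \<in> lmod_hom R (Pm (Suc i)) (self_module R)"
    by (rule lmod_hom_compose [OF Pm_lm graded_homD(1) [OF dm_graded] z])
  have 0: "(\<lambda>x \<in> carrier (Pm (Suc i)). \<zero>) \<in> lmod_hom R (Pm (Suc i)) (self_module R)"
    using hom_dual_closed(1) [OF ring_axioms Pm_lm zd zd] .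
  have "z \<in> cocycles R Pm dm i \<longleftrightarrow> compose (carrier (Pm (Suc i))) z (dm i) = (\<lambda>x \<in> carrier (Pm (Suc i)). \<zero>)"
    using z by (simp add: cocycles_def codiff_def hom_dual_simps)
  also have "\<dots> \<longleftrightarrow> (\<forall>a < rk (Suc i). z (dm i (e a)) = \<zero>)"
  proof
    assume *: "compose (carrier (Pm (Suc i))) z (dm i) = (\<lambda>x \<in> carrier (Pm (Suc i)). \<zero>)"
    show "\<forall>a < rk (Suc i). z (dm i (e a)) = \<zero>"
    proof (intro allI impI)
      fix a assume "a < rk (Suc i)"
      then show "z (dm i (e a)) = \<zero>" using fun_cong [OF *, of "e a"] e_closed by (simp add: compose_def)
    qed
  next
    assume "\<forall>a < rk (Suc i). z (dm i (e a)) = \<zero>"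
    then show "compose (carrier (Pm (Suc i))) z (dm i) = (\<lambda>x \<in> carrier (Pm (Suc i)). \<zero>)"
      by (intro hom_eqI [OF zd 0]) (simp add: compose_def e_closed)
  qed
  finally show ?thesis using hom_dm_e [OF z] by simp
qed

lemma cocycles_0_subset:
  assumes "\<And>w. (\<And>s. s < rk 0 \<Longrightarrow> w s \<in> carrier R) \<Longrightarrow>
      (\<And>a. a < rk 1 \<Longrightarrow> (\<Oplus>s \<in> {..<rk 0}. mat 0 a s \<otimes> w s) = \<zero>) \<Longrightarrow> \<forall>s < rk 0. w s = \<zero>"
  shows "cocycles R Pm dm 0 \<subseteq> coboundaries R Pm dm 0"
proof
  fix z assume z: "z \<in> cocycles R Pm dm 0"
  then have zh: "z \<in> lmod_hom R (Pm 0) (self_module R)" by (simp add: cocycles_def hom_dual_simps)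
  have "\<forall>s < rk 0. z (e s) = \<zero>"
  proof (rule assms)
    show "z (e s) \<in> carrier R" if "s < rk 0" for s
      using lmod_homD(1) [OF zh e_closed [OF that]] by simp
    show "(\<Oplus>s \<in> {..<rk 0}. mat 0 a s \<otimes> z (e s)) = \<zero>" if "a < rk 1" for a
      using z that unfolding cocycle_iff_col [OF zh] by simp
  qed
  moreover have 0: "(\<lambda>x \<in> carrier (Pm 0). \<zero>) \<in> lmod_hom R (Pm 0) (self_module R)"
    using hom_dual_closed(1) [OF ring_axioms Pm_lm zh zh] .
  ultimately have "z = (\<lambda>x \<in> carrier (Pm 0). \<zero>)"
    by (intro hom_eqI [OF zh 0]) (simp add: e_closed)
  then show "z \<in> coboundaries R Pm dm 0" by (simp add: hom_dual_simps)
qed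

lemma coboundary_iff_col:
  assumes z: "z \<in> lmod_hom R (Pm (Suc k)) (self_module R)"
  shows "z \<in> coboundaries R Pm dm (Suc k) \<longleftrightarrow>
    (\<exists>v. (\<forall>b < rk k. v b \<in> carrier R) \<and> (\<forall>s < rk (Suc k). z (e s) = (\<Oplus>b \<in> {..<rk k}. mat k s b \<otimes> v b)))"
proof
  assume "z \<in> coboundaries R Pm dm (Suc k)"
  then obtain v where v: "v \<in> lmod_hom R (Pm k) (self_module R)" "z = compose (carrier (Pm (Suc k))) v (dm k)"
    by (auto simp: codiff_def hom_dual_simps)
  have "z (e s) = (\<Oplus>b \<in> {..<rk k}. mat k s b \<otimes> v (e b))" if "s < rk (Suc k)" for s
    using hom_dm_e [OF v(1) that] e_closed [OF that] by (simp add: v(2) compose_def)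
  then show "\<exists>v. (\<forall>b < rk k. v b \<in> carrier R) \<and> (\<forall>s < rk (Suc k). z (e s) = (\<Oplus>b \<in> {..<rk k}. mat k s b \<otimes> v b))"
    using lmod_homD(1) [OF v(1) e_closed] by (intro exI [of _ "\<lambda>b. v (e b)"]) auto
next
  assume "\<exists>v. (\<forall>b < rk k. v b \<in> carrier R) \<and> (\<forall>s < rk (Suc k). z (e s) = (\<Oplus>b \<in> {..<rk k}. mat k s b \<otimes> v b))"
  then obtain v where v: "\<And>b. b < rk k \<Longrightarrow> v b \<in> carrier R"
    "\<And>s. s < rk (Suc k) \<Longrightarrow> z (e s) = (\<Oplus>b \<in> {..<rk k}. mat k s b \<otimes> v b)" by blast
  note h = hom_of_hom [of k v, OF v(1)]
  have c: "compose (carrier (Pm (Suc k))) (hom_of k v) (dm k) \<in> lmod_hom R (Pm (Suc k)) (self_module R)"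
    by (rule lmod_hom_compose [OF Pm_lm graded_homD(1) [OF dm_graded] h(1)])
  have "z = compose (carrier (Pm (Suc k))) (hom_of k v) (dm k)"
  proof (rule hom_eqI [OF z c])
    fix s assume s: "s < rk (Suc k)"
    have "compose (carrier (Pm (Suc k))) (hom_of k v) (dm k) (e s) = (\<Oplus>b \<in> {..<rk k}. mat k s b \<otimes> hom_of k v (e b))"
      using hom_dm_e [OF h(1) s] e_closed [OF s] by (simp add: compose_def)
    also have "\<dots> = z (e s)"
      using s v h(2) by (auto intro!: finsum_cong' simp: mat_closed)
    finally show "z (e s) = compose (carrier (Pm (Suc k))) (hom_of k v) (dm k) (e s)" by simp
  qed
  then show "z \<in> coboundaries R Pm dm (Suc k)"
    using h(1) by (auto simp: codiff_def hom_dual_simps)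
qed

lemma cocycles_Suc_subset:
  assumes "\<And>w. (\<And>s. s < rk (Suc k) \<Longrightarrow> w s \<in> carrier R) \<Longrightarrow>
      (\<And>a. a < rk (Suc (Suc k)) \<Longrightarrow> (\<Oplus>s \<in> {..<rk (Suc k)}. mat (Suc k) a s \<otimes> w s) = \<zero>) \<Longrightarrow>
      \<exists>v. (\<forall>b < rk k. v b \<in> carrier R) \<and> (\<forall>s < rk (Suc k). w s = (\<Oplus>b \<in> {..<rk k}. mat k s b \<otimes> v b))"
  shows "cocycles R Pm dm (Suc k) \<subseteq> coboundaries R Pm dm (Suc k)"
proof
  fix z assume z: "z \<in> cocycles R Pm dm (Suc k)"
  then have zh: "z \<in> lmod_hom R (Pm (Suc k)) (self_module R)" by (simp add: cocycles_def hom_dual_simps)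
  show "z \<in> coboundaries R Pm dm (Suc k)"
    unfolding coboundary_iff_col [OF zh]
  proof (rule assms)
    show "z (e s) \<in> carrier R" if "s < rk (Suc k)" for s
      using lmod_homD(1) [OF zh e_closed [OF that]] by simp
    show "(\<Oplus>s \<in> {..<rk (Suc k)}. mat (Suc k) a s \<otimes> z (e s)) = \<zero>" if "a < rk (Suc (Suc k))" for a
      using z that unfolding cocycle_iff_col [OF zh] by blast
  qed
qed

end

section \<open>Algebras with the relations of the quantum Heisenberg algebra\<close>

fun mon_deg :: "mon \<Rightarrow> int" where "mon_deg (i, j, k) = int (i + j + k)"

locale heisenberg_algebra = based_algebra B \<kappa> mon_deg
  for B :: "('k :: field, 'b) graded_module" (structure) and \<kappa> :: "'b \<Rightarrow> mon \<Rightarrow>\<^sub>0 'k" +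
  fixes p q c :: 'k and ge :: "gen \<Rightarrow> 'b"
  assumes pq: "p * q = 1" and ge_grade: "ge g \<in> grade B 1"
    and \<kappa>_one: "\<kappa> \<one> = Poly_Mapping.single (0, 0, 0) 1"
    and \<kappa>_ge: "b \<in> carrier B \<Longrightarrow> \<kappa> (ge g \<otimes> b) = lmul (*) p q c g (\<kappa> b)"
    and rel1: "ge T \<otimes> ge X = p \<odot> (ge X \<otimes> ge T)"
    and rel2: "ge Y \<otimes> ge T = p \<odot> (ge T \<otimes> ge Y)"
    and rel3: "ge Y \<otimes> ge X = q \<odot> (ge X \<otimes> ge Y) \<oplus> c \<odot> (ge T \<otimes> ge T)"
begin

lemma ge_closed [simp]: "ge g \<in> carrier B"
  by (rule grade_closed [OF ge_grade])

text \<open>Right multiplication transported to coordinates. It is never expanded in monomials: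
  associativity and the relations yield what \<open>bimodule_coords\<close> asks for, with the
  letters in reversed order because the operators compose from the right.\<close>

definition \<rho> :: "gen \<Rightarrow> (mon \<Rightarrow>\<^sub>0 'k) \<Rightarrow> mon \<Rightarrow>\<^sub>0 'k" where
  "\<rho> g v = \<kappa> (kinv v \<otimes> ge g)"

lemma \<kappa>_ge_right: "b \<in> carrier B \<Longrightarrow> \<kappa> (b \<otimes> ge g) = \<rho> g (\<kappa> b)"
  by (simp add: \<rho>_def)

lemma kinv_scale: "kinv (pscale (*) k v) = k \<odot> kinv v"
  by (rule \<kappa>_eqI) (simp_all add: \<kappa>_scale scal_closed)

sublocale left: skew_rep "(*)" p q c
  by (intro skew_rep.intro vector_space_mult skew_rep_axioms.intro pq)

sublocale C: bimodule_coords "pscale (*)" p q c \<rho>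
proof (intro bimodule_coords.intro skew_rep.intro vector_space_pscale vector_space_mult skew_rep_axioms.intro pq
    bimodule_coords_axioms.intro)
  show "additive (\<rho> g)" for g by (simp add: additive_def \<rho>_def kinv_add l_distr \<kappa>_add)
  show "\<rho> g (pscale (*) k a) = pscale (*) k (\<rho> g a)" for g k a
    by (simp add: \<rho>_def kinv_scale scal_mult_l \<kappa>_scale)
  show "\<rho> X (\<rho> T a) = pscale (*) p (\<rho> T (\<rho> X a))" for a
    by (simp add: \<rho>_def m_assoc rel1 scal_mult_r \<kappa>_scale)
  show "\<rho> T (\<rho> Y a) = pscale (*) p (\<rho> Y (\<rho> T a))" for a
    by (simp add: \<rho>_def m_assoc rel2 scal_mult_r \<kappa>_scale)
  show "\<rho> X (\<rho> Y a) = pscale (*) q (\<rho> Y (\<rho> X a)) + pscale (*) c (\<rho> T (\<rho> T a))" for a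
    by (simp add: \<rho>_def m_assoc rel3 scal_mult_r \<kappa>_scale r_distr \<kappa>_add scal_closed)
qed

lemma S_tensor: "C.S k (tensor \<gamma> \<alpha>) = tensor \<gamma> (pscale (*) k \<alpha>)"
proof (rule additive_eqI [of "\<lambda>\<gamma>. C.S k (tensor \<gamma> \<alpha>)" "\<lambda>\<gamma>. tensor \<gamma> (pscale (*) k \<alpha>)"])
  show "additive (\<lambda>\<gamma>. C.S k (tensor \<gamma> \<alpha>))"
    by (intro additive_comp [OF _ tensor_additive1]) (simp add: additive_def C.S.scale_right_distrib)
qed (auto simp: tensor_single tensor_additive1 C.vs P.scale_scale mult.commute)

lemma R_tensor: "C.R g (tensor \<gamma> \<alpha>) = tensor \<gamma> (\<rho> g \<alpha>)"
  by (rule additive_eqI [of "\<lambda>\<gamma>. C.R g (tensor \<gamma> \<alpha>)" "\<lambda>\<gamma>. tensor \<gamma> (\<rho> g \<alpha>)"])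
    (auto simp: tensor_single tensor_additive1 C.\<rho>_scale intro: additive_comp [OF C.additive_R tensor_additive1])

lemma L_tensor: "C.L g (tensor \<gamma> \<alpha>) = tensor (left.L g \<gamma>) \<alpha>"
proof (rule additive_eqI [of "\<lambda>\<gamma>. C.L g (tensor \<gamma> \<alpha>)" "\<lambda>\<gamma>. tensor (left.L g \<gamma>) \<alpha>"])
  fix m and x :: 'k
  show "C.L g (tensor (Poly_Mapping.single m x) \<alpha>) = tensor (left.L g (Poly_Mapping.single m x)) \<alpha>"
    by (cases m; cases g) (simp_all add: tensor_single P.scale_scale additive.add [OF tensor_additive1])
qed (intro additive_comp [OF C.additive_L tensor_additive1] additive_comp [OF tensor_additive1 left.additive_L])+

definition ent :: "gen \<Rightarrow> 'k \<Rightarrow> 'k \<Rightarrow> ('k, 'b) env" where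
  "ent g \<alpha> \<beta> = tens (\<alpha> \<odot> ge g) \<one> \<oplus>\<^bsub>BB\<^esub> tens \<one> (\<beta> \<odot> ge g)"

lemma ent_closed [simp]: "ent g \<alpha> \<beta> \<in> carrier BB"
  by (simp add: ent_def scal_closed)

lemma ent_grade: "ent g \<alpha> \<beta> \<in> grade BB 1"
proof -
  have "tens (\<alpha> \<odot> ge g) \<one> \<in> grade BB 1"
    using one_grade by (intro tens_grade [of _ _ 1] scal_grade ge_grade) (simp_all add: scal_closed)
  moreover have "tens \<one> (\<beta> \<odot> ge g) \<in> grade BB 1"
    using scal_grade [OF ge_grade] by (intro tens_grade [of _ _ 0] one_grade) (simp_all add: scal_closed)
  ultimately show ?thesis unfolding ent_def by (rule BB_grade_add)
qed

text \<open>The second factors of the enveloping algebra multiply in opposite order. Right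
  multiplication by an entry therefore multiplies the left factor on the right (\<open>R\<close>, on
  coefficients) and the right factor on the left (\<open>L\<close>, on indices).\<close>

lemma \<Theta>_ent: "u \<in> carrier BB \<Longrightarrow> \<Theta> (u \<otimes>\<^bsub>BB\<^esub> ent g \<alpha> \<beta>) = C.op g \<alpha> \<beta> (\<Theta> u)"
proof (induction u rule: BB_induct)
  case (tens a d)
  then show ?case
    by (simp add: ent_def BB.r_distr tens_mult \<Theta>_add \<Theta>_tens scal_closed scal_mult_r scal_mult_l \<kappa>_scale
        \<kappa>_ge \<kappa>_ge_right C.op_def S_tensor R_tensor L_tensor tensor_pscale)
qed (simp_all add: BB.l_distr \<Theta>_add C.op_add)

text \<open>Left multiplication by an entry reaches the outer sides: the left factor, now the index,
  is multiplied on the left and the right factor on the right. The same operator results, with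
  \<open>\<alpha>\<close> and \<open>\<beta>\<close> exchanged.\<close>

lemma \<Theta>'_ent: "u \<in> carrier BB \<Longrightarrow> \<Theta>' (ent g \<alpha> \<beta> \<otimes>\<^bsub>BB\<^esub> u) = C.op g \<beta> \<alpha> (\<Theta>' u)"
proof (induction u rule: BB_induct)
  case (tens a d)
  then show ?case
    by (simp add: ent_def BB.l_distr tens_mult \<Theta>'_add \<Theta>'_tens scal_closed scal_mult_r scal_mult_l \<kappa>_scale
        \<kappa>_ge \<kappa>_ge_right C.op_def S_tensor R_tensor L_tensor tensor_pscale add.commute)
qed (simp_all add: BB.r_distr \<Theta>'_add C.op_add)

end

section \<open>The Koszul matrices over the enveloping algebra\<close>

definition gn :: "nat \<Rightarrow> gen" where
  "gn a = (if a = 0 then X else if a = 1 then T else Y)"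

fun gi :: "gen \<Rightarrow> nat" where "gi X = 0" | "gi T = 1" | "gi Y = 2"

lemma gn_simps [simp]: "gn 0 = X" "gn (Suc 0) = T" "gn 2 = Y" "gn (Suc (Suc 0)) = Y" "gn (gi g) = g"
  by (simp_all add: gn_def) (cases g; simp)

lemma gi_less: "gi g < 3" by (cases g) auto

lemma less_3: "(a :: nat) < 3 \<longleftrightarrow> a = 0 \<or> a = 1 \<or> a = 2" by auto

definition koszul_rank :: "nat \<Rightarrow> nat" where
  "koszul_rank i = (if i = 0 \<or> i = 3 then 1 else if i = 1 \<or> i = 2 then 3 else 0)"

lemma koszul_rank_simps [simp]: "koszul_rank 0 = 1" "koszul_rank (Suc 0) = 3" "koszul_rank (Suc (Suc 0)) = 3"
    "koszul_rank 2 = 3" "koszul_rank 3 = 1" "koszul_rank (Suc (Suc (Suc 0))) = 1" "3 < i \<Longrightarrow> koszul_rank i = 0"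
  by (auto simp: koszul_rank_def numeral_3_eq_3)

lemma sum_3: "(\<Sum>i<3. f i) = f 0 + f (Suc 0) + (f 2 :: 'v :: comm_monoid_add)"
  by (simp add: eval_nat_numeral)

context heisenberg_algebra
begin

text \<open>
  A triple \<open>(g, \<alpha>, \<beta>)\<close> stands for the entry \<open>\<alpha> (g \<otimes> 1) + \<beta> (1 \<otimes> g)\<close>.
  The row of \<open>X\<close>, \<open>T\<close>, \<open>Y\<close> holds the noncommutative partial derivatives of the relation that is dual
  to that generator.  Transposing the table swaps the two coefficients of each entry, which makes
  the complex self-dual.
\<close>

fun coef :: "gen \<Rightarrow> gen \<Rightarrow> gen \<times> 'k \<times> 'k" where
  "coef X X = (X, 0, 0)" | "coef X T = (Y, - q, 1)" | "coef X Y = (T, 1, - q)"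
| "coef T X = (Y, 1, - q)" | "coef T T = (T, - c, - c)" | "coef T Y = (X, - q, 1)"
| "coef Y X = (T, - q, 1)" | "coef Y T = (X, 1, - q)" | "coef Y Y = (X, 0, 0)"

definition matop :: "gen \<Rightarrow> gen \<Rightarrow> (mon \<Rightarrow>\<^sub>0 (mon \<Rightarrow>\<^sub>0 'k)) \<Rightarrow> mon \<Rightarrow>\<^sub>0 (mon \<Rightarrow>\<^sub>0 'k)" where
  "matop v u = (case coef v u of (g, \<alpha>, \<beta>) \<Rightarrow> C.op g \<alpha> \<beta>)"

text \<open>The entries \<open>g \<otimes> 1 - 1 \<otimes> g\<close> form a column in the matrix of
  index 0 and a row in the one of index 2. The latter is the transpose of the former, which gives
  the self-duality at the two ends.\<close>

definition kmat :: "nat \<Rightarrow> nat \<Rightarrow> nat \<Rightarrow> ('k, 'b) env" where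
  "kmat i a b = (if i = 0 then ent (gn a) 1 (- 1) else if i = 1
     then (case coef (gn a) (gn b) of (g, \<alpha>, \<beta>) \<Rightarrow> ent g \<alpha> \<beta>) else ent (gn b) 1 (- 1))"

lemma kmat_grade: "kmat i a b \<in> grade BB 1"
  by (auto simp: kmat_def ent_grade split: prod.splits)

lemma kmat_closed [simp]: "kmat i a b \<in> carrier BB"
  by (rule BB_grade_subset [OF kmat_grade])

lemma BB_one_grade: "\<one>\<^bsub>BB\<^esub> \<in> grade BB 0"
  unfolding BB_one by (intro tens_grade [of _ _ 0]) (simp_all add: one_grade)

lemma BB_one_not_zero: "\<one>\<^bsub>BB\<^esub> \<noteq> \<zero>\<^bsub>BB\<^esub>"
proof
  assume "\<one>\<^bsub>BB\<^esub> = \<zero>\<^bsub>BB\<^esub>"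
  then have "\<Theta> (tens \<one> \<one>) = 0" by (simp add: BB_one [symmetric])
  then have "Poly_Mapping.lookup (Poly_Mapping.lookup (\<Theta> (tens \<one> \<one>)) (0, 0, 0)) (0, 0, 0) = 0" by simp
  then show False by (simp add: \<Theta>_tens \<kappa>_one tensor_single vector_space_mult)
qed

sublocale K: matrix_complex BB koszul_rank kmat
  by (intro matrix_complex.intro matrix_complex_axioms.intro BB_ring BB_graded_group BB_mult_grade
      BB_one_not_zero kmat_grade)

lemma op_0: "C.op g 0 0 u = 0"
  by (simp add: C.op_def)

lemma d2_eq: "C.d2 b g = matop X g (b X) + matop T g (b T) + matop Y g (b Y)"
  by (cases g) (simp_all add: matop_def op_0)

lemma \<Theta>_kmat:
  assumes "u \<in> carrier BB"
  shows "\<Theta> (u \<otimes>\<^bsub>BB\<^esub> kmat 0 a b) = C.op (gn a) 1 (- 1) (\<Theta> u)"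
    and "\<Theta> (u \<otimes>\<^bsub>BB\<^esub> kmat (Suc 0) a b) = matop (gn a) (gn b) (\<Theta> u)"
    and "\<Theta> (u \<otimes>\<^bsub>BB\<^esub> kmat 2 a b) = C.d3 (\<Theta> u) (gn b)"
  using assms by (auto simp: kmat_def matop_def \<Theta>_ent C.d3_def split: prod.splits)

lemma op_swap: "C.op g (- 1) 1 w = - C.op g 1 (- 1) w"
  by (simp add: C.op_def)

text \<open>Transposition carries the first matrix to \<open>d3\<close> and the last to
  \<open>d1\<close>; the sign comes from exchanging the coefficients 1 and -1. The middle matrix
  becomes \<open>d2\<close> again without a sign, because \<open>coef u v\<close> and
  \<open>coef v u\<close> differ by exactly this exchange.\<close>

lemma \<Theta>'_kmat:
  assumes "u \<in> carrier BB"
  shows "\<Theta>' (kmat 0 a b \<otimes>\<^bsub>BB\<^esub> u) = - C.d3 (\<Theta>' u) (gn a)"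
    and "\<Theta>' (kmat (Suc 0) a b \<otimes>\<^bsub>BB\<^esub> u) = matop (gn b) (gn a) (\<Theta>' u)"
    and "\<Theta>' (kmat 2 a b \<otimes>\<^bsub>BB\<^esub> u) = - C.op (gn b) 1 (- 1) (\<Theta>' u)"
proof -
  show "\<Theta>' (kmat 0 a b \<otimes>\<^bsub>BB\<^esub> u) = - C.d3 (\<Theta>' u) (gn a)"
    and "\<Theta>' (kmat 2 a b \<otimes>\<^bsub>BB\<^esub> u) = - C.op (gn b) 1 (- 1) (\<Theta>' u)"
    using assms by (simp_all add: kmat_def \<Theta>'_ent C.d3_def op_swap)
  show "\<Theta>' (kmat (Suc 0) a b \<otimes>\<^bsub>BB\<^esub> u) = matop (gn b) (gn a) (\<Theta>' u)"
    using assms by (cases "gn a"; cases "gn b") (simp_all add: kmat_def matop_def \<Theta>'_ent)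
qed

lemma \<Theta>_finsum: "finite A \<Longrightarrow> (\<And>i. i \<in> A \<Longrightarrow> f i \<in> carrier BB) \<Longrightarrow> \<Theta> (finsum BB f A) = (\<Sum>i\<in>A. \<Theta> (f i))"
  by (rule coords_finsum [OF BB.is_abelian_group \<Theta>_add])

lemma \<Theta>'_finsum: "finite A \<Longrightarrow> (\<And>i. i \<in> A \<Longrightarrow> f i \<in> carrier BB) \<Longrightarrow> \<Theta>' (finsum BB f A) = (\<Sum>i\<in>A. \<Theta>' (f i))"
  by (rule coords_finsum [OF BB.is_abelian_group \<Theta>'_add])

lemma \<Theta>_eq_0: "u \<in> carrier BB \<Longrightarrow> \<Theta> u = 0 \<longleftrightarrow> u = \<zero>\<^bsub>BB\<^esub>"
  using \<Theta>_inj [of u "\<zero>\<^bsub>BB\<^esub>"] by auto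

lemma \<Theta>'_eq_0: "u \<in> carrier BB \<Longrightarrow> \<Theta>' u = 0 \<longleftrightarrow> u = \<zero>\<^bsub>BB\<^esub>"
  using \<Theta>'_inj [of u "\<zero>\<^bsub>BB\<^esub>"] by auto

section \<open>Exactness for rows, and for columns in the dual complex\<close>

context
  fixes f :: "nat \<Rightarrow> ('k, 'b) env"
  assumes f: "\<forall>a < 3. f a \<in> carrier BB"
begin

lemma row0: "\<Theta> (\<Oplus>\<^bsub>BB\<^esub>a\<in>{..<3}. f a \<otimes>\<^bsub>BB\<^esub> kmat 0 a s) = C.d1 (\<lambda>g. \<Theta> (f (gi g)))"
proof -
  have "\<Theta> (\<Oplus>\<^bsub>BB\<^esub>a\<in>{..<3}. f a \<otimes>\<^bsub>BB\<^esub> kmat 0 a s) = (\<Sum>a<3. C.op (gn a) 1 (- 1) (\<Theta> (f a)))"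
    using f by (subst \<Theta>_finsum) (auto intro!: sum.cong simp: \<Theta>_kmat(1))
  then show ?thesis by (simp add: sum_3 C.d1_def)
qed

lemma row1: "\<Theta> (\<Oplus>\<^bsub>BB\<^esub>a\<in>{..<3}. f a \<otimes>\<^bsub>BB\<^esub> kmat (Suc 0) a s) = C.d2 (\<lambda>g. \<Theta> (f (gi g))) (gn s)"
proof -
  have "\<Theta> (\<Oplus>\<^bsub>BB\<^esub>a\<in>{..<3}. f a \<otimes>\<^bsub>BB\<^esub> kmat (Suc 0) a s) = (\<Sum>a<3. matop (gn a) (gn s) (\<Theta> (f a)))"
    using f by (subst \<Theta>_finsum) (auto intro!: sum.cong simp: \<Theta>_kmat(2))
  then show ?thesis by (simp add: sum_3 d2_eq)
qed

lemma col1: "\<Theta>' (\<Oplus>\<^bsub>BB\<^esub>b\<in>{..<3}. kmat (Suc 0) a b \<otimes>\<^bsub>BB\<^esub> f b) = C.d2 (\<lambda>g. \<Theta>' (f (gi g))) (gn a)"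
proof -
  have "\<Theta>' (\<Oplus>\<^bsub>BB\<^esub>b\<in>{..<3}. kmat (Suc 0) a b \<otimes>\<^bsub>BB\<^esub> f b) = (\<Sum>b<3. matop (gn b) (gn a) (\<Theta>' (f b)))"
    using f by (subst \<Theta>'_finsum) (auto intro!: sum.cong simp: \<Theta>'_kmat(2))
  then show ?thesis by (simp add: sum_3 d2_eq)
qed

lemma col2: "\<Theta>' (\<Oplus>\<^bsub>BB\<^esub>b\<in>{..<3}. kmat 2 a b \<otimes>\<^bsub>BB\<^esub> f b) = - C.d1 (\<lambda>g. \<Theta>' (f (gi g)))"
proof -
  have "\<Theta>' (\<Oplus>\<^bsub>BB\<^esub>b\<in>{..<3}. kmat 2 a b \<otimes>\<^bsub>BB\<^esub> f b) = (\<Sum>b<3. - C.op (gn b) 1 (- 1) (\<Theta>' (f b)))"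
    using f by (subst \<Theta>'_finsum) (auto intro!: sum.cong simp: \<Theta>'_kmat(3))
  then show ?thesis by (simp add: sum_3 C.d1_def)
qed

lemma sums_closed:
  "(\<Oplus>\<^bsub>BB\<^esub>a\<in>{..<3}. f a \<otimes>\<^bsub>BB\<^esub> kmat i a s) \<in> carrier BB" "(\<Oplus>\<^bsub>BB\<^esub>b\<in>{..<3}. kmat i s b \<otimes>\<^bsub>BB\<^esub> f b) \<in> carrier BB"
  using f by (auto intro!: BB.finsum_closed)

end

lemma all_gen: "(\<forall>a < 3. P (gn a)) \<longleftrightarrow> (\<forall>g. P g)"
  by (metis gi_less gn_simps(5))

lemma vector_exists:
  assumes "bij_betw F (carrier BB) UNIV"
  shows "\<exists>f. (\<forall>a < 3. f a \<in> carrier BB) \<and> (\<forall>g. F (f (gi g)) = b g)"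
proof -
  have "\<exists>u \<in> carrier BB. F u = w" for w using bij_betw_imp_surj_on [OF assms] by (metis UNIV_I imageE)
  then obtain G where "\<And>w. G w \<in> carrier BB" "\<And>w. F (G w) = w" by metis
  then show ?thesis by (intro exI [of _ "\<lambda>a. G (b (gn a))"]) simp
qed

text \<open>Passes from vectors indexed by the numbers 0, 1, 2 to families indexed by generators,
  the form in which exactness was shown in coordinates.\<close>

lemma vec_eq_iff:
  assumes "\<forall>a < 3. f a \<in> carrier BB" and "\<forall>a < 3. h a \<in> carrier BB"
  shows "(\<forall>a < 3. f a = h a) \<longleftrightarrow> (\<forall>g. \<Theta> (f (gi g)) = \<Theta> (h (gi g)))"
    and "(\<forall>a < 3. f a = h a) \<longleftrightarrow> (\<forall>g. \<Theta>' (f (gi g)) = \<Theta>' (h (gi g)))"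
proof -
  have *: "(\<forall>a < 3. f a = h a) \<longleftrightarrow> (\<forall>g. f (gi g) = h (gi g))"
    by (metis all_gen less_3 gi.simps gi_less)
  show "(\<forall>a < 3. f a = h a) \<longleftrightarrow> (\<forall>g. \<Theta> (f (gi g)) = \<Theta> (h (gi g)))"
    and "(\<forall>a < 3. f a = h a) \<longleftrightarrow> (\<forall>g. \<Theta>' (f (gi g)) = \<Theta>' (h (gi g)))"
    unfolding * using assms gi_less \<Theta>_inj \<Theta>'_inj by metis+
qed

lemma row_exact_1:
  assumes f: "\<forall>a < 3. f a \<in> carrier BB"
  shows "(\<Oplus>\<^bsub>BB\<^esub>a\<in>{..<3}. f a \<otimes>\<^bsub>BB\<^esub> kmat 0 a s) = \<zero>\<^bsub>BB\<^esub> \<longleftrightarrow>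
    (\<exists>h. (\<forall>b < 3. h b \<in> carrier BB) \<and> (\<forall>a < 3. f a = (\<Oplus>\<^bsub>BB\<^esub>b\<in>{..<3}. h b \<otimes>\<^bsub>BB\<^esub> kmat (Suc 0) b a)))"
proof -
  have "(\<Oplus>\<^bsub>BB\<^esub>a\<in>{..<3}. f a \<otimes>\<^bsub>BB\<^esub> kmat 0 a s) = \<zero>\<^bsub>BB\<^esub> \<longleftrightarrow> C.d1 (\<lambda>g. \<Theta> (f (gi g))) = 0"
    by (simp add: row0 [OF f, of s, symmetric] \<Theta>_eq_0 sums_closed(1) [OF f])
  also have "\<dots> \<longleftrightarrow> (\<exists>b. \<forall>g. \<Theta> (f (gi g)) = C.d2 b g)"
  proof
    assume "\<exists>b. \<forall>g. \<Theta> (f (gi g)) = C.d2 b g"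
    then obtain b where "\<forall>g. \<Theta> (f (gi g)) = C.d2 b g" by blast
    then have "(\<lambda>g. \<Theta> (f (gi g))) = C.d2 b" by (intro ext) simp
    then show "C.d1 (\<lambda>g. \<Theta> (f (gi g))) = 0" by (simp only: C.d1_d2)
  qed (rule C.exact_d1_d2)
  also have "\<dots> \<longleftrightarrow> (\<exists>h. (\<forall>b < 3. h b \<in> carrier BB) \<and> (\<forall>g. \<Theta> (f (gi g)) = C.d2 (\<lambda>g. \<Theta> (h (gi g))) g))"
  proof
    assume "\<exists>b. \<forall>g. \<Theta> (f (gi g)) = C.d2 b g"
    then obtain b where b: "\<forall>g. \<Theta> (f (gi g)) = C.d2 b g" by blast
    obtain h :: "nat \<Rightarrow> ('k, 'b) env" where h: "\<forall>a < 3. h a \<in> carrier BB" "\<forall>g. \<Theta> (h (gi g)) = b g"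
      using vector_exists [OF \<Theta>_bij, of b] by blast
    then have "(\<lambda>g. \<Theta> (h (gi g))) = b" by (intro ext) simp
    then show "\<exists>h. (\<forall>b < 3. h b \<in> carrier BB) \<and> (\<forall>g. \<Theta> (f (gi g)) = C.d2 (\<lambda>g. \<Theta> (h (gi g))) g)"
      using b h(1) by (intro exI [of _ h]) simp
  qed blast
  also have "\<dots> \<longleftrightarrow> (\<exists>h. (\<forall>b < 3. h b \<in> carrier BB) \<and> (\<forall>a < 3. f a = (\<Oplus>\<^bsub>BB\<^esub>b\<in>{..<3}. h b \<otimes>\<^bsub>BB\<^esub> kmat (Suc 0) b a)))"
  proof (intro arg_cong [of _ _ Ex] ext conj_cong refl)
    fix h :: "nat \<Rightarrow> ('k, 'b) env" assume h: "\<forall>b < 3. h b \<in> carrier BB"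
    then show "(\<forall>g. \<Theta> (f (gi g)) = C.d2 (\<lambda>g. \<Theta> (h (gi g))) g) \<longleftrightarrow>
      (\<forall>a < 3. f a = (\<Oplus>\<^bsub>BB\<^esub>b\<in>{..<3}. h b \<otimes>\<^bsub>BB\<^esub> kmat (Suc 0) b a))"
      using vec_eq_iff(1) [OF f, of "\<lambda>a. \<Oplus>\<^bsub>BB\<^esub>b\<in>{..<3}. h b \<otimes>\<^bsub>BB\<^esub> kmat (Suc 0) b a"]
        sums_closed(1) [OF h] row1 [OF h] by simp
  qed
  finally show ?thesis .
qed

text \<open>The kernel and the image are both described in coordinates, where the claim is
  \<open>exact_d2_d3\<close>; surjectivity of \<open>\<Theta>\<close> turns the coordinate witness
  into an element of the enveloping algebra.\<close>

lemma row_exact_2: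
  assumes f: "\<forall>a < 3. f a \<in> carrier BB"
  shows "(\<forall>s < 3. (\<Oplus>\<^bsub>BB\<^esub>a\<in>{..<3}. f a \<otimes>\<^bsub>BB\<^esub> kmat (Suc 0) a s) = \<zero>\<^bsub>BB\<^esub>) \<longleftrightarrow>
    (\<exists>u \<in> carrier BB. \<forall>a < 3. f a = u \<otimes>\<^bsub>BB\<^esub> kmat 2 0 a)"
proof -
  have "(\<forall>s < 3. (\<Oplus>\<^bsub>BB\<^esub>a\<in>{..<3}. f a \<otimes>\<^bsub>BB\<^esub> kmat (Suc 0) a s) = \<zero>\<^bsub>BB\<^esub>) \<longleftrightarrow>
    (\<forall>s < 3. C.d2 (\<lambda>g. \<Theta> (f (gi g))) (gn s) = 0)"
    by (simp add: row1 [OF f, symmetric] \<Theta>_eq_0 sums_closed(1) [OF f])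
  also have "\<dots> \<longleftrightarrow> (\<forall>g. C.d2 (\<lambda>g. \<Theta> (f (gi g))) g = 0)"
    by (rule all_gen)
  also have "\<dots> \<longleftrightarrow> (\<exists>w. \<forall>g. \<Theta> (f (gi g)) = C.d3 w g)"
  proof
    assume "\<exists>w. \<forall>g. \<Theta> (f (gi g)) = C.d3 w g"
    then obtain w where "\<forall>g. \<Theta> (f (gi g)) = C.d3 w g" by blast
    then have "(\<lambda>g. \<Theta> (f (gi g))) = C.d3 w" by (intro ext) simp
    then show "\<forall>g. C.d2 (\<lambda>g. \<Theta> (f (gi g))) g = 0" by (simp only: C.d2_d3 simp_thms)
  next
    assume "\<forall>g. C.d2 (\<lambda>g. \<Theta> (f (gi g))) g = 0"
    then show "\<exists>w. \<forall>g. \<Theta> (f (gi g)) = C.d3 w g" by (intro C.exact_d2_d3) simp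
  qed
  also have "\<dots> \<longleftrightarrow> (\<exists>u \<in> carrier BB. \<forall>g. \<Theta> (f (gi g)) = C.d3 (\<Theta> u) g)"
    using \<Theta>_\<Psi> \<Psi>_closed by metis
  also have "\<dots> \<longleftrightarrow> (\<exists>u \<in> carrier BB. \<forall>a < 3. f a = u \<otimes>\<^bsub>BB\<^esub> kmat 2 0 a)"
    using vec_eq_iff(1) [OF f] by (intro bex_cong refl) (simp add: \<Theta>_kmat(3))
  finally show ?thesis .
qed

lemma row_exact_3:
  assumes u: "u \<in> carrier BB"
  shows "(\<forall>s < 3. u \<otimes>\<^bsub>BB\<^esub> kmat 2 0 s = \<zero>\<^bsub>BB\<^esub>) \<longleftrightarrow> u = \<zero>\<^bsub>BB\<^esub>"
proof
  assume "\<forall>s < 3. u \<otimes>\<^bsub>BB\<^esub> kmat 2 0 s = \<zero>\<^bsub>BB\<^esub>"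
  then have "\<Theta> (u \<otimes>\<^bsub>BB\<^esub> kmat 2 0 (Suc 0)) = 0" by simp
  then show "u = \<zero>\<^bsub>BB\<^esub>" using C.d3_inj [of "\<Theta> u"] u by (simp add: \<Theta>_kmat(3) \<Theta>_eq_0)
qed simp

text \<open>The action of u on 1 in the two module structures: \<open>a \<otimes> c\<close> goes to
  \<open>a c\<close> and to \<open>c a\<close>. The first is the augmentation of the resolution, the
  second identifies the cokernel of the dual complex with B.\<close>

abbreviation "mul_left u \<equiv> act (\<lambda>a c. a \<otimes> \<one> \<otimes> c) u"
abbreviation "mul_right u \<equiv> act (\<lambda>a c. c \<otimes> \<one> \<otimes> a) u"

lemma single_0_tens: "\<Theta> (tens b \<one>) = Poly_Mapping.single (0, 0, 0) (\<kappa> b)"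
    "\<Theta>' (tens \<one> b) = Poly_Mapping.single (0, 0, 0) (\<kappa> b)" if "b \<in> carrier B"
  using that by (simp_all add: \<Theta>_tens \<Theta>'_tens \<kappa>_one tensor_single)

lemma scal_minus_one: "a \<in> carrier B \<Longrightarrow> a \<oplus> - 1 \<odot> a = \<zero>"
  using scal_l_distr [of a 1 "- 1"] scal_one [of a] scal_l_distr [of a 0 0] scal_closed [of a 0]
  by (simp add: add.r_cancel_one')

lemma mul_ent: "mul_left (ent g 1 (- 1)) = \<zero>" "mul_right (ent g 1 (- 1)) = \<zero>"
  by (simp_all add: ent_def left_add left_tens right_add right_tens scal_closed scal_one scal_minus_one)

text \<open>In \<open>v (g \<otimes> 1 - 1 \<otimes> g)\<close> the second factor acts on 1 first
  and gives \<open>g - g\<close>. For the right structure the order of the factors is reversed, so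
  there the matrix entry has to stand in front of v.\<close>

lemma mul_left_kmat: "v \<in> carrier BB \<Longrightarrow> mul_left (v \<otimes>\<^bsub>BB\<^esub> kmat 0 i j) = \<zero>"
proof -
  assume v: "v \<in> carrier BB"
  interpret L: left_module BB "env_left B" by (rule env_left_module)
  have "mul_left (v \<otimes>\<^bsub>BB\<^esub> kmat 0 i j) = act (\<lambda>a c. a \<otimes> mul_left (kmat 0 i j) \<otimes> c) v"
    using L.smult_assoc [OF v kmat_closed, of \<one>] by simp
  also have "\<dots> = act (\<lambda>a c. a \<otimes> \<zero> \<otimes> c) v" by (simp add: kmat_def mul_ent)
  also have "\<dots> = \<zero>" using L.smult_zero_right [OF v] by simp
  finally show ?thesis .
qed

lemma act_right_zero: "v \<in> carrier BB \<Longrightarrow> act (\<lambda>a c. c \<otimes> \<zero> \<otimes> a) v = \<zero>"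
  by (induction v rule: BB_induct) (simp_all add: right_zero right_add right_tens)

lemma mul_right_kmat: "v \<in> carrier BB \<Longrightarrow> mul_right (kmat 2 i j \<otimes>\<^bsub>BB\<^esub> v) = \<zero>"
  by (simp add: right_mult) (simp add: kmat_def mul_ent act_right_zero)

lemma mul_finsum:
  assumes "finite A" and "\<And>i. i \<in> A \<Longrightarrow> g i \<in> carrier BB"
  shows "mul_left (finsum BB g A) = (\<Oplus>i\<in>A. mul_left (g i))" "mul_right (finsum BB g A) = (\<Oplus>i\<in>A. mul_right (g i))"
  by (rule BB.hom_finsum [OF B_group]; use assms in \<open>simp add: left_closed left_add right_closed right_add\<close>)+

text \<open>By \<open>exact_d1\<close> every u equals some \<open>b \<otimes> 1\<close> modulo the
  image, and the augmentation recovers b. It vanishes exactly when the remainder does.\<close>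

lemma row_exact_0:
  assumes u: "u \<in> carrier BB"
  shows "mul_left u = \<zero> \<longleftrightarrow> (\<exists>f. (\<forall>a < 3. f a \<in> carrier BB) \<and> u = (\<Oplus>\<^bsub>BB\<^esub>a\<in>{..<3}. f a \<otimes>\<^bsub>BB\<^esub> kmat 0 a 0))"
proof
  assume "\<exists>f. (\<forall>a < 3. f a \<in> carrier BB) \<and> u = (\<Oplus>\<^bsub>BB\<^esub>a\<in>{..<3}. f a \<otimes>\<^bsub>BB\<^esub> kmat 0 a 0)"
  then obtain f where f: "\<forall>a < 3. f a \<in> carrier BB" "u = (\<Oplus>\<^bsub>BB\<^esub>a\<in>{..<3}. f a \<otimes>\<^bsub>BB\<^esub> kmat 0 a 0)" by blast
  have "mul_left u = (\<Oplus>a\<in>{..<3}. mul_left (f a \<otimes>\<^bsub>BB\<^esub> kmat 0 a 0))"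
    unfolding f(2) using f(1) by (intro mul_finsum(1)) auto
  also have "\<dots> = \<zero>" using f(1) by (intro add.finprod_one_eqI) (simp add: mul_left_kmat)
  finally show "mul_left u = \<zero>" .
next
  assume 0: "mul_left u = \<zero>"
  obtain a r where "\<Theta> u = C.d1 a + Poly_Mapping.single (0, 0, 0) r" using C.exact_d1 by blast
  moreover obtain f where f: "\<forall>a < 3. f a \<in> carrier BB" "\<forall>g. \<Theta> (f (gi g)) = a g"
    using vector_exists [OF \<Theta>_bij] by blast
  ultimately have "\<Theta> u = \<Theta> (\<Oplus>\<^bsub>BB\<^esub>a\<in>{..<3}. f a \<otimes>\<^bsub>BB\<^esub> kmat 0 a 0) + \<Theta> (tens (kinv r) \<one>)"
    using row0 [OF f(1)] by (simp add: single_0_tens)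
  then have ueq: "u = (\<Oplus>\<^bsub>BB\<^esub>a\<in>{..<3}. f a \<otimes>\<^bsub>BB\<^esub> kmat 0 a 0) \<oplus>\<^bsub>BB\<^esub> tens (kinv r) \<one>"
    using f u by (intro \<Theta>_inj) (auto simp: \<Theta>_add sums_closed)
  have "mul_left u = mul_left (\<Oplus>\<^bsub>BB\<^esub>a\<in>{..<3}. f a \<otimes>\<^bsub>BB\<^esub> kmat 0 a 0) \<oplus> mul_left (tens (kinv r) \<one>)"
    unfolding ueq using f by (intro left_add) (auto simp: sums_closed)
  also have "mul_left (tens (kinv r) \<one>) = kinv r" by (simp add: left_tens)
  also have "mul_left (\<Oplus>\<^bsub>BB\<^esub>a\<in>{..<3}. f a \<otimes>\<^bsub>BB\<^esub> kmat 0 a 0) = (\<Oplus>a\<in>{..<3}. mul_left (f a \<otimes>\<^bsub>BB\<^esub> kmat 0 a 0))"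
    using f(1) by (intro mul_finsum(1)) auto
  also have "(\<Oplus>a\<in>{..<3}. mul_left (f a \<otimes>\<^bsub>BB\<^esub> kmat 0 a 0)) = \<zero>"
    using f(1) by (intro add.finprod_one_eqI) (simp add: mul_left_kmat)
  finally have "kinv r = \<zero>" using 0 by simp
  then have "u = (\<Oplus>\<^bsub>BB\<^esub>a\<in>{..<3}. f a \<otimes>\<^bsub>BB\<^esub> kmat 0 a 0)"
    using ueq f by (simp add: tens_zero sums_closed)
  then show "\<exists>f. (\<forall>a < 3. f a \<in> carrier BB) \<and> u = (\<Oplus>\<^bsub>BB\<^esub>a\<in>{..<3}. f a \<otimes>\<^bsub>BB\<^esub> kmat 0 a 0)"
    using f by blast
qed

text \<open>The same division in the coordinates \<open>\<Theta>'\<close> leaves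
  \<open>1 \<otimes> b\<close>, from which \<open>mul_right\<close> recovers b. Hence the cokernel
  of the last dual map is B.\<close>

lemma col_exact_3:
  assumes u: "u \<in> carrier BB"
  shows "mul_right u = \<zero> \<longleftrightarrow> (\<exists>f. (\<forall>a < 3. f a \<in> carrier BB) \<and> u = (\<Oplus>\<^bsub>BB\<^esub>b\<in>{..<3}. kmat 2 0 b \<otimes>\<^bsub>BB\<^esub> f b))"
proof
  assume "\<exists>f. (\<forall>a < 3. f a \<in> carrier BB) \<and> u = (\<Oplus>\<^bsub>BB\<^esub>b\<in>{..<3}. kmat 2 0 b \<otimes>\<^bsub>BB\<^esub> f b)"
  then obtain f where f: "\<forall>a < 3. f a \<in> carrier BB" "u = (\<Oplus>\<^bsub>BB\<^esub>b\<in>{..<3}. kmat 2 0 b \<otimes>\<^bsub>BB\<^esub> f b)" by blast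
  have "mul_right u = (\<Oplus>b\<in>{..<3}. mul_right (kmat 2 0 b \<otimes>\<^bsub>BB\<^esub> f b))"
    unfolding f(2) using f(1) by (intro mul_finsum(2)) auto
  also have "\<dots> = \<zero>" using f(1) by (intro add.finprod_one_eqI) (simp add: mul_right_kmat)
  finally show "mul_right u = \<zero>" .
next
  assume 0: "mul_right u = \<zero>"
  obtain a r where "\<Theta>' u = C.d1 a + Poly_Mapping.single (0, 0, 0) r" using C.exact_d1 by blast
  \<comment> \<open>The negative of a is taken because \<open>col2\<close> carries a minus
    sign.\<close>
  moreover obtain f where f: "\<forall>a < 3. f a \<in> carrier BB" "\<forall>g. \<Theta>' (f (gi g)) = - a g"
    using vector_exists [OF \<Theta>'_bij, of "\<lambda>g. - a g"] by blast
  moreover have "- C.d1 (\<lambda>g. - a g) = C.d1 a" by (simp add: C.d1_def C.op_minus)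
  ultimately have "\<Theta>' u = \<Theta>' (\<Oplus>\<^bsub>BB\<^esub>b\<in>{..<3}. kmat 2 0 b \<otimes>\<^bsub>BB\<^esub> f b) + \<Theta>' (tens \<one> (kinv r))"
    using col2 [OF f(1), of 0] by (simp add: single_0_tens)
  then have ueq: "u = (\<Oplus>\<^bsub>BB\<^esub>b\<in>{..<3}. kmat 2 0 b \<otimes>\<^bsub>BB\<^esub> f b) \<oplus>\<^bsub>BB\<^esub> tens \<one> (kinv r)"
    using f u by (intro \<Theta>'_inj) (auto simp: \<Theta>'_add sums_closed)
  have "mul_right u = mul_right (\<Oplus>\<^bsub>BB\<^esub>b\<in>{..<3}. kmat 2 0 b \<otimes>\<^bsub>BB\<^esub> f b) \<oplus> mul_right (tens \<one> (kinv r))"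
    unfolding ueq using f by (intro right_add) (auto simp: sums_closed)
  also have "mul_right (tens \<one> (kinv r)) = kinv r" by (simp add: right_tens)
  also have "mul_right (\<Oplus>\<^bsub>BB\<^esub>b\<in>{..<3}. kmat 2 0 b \<otimes>\<^bsub>BB\<^esub> f b) = (\<Oplus>b\<in>{..<3}. mul_right (kmat 2 0 b \<otimes>\<^bsub>BB\<^esub> f b))"
    using f(1) by (intro mul_finsum(2)) auto
  also have "(\<Oplus>b\<in>{..<3}. mul_right (kmat 2 0 b \<otimes>\<^bsub>BB\<^esub> f b)) = \<zero>"
    using f(1) by (intro add.finprod_one_eqI) (simp add: mul_right_kmat)
  finally have "kinv r = \<zero>" using 0 by simp
  then have "u = (\<Oplus>\<^bsub>BB\<^esub>b\<in>{..<3}. kmat 2 0 b \<otimes>\<^bsub>BB\<^esub> f b)"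
    using ueq f by (simp add: tens_zero_right sums_closed)
  then show "\<exists>f. (\<forall>a < 3. f a \<in> carrier BB) \<and> u = (\<Oplus>\<^bsub>BB\<^esub>b\<in>{..<3}. kmat 2 0 b \<otimes>\<^bsub>BB\<^esub> f b)"
    using f by blast
qed

lemma col_exact_1:
  assumes f: "\<forall>a < 3. f a \<in> carrier BB"
    and 0: "\<And>a. a < 3 \<Longrightarrow> (\<Oplus>\<^bsub>BB\<^esub>b\<in>{..<3}. kmat (Suc 0) a b \<otimes>\<^bsub>BB\<^esub> f b) = \<zero>\<^bsub>BB\<^esub>"
  shows "\<exists>u \<in> carrier BB. \<forall>a < 3. f a = kmat 0 a 0 \<otimes>\<^bsub>BB\<^esub> u"
proof -
  have "C.d2 (\<lambda>g. \<Theta>' (f (gi g))) g = 0" for g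
    using col1 [OF f, of "gi g"] 0 [OF gi_less, of g] by simp
  then obtain w where w: "\<forall>g. \<Theta>' (f (gi g)) = C.d3 w g"
    using C.exact_d2_d3 [of "\<lambda>g. \<Theta>' (f (gi g))"] by blast
  \<comment> \<open>The witness is negated to cancel the sign with which the first matrix turns into
    \<open>d3\<close>.\<close>
  obtain u where u: "u \<in> carrier BB" "\<Theta>' u = - w" using \<Theta>'_surj by blast
  have "\<forall>a < 3. f a = kmat 0 a 0 \<otimes>\<^bsub>BB\<^esub> u"
    using vec_eq_iff(2) [OF f, of "\<lambda>a. kmat 0 a 0 \<otimes>\<^bsub>BB\<^esub> u"] u w
    by (simp add: \<Theta>'_kmat(1) C.d3_def C.op_minus)
  then show ?thesis using u by blast
qed

lemma col_exact_2:
  assumes f: "\<forall>a < 3. f a \<in> carrier BB"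
    and 0: "(\<Oplus>\<^bsub>BB\<^esub>b\<in>{..<3}. kmat 2 0 b \<otimes>\<^bsub>BB\<^esub> f b) = \<zero>\<^bsub>BB\<^esub>"
  shows "\<exists>h. (\<forall>b < 3. h b \<in> carrier BB) \<and> (\<forall>a < 3. f a = (\<Oplus>\<^bsub>BB\<^esub>b\<in>{..<3}. kmat (Suc 0) a b \<otimes>\<^bsub>BB\<^esub> h b))"
proof -
  have "C.d1 (\<lambda>g. \<Theta>' (f (gi g))) = 0" using col2 [OF f, of 0] 0 by simp
  then obtain w where w: "\<forall>g. \<Theta>' (f (gi g)) = C.d2 w g"
    using C.exact_d1_d2 [of "\<lambda>g. \<Theta>' (f (gi g))"] by blast
  obtain h where h: "\<forall>a < 3. h a \<in> carrier BB" "\<forall>g. \<Theta>' (h (gi g)) = w g"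
    using vector_exists [OF \<Theta>'_bij] by blast
  have "\<forall>a < 3. f a = (\<Oplus>\<^bsub>BB\<^esub>b\<in>{..<3}. kmat (Suc 0) a b \<otimes>\<^bsub>BB\<^esub> h b)"
    using vec_eq_iff(2) [OF f, of "\<lambda>a. \<Oplus>\<^bsub>BB\<^esub>b\<in>{..<3}. kmat (Suc 0) a b \<otimes>\<^bsub>BB\<^esub> h b"] h w col1 [OF h(1)] sums_closed(2) [OF h(1)]
    by simp
  then show ?thesis using h by blast
qed

lemma rank_cases: obtains "i = 0" | "i = 1" | "i = 2" | "2 < (i :: nat)"
  by linarith

lemma koszul_resolution: "graded_projective_resolution BB (env_left B) K.Pm K.dm (K.aug (env_left B) \<one>)"
proof (rule K.matrix_resolution [OF env_left_graded])
  show "\<one> \<in> grade (env_left B) 0" by (simp add: one_grade)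
  show "koszul_rank 0 = 1" by simp
  show "\<exists>u \<in> carrier BB. u \<odot>\<^bsub>env_left B\<^esub> \<one> = m" if "m \<in> carrier (env_left B)" for m
    using that by (intro bexI [of _ "tens m \<one>"]) (simp_all add: left_tens)
  show "u \<odot>\<^bsub>env_left B\<^esub> \<one> = \<zero>\<^bsub>env_left B\<^esub> \<longleftrightarrow> (\<exists>f. (\<forall>a < koszul_rank 1. f a \<in> carrier BB) \<and>
      u = (\<Oplus>\<^bsub>BB\<^esub>a\<in>{..<koszul_rank 1}. f a \<otimes>\<^bsub>BB\<^esub> kmat 0 a 0))" if "u \<in> carrier BB" for u
    using row_exact_0 [OF that] by simp
  show "(\<forall>s < koszul_rank i. (\<Oplus>\<^bsub>BB\<^esub>a\<in>{..<koszul_rank (Suc i)}. f a \<otimes>\<^bsub>BB\<^esub> kmat i a s) = \<zero>\<^bsub>BB\<^esub>) \<longleftrightarrow>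
      (\<exists>g. (\<forall>b < koszul_rank (Suc (Suc i)). g b \<in> carrier BB) \<and>
        (\<forall>a < koszul_rank (Suc i). f a = (\<Oplus>\<^bsub>BB\<^esub>b\<in>{..<koszul_rank (Suc (Suc i))}. g b \<otimes>\<^bsub>BB\<^esub> kmat (Suc i) b a)))"
    if f: "\<And>a. a < koszul_rank (Suc i) \<Longrightarrow> f a \<in> carrier BB" for i f
  proof (cases i rule: rank_cases)
    case 1
    then show ?thesis using row_exact_1 [of f 0] f by simp
  next
    case 2
    have "(\<exists>u \<in> carrier BB. \<forall>a < 3. f a = u \<otimes>\<^bsub>BB\<^esub> kmat 2 0 a) \<longleftrightarrow>
      (\<exists>g. g 0 \<in> carrier BB \<and> (\<forall>a < 3. f a = (\<Oplus>\<^bsub>BB\<^esub>b\<in>{..<1}. g b \<otimes>\<^bsub>BB\<^esub> kmat 2 b a)))"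
      (is "?L \<longleftrightarrow> ?R")
    proof
      assume ?L
      then obtain u where "u \<in> carrier BB" "\<forall>a < 3. f a = u \<otimes>\<^bsub>BB\<^esub> kmat 2 0 a" by blast
      then show ?R by (intro exI [of _ "\<lambda>_. u"]) (simp add: lessThan_Suc)
    next
      assume ?R
      then show ?L by (auto simp: lessThan_Suc)
    qed
    then show ?thesis using 2 row_exact_2 [of f] f by (simp add: numeral_2_eq_2)
  next
    case 3
    \<comment> \<open>The next module has rank 0, so the sums on the right are empty and exactness
      says that the last differential is injective.\<close>
    then show ?thesis using row_exact_3 [of "f 0"] f by (simp add: lessThan_Suc numeral_3_eq_3 [symmetric])
  next
    case 4
    then show ?thesis by (auto intro: exI [of _ "\<lambda>_. \<zero>\<^bsub>BB\<^esub>"])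
  qed
qed

lemma koszul_Ext_trivial:
  assumes "i \<noteq> 3"
  shows "cocycles BB K.Pm K.dm i \<subseteq> coboundaries BB K.Pm K.dm i"
proof (cases i)
  case 0
  have "w 0 = \<zero>\<^bsub>BB\<^esub>" if w: "w 0 \<in> carrier BB" and "\<And>a. a < 3 \<Longrightarrow> (\<Oplus>\<^bsub>BB\<^esub>s\<in>{..<1}. kmat 0 a s \<otimes>\<^bsub>BB\<^esub> w s) = \<zero>\<^bsub>BB\<^esub>" for w
  proof -
    \<comment> \<open>The component of t suffices: \<open>d3_inj\<close> rests on the leading term
      of division by t.\<close>
    have "\<Theta>' (kmat 0 (Suc 0) 0 \<otimes>\<^bsub>BB\<^esub> w 0) = 0" using that(2) [of "Suc 0"] w by (simp add: lessThan_Suc)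
    then show ?thesis using C.d3_inj [of "\<Theta>' (w 0)"] w by (simp add: \<Theta>'_kmat(1) \<Theta>'_eq_0)
  qed
  then show ?thesis unfolding 0 by (intro K.cocycles_0_subset) simp
next
  case (Suc k)
  show ?thesis unfolding Suc
  proof (rule K.cocycles_Suc_subset)
    fix w
    assume w: "\<And>s. s < koszul_rank (Suc k) \<Longrightarrow> w s \<in> carrier BB"
      and 0: "\<And>a. a < koszul_rank (Suc (Suc k)) \<Longrightarrow> (\<Oplus>\<^bsub>BB\<^esub>s\<in>{..<koszul_rank (Suc k)}. kmat (Suc k) a s \<otimes>\<^bsub>BB\<^esub> w s) = \<zero>\<^bsub>BB\<^esub>"
    show "\<exists>v. (\<forall>b < koszul_rank k. v b \<in> carrier BB) \<and>
      (\<forall>s < koszul_rank (Suc k). w s = (\<Oplus>\<^bsub>BB\<^esub>b\<in>{..<koszul_rank k}. kmat k s b \<otimes>\<^bsub>BB\<^esub> v b))"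
    proof (cases k rule: rank_cases)
      case 1
      then obtain u where "u \<in> carrier BB" "\<forall>a < 3. w a = kmat 0 a 0 \<otimes>\<^bsub>BB\<^esub> u"
        using col_exact_1 [of w] w 0 by auto
      then show ?thesis using 1 by (intro exI [of _ "\<lambda>_. u"]) (simp add: lessThan_Suc)
    next
      case 2
      then show ?thesis using col_exact_2 [of w] w 0 [of 0] by (simp add: numeral_2_eq_2)
    next
      case 3
      then show ?thesis using assms Suc by simp
    next
      case 4
      \<comment> \<open>The module in degree \<open>Suc k\<close> has rank 0, so any vector is a
        preimage.\<close>
      then show ?thesis by (auto intro: exI [of _ "\<lambda>_. \<zero>\<^bsub>BB\<^esub>"])
    qed
  qed
qed

lemma shift_simps [simp]: "carrier (shift l M) = carrier M" "add (shift l M) = add M" "zero (shift l M) = zero M"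
  "smult (shift l M) = smult M" "grade (shift l M) n = grade M (n + l)"
  by (simp_all add: shift_def)

theorem calabi_yau: "graded_calabi_yau 3 B"
proof -
  have Q: "resolution BB (env_left B) K.Pm K.dm (K.aug (env_left B) \<one>)"
    by (intro resolution.intro BB_ring BB_graded_group env_left_graded koszul_resolution)
  interpret Q: resolution BB "env_left B" K.Pm K.dm "K.aug (env_left B) \<one>" by (rule Q)
  \<comment> \<open>The generator of the top module has degree 3, so a homomorphism of degree n
    sends it to degree \<open>n + 3\<close>.\<close>
  let ?N = "shift 3 (env_right B)"
  \<comment> \<open>A homomorphism on the rank 1 top module is its value on the generator. By
    \<open>col_exact_3\<close>, multiplying out that value kills exactly the coboundaries.\<close>
  let ?\<eta> = "\<lambda>z. mul_right (z (K.e 0))"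
  have e0: "K.e 0 \<in> carrier (K.Pm 3)" by (rule K.e_closed) simp
  have N: "abelian_group ?N"
    by (rule abelian_groupI) (auto simp: a_ac intro: add.l_inv_ex)
  \<comment> \<open>The module in degree 4 has rank 0, so the cocycle condition is empty.\<close>
  have Z3: "z \<in> cocycles BB K.Pm K.dm 3 \<longleftrightarrow> z \<in> lmod_hom BB (K.Pm 3) (self_module BB)" for z
    using K.cocycle_iff_col [of z 3] Q.Z_hom [of z 3] by auto
  have z0: "z (K.e 0) \<in> carrier BB" if "z \<in> lmod_hom BB (K.Pm 3) (self_module BB)" for z
    using lmod_homD(1) [OF that e0] by simp
  have surj: "\<exists>z \<in> cocycles BB K.Pm K.dm 3. ?\<eta> z = b \<and>
      (b \<in> grade B (n + 3) \<longrightarrow> z \<in> grade (hom_dual BB (K.Pm 3)) n)" if b: "b \<in> carrier B" for b n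
  proof (intro bexI conjI impI)
    \<comment> \<open>The value \<open>1 \<otimes> b\<close> is sent to b by
      \<open>mul_right\<close> and has the degree of b, so one witness settles surjectivity and
      degrees together.\<close>
    let ?u = "tens \<one> b"
    let ?z = "K.hom_of 3 (\<lambda>_. ?u)"
    have z: "?z \<in> lmod_hom BB (K.Pm 3) (self_module BB)" "?z (K.e 0) = ?u"
      using K.hom_of_hom [of 3 "\<lambda>_. ?u"] b by simp_all
    then show "?z \<in> cocycles BB K.Pm K.dm 3" by (simp add: Z3)
    show "?\<eta> ?z = b" using z b by (simp add: right_tens)
    assume bg: "b \<in> grade B (n + 3)"
    have u: "?u \<in> grade BB (n + 3)" using b bg one_grade by (intro tens_grade [of _ _ 0]) simp_all
    have "?z f \<in> grade BB (j + n)" if f: "f \<in> grade (K.Pm 3) j" for f j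
    proof -
      have fc: "f \<in> carrier (K.Pm 3)" using f by (simp add: K.Pm_simps)
      have "f 0 \<in> grade BB (j - 3)" using f by (simp add: K.Pm_simps)
      then have "f 0 \<otimes>\<^bsub>BB\<^esub> ?u \<in> grade BB (j - 3 + (n + 3))" using u by (rule BB_mult_grade)
      moreover have "f 0 \<in> carrier BB" using fc by simp
      ultimately show ?thesis using fc b by (simp add: K.hom_of_def lessThan_Suc algebra_simps)
    qed
    then show "?z \<in> grade (hom_dual BB (K.Pm 3)) n" using z by (auto simp: hom_dual_simps)
  qed
  have iso: "graded_isomorphic (opp BB) (Ext BB P \<delta> 3) ?N"
    if "homotopy_inverse BB (env_left B) P \<delta> \<epsilon> K.Pm K.dm (K.aug (env_left B) \<one>) \<psi> \<phi>"
      "homotopy_inverse BB (env_left B) K.Pm K.dm (K.aug (env_left B) \<one>) P \<delta> \<epsilon> \<phi> \<psi>"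
    for P :: "nat \<Rightarrow> (('k, 'b) env, nat \<Rightarrow> ('k, 'b) env) graded_module" and \<delta> \<epsilon> \<psi> \<phi>
  proof (rule Ext_iso_transfer [OF that N, where \<eta> = ?\<eta>])
    fix z w r
    assume z: "z \<in> cocycles BB K.Pm K.dm 3"
    then have zc: "z (K.e 0) \<in> carrier BB" using z0 Z3 by blast
    show "w \<in> cocycles BB K.Pm K.dm 3 \<Longrightarrow> ?\<eta> (\<lambda>x \<in> carrier (K.Pm 3). z x \<oplus>\<^bsub>BB\<^esub> w x) = ?\<eta> z \<oplus>\<^bsub>?N\<^esub> ?\<eta> w"
      using zc z0 [of w] e0 by (simp add: Z3 right_add)
    show "r \<in> carrier BB \<Longrightarrow> ?\<eta> (\<lambda>x \<in> carrier (K.Pm 3). z x \<otimes>\<^bsub>BB\<^esub> r) = r \<odot>\<^bsub>?N\<^esub> ?\<eta> z"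
      using zc e0 by (simp add: right_mult)
    show "?\<eta> z = \<zero>\<^bsub>?N\<^esub> \<longleftrightarrow> z \<in> coboundaries BB K.Pm K.dm 3"
      using col_exact_3 [OF zc] K.coboundary_iff_col [of z 2] z Z3
      by (simp add: numeral_3_eq_3 numeral_2_eq_2)
  next
    show "?\<eta> ` cocycles BB K.Pm K.dm 3 = carrier ?N"
      using surj z0 Z3 by (auto simp: right_closed)
    fix n
    show "?\<eta> ` (cocycles BB K.Pm K.dm 3 \<inter> grade (hom_dual BB (K.Pm 3)) n) = grade ?N n"
    proof (intro equalityI subsetI)
      fix b assume "b \<in> ?\<eta> ` (cocycles BB K.Pm K.dm 3 \<inter> grade (hom_dual BB (K.Pm 3)) n)"
      then obtain z where z: "z \<in> grade (hom_dual BB (K.Pm 3)) n" "b = ?\<eta> z" by blast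
      have "K.e 0 \<in> grade (K.Pm 3) 3" using K.e_grade [OF BB_one_grade, of 0 3] by simp
      then have "z (K.e 0) \<in> grade BB (3 + n)" using z by (auto simp: hom_dual_simps)
      then show "b \<in> grade ?N n" using right_grade [OF _ one_grade, of "z (K.e 0)" "3 + n"] z by (simp add: add.commute)
    next
      fix b assume b: "b \<in> grade ?N n"
      then have "b \<in> grade B (n + 3)" by simp
      then show "b \<in> ?\<eta> ` (cocycles BB K.Pm K.dm 3 \<inter> grade (hom_dual BB (K.Pm 3)) n)"
        using surj [of b n] grade_closed by blast
    qed
  qed
  have Ext: "(\<forall>i. i \<noteq> 3 \<longrightarrow> carrier (Ext BB P \<delta> i) = {\<zero>\<^bsub>Ext BB P \<delta> i\<^esub>}) \<and>
      graded_isomorphic (opp BB) (Ext BB P \<delta> 3) ?N"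
    if "graded_projective_resolution BB (env_left B) P \<delta> \<epsilon>"
    for P :: "nat \<Rightarrow> (('k, 'b) env, nat \<Rightarrow> ('k, 'b) env) graded_module" and \<delta> \<epsilon>
  proof -
    have P: "resolution BB (env_left B) P \<delta> \<epsilon>"
      by (intro resolution.intro BB_ring BB_graded_group env_left_graded that)
    obtain \<psi> \<phi> where h: "homotopy_inverse BB (env_left B) P \<delta> \<epsilon> K.Pm K.dm (K.aug (env_left B) \<one>) \<psi> \<phi>"
      "homotopy_inverse BB (env_left B) K.Pm K.dm (K.aug (env_left B) \<one>) P \<delta> \<epsilon> \<phi> \<psi>"
      using homotopy_inverse_exists [OF P Q] by blast
    show ?thesis
      using homotopy_inverse.Ext_trivial_transfer [OF h(1) koszul_Ext_trivial] iso [OF h] by blast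
  qed
  have "carrier (K.Pm i) = {\<zero>\<^bsub>K.Pm i\<^esub>}" if "3 < i" for i
    using that K.Pm_carrier [of _ i] by (auto simp: K.Pm_simps(2) BB.free_simps(2) fun_eq_iff)
  then show ?thesis
    unfolding graded_calabi_yau_def
    using B_graded_algebra koszul_resolution K.Pm_finitely_generated Ext by blast
qed

end

section \<open>The quantum Heisenberg algebra\<close>

abbreviation "words \<equiv> \<lparr>carrier = UNIV, mult = (@), one = []\<rparr> :: gen list monoid"

lemma monoid_words: "monoid words"
  by (rule monoidI) auto

text \<open>The relations are given as explicit vectors, already evaluated at the polynomials f and
  g; the final theorem supplies the evaluation.\<close>

locale heisenberg_setup =
  fixes p q c :: "'k :: field" and rels :: "(gen list \<Rightarrow>\<^sub>0 'k) set"
  assumes pq: "p * q = 1"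
    and rels_def: "rels = {Poly_Mapping.single [T, X] 1 - Poly_Mapping.single [X, T] p,
      Poly_Mapping.single [Y, T] 1 - Poly_Mapping.single [T, Y] p,
      Poly_Mapping.single [Y, X] 1 - Poly_Mapping.single [X, Y] q - Poly_Mapping.single [T, T] c}"
begin

abbreviation FA :: "('k, gen list \<Rightarrow>\<^sub>0 'k) graded_module" where "FA \<equiv> free_algebra"
abbreviation "I \<equiv> genideal FA rels"
abbreviation "H \<equiv> quot_algebra FA I"

lemma FA_carrier [simp]: "u \<in> carrier FA"
  by (simp add: free_algebra_def ma_carrier [OF monoid_words refl])

lemmas FA_simps [simp] = ma_add [OF monoid_words free_algebra_def] ma_zero [OF monoid_words free_algebra_def]
  ma_mult_single [OF monoid_words free_algebra_def, simplified]
lemmas FA_mult_add = ma_mult_add_left [OF monoid_words free_algebra_def] ma_mult_add_right [OF monoid_words free_algebra_def]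
lemmas FA_mult_zero = ma_mult_zero [OF monoid_words free_algebra_def]
lemmas FA_smult = ma_smult [OF monoid_words free_algebra_def]
lemmas FA_one = ma_one [OF monoid_words free_algebra_def, simplified]

lemma FA_grade: "u \<in> grade FA n \<longleftrightarrow> Poly_Mapping.keys u \<subseteq> {w. int (length w) = n}"
  by (simp add: ma_grade [OF monoid_words free_algebra_def])

lemma FA_k_algebra: "k_algebra FA"
  by (rule ma_k_algebra [OF monoid_words free_algebra_def])

sublocale F: k_algebra FA by (rule FA_k_algebra)

sublocale Q: algebra_quotient FA I
  by (intro algebra_quotient.intro FA_k_algebra F.genideal_ideal) auto

sublocale H: k_algebra H by (rule Q.Q_k_algebra)

sublocale left: skew_rep "(*)" p q c
  by (intro skew_rep.intro vector_space_mult skew_rep_axioms.intro pq)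

abbreviation "S \<equiv> pscale ((*) :: 'k \<Rightarrow> 'k \<Rightarrow> 'k)"

lemma S_additive: "additive (\<lambda>k. S k v)"
  by (rule pscale_additive(2))

definition word_act :: "gen list \<Rightarrow> (mon \<Rightarrow>\<^sub>0 'k) \<Rightarrow> mon \<Rightarrow>\<^sub>0 'k" where
  "word_act w v = foldr left.L w v"

lemma word_act_simps [simp]: "word_act [] v = v" "word_act (g # w) v = left.L g (word_act w v)"
    "word_act (w @ w') v = word_act w (word_act w' v)"
  by (simp_all add: word_act_def)

lemma word_act_linear: "additive (word_act w)" "word_act w (S k v) = S k (word_act w v)"
  by (induction w) (auto simp: additive_def left.L_scale)

definition free_act :: "(gen list \<Rightarrow>\<^sub>0 'k) \<Rightarrow> (mon \<Rightarrow>\<^sub>0 'k) \<Rightarrow> mon \<Rightarrow>\<^sub>0 'k" where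
  "free_act u v = extend (\<lambda>w k. S k (word_act w v)) u"

lemma free_act_additive: "additive (\<lambda>u. free_act u v)"
  unfolding free_act_def by (intro extend_additive S_additive)

lemma free_act_single [simp]: "free_act (Poly_Mapping.single w k) v = S k (word_act w v)"
  unfolding free_act_def by (intro extend_single S_additive)

lemmas free_act_add = additive.add [OF free_act_additive]
  and free_act_diff = additive.diff [OF free_act_additive]
  and free_act_zero = additive.zero [OF free_act_additive]

lemma free_act_linear: "additive (free_act u)" "free_act u (S k v) = S k (free_act u v)"
proof -
  show "additive (free_act u)"
    by (induction u rule: poly_mapping_add_induct)
      (auto simp: additive_def free_act_zero free_act_add left.S.scale_right_distrib
        additive.add [OF word_act_linear(1)] algebra_simps)
  show "free_act u (S k v) = S k (free_act u v)"
    by (induction u rule: poly_mapping_add_induct)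
      (auto simp: free_act_zero free_act_add left.S.scale_right_distrib word_act_linear(2) mult.commute)
qed

lemma free_act_mult: "free_act (u \<otimes>\<^bsub>FA\<^esub> v) m = free_act u (free_act v m)"
proof (induction u rule: poly_mapping_add_induct)
  case (single w k)
  show ?case
    by (induction v rule: poly_mapping_add_induct)
      (auto simp: FA_mult_zero FA_mult_add free_act_zero free_act_add additive.zero [OF word_act_linear(1)]
        additive.add [OF word_act_linear(1)] word_act_linear(2) left.S.scale_right_distrib)
qed (auto simp: FA_mult_zero FA_mult_add free_act_zero free_act_add)

text \<open>The annihilator of a module is a two-sided ideal. It contains the relations by
  \<open>L_rel1\<close>, \<open>L_rel2\<close> and \<open>L_rel3\<close>, hence all of
  \<open>I\<close>.\<close>

lemma free_act_ideal:
  assumes "u \<in> I"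
  shows "free_act u m = 0"
proof -
  let ?J = "{u. \<forall>m. free_act u m = 0}"
  have "ideal ?J FA"
  proof (rule idealI)
    show "ring FA" by (rule F.ring_axioms)
    show "subgroup ?J (add_monoid FA)"
    proof (rule F.add.subgroupI)
      fix u assume u: "u \<in> ?J"
      have "\<ominus>\<^bsub>FA\<^esub> u = - u" by (rule F.minus_equality) simp_all
      then show "\<ominus>\<^bsub>FA\<^esub> u \<in> ?J" using u by (simp add: additive.minus [OF free_act_additive])
    qed (auto simp: free_act_add intro: exI [of _ 0] free_act_zero)
  qed (auto simp: free_act_mult additive.zero [OF free_act_linear(1)])
  moreover have "rels \<subseteq> ?J"
    by (auto simp: rels_def free_act_diff left.L_rel1 left.L_rel2 left.L_rel3)
  ultimately have "I \<subseteq> ?J" by (rule F.genideal_minimal)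
  then show ?thesis using assms by blast
qed

abbreviation "e0 \<equiv> Poly_Mapping.single (0, 0, 0) 1 :: mon \<Rightarrow>\<^sub>0 'k"

text \<open>The coordinates of an element are obtained by letting it act on the vector of the empty
  monomial; by \<open>free_act_ideal\<close> every representative gives the same result.\<close>

definition \<kappa> :: "(gen list \<Rightarrow>\<^sub>0 'k) set \<Rightarrow> mon \<Rightarrow>\<^sub>0 'k" where
  "\<kappa> U = the_elem ((\<lambda>u. free_act u e0) ` U)"

lemma \<kappa>_cls: "\<kappa> (Q.cls u) = free_act u e0"
proof -
  have "free_act w e0 = free_act u e0" if w: "w \<in> Q.cls u" for w
  proof -
    obtain z where "z \<in> I" "w = z + u" using w by (auto simp: a_r_coset_def')
    then show ?thesis by (simp add: free_act_add free_act_ideal)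
  qed
  then have "(\<lambda>u. free_act u e0) ` Q.cls u \<subseteq> {free_act u e0}" by blast
  moreover have "free_act u e0 \<in> (\<lambda>u. free_act u e0) ` Q.cls u"
    using Q.cls_self [OF FA_carrier] by (rule imageI)
  ultimately have "(\<lambda>u. free_act u e0) ` Q.cls u = {free_act u e0}" by blast
  then show ?thesis by (simp add: \<kappa>_def)
qed

definition ge :: "gen \<Rightarrow> (gen list \<Rightarrow>\<^sub>0 'k) set" where
  "ge g = Q.cls (Poly_Mapping.single [g] 1)"

fun mon_word :: "mon \<Rightarrow> gen list" where
  "mon_word (i, j, k) = replicate i X @ replicate j T @ replicate k Y"

definition normal :: "(mon \<Rightarrow>\<^sub>0 'k) \<Rightarrow> gen list \<Rightarrow>\<^sub>0 'k" where
  "normal = extend (\<lambda>m. Poly_Mapping.single (mon_word m))"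

lemma normal_additive: "additive normal"
  unfolding normal_def by (intro extend_additive additive_single)

lemma normal_single [simp]: "normal (Poly_Mapping.single m k) = Poly_Mapping.single (mon_word m) k"
  unfolding normal_def by (intro extend_single additive_single)

text \<open>In a normal word the letters y act first, then t, then x, so nothing is ever reordered
  and no factor p, q or c arises. Linear independence of the normal monomials follows.\<close>

lemma word_act_normal: "word_act (mon_word m) e0 = Poly_Mapping.single m 1"
proof -
  have Y: "word_act (replicate k Y) e0 = Poly_Mapping.single (0, 0, k) 1" for k
    by (induction k) simp_all
  have T: "word_act (replicate j T) (Poly_Mapping.single (0, 0, k) 1) = Poly_Mapping.single (0, j, k) 1" for j k
    by (induction j) simp_all
  have X: "word_act (replicate i X) (Poly_Mapping.single (0, j, k) 1) = Poly_Mapping.single (i, j, k) 1" for i j k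
    by (induction i) simp_all
  show ?thesis by (cases m) (simp add: X Y T)
qed

lemma free_act_normal: "free_act (normal v) e0 = v"
  by (rule additive_eqI [of "\<lambda>v. free_act (normal v) e0" "\<lambda>v. v"])
    (simp_all add: additive_comp [OF free_act_additive normal_additive] additive_id word_act_normal vector_space_mult)

lemma H_closed [simp]: "Q.cls u \<in> carrier H"
  by (simp add: Q.Q_carrier)

lemma ge_closed [simp]: "ge g \<in> carrier H"
  by (simp add: ge_def)

lemma cls_mult: "Q.cls (u \<otimes>\<^bsub>FA\<^esub> v) = Q.cls u \<otimes>\<^bsub>H\<^esub> Q.cls v"
  by (simp add: Q.Q_mult)

lemma cls_add: "Q.cls (u + v) = Q.cls u \<oplus>\<^bsub>H\<^esub> Q.cls v"
  by (simp add: Q.Q_add)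

lemma cls_scale: "Q.cls (Poly_Mapping.single w k) = k \<odot>\<^bsub>H\<^esub> Q.cls (Poly_Mapping.single w 1)"
  by (simp add: Q.Q_smult FA_smult vector_space_mult)

lemma cls_Cons: "Q.cls (Poly_Mapping.single (g # w) k) = ge g \<otimes>\<^bsub>H\<^esub> Q.cls (Poly_Mapping.single w k)"
  unfolding ge_def cls_mult [symmetric] by simp

lemma cls_append: "Q.cls (Poly_Mapping.single (w @ w') 1) = Q.cls (Poly_Mapping.single w 1) \<otimes>\<^bsub>H\<^esub> Q.cls (Poly_Mapping.single w' 1)"
  unfolding cls_mult [symmetric] by simp

lemma cls_replicate: "Q.cls (Poly_Mapping.single (replicate n g) 1) = ge g [^]\<^bsub>H\<^esub> n"
proof (induction n)
  case 0
  then show ?case by (simp add: Q.Q_one FA_one)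
next
  case (Suc n)
  then show ?case by (simp add: cls_Cons H.nat_pow_Suc2 del: H.nat_pow_Suc nat_pow_Suc)
qed

lemma cls_eqI: "u - v \<in> I \<Longrightarrow> Q.cls u = Q.cls v"
proof -
  have "\<ominus>\<^bsub>FA\<^esub> v = - v" by (rule F.minus_equality) simp_all
  then show "u - v \<in> I \<Longrightarrow> Q.cls u = Q.cls v" by (simp add: Q.cls_eq a_minus_def)
qed

lemma H_rel1: "ge T \<otimes>\<^bsub>H\<^esub> ge X = p \<odot>\<^bsub>H\<^esub> (ge X \<otimes>\<^bsub>H\<^esub> ge T)"
  and H_rel2: "ge Y \<otimes>\<^bsub>H\<^esub> ge T = p \<odot>\<^bsub>H\<^esub> (ge T \<otimes>\<^bsub>H\<^esub> ge Y)"
  and H_rel3: "ge Y \<otimes>\<^bsub>H\<^esub> ge X = q \<odot>\<^bsub>H\<^esub> (ge X \<otimes>\<^bsub>H\<^esub> ge Y) \<oplus>\<^bsub>H\<^esub> c \<odot>\<^bsub>H\<^esub> (ge T \<otimes>\<^bsub>H\<^esub> ge T)"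
proof -
  have w: "ge g \<otimes>\<^bsub>H\<^esub> ge h = Q.cls (Poly_Mapping.single [g, h] 1)" for g h
    unfolding ge_def cls_mult [symmetric] by simp
  have "rels \<subseteq> I" by (rule F.genideal_self) auto
  then have r: "r \<in> rels \<Longrightarrow> r \<in> I" for r by blast
  show "ge T \<otimes>\<^bsub>H\<^esub> ge X = p \<odot>\<^bsub>H\<^esub> (ge X \<otimes>\<^bsub>H\<^esub> ge T)" "ge Y \<otimes>\<^bsub>H\<^esub> ge T = p \<odot>\<^bsub>H\<^esub> (ge T \<otimes>\<^bsub>H\<^esub> ge Y)"
    "ge Y \<otimes>\<^bsub>H\<^esub> ge X = q \<odot>\<^bsub>H\<^esub> (ge X \<otimes>\<^bsub>H\<^esub> ge Y) \<oplus>\<^bsub>H\<^esub> c \<odot>\<^bsub>H\<^esub> (ge T \<otimes>\<^bsub>H\<^esub> ge T)"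
    unfolding w cls_scale [symmetric] cls_add [symmetric]
    by (rule cls_eqI, rule r, simp add: rels_def diff_diff_eq)+
qed

abbreviation "x \<equiv> ge X"
abbreviation "t \<equiv> ge T"
abbreviation "y \<equiv> ge Y"
abbreviation "monomial i j k \<equiv> x [^]\<^bsub>H\<^esub> (i :: nat) \<otimes>\<^bsub>H\<^esub> (t [^]\<^bsub>H\<^esub> (j :: nat) \<otimes>\<^bsub>H\<^esub> y [^]\<^bsub>H\<^esub> (k :: nat))"

lemma cls_normal: "Q.cls (normal (Poly_Mapping.single (i, j, k) a)) = a \<odot>\<^bsub>H\<^esub> monomial i j k"
  by (simp add: cls_scale [of _ a] cls_append cls_replicate)

section \<open>Normal ordering in the quotient\<close>

lemmas H_scal = H.scal_mult_l H.scal_mult_r H.scal_closed H.scal_r_distr H.scal_assoc [symmetric]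

lemma t_pow_x: "t \<otimes>\<^bsub>H\<^esub> x [^]\<^bsub>H\<^esub> (i :: nat) = p ^ i \<odot>\<^bsub>H\<^esub> (x [^]\<^bsub>H\<^esub> i \<otimes>\<^bsub>H\<^esub> t)"
proof (induction i)
  case 0
  then show ?case by (simp add: H.scal_one)
next
  case (Suc i)
  have "t \<otimes>\<^bsub>H\<^esub> x [^]\<^bsub>H\<^esub> Suc i = (t \<otimes>\<^bsub>H\<^esub> x [^]\<^bsub>H\<^esub> i) \<otimes>\<^bsub>H\<^esub> x" by (simp add: H.m_assoc)
  also have "\<dots> = p ^ i \<odot>\<^bsub>H\<^esub> (x [^]\<^bsub>H\<^esub> i \<otimes>\<^bsub>H\<^esub> (t \<otimes>\<^bsub>H\<^esub> x))" by (simp add: Suc H_scal H.m_assoc)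
  also have "\<dots> = p ^ Suc i \<odot>\<^bsub>H\<^esub> (x [^]\<^bsub>H\<^esub> Suc i \<otimes>\<^bsub>H\<^esub> t)"
    by (simp add: H_rel1 H_scal H.m_assoc mult.commute)
  finally show ?case .
qed

lemma y_pow_t: "y \<otimes>\<^bsub>H\<^esub> t [^]\<^bsub>H\<^esub> (j :: nat) = p ^ j \<odot>\<^bsub>H\<^esub> (t [^]\<^bsub>H\<^esub> j \<otimes>\<^bsub>H\<^esub> y)"
proof (induction j)
  case 0
  then show ?case by (simp add: H.scal_one)
next
  case (Suc j)
  have "y \<otimes>\<^bsub>H\<^esub> t [^]\<^bsub>H\<^esub> Suc j = (y \<otimes>\<^bsub>H\<^esub> t [^]\<^bsub>H\<^esub> j) \<otimes>\<^bsub>H\<^esub> t" by (simp add: H.m_assoc)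
  also have "\<dots> = p ^ j \<odot>\<^bsub>H\<^esub> (t [^]\<^bsub>H\<^esub> j \<otimes>\<^bsub>H\<^esub> (y \<otimes>\<^bsub>H\<^esub> t))" by (simp add: Suc H_scal H.m_assoc)
  also have "\<dots> = p ^ Suc j \<odot>\<^bsub>H\<^esub> (t [^]\<^bsub>H\<^esub> Suc j \<otimes>\<^bsub>H\<^esub> y)"
    by (simp add: H_rel2 H_scal H.m_assoc mult.commute)
  finally show ?case .
qed

lemma scal_zero: "b \<in> carrier H \<Longrightarrow> 0 \<odot>\<^bsub>H\<^esub> b = \<zero>\<^bsub>H\<^esub>"
  using H.scal_l_distr [of b 0 0] H.scal_closed [of b 0] by (simp add: H.add.r_cancel_one')

text \<open>The counterpart in the algebra of the recursion for \<open>skew\<close>: one x is split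
  off on the left, the first relation term is handled by induction, and \<open>t^2\<close> is moved
  past \<open>x^i\<close>.\<close>

lemma y_pow_x: "y \<otimes>\<^bsub>H\<^esub> x [^]\<^bsub>H\<^esub> (i :: nat) = q ^ i \<odot>\<^bsub>H\<^esub> (x [^]\<^bsub>H\<^esub> i \<otimes>\<^bsub>H\<^esub> y)
    \<oplus>\<^bsub>H\<^esub> (c * skew p q i) \<odot>\<^bsub>H\<^esub> (x [^]\<^bsub>H\<^esub> (i - 1) \<otimes>\<^bsub>H\<^esub> (t \<otimes>\<^bsub>H\<^esub> t))"
proof (induction i)
  case 0
  then show ?case by (simp add: H.scal_one scal_zero)
next
  case (Suc i)
  have txx: "(t \<otimes>\<^bsub>H\<^esub> t) \<otimes>\<^bsub>H\<^esub> x [^]\<^bsub>H\<^esub> i = (p ^ i) ^ 2 \<odot>\<^bsub>H\<^esub> (x [^]\<^bsub>H\<^esub> i \<otimes>\<^bsub>H\<^esub> (t \<otimes>\<^bsub>H\<^esub> t))"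
  proof -
    have "(t \<otimes>\<^bsub>H\<^esub> t) \<otimes>\<^bsub>H\<^esub> x [^]\<^bsub>H\<^esub> i = t \<otimes>\<^bsub>H\<^esub> (p ^ i \<odot>\<^bsub>H\<^esub> (x [^]\<^bsub>H\<^esub> i \<otimes>\<^bsub>H\<^esub> t))"
      by (simp add: H.m_assoc t_pow_x)
    also have "\<dots> = p ^ i \<odot>\<^bsub>H\<^esub> ((t \<otimes>\<^bsub>H\<^esub> x [^]\<^bsub>H\<^esub> i) \<otimes>\<^bsub>H\<^esub> t)" by (simp add: H_scal H.m_assoc)
    also have "\<dots> = (p ^ i) ^ 2 \<odot>\<^bsub>H\<^esub> (x [^]\<^bsub>H\<^esub> i \<otimes>\<^bsub>H\<^esub> (t \<otimes>\<^bsub>H\<^esub> t))"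
      by (simp add: t_pow_x H_scal H.m_assoc power2_eq_square)
    finally show ?thesis .
  qed
  \<comment> \<open>For \<open>i = 0\<close> the truncated exponent would make this false; there the
    coefficient \<open>skew 0\<close> vanishes instead.\<close>
  have xi: "x \<otimes>\<^bsub>H\<^esub> (x [^]\<^bsub>H\<^esub> (i - 1) \<otimes>\<^bsub>H\<^esub> (t \<otimes>\<^bsub>H\<^esub> t)) = x [^]\<^bsub>H\<^esub> i \<otimes>\<^bsub>H\<^esub> (t \<otimes>\<^bsub>H\<^esub> t)" if "i \<noteq> 0"
    using that by (cases i) (simp_all add: H.m_assoc [symmetric] H.nat_pow_Suc2 [symmetric] del: H.nat_pow_Suc nat_pow_Suc)
  have "y \<otimes>\<^bsub>H\<^esub> x [^]\<^bsub>H\<^esub> Suc i = (y \<otimes>\<^bsub>H\<^esub> x) \<otimes>\<^bsub>H\<^esub> x [^]\<^bsub>H\<^esub> i"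
    by (simp add: H.nat_pow_Suc2 H.m_assoc del: H.nat_pow_Suc nat_pow_Suc)
  also have "\<dots> = q \<odot>\<^bsub>H\<^esub> (x \<otimes>\<^bsub>H\<^esub> (y \<otimes>\<^bsub>H\<^esub> x [^]\<^bsub>H\<^esub> i)) \<oplus>\<^bsub>H\<^esub> c \<odot>\<^bsub>H\<^esub> ((t \<otimes>\<^bsub>H\<^esub> t) \<otimes>\<^bsub>H\<^esub> x [^]\<^bsub>H\<^esub> i)"
    by (simp add: H_rel3 H.l_distr H_scal H.m_assoc)
  also have "\<dots> = q ^ Suc i \<odot>\<^bsub>H\<^esub> (x [^]\<^bsub>H\<^esub> Suc i \<otimes>\<^bsub>H\<^esub> y)
      \<oplus>\<^bsub>H\<^esub> (q * (c * skew p q i)) \<odot>\<^bsub>H\<^esub> (x \<otimes>\<^bsub>H\<^esub> (x [^]\<^bsub>H\<^esub> (i - 1) \<otimes>\<^bsub>H\<^esub> (t \<otimes>\<^bsub>H\<^esub> t)))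
      \<oplus>\<^bsub>H\<^esub> (c * (p ^ i) ^ 2) \<odot>\<^bsub>H\<^esub> (x [^]\<^bsub>H\<^esub> i \<otimes>\<^bsub>H\<^esub> (t \<otimes>\<^bsub>H\<^esub> t))"
    unfolding Suc txx H.nat_pow_Suc2 [OF ge_closed] by (simp add: H.r_distr H_scal H.m_assoc)
  also have "(q * (c * skew p q i)) \<odot>\<^bsub>H\<^esub> (x \<otimes>\<^bsub>H\<^esub> (x [^]\<^bsub>H\<^esub> (i - 1) \<otimes>\<^bsub>H\<^esub> (t \<otimes>\<^bsub>H\<^esub> t)))
      = (q * (c * skew p q i)) \<odot>\<^bsub>H\<^esub> (x [^]\<^bsub>H\<^esub> i \<otimes>\<^bsub>H\<^esub> (t \<otimes>\<^bsub>H\<^esub> t))"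
  proof (cases "i = 0")
    case False
    show ?thesis unfolding xi [OF False] ..
  qed (simp add: scal_zero)
  also have "q ^ Suc i \<odot>\<^bsub>H\<^esub> (x [^]\<^bsub>H\<^esub> Suc i \<otimes>\<^bsub>H\<^esub> y)
      \<oplus>\<^bsub>H\<^esub> (q * (c * skew p q i)) \<odot>\<^bsub>H\<^esub> (x [^]\<^bsub>H\<^esub> i \<otimes>\<^bsub>H\<^esub> (t \<otimes>\<^bsub>H\<^esub> t))
      \<oplus>\<^bsub>H\<^esub> (c * (p ^ i) ^ 2) \<odot>\<^bsub>H\<^esub> (x [^]\<^bsub>H\<^esub> i \<otimes>\<^bsub>H\<^esub> (t \<otimes>\<^bsub>H\<^esub> t))
      = q ^ Suc i \<odot>\<^bsub>H\<^esub> (x [^]\<^bsub>H\<^esub> Suc i \<otimes>\<^bsub>H\<^esub> y)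
      \<oplus>\<^bsub>H\<^esub> (q * (c * skew p q i) + c * (p ^ i) ^ 2) \<odot>\<^bsub>H\<^esub> (x [^]\<^bsub>H\<^esub> i \<otimes>\<^bsub>H\<^esub> (t \<otimes>\<^bsub>H\<^esub> t))"
    by (simp add: H.scal_l_distr H.scal_closed H.a_assoc del: H.nat_pow_Suc nat_pow_Suc)
  also have "q * (c * skew p q i) + c * (p ^ i) ^ 2 = c * skew p q (Suc i)"
    by (simp only: skew.simps distrib_left mult.left_commute [of q c] add.commute)
  finally show ?case unfolding diff_Suc_1 .
qed

text \<open>The operators on coordinates really are left multiplication on classes of normal
  monomials. This is the link between the constructed representation and the presented
  algebra.\<close>

lemma cls_L: "Q.cls (normal (left.L g v)) = ge g \<otimes>\<^bsub>H\<^esub> Q.cls (normal v)"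
proof (induction v rule: poly_mapping_add_induct)
  case zero
  have "Q.cls 0 = \<zero>\<^bsub>H\<^esub>" using Q.Q_zero by simp
  then show ?case by (simp add: additive.zero [OF normal_additive])
next
  case (add v w)
  then show ?case by (simp add: additive.add [OF normal_additive] cls_add H.r_distr)
next
  case (single m a)
  obtain i j k where m: "m = (i, j, k)" by (cases m)
  show ?case
  proof (cases g)
    case X
    then show ?thesis unfolding m
      by (simp add: cls_normal H_scal H.m_assoc [symmetric] H.nat_pow_Suc2 [symmetric] del: H.nat_pow_Suc nat_pow_Suc normal_single)
  next
    case T
    have "t \<otimes>\<^bsub>H\<^esub> monomial i j k = (t \<otimes>\<^bsub>H\<^esub> x [^]\<^bsub>H\<^esub> i) \<otimes>\<^bsub>H\<^esub> (t [^]\<^bsub>H\<^esub> j \<otimes>\<^bsub>H\<^esub> y [^]\<^bsub>H\<^esub> k)" by (simp add: H.m_assoc)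
    also have "\<dots> = p ^ i \<odot>\<^bsub>H\<^esub> monomial i (Suc j) k"
      unfolding t_pow_x H.nat_pow_Suc2 [OF ge_closed] by (simp add: H_scal H.m_assoc)
    finally show ?thesis unfolding m T
      by (simp add: cls_normal H_scal mult.commute del: H.nat_pow_Suc nat_pow_Suc normal_single)
  next
    case Y
    have yt: "y \<otimes>\<^bsub>H\<^esub> (t [^]\<^bsub>H\<^esub> j \<otimes>\<^bsub>H\<^esub> y [^]\<^bsub>H\<^esub> k) = p ^ j \<odot>\<^bsub>H\<^esub> (t [^]\<^bsub>H\<^esub> j \<otimes>\<^bsub>H\<^esub> y [^]\<^bsub>H\<^esub> Suc k)"
    proof -
      have "y \<otimes>\<^bsub>H\<^esub> (t [^]\<^bsub>H\<^esub> j \<otimes>\<^bsub>H\<^esub> y [^]\<^bsub>H\<^esub> k) = (y \<otimes>\<^bsub>H\<^esub> t [^]\<^bsub>H\<^esub> j) \<otimes>\<^bsub>H\<^esub> y [^]\<^bsub>H\<^esub> k" by (simp add: H.m_assoc)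
      then show ?thesis unfolding y_pow_t H.nat_pow_Suc2 [OF ge_closed] by (simp add: H_scal H.m_assoc)
    qed
    have tt: "(t \<otimes>\<^bsub>H\<^esub> t) \<otimes>\<^bsub>H\<^esub> (t [^]\<^bsub>H\<^esub> j \<otimes>\<^bsub>H\<^esub> y [^]\<^bsub>H\<^esub> k) = t [^]\<^bsub>H\<^esub> (j + 2) \<otimes>\<^bsub>H\<^esub> y [^]\<^bsub>H\<^esub> k"
      unfolding add_2_eq_Suc' H.nat_pow_Suc2 [OF ge_closed] by (simp add: H.m_assoc)
    have "y \<otimes>\<^bsub>H\<^esub> monomial i j k = (y \<otimes>\<^bsub>H\<^esub> x [^]\<^bsub>H\<^esub> i) \<otimes>\<^bsub>H\<^esub> (t [^]\<^bsub>H\<^esub> j \<otimes>\<^bsub>H\<^esub> y [^]\<^bsub>H\<^esub> k)" by (simp add: H.m_assoc)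
    also have "\<dots> = q ^ i \<odot>\<^bsub>H\<^esub> (x [^]\<^bsub>H\<^esub> i \<otimes>\<^bsub>H\<^esub> (y \<otimes>\<^bsub>H\<^esub> (t [^]\<^bsub>H\<^esub> j \<otimes>\<^bsub>H\<^esub> y [^]\<^bsub>H\<^esub> k)))
      \<oplus>\<^bsub>H\<^esub> (c * skew p q i) \<odot>\<^bsub>H\<^esub> (x [^]\<^bsub>H\<^esub> (i - 1) \<otimes>\<^bsub>H\<^esub> ((t \<otimes>\<^bsub>H\<^esub> t) \<otimes>\<^bsub>H\<^esub> (t [^]\<^bsub>H\<^esub> j \<otimes>\<^bsub>H\<^esub> y [^]\<^bsub>H\<^esub> k)))"
      unfolding y_pow_x by (simp add: H.l_distr H_scal H.m_assoc)
    also have "\<dots> = (q ^ i * p ^ j) \<odot>\<^bsub>H\<^esub> monomial i j (Suc k) \<oplus>\<^bsub>H\<^esub> (c * skew p q i) \<odot>\<^bsub>H\<^esub> monomial (i - 1) (j + 2) k"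
      unfolding yt tt by (simp add: H_scal del: H.nat_pow_Suc nat_pow_Suc add_2_eq_Suc')
    finally have y: "y \<otimes>\<^bsub>H\<^esub> monomial i j k = (q ^ i * p ^ j) \<odot>\<^bsub>H\<^esub> monomial i j (Suc k)
      \<oplus>\<^bsub>H\<^esub> (c * skew p q i) \<odot>\<^bsub>H\<^esub> monomial (i - 1) (j + 2) k" .
    have mon: "monomial i' j' k' \<in> carrier H" for i' j' k' by simp
    have "ge Y \<otimes>\<^bsub>H\<^esub> Q.cls (normal (Poly_Mapping.single m a)) = a \<odot>\<^bsub>H\<^esub> (y \<otimes>\<^bsub>H\<^esub> monomial i j k)"
      unfolding m cls_normal by (rule H.scal_mult_r [OF ge_closed mon])
    also have "\<dots> = (a * (q ^ i * p ^ j)) \<odot>\<^bsub>H\<^esub> monomial i j (Suc k)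
      \<oplus>\<^bsub>H\<^esub> (a * (c * skew p q i)) \<odot>\<^bsub>H\<^esub> monomial (i - 1) (j + 2) k"
      unfolding y H.scal_r_distr [OF H.scal_closed [OF mon] H.scal_closed [OF mon]] H.scal_assoc [OF mon, of a] ..
    also have "\<dots> = Q.cls (normal (left.L Y (Poly_Mapping.single m a)))"
      unfolding m left.L_single lmul_mon.simps additive.add [OF normal_additive] cls_add cls_normal
      by (simp only: mult.commute [of a])
    finally show ?thesis unfolding Y by (rule sym)
  qed
qed

text \<open>The spanning half of the basis statement: the letters of a word are absorbed one by one
  from the right end by \<open>cls_L\<close>. Together with \<open>free_act_normal\<close> it makes
  \<open>\<kappa>\<close> bijective.\<close>

lemma cls_normal_form: "Q.cls (normal (free_act u e0)) = Q.cls u"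
proof (induction u rule: poly_mapping_add_induct)
  case zero
  then show ?case by (simp add: free_act_zero additive.zero [OF normal_additive])
next
  case (add v w)
  then show ?case by (simp add: free_act_add additive.add [OF normal_additive] cls_add)
next
  case (single w a)
  show ?case
  proof (induction w)
    case Nil
    then show ?case by (simp add: vector_space_mult)
  next
    case (Cons g w)
    then show ?case by (simp add: left.L_scale [symmetric] cls_L cls_Cons)
  qed
qed

section \<open>The grading of the quotient in coordinates\<close>

definition homog :: "int \<Rightarrow> (mon \<Rightarrow>\<^sub>0 'k) \<Rightarrow> bool" where
  "homog n v \<longleftrightarrow> Poly_Mapping.keys v \<subseteq> {m. mon_deg m = n}"

lemma homog_closed: "homog n 0" "homog n v \<Longrightarrow> homog n w \<Longrightarrow> homog n (v + w)" "homog n v \<Longrightarrow> homog n (S k v)"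
proof -
  show "homog n 0" by (simp add: homog_def)
  show "homog n (v + w)" if "homog n v" "homog n w"
    using that keys_add [of v w] unfolding homog_def by blast
  show "homog n (S k v)" if "homog n v"
    using that by (auto simp: homog_def in_keys_iff lookup_pscale vector_space_mult subset_iff)
qed

lemma homog_L:
  assumes "homog n v"
  shows "homog (n + 1) (left.L g v)"
proof (induction v rule: poly_mapping_add_induct)
  case (single m a)
  then have m: "mon_deg m = n" using assms by (auto simp: homog_def)
  obtain i j k where ijk: "m = (i, j, k)" by (cases m)
  show ?case
  proof (cases g)
    case Y
    have "homog (n + 1) (Poly_Mapping.single (i - 1, j + 2, k) (c * skew p q i * a))"
      \<comment> \<open>For \<open>i = 0\<close> the monomial has the wrong degree, but its
        coefficient contains \<open>skew 0 = 0\<close>.\<close>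
      using m by (cases i) (auto simp: homog_def ijk)
    moreover have "homog (n + 1) (Poly_Mapping.single (i, j, Suc k) (q ^ i * p ^ j * a))"
      using m by (auto simp: homog_def ijk)
    ultimately show ?thesis unfolding ijk Y left.L_single lmul_mon.simps by (intro homog_closed(2))
  qed (use m in \<open>auto simp: ijk homog_def\<close>)
qed (auto simp: homog_closed)

lemma homog_word: "homog (int (length w)) (word_act w e0)"
proof (induction w)
  case Nil
  then show ?case by (simp add: homog_def)
next
  case (Cons g w)
  then show ?case using homog_L [of "int (length w)" "word_act w e0" g] by (simp add: add.commute)
qed

lemma homog_free_act:
  assumes "u \<in> grade FA n"
  shows "homog n (free_act u e0)"
proof (induction u rule: poly_mapping_add_induct)
  case zero
  then show ?case by (simp add: free_act_zero homog_closed)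
next
  case (single w k)
  then have "int (length w) = n" using assms by (auto simp: FA_grade)
  then show ?case using homog_word [of w] by (simp add: homog_closed)
next
  case (add v w)
  then show ?case by (simp add: free_act_add homog_closed)
qed

lemma FA_grade_add: "u \<in> grade FA n \<Longrightarrow> v \<in> grade FA n \<Longrightarrow> u + v \<in> grade FA n"
  using keys_add [of u v] by (auto simp: FA_grade)

lemma normal_grade:
  assumes "homog n v"
  shows "normal v \<in> grade FA n"
proof (induction v rule: poly_mapping_add_induct)
  case zero
  then show ?case by (simp add: additive.zero [OF normal_additive] FA_grade)
next
  case (single m k)
  then have "mon_deg m = n" using assms by (auto simp: homog_def)
  then show ?case by (cases m) (auto simp: FA_grade)
next
  case (add v w)
  then show ?case by (simp add: additive.add [OF normal_additive] FA_grade_add)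
qed

lemma FA_grade_mult:
  assumes "u \<in> grade FA m" and "v \<in> grade FA n"
  shows "u \<otimes>\<^bsub>FA\<^esub> v \<in> grade FA (m + n)"
proof (induction u rule: poly_mapping_add_induct)
  case zero
  then show ?case by (simp add: FA_mult_zero FA_grade)
next
  case (single w k)
  then have w: "int (length w) = m" using assms(1) by (auto simp: FA_grade)
  show ?case
  proof (induction v rule: poly_mapping_add_induct)
    case zero
    then show ?case by (simp add: FA_mult_zero FA_grade)
  next
    case (single w' k')
    then have "int (length w') = n" using assms(2) by (auto simp: FA_grade)
    then show ?case using w by (auto simp: FA_grade)
  qed (simp add: FA_mult_add FA_grade_add)
qed (simp add: FA_mult_add FA_grade_add)

text \<open>Acting by a letter raises the degree by 1, so homogeneous elements have homogeneous
  coordinates. Conversely, such coordinates give a normal form that is a homogeneous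
  representative.\<close>

lemma H_grade: "grade H n = {a \<in> carrier H. Poly_Mapping.keys (\<kappa> a) \<subseteq> {m. mon_deg m = n}}"
proof (intro equalityI subsetI)
  fix a assume "a \<in> grade H n"
  then obtain u where "u \<in> grade FA n" "a = Q.cls u" by (auto simp: Q.Q_grade)
  then show "a \<in> {a \<in> carrier H. Poly_Mapping.keys (\<kappa> a) \<subseteq> {m. mon_deg m = n}}"
    using homog_free_act by (simp add: \<kappa>_cls homog_def)
next
  fix a assume "a \<in> {a \<in> carrier H. Poly_Mapping.keys (\<kappa> a) \<subseteq> {m. mon_deg m = n}}"
  then obtain u where u: "a = Q.cls u" "homog n (free_act u e0)" by (auto simp: Q.Q_carrier \<kappa>_cls homog_def)
  then have "Q.cls (normal (free_act u e0)) \<in> grade H n" by (auto simp: Q.Q_grade normal_grade)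
  then show "a \<in> grade H n" by (simp add: cls_normal_form u)
qed

lemma heisenberg_algebra: "heisenberg_algebra H \<kappa> p q c ge"
proof (intro heisenberg_algebra.intro based_algebra.intro enveloping_algebra.intro H.k_algebra_axioms
    based_algebra_axioms.intro heisenberg_algebra_axioms.intro pq H_rel1 H_rel2 H_rel3 H_grade)
  show "bij_betw \<kappa> (carrier H) UNIV"
  proof (rule bij_betwI [of _ _ _ "\<lambda>v. Q.cls (normal v)"])
    show "Q.cls (normal (\<kappa> a)) = a" if "a \<in> carrier H" for a
      using that by (auto simp: Q.Q_carrier \<kappa>_cls cls_normal_form)
  qed (auto simp: \<kappa>_cls free_act_normal)
  show "\<kappa> (a \<oplus>\<^bsub>H\<^esub> b) = \<kappa> a + \<kappa> b" if "a \<in> carrier H" "b \<in> carrier H" for a b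
    using that by (auto simp: Q.Q_carrier cls_add [symmetric] \<kappa>_cls free_act_add)
  show "\<kappa> (k \<odot>\<^bsub>H\<^esub> a) = S k (\<kappa> a)" if a: "a \<in> carrier H" for a k
  proof -
    obtain u where u: "a = Q.cls u" using a by (auto simp: Q.Q_carrier)
    have "free_act (S k u) e0 = S k (free_act u e0)"
      by (rule additive_eqI [of "\<lambda>u. free_act (S k u) e0" "\<lambda>u. S k (free_act u e0)"])
        (auto simp: vector_space_mult intro: additive_comp [OF free_act_additive pscale_additive(1)]
          additive_comp [OF pscale_additive(1) free_act_additive])
    then show ?thesis by (simp add: u Q.Q_smult FA_smult \<kappa>_cls)
  qed
  show "\<one>\<^bsub>H\<^esub> \<in> grade H 0" by (auto simp: Q.Q_one Q.Q_grade FA_one FA_grade)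
  show "a \<otimes>\<^bsub>H\<^esub> b \<in> grade H (i + j)" if "a \<in> grade H i" "b \<in> grade H j" for a b i j
    using that FA_grade_mult by (auto simp: Q.Q_grade cls_mult [symmetric])
  show "ge g \<in> grade H 1" for g by (auto simp: ge_def Q.Q_grade FA_grade)
  show "\<kappa> \<one>\<^bsub>H\<^esub> = e0" by (simp add: Q.Q_one \<kappa>_cls FA_one)
  show "\<kappa> (ge g \<otimes>\<^bsub>H\<^esub> b) = left.L g (\<kappa> b)" if "b \<in> carrier H" for g b
    using that by (auto simp: Q.Q_carrier ge_def cls_mult [symmetric] \<kappa>_cls free_act_mult)
qed

end

text \<open>Any bound on the degree is allowed as the upper limit, since the degree of
  \<open>[:0, 0, c:]\<close> drops when c is zero.\<close>

lemma poly_eval_var: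
  fixes h :: "'k :: field poly"
  assumes "degree h \<le> n"
  shows "poly_eval free_algebra h (var g) = (\<Sum>i\<le>n. Poly_Mapping.single (replicate i g) (coeff h i))"
proof -
  let ?F = "free_algebra :: ('k, gen list \<Rightarrow>\<^sub>0 'k) graded_module"
  interpret F: k_algebra ?F by (rule ma_k_algebra [OF monoid_words free_algebra_def])
  note simps = ma_add [OF monoid_words free_algebra_def] ma_zero [OF monoid_words free_algebra_def]
    ma_mult_single [OF monoid_words free_algebra_def, simplified] ma_smult [OF monoid_words free_algebra_def]
    ma_one [OF monoid_words free_algebra_def, simplified] ma_carrier [OF monoid_words free_algebra_def, simplified]
  have pow: "var g [^]\<^bsub>?F\<^esub> i = Poly_Mapping.single (replicate i g) 1" for i
    by (induction i) (simp_all add: simps var_def replicate_append_same)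
  have "poly_eval ?F h (var g) = (\<Sum>i\<le>degree h. Poly_Mapping.single (replicate i g) (coeff h i))"
    unfolding poly_eval_def
    using coords_finsum [OF F.is_abelian_group, of "\<lambda>u. u" "{..degree h}"]
    by (simp add: simps pow vector_space_mult)
  also have "\<dots> = (\<Sum>i\<le>n. Poly_Mapping.single (replicate i g) (coeff h i))"
    using assms by (intro sum.mono_neutral_left) (auto simp: coeff_eq_0)
  finally show ?thesis .
qed

theorem theorem5p7:
  fixes p q :: "'k :: alg_closed_field" and f g :: "'k poly"
  assumes "CHAR('k) \<noteq> 2" and "CHAR('k) \<noteq> 3"
    and "p \<noteq> 0" and "q = inverse p"
    and "f = [:0, p:]"
    and "\<exists>c. g = [:0, 0, c:]"
  shows "graded_calabi_yau 3 (quantum_heisenberg q f g)"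
proof -
  obtain c where g: "g = [:0, 0, c:]" using assms by blast
  let ?F = "free_algebra :: ('k, gen list \<Rightarrow>\<^sub>0 'k) graded_module"
  interpret F: k_algebra ?F by (rule ma_k_algebra [OF monoid_words free_algebra_def])
  note simps = ma_add [OF monoid_words free_algebra_def] ma_zero [OF monoid_words free_algebra_def]
    ma_mult_single [OF monoid_words free_algebra_def, simplified] ma_smult [OF monoid_words free_algebra_def]
    ma_carrier [OF monoid_words free_algebra_def, simplified]
  have neg: "u \<ominus>\<^bsub>?F\<^esub> v = u - v" for u v
  proof -
    have "\<ominus>\<^bsub>?F\<^esub> v = - v" by (rule F.minus_equality) (simp_all add: simps)
    then show ?thesis by (simp add: a_minus_def simps)
  qed
  have f: "poly_eval ?F f (var T) = Poly_Mapping.single [T] p"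
    by (subst poly_eval_var [of f 1]) (simp_all add: assms)
  have g': "poly_eval ?F g (var T) = Poly_Mapping.single [T, T] c"
    by (subst poly_eval_var [of g 2]) (simp_all add: g eval_nat_numeral)
  \<comment> \<open>With both polynomials evaluated at t, the three differences become the vectors
    listed in \<open>rels_def\<close>.\<close>
  interpret heisenberg_setup p q c "heisenberg_relations q f g"
  proof
    show "p * q = 1" using assms by simp
    show "heisenberg_relations q f g = {Poly_Mapping.single [T, X] 1 - Poly_Mapping.single [X, T] p,
      Poly_Mapping.single [Y, T] 1 - Poly_Mapping.single [T, Y] p,
      Poly_Mapping.single [Y, X] 1 - Poly_Mapping.single [X, Y] q - Poly_Mapping.single [T, T] c}"
      unfolding heisenberg_relations_def Let_def f g' neg by (simp add: var_def simps vector_space_mult)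
  qed
  show ?thesis
    using heisenberg_algebra.calabi_yau [OF heisenberg_algebra] by (simp add: quantum_heisenberg_def)
qed

end
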